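(* Let $\mathcal{A}$ be a computable Archimedean real closed ordered field, and let $K$ be the class of Archimedean real closed ordered fields. (1) If the transcendence degree of $\mathcal{A}$ (over $\mathbb{Q}$) is $0$, i.e. $\mathcal{A}$ is isomorphic to the ordered field of real algebraic numbers, then $I(\mathcal{A})$ is $m$-complete $\Pi^0_2$ within $K$. (2) If the transcendence degree is finite but not $0$, then $I(\mathcal{A})$ is $m$-complete $d$-$\Sigma^0_2$ within $K$. (3) If the transcendence degree is infinite, then $I(\mathcal{A})$ is $m$-complete $\Pi^0_3$ within $K$.
   Context: Structures have universes contained in $\omega$ and are identified with their atomic diagrams; $\mathcal{A}$ is computable if its atomic diagram $D(\mathcal{A})$ is computable. An index for a computable structure $\mathcal{A}$ is a number $a$ such that the $a$-th unary partial computable function equals $\chi_{D(\mathcal{A})}$. $I(\mathcal{A})$ is the set of indices of computable structures isomorphic to $\mathcal{A}$; $I(K)$ is the set of indices of computable members of $K$. For a complexity class $\Gamma$, $I(\mathcal{A})$ is $\Gamma$ within $K$ if $I(\mathcal{A})=R\cap I(K)$ for some $R\in\Gamma$, and $m$-complete $\Gamma$ within $K$ if moreover for every $S\in\Gamma$ there is a computable $f:\omega\to I(K)$ with $n\in S$ iff $f(n)\in I(\mathcal{A})$. A set is $d$-$\Sigma^0_2$ if it has the form $S_1-S_2$ with $S_1,S_2\in\Sigma^0_2$. *)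

theory Defs
  imports Main "HOL-Library.Nat_Bijection" "HOL-Library.Extended_Nat"
begin

datatype recf = Zr | Sc | Pj nat | Cn recf "recf list" | Pr recf recf | Mn recf

inductive ev :: "recf \<Rightarrow> nat list \<Rightarrow> nat \<Rightarrow> bool" where
  ev_Zr: "ev Zr xs 0"
| ev_Sc: "ev Sc (x # xs) (Suc x)"
| ev_Pj: "i < length xs \<Longrightarrow> ev (Pj i) xs (xs ! i)"
| ev_Cn: "list_all2 (\<lambda>g y. ev g xs y) gs ys \<Longrightarrow> ev f ys z \<Longrightarrow> ev (Cn f gs) xs z"
| ev_Pr0: "ev f xs y \<Longrightarrow> ev (Pr f g) (0 # xs) y"
| ev_PrS: "ev (Pr f g) (n # xs) y \<Longrightarrow> ev g (n # y # xs) z \<Longrightarrow> ev (Pr f g) (Suc n # xs) z"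
| ev_Mn: "ev f (n # xs) 0 \<Longrightarrow> (\<forall>m<n. \<exists>k. ev f (m # xs) (Suc k)) \<Longrightarrow> ev (Mn f) xs n"

fun enc :: "recf \<Rightarrow> nat" where
  "enc Zr = prod_encode (0, 0)"
| "enc Sc = prod_encode (1, 0)"
| "enc (Pj i) = prod_encode (2, i)"
| "enc (Cn f gs) = prod_encode (3, prod_encode (enc f, list_encode (map enc gs)))"
| "enc (Pr f g) = prod_encode (4, prod_encode (enc f, enc g))"
| "enc (Mn f) = prod_encode (5, enc f)"

definition phi :: "nat \<Rightarrow> nat \<Rightarrow> nat option" where
  "phi e x = (if \<exists>p v. enc p = e \<and> ev p [x] v
              then Some (THE v. \<exists>p. enc p = e \<and> ev p [x] v) else None)"

definition computable_set :: "nat set \<Rightarrow> bool" where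
  "computable_set S \<longleftrightarrow> (\<exists>e. \<forall>x. phi e x = Some (if x \<in> S then 1 else 0))"

definition computable_fun :: "(nat \<Rightarrow> nat) \<Rightarrow> bool" where
  "computable_fun f \<longleftrightarrow> (\<exists>e. \<forall>n. phi e n = Some (f n))"

fun sigma_cls :: "nat \<Rightarrow> nat set set" where
  "sigma_cls 0 = {S. computable_set S}"
| "sigma_cls (Suc n) = {S. \<exists>R. - R \<in> sigma_cls n \<and> S = {x. \<exists>y. prod_encode (x, y) \<in> R}}"

definition pi_cls :: "nat \<Rightarrow> nat set set" where
  "pi_cls n = {S. - S \<in> sigma_cls n}"

definition d_sigma2 :: "nat set set" where
  "d_sigma2 = {S. \<exists>S1 S2. S1 \<in> sigma_cls 2 \<and> S2 \<in> sigma_cls 2 \<and> S = S1 - S2}"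

record ostr =
  s_carrier :: "nat set"
  s_add :: "nat \<Rightarrow> nat \<Rightarrow> nat"
  s_mul :: "nat \<Rightarrow> nat \<Rightarrow> nat"
  s_neg :: "nat \<Rightarrow> nat"
  s_zero :: nat
  s_one :: nat
  s_less :: "nat \<Rightarrow> nat \<Rightarrow> bool"

definition wf_str :: "ostr \<Rightarrow> bool" where
  "wf_str A \<longleftrightarrow> s_zero A \<in> s_carrier A \<and> s_one A \<in> s_carrier A
     \<and> (\<forall>x\<in>s_carrier A. \<forall>y\<in>s_carrier A. s_add A x y \<in> s_carrier A \<and> s_mul A x y \<in> s_carrier A)
     \<and> (\<forall>x\<in>s_carrier A. s_neg A x \<in> s_carrier A)"

definition iso :: "ostr \<Rightarrow> ostr \<Rightarrow> bool" where
  "iso A B \<longleftrightarrow> (\<exists>f. bij_betw f (s_carrier A) (s_carrier B)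
     \<and> f (s_zero A) = s_zero B \<and> f (s_one A) = s_one B
     \<and> (\<forall>x\<in>s_carrier A. \<forall>y\<in>s_carrier A.
          f (s_add A x y) = s_add B (f x) (f y) \<and> f (s_mul A x y) = s_mul B (f x) (f y)
          \<and> (s_less A x y \<longleftrightarrow> s_less B (f x) (f y)))
     \<and> (\<forall>x\<in>s_carrier A. f (s_neg A x) = s_neg B (f x)))"

datatype tm = TC nat | TZ | TO | TAdd tm tm | TMul tm tm | TNeg tm
datatype lit = LEq tm tm | LLt tm tm | LNEq tm tm | LNLt tm tm

fun code_tm :: "tm \<Rightarrow> nat" where
  "code_tm (TC n) = prod_encode (0, n)"
| "code_tm TZ = prod_encode (1, 0)"
| "code_tm TO = prod_encode (2, 0)"
| "code_tm (TAdd a b) = prod_encode (3, prod_encode (code_tm a, code_tm b))"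
| "code_tm (TMul a b) = prod_encode (4, prod_encode (code_tm a, code_tm b))"
| "code_tm (TNeg a) = prod_encode (5, code_tm a)"

fun code_lit :: "lit \<Rightarrow> nat" where
  "code_lit (LEq a b) = prod_encode (0, prod_encode (code_tm a, code_tm b))"
| "code_lit (LLt a b) = prod_encode (1, prod_encode (code_tm a, code_tm b))"
| "code_lit (LNEq a b) = prod_encode (2, prod_encode (code_tm a, code_tm b))"
| "code_lit (LNLt a b) = prod_encode (3, prod_encode (code_tm a, code_tm b))"

fun tm_consts :: "tm \<Rightarrow> nat set" where
  "tm_consts (TC n) = {n}"
| "tm_consts TZ = {}"
| "tm_consts TO = {}"
| "tm_consts (TAdd a b) = tm_consts a \<union> tm_consts b"
| "tm_consts (TMul a b) = tm_consts a \<union> tm_consts b"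
| "tm_consts (TNeg a) = tm_consts a"

fun lit_consts :: "lit \<Rightarrow> nat set" where
  "lit_consts (LEq a b) = tm_consts a \<union> tm_consts b"
| "lit_consts (LLt a b) = tm_consts a \<union> tm_consts b"
| "lit_consts (LNEq a b) = tm_consts a \<union> tm_consts b"
| "lit_consts (LNLt a b) = tm_consts a \<union> tm_consts b"

fun tm_val :: "ostr \<Rightarrow> tm \<Rightarrow> nat" where
  "tm_val A (TC n) = n"
| "tm_val A TZ = s_zero A"
| "tm_val A TO = s_one A"
| "tm_val A (TAdd a b) = s_add A (tm_val A a) (tm_val A b)"
| "tm_val A (TMul a b) = s_mul A (tm_val A a) (tm_val A b)"
| "tm_val A (TNeg a) = s_neg A (tm_val A a)"

fun lit_holds :: "ostr \<Rightarrow> lit \<Rightarrow> bool" where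
  "lit_holds A (LEq a b) = (tm_val A a = tm_val A b)"
| "lit_holds A (LLt a b) = s_less A (tm_val A a) (tm_val A b)"
| "lit_holds A (LNEq a b) = (tm_val A a \<noteq> tm_val A b)"
| "lit_holds A (LNLt a b) = (\<not> s_less A (tm_val A a) (tm_val A b))"

definition diag :: "ostr \<Rightarrow> nat set" where
  "diag A = {code_lit l | l. lit_consts l \<subseteq> s_carrier A \<and> lit_holds A l}"

definition computable_str :: "ostr \<Rightarrow> bool" where
  "computable_str A \<longleftrightarrow> wf_str A \<and> computable_set (diag A)"

definition is_index :: "nat \<Rightarrow> ostr \<Rightarrow> bool" where
  "is_index a A \<longleftrightarrow> (\<forall>x. phi a x = Some (if x \<in> diag A then 1 else 0))"

definition ordered_field_str :: "ostr \<Rightarrow> bool" where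
  "ordered_field_str A \<longleftrightarrow> wf_str A \<and>
   (let C = s_carrier A; ad = s_add A; mu = s_mul A; ng = s_neg A;
        z = s_zero A; u = s_one A; lt = s_less A in
    (\<forall>x\<in>C. \<forall>y\<in>C. \<forall>w\<in>C. ad (ad x y) w = ad x (ad y w) \<and> mu (mu x y) w = mu x (mu y w)
        \<and> mu x (ad y w) = ad (mu x y) (mu x w)) \<and>
    (\<forall>x\<in>C. \<forall>y\<in>C. ad x y = ad y x \<and> mu x y = mu y x) \<and>
    (\<forall>x\<in>C. ad x z = x \<and> mu x u = x \<and> ad x (ng x) = z) \<and>
    z \<noteq> u \<and>
    (\<forall>x\<in>C. x \<noteq> z \<longrightarrow> (\<exists>y\<in>C. mu x y = u)) \<and>
    (\<forall>x\<in>C. \<not> lt x x) \<and>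
    (\<forall>x\<in>C. \<forall>y\<in>C. \<forall>w\<in>C. lt x y \<longrightarrow> lt y w \<longrightarrow> lt x w) \<and>
    (\<forall>x\<in>C. \<forall>y\<in>C. lt x y \<or> x = y \<or> lt y x) \<and>
    (\<forall>x\<in>C. \<forall>y\<in>C. \<forall>w\<in>C. lt x y \<longrightarrow> lt (ad x w) (ad y w)) \<and>
    (\<forall>x\<in>C. \<forall>y\<in>C. lt z x \<longrightarrow> lt z y \<longrightarrow> lt z (mu x y)))"

text \<open>Evaluation of a one-variable polynomial, coefficients listed from degree 0 upward.\<close>
fun hev :: "ostr \<Rightarrow> nat list \<Rightarrow> nat \<Rightarrow> nat" where
  "hev A [] x = s_zero A"
| "hev A (c # cs) x = s_add A c (s_mul A x (hev A cs x))"

definition real_closed_str :: "ostr \<Rightarrow> bool" where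
  "real_closed_str A \<longleftrightarrow> ordered_field_str A \<and>
    (\<forall>x\<in>s_carrier A. s_less A (s_zero A) x \<longrightarrow> (\<exists>y\<in>s_carrier A. s_mul A y y = x)) \<and>
    (\<forall>cs. set cs \<subseteq> s_carrier A \<and> cs \<noteq> [] \<and> last cs \<noteq> s_zero A \<and> odd (length cs - 1)
       \<longrightarrow> (\<exists>x\<in>s_carrier A. hev A cs x = s_zero A))"

fun nat_el :: "ostr \<Rightarrow> nat \<Rightarrow> nat" where
  "nat_el A 0 = s_zero A"
| "nat_el A (Suc n) = s_add A (nat_el A n) (s_one A)"

definition archimedean_str :: "ostr \<Rightarrow> bool" where
  "archimedean_str A \<longleftrightarrow> (\<forall>x\<in>s_carrier A. \<exists>n. s_less A x (nat_el A n))"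

definition arch_rcf :: "ostr \<Rightarrow> bool" where
  "arch_rcf A \<longleftrightarrow> real_closed_str A \<and> archimedean_str A"

definition int_el :: "ostr \<Rightarrow> int \<Rightarrow> nat" where
  "int_el A k = (if 0 \<le> k then nat_el A (nat k) else s_neg A (nat_el A (nat (- k))))"

fun pow_el :: "ostr \<Rightarrow> nat \<Rightarrow> nat \<Rightarrow> nat" where
  "pow_el A x 0 = s_one A"
| "pow_el A x (Suc k) = s_mul A x (pow_el A x k)"

definition mono_el :: "ostr \<Rightarrow> nat list \<Rightarrow> nat list \<Rightarrow> nat" where
  "mono_el A e xs = foldr (\<lambda>(k, x) acc. s_mul A (pow_el A x k) acc) (zip e xs) (s_one A)"

text \<open>A multivariate integer polynomial given as a list of (coefficient, exponent vector) pairs\<close>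
definition peval :: "ostr \<Rightarrow> (int \<times> nat list) list \<Rightarrow> nat list \<Rightarrow> nat" where
  "peval A ps xs = foldr (\<lambda>(c, e) acc. s_add A (s_mul A (int_el A c) (mono_el A e xs)) acc) ps (s_zero A)"

definition nonzero_poly :: "nat \<Rightarrow> (int \<times> nat list) list \<Rightarrow> bool" where
  "nonzero_poly n ps \<longleftrightarrow> distinct (map snd ps) \<and> (\<forall>(c, e)\<in>set ps. length e = n)
      \<and> (\<exists>(c, e)\<in>set ps. c \<noteq> 0)"

definition alg_indep :: "ostr \<Rightarrow> nat list \<Rightarrow> bool" where
  "alg_indep A xs \<longleftrightarrow> set xs \<subseteq> s_carrier A \<and> distinct xs \<and>
     (\<forall>ps. nonzero_poly (length xs) ps \<longrightarrow> peval A ps xs \<noteq> s_zero A)"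

definition trdeg :: "ostr \<Rightarrow> enat" where
  "trdeg A = Sup {enat (length xs) | xs. alg_indep A xs}"

definition I_str :: "ostr \<Rightarrow> nat set" where
  "I_str A = {a. \<exists>B. wf_str B \<and> iso B A \<and> is_index a B}"

definition I_K :: "nat set" where
  "I_K = {a. \<exists>B. arch_rcf B \<and> is_index a B}"

definition in_within :: "nat set set \<Rightarrow> nat set \<Rightarrow> nat set \<Rightarrow> bool" where
  "in_within \<Gamma> X IK \<longleftrightarrow> (\<exists>R\<in>\<Gamma>. X = R \<inter> IK)"

definition m_complete_within :: "nat set set \<Rightarrow> nat set \<Rightarrow> nat set \<Rightarrow> bool" where
  "m_complete_within \<Gamma> X IK \<longleftrightarrow> in_within \<Gamma> X IK \<and>
     (\<forall>S\<in>\<Gamma>. \<exists>f. computable_fun f \<and> (\<forall>n. f n \<in> IK) \<and> (\<forall>n. n \<in> S \<longleftrightarrow> f n \<in> X))"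

end

theory Submission
  imports Defs Complex_Main "HOL-Computational_Algebra.Computational_Algebra"
begin

text \<open>An Archimedean real closed field is determined up to isomorphism by its image \<open>F\<close> in the reals, so membership in the
  index set is a statement about cuts, and, for finite transcendence degree, about algebraic independence of tuples;
  counting quantifiers gives the upper bounds.

  For the lower bounds, let \<open>\<rho>\<^sub>i\<close> be uniformly computable reals and \<open>G\<^sub>n\<close> a uniformly \<open>\<Sigma>\<^sub>2\<close> family of index sets
  such that the \<open>\<rho>\<^sub>i\<close> with \<open>i \<in> G\<^sub>n\<close> are algebraically independent. Then the real closures of \<open>{\<rho>\<^sub>i | i \<in> G\<^sub>n}\<close> have
  uniformly computable presentations: a generator whose guess turns out wrong is turned into the current rational
  approximation, the other elements are named as isolated simple roots, nonzero values are recognised by ball arithmetic,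
  and zero values by certificates that express a nonzero multiple of the polynomial through the defining relations
  of the names occurring in it. Such certificates exist because each relation has a simple root. Adding to, or removing
  from, a transcendence basis of \<open>F\<close> elements controlled by the given set (and one computable real outside \<open>F\<close>) yields the
  reductions.\<close>

section \<open>Computable functions on encodable types\<close>

text \<open>Equality in the closure has to be decided although membership in \<open>G n\<close> is
  only \<open>\<Sigma>\<^sub>2\<close>. Two searches run side by side: balls confirm a nonzero
  value, certificates a zero value, and one of them succeeds. Wrong guesses do no harm: a refuted
  name has become a rational, whose linear equation is one more relation, and from some stage on all
  wrong names in a given term are refuted. Right names have no relation at all; there the
  independence of the generators in \<open>G n\<close> enters. The simple root matters because a
  defining term need not be minimal: it is a multiple of a minimal polynomial \<open>mu\<close> at
  the point, and the nonzero derivative says that the cofactor of \<open>mu\<close> does not vanish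
  there and may be cancelled. The three levels differ in which generators are conditional. For
  \<open>\<Pi>\<^sub>2\<close>, the outside real is adjoined iff \<open>n \<notin> S\<close>. For
  \<open>S1 - S2\<close>, the last basis element is kept iff \<open>n \<in> S1\<close> and the
  outside real adjoined iff \<open>n \<in> S2\<close>. For \<open>\<Pi>\<^sub>3\<close>, basis
  element \<open>i\<close> is kept iff conditions 0 to \<open>i\<close> hold, so that one failing
  condition leaves only a finite set.\<close>

inductive_cases ev_ZrE: "ev Zr xs v"
inductive_cases ev_ScE: "ev Sc xs v"
inductive_cases ev_PjE: "ev (Pj i) xs v"
inductive_cases ev_CnE: "ev (Cn f gs) xs v"
inductive_cases ev_PrE: "ev (Pr f g) xs v"
inductive_cases ev_MnE: "ev (Mn f) xs v"

lemma ev_det: "ev p xs v \<Longrightarrow> ev p xs w \<Longrightarrow> v = w"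
proof (induction arbitrary: w rule: ev.induct)
  case (ev_Zr xs) then show ?case by (auto elim: ev_ZrE)
next
  case (ev_Sc x xs) then show ?case by (auto elim: ev_ScE)
next
  case (ev_Pj i xs) then show ?case by (auto elim: ev_PjE)
next
  case (ev_Cn xs gs ys f z)
  from ev_Cn.prems obtain ys' where ys': "list_all2 (\<lambda>g y. ev g xs y) gs ys'" "ev f ys' w"
    by (auto elim: ev_CnE)
  have "ys = ys'"
  proof (rule nth_equalityI)
    show "length ys = length ys'" using ev_Cn.IH(1) ys'(1) by (simp add: list_all2_conv_all_nth)
    fix i assume "i < length ys"
    then show "ys ! i = ys' ! i" using ev_Cn.IH(1) ys'(1) unfolding list_all2_conv_all_nth by metis
  qed
  then show ?case using ys'(2) ev_Cn.IH(2) by simp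
next
  case (ev_Pr0 f xs y g) from ev_Pr0.prems show ?case by (rule ev_PrE) (use ev_Pr0.IH in auto)
next
  case (ev_PrS f g n xs y z)
  from ev_PrS.prems obtain y' where "ev (Pr f g) (n # xs) y'" "ev g (n # y' # xs) w"
    by (rule ev_PrE) auto
  then show ?case using ev_PrS.IH by metis
next
  case (ev_Mn f n xs)
  from ev_Mn.prems have w: "ev f (w # xs) 0" "\<forall>m<w. \<exists>k. ev f (m # xs) (Suc k)"
    by (auto elim: ev_MnE)
  have "\<not> n < w" using ev_Mn.IH(1) w(2) by (metis nat.distinct(1))
  moreover have "\<not> w < n" using ev_Mn.IH(2) w(1) by (metis nat.distinct(1))
  ultimately show ?case by simp
qed

text \<open>\<open>phi\<close> speaks of programs through their codes; this is what identifies two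
  programs found for the same code.\<close>

lemma enc_inject: "enc p = enc q \<Longrightarrow> p = q"
proof (induction p arbitrary: q)
  case (Cn f gs)
  from Cn.prems obtain f' gs' where q: "q = Cn f' gs'" by (cases q) auto
  have "f = f'" using Cn.prems q Cn.IH(1) by auto
  moreover have "map enc gs = map enc gs'" using Cn.prems q by (auto simp: list_encode_eq)
  then have "gs = gs'" by (rule list.inj_map_strong[rotated]) (use Cn.IH(2) in blast)
  ultimately show ?case using q by simp
next
  case Zr then show ?case by (cases q) auto
next
  case Sc then show ?case by (cases q) auto
next
  case (Pj i) then show ?case by (cases q) auto
next
  case (Pr f g) then show ?case by (cases q) auto
next
  case (Mn f) then show ?case by (cases q) auto
qed

lemma ev_Cn1: "ev g xs y \<Longrightarrow> ev f [y] z \<Longrightarrow> ev (Cn f [g]) xs z"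
  by (rule ev_Cn[where ys = "[y]"]) auto

lemma ev_Cn2: "ev g xs y \<Longrightarrow> ev h xs w \<Longrightarrow> ev f [y, w] z \<Longrightarrow> ev (Cn f [g, h]) xs z"
  by (rule ev_Cn[where ys = "[y, w]"]) auto

text \<open>Injectivity of \<open>enc\<close> and determinacy of \<open>ev\<close> make the definite
  description in \<open>phi\<close> harmless.\<close>

lemma phi_iff: "phi e x = Some v \<longleftrightarrow> (\<exists>p. enc p = e \<and> ev p [x] v)"
proof
  assume "phi e x = Some v"
  then have ex: "\<exists>p v. enc p = e \<and> ev p [x] v" and v: "v = (THE v. \<exists>p. enc p = e \<and> ev p [x] v)"
    unfolding phi_def by (auto split: if_splits)
  then obtain p w where pw: "enc p = e" "ev p [x] w" by blast
  have "(THE v. \<exists>p. enc p = e \<and> ev p [x] v) = w"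
  proof (rule the_equality)
    fix u assume "\<exists>p. enc p = e \<and> ev p [x] u"
    then obtain q where q: "enc q = e" "ev q [x] u" by blast
    then have "q = p" using pw(1) by (intro enc_inject) simp
    then show "u = w" using q(2) pw(2) ev_det by simp
  qed (use pw in auto)
  then show "\<exists>p. enc p = e \<and> ev p [x] v" using pw v by blast
next
  assume "\<exists>p. enc p = e \<and> ev p [x] v"
  then obtain p where pw: "enc p = e" "ev p [x] v" by blast
  have "(THE v. \<exists>p. enc p = e \<and> ev p [x] v) = v"
  proof (rule the_equality)
    fix u assume "\<exists>p. enc p = e \<and> ev p [x] u"
    then obtain q where q: "enc q = e" "ev q [x] u" by blast
    then have "q = p" using pw(1) by (intro enc_inject) simp
    then show "u = v" using q(2) pw(2) ev_det by simp
  qed (use pw in auto)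
  then show "phi e x = Some v" using pw unfolding phi_def by auto
qed

text \<open>\<open>phi\<close> would allow another program for every input; injectivity of
  \<open>enc\<close> forces a single one.\<close>

lemma phi_total_iff: "(\<exists>e. \<forall>x. phi e x = Some (f x)) \<longleftrightarrow> (\<exists>p. \<forall>x. ev p [x] (f x))"
proof
  assume "\<exists>e. \<forall>x. phi e x = Some (f x)"
  then obtain e where e: "\<forall>x. \<exists>p. enc p = e \<and> ev p [x] (f x)" unfolding phi_iff by blast
  then obtain p where p: "enc p = e" by blast
  have "ev p [x] (f x)" for x
  proof -
    obtain q where q: "enc q = e" "ev q [x] (f x)" using e by blast
    then have "q = p" using p by (intro enc_inject) simp
    then show ?thesis using q by simp
  qed
  then show "\<exists>p. \<forall>x. ev p [x] (f x)" by blast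
qed (auto simp: phi_iff)

text \<open>A bootstrap notion with explicit arity, close to the program constructors. The results
  are then transferred to functions between coded types, which is the notion used
  afterwards.\<close>

definition recn :: "nat \<Rightarrow> (nat list \<Rightarrow> nat) \<Rightarrow> bool" where
  "recn k F \<longleftrightarrow> (\<exists>p. \<forall>xs. length xs = k \<longrightarrow> ev p xs (F xs))"

lemma recn_cong: "recn k F \<Longrightarrow> (\<And>xs. length xs = k \<Longrightarrow> F xs = G xs) \<Longrightarrow> recn k G"
  unfolding recn_def by metis

lemma recn_nth: "i < k \<Longrightarrow> recn k (\<lambda>xs. xs ! i)"
  unfolding recn_def by (rule exI[of _ "Pj i"]) (auto intro: ev_Pj)

lemma recn_nth_small: "recn 2 (\<lambda>xs. xs ! 0)" "recn 2 (\<lambda>xs. xs ! Suc 0)" "recn (Suc 0) (\<lambda>xs. xs ! 0)"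
  by (simp_all add: recn_nth)

lemma recn_zero: "recn k (\<lambda>xs. 0)"
  unfolding recn_def by (rule exI[of _ Zr]) (auto intro: ev_Zr)

lemma recn_Suc: "recn k F \<Longrightarrow> recn k (\<lambda>xs. Suc (F xs))"
proof -
  assume "recn k F"
  then obtain p where p: "\<And>xs. length xs = k \<Longrightarrow> ev p xs (F xs)" unfolding recn_def by blast
  have "ev (Cn Sc [p]) xs (Suc (F xs))" if "length xs = k" for xs
    by (rule ev_Cn[where ys = "[F xs]"]) (use p that in \<open>auto intro: ev_Sc\<close>)
  then show ?thesis unfolding recn_def by blast
qed

lemma recn_comp1:
  assumes "recn 1 (\<lambda>xs. h (xs ! 0))" "recn k F"
  shows "recn k (\<lambda>xs. h (F xs))"
proof -
  obtain p q where p: "\<forall>xs. length xs = 1 \<longrightarrow> ev p xs (h (xs ! 0))"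
    and q: "\<forall>xs. length xs = k \<longrightarrow> ev q xs (F xs)"
    using assms unfolding recn_def by auto
  show ?thesis unfolding recn_def
  proof (rule exI[of _ "Cn p [q]"], intro allI impI)
    fix xs :: "nat list" assume "length xs = k"
    moreover have "ev p [F xs] (h (F xs))" using p[rule_format, of "[F xs]"] by simp
    ultimately show "ev (Cn p [q]) xs (h (F xs))" using q by (auto intro!: ev_Cn[where ys = "[F xs]"])
  qed
qed

lemma recn_comp2:
  assumes "recn 2 (\<lambda>xs. h (xs ! 0) (xs ! 1))" "recn k F" "recn k G"
  shows "recn k (\<lambda>xs. h (F xs) (G xs))"
proof -
  obtain p q r where p: "\<forall>xs. length xs = 2 \<longrightarrow> ev p xs (h (xs ! 0) (xs ! 1))"
    and q: "\<forall>xs. length xs = k \<longrightarrow> ev q xs (F xs)" and r: "\<forall>xs. length xs = k \<longrightarrow> ev r xs (G xs)"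
    using assms unfolding recn_def by auto
  show ?thesis unfolding recn_def
  proof (rule exI[of _ "Cn p [q, r]"], intro allI impI)
    fix xs :: "nat list" assume "length xs = k"
    moreover have "ev p [F xs, G xs] (h (F xs) (G xs))" using p[rule_format, of "[F xs, G xs]"] by simp
    ultimately show "ev (Cn p [q, r]) xs (h (F xs) (G xs))"
      using q r by (auto intro!: ev_Cn[where ys = "[F xs, G xs]"])
  qed
qed

lemma recn_rec2:
  assumes "recn 1 (\<lambda>xs. f (xs ! 0))" "recn 3 (\<lambda>xs. g (xs ! 0) (xs ! 1) (xs ! 2))"
  shows "recn 2 (\<lambda>xs. rec_nat (f (xs ! 1)) (\<lambda>i r. g i r (xs ! 1)) (xs ! 0))"
proof -
  obtain p q where p: "\<forall>xs. length xs = 1 \<longrightarrow> ev p xs (f (xs ! 0))"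
    and q: "\<forall>xs. length xs = 3 \<longrightarrow> ev q xs (g (xs ! 0) (xs ! 1) (xs ! 2))"
    using assms unfolding recn_def by auto
  have p': "ev p [x] (f x)" for x using p[rule_format, of "[x]"] by simp
  have q': "ev q [i, r, x] (g i r x)" for i r x using q[rule_format, of "[i, r, x]"] by simp
  have "ev (Pr p q) [n, x] (rec_nat (f x) (\<lambda>i r. g i r x) n)" for n x
    by (induction n) (auto intro: ev_Pr0 ev_PrS p' q')
  then show ?thesis unfolding recn_def
    by (intro exI[of _ "Pr p q"]) (auto simp: numeral_2_eq_2 length_Suc_conv)
qed

lemma recn_mu:
  assumes "recn 2 (\<lambda>xs. f (xs ! 0) (xs ! 1))" "\<And>x. \<exists>n. f n x = 0"
  shows "recn 1 (\<lambda>xs. LEAST n. f n (xs ! 0) = 0)"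
proof -
  obtain p where p: "\<forall>xs. length xs = 2 \<longrightarrow> ev p xs (f (xs ! 0) (xs ! 1))"
    using assms unfolding recn_def by auto
  have p': "ev p [n, x] (f n x)" for n x using p[rule_format, of "[n, x]"] by simp
  have "ev (Mn p) [x] (LEAST n. f n x = 0)" for x
  proof (rule ev_Mn)
    have "f (LEAST n. f n x = 0) x = 0" by (rule LeastI_ex) (rule assms)
    then show "ev p [LEAST n. f n x = 0, x] 0" using p' by metis
    show "\<forall>m<LEAST n. f n x = 0. \<exists>k. ev p [m, x] (Suc k)"
      using not_less_Least p' by (metis not0_implies_Suc)
  qed
  then show ?thesis unfolding recn_def
    by (intro exI[of _ "Mn p"]) (auto simp: length_Suc_conv)
qed

lemma recn_add: "recn k F \<Longrightarrow> recn k G \<Longrightarrow> recn k (\<lambda>xs. F xs + G xs)"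
proof (rule recn_comp2[where h = "(+)"])
  have "rec_nat y (\<lambda>i r. Suc r) x = x + y" for x y :: nat by (induction x) auto
  then show "recn 2 (\<lambda>xs. xs ! 0 + xs ! 1)"
    using recn_rec2[of "\<lambda>x. x" "\<lambda>i r x. Suc r"] by (simp add: recn_nth recn_Suc)
qed

lemma recn_mult: "recn k F \<Longrightarrow> recn k G \<Longrightarrow> recn k (\<lambda>xs. F xs * G xs)"
proof (rule recn_comp2[where h = times])
  have "rec_nat 0 (\<lambda>i r. r + y) x = x * y" for x y :: nat by (induction x) auto
  then show "recn 2 (\<lambda>xs. xs ! 0 * xs ! 1)"
    using recn_rec2[of "\<lambda>x. 0" "\<lambda>i r x. r + x"] by (simp add: recn_nth recn_add recn_zero)
qed

lemma recn_pred: "recn k F \<Longrightarrow> recn k (\<lambda>xs. F xs - 1)"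
proof (rule recn_comp1[where h = "\<lambda>x. x - 1"])
  have e: "rec_nat 0 (\<lambda>i r. i) x = x - 1" for x :: nat by (cases x) auto
  have "recn 2 (\<lambda>xs. rec_nat 0 (\<lambda>i r. i) (xs ! 0))"
    using recn_rec2[of "\<lambda>x. 0" "\<lambda>i r x. i"] by (simp add: recn_nth recn_zero)
  then have "recn 2 (\<lambda>xs. xs ! 0 - 1)" unfolding e .
  from recn_comp2[of "\<lambda>a b. a - 1", OF this, of 1 "\<lambda>xs. xs ! 0" "\<lambda>xs. xs ! 0"]
  show "recn 1 (\<lambda>xs. xs ! 0 - 1)" by (simp add: recn_nth)
qed

lemma recn_diff: "recn k F \<Longrightarrow> recn k G \<Longrightarrow> recn k (\<lambda>xs. F xs - G xs)"
proof (rule recn_comp2[where h = "(-)"])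
  have e: "rec_nat y (\<lambda>i r. r - 1) x = y - x" for x y :: nat by (induction x) auto
  have "recn 2 (\<lambda>xs. rec_nat (xs ! 1) (\<lambda>i r. r - 1) (xs ! 0))"
    using recn_rec2[of "\<lambda>x. x" "\<lambda>i r x. r - 1", OF recn_nth recn_pred[OF recn_nth]] by simp
  then have "recn 2 (\<lambda>xs. xs ! 1 - xs ! 0)" unfolding e .
  from recn_comp2[of "\<lambda>a b. b - a", OF this, of 2 "\<lambda>xs. xs ! 1" "\<lambda>xs. xs ! 0"]
  show "recn 2 (\<lambda>xs. xs ! 0 - xs ! 1)" by (simp add: recn_nth)
qed

lemma recn_triangle: "recn k F \<Longrightarrow> recn k (\<lambda>xs. triangle (F xs))"
proof (rule recn_comp1[where h = "triangle"])
  have e: "rec_nat 0 (\<lambda>i r. r + Suc i) x = triangle x" for x :: nat by (induction x) auto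
  have "recn 2 (\<lambda>xs. rec_nat 0 (\<lambda>i r. r + Suc i) (xs ! 0))"
    using recn_rec2[of "\<lambda>x. 0" "\<lambda>i r x. r + Suc i"] recn_add[OF recn_nth recn_Suc[OF recn_nth], of 1 3 0]
    by (simp add: recn_zero)
  then have "recn 2 (\<lambda>xs. triangle (xs ! 0))" unfolding e .
  from recn_comp2[of "\<lambda>a b. triangle a", OF this, of 1 "\<lambda>xs. xs ! 0" "\<lambda>xs. xs ! 0"]
  show "recn 1 (\<lambda>xs. triangle (xs ! 0))" by (simp add: recn_nth)
qed

lemma recn_pair: "recn k F \<Longrightarrow> recn k G \<Longrightarrow> recn k (\<lambda>xs. prod_encode (F xs, G xs))"
  unfolding prod_encode_def case_prod_conv by (intro recn_add recn_triangle)

lemma mono_triangle: "m \<le> n \<Longrightarrow> triangle m \<le> triangle n"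
  by (induction n) (auto simp: le_Suc_eq)

text \<open>The diagonal \<open>a + b\<close> of a Cantor pair is the least \<open>n\<close> with
  \<open>x < triangle (n + 1)\<close>. The condition is written as an equation with 0, the only test
  that \<open>Mn\<close> performs.\<close>

lemma prod_decode_via_triangle:
  fixes x defines "s \<equiv> LEAST n. Suc x - triangle (Suc n) = 0"
  shows "fst (prod_decode x) = x - triangle s" "snd (prod_decode x) = s - (x - triangle s)"
proof -
  obtain a b where ab: "prod_decode x = (a, b)" by force
  then have "x = prod_encode (a, b)" by (metis prod_decode_inverse)
  then have x: "x = triangle (a + b) + a" by (simp add: prod_encode_def)
  have "s = a + b" unfolding s_def
  proof (rule Least_equality)
    show "Suc x - triangle (Suc (a + b)) = 0" using x by simp
    fix y assume "Suc x - triangle (Suc y) = 0"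
    then have "Suc x \<le> triangle (Suc y)" by simp
    then show "a + b \<le> y" using x mono_triangle[of "Suc y" "a + b"] by (cases "a + b \<le> y") auto
  qed
  then show "fst (prod_decode x) = x - triangle s" "snd (prod_decode x) = s - (x - triangle s)"
    using ab x by auto
qed

lemma recn_unpair:
  "recn 1 (\<lambda>xs. fst (prod_decode (xs ! 0)))" "recn 1 (\<lambda>xs. snd (prod_decode (xs ! 0)))"
proof -
  have s: "recn 1 (\<lambda>xs. LEAST n. Suc (xs ! 0) - triangle (Suc n) = 0)"
  proof (rule recn_mu)
    show "recn 2 (\<lambda>xs. Suc (xs ! 1) - triangle (Suc (xs ! 0)))"
      by (intro recn_diff recn_Suc recn_triangle recn_nth) auto
    fix x
    have "x \<le> triangle x" by (induction x) auto
    then have "Suc x - triangle (Suc x) = 0" by simp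
    then show "\<exists>n. Suc x - triangle (Suc n) = 0" by blast
  qed
  show "recn 1 (\<lambda>xs. fst (prod_decode (xs ! 0)))" "recn 1 (\<lambda>xs. snd (prod_decode (xs ! 0)))"
    unfolding prod_decode_via_triangle by (intro recn_diff recn_triangle s recn_nth; simp)+
qed

text \<open>With truncated subtraction, \<open>1 - x\<close> and \<open>1 - (1 - x)\<close> are the
  indicators of \<open>x = 0\<close> and \<open>x \<noteq> 0\<close>.\<close>

lemma recn_if0: "recn 3 (\<lambda>xs. if xs ! 0 = 0 then xs ! 1 else xs ! 2)"
proof -
  have "recn 3 (\<lambda>xs. (1 - xs ! 0) * xs ! 1 + (1 - (1 - xs ! 0)) * xs ! 2)"
    unfolding One_nat_def
    by (intro recn_add recn_mult recn_diff recn_Suc recn_zero recn_nth) auto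
  then show ?thesis by (rule recn_cong) auto
qed

section \<open>Coded types and computable functions between them\<close>

class cod =
  fixes cd :: "'a \<Rightarrow> nat"
  assumes cd_inj: "cd x = cd y \<Longrightarrow> x = y"

text \<open>A bijective coding lets a quantifier over the type stand for a quantifier over numbers,
  as in the arithmetical classes. Results of tests have type \<open>bool\<close>, which is only
  injectively coded.\<close>

class bcod = cod +
  assumes cd_surj: "\<exists>x. cd x = n"

instantiation nat :: bcod begin
definition "cd_nat = (\<lambda>n :: nat. n)"
instance by standard (auto simp: cd_nat_def)
end

instantiation bool :: cod begin
definition "cd_bool = (of_bool :: bool \<Rightarrow> nat)"
instance by standard (simp add: cd_bool_def of_bool_eq_iff)
end

instantiation prod :: (cod, cod) cod begin
definition "cd_prod = (\<lambda>(a, b). prod_encode (cd a, cd b))"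
instance by standard (auto simp: cd_prod_def dest: cd_inj)
end

instance prod :: (bcod, bcod) bcod
proof
  fix n
  obtain a b :: nat where "n = prod_encode (a, b)" by (metis prod_decode_inverse surj_pair)
  moreover obtain x y where "cd (x :: 'a) = a" "cd (y :: 'b) = b" by (metis cd_surj)
  ultimately show "\<exists>x. cd (x :: 'a \<times> 'b) = n" by (intro exI[of _ "(x, y)"]) (simp add: cd_prod_def)
qed

instantiation list :: (cod) cod begin
definition "cd_list xs = list_encode (map cd xs)"
instance
proof
  fix xs ys :: "'a list" assume "cd xs = cd ys"
  then have "map cd xs = map cd ys" by (simp add: cd_list_def list_encode_eq)
  then show "xs = ys" by (rule list.inj_map_strong[rotated]) (rule cd_inj)
qed
end

instance list :: (bcod) bcod
proof
  fix n
  have "\<exists>xs :: 'a list. list_decode n = map cd xs"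
    unfolding ex_map_conv by (metis cd_surj)
  then obtain xs :: "'a list" where "map cd xs = list_decode n" by metis
  then show "\<exists>xs. cd (xs :: 'a list) = n"
    by (intro exI[of _ xs]) (simp add: cd_list_def)
qed

lemma cd_eq_iff: "cd x = cd y \<longleftrightarrow> x = y"
  by (auto dest: cd_inj)

lemma cd_list_simps: "cd [] = 0" "cd (x # xs) = Suc (prod_encode (cd x, cd xs))"
  by (auto simp: cd_list_def)

definition dc :: "nat \<Rightarrow> 'a :: bcod" where "dc n = (SOME x. cd x = n)"

lemma cd_dc [simp]: "cd (dc n :: 'a :: bcod) = n"
  unfolding dc_def by (rule someI_ex) (rule cd_surj)

lemma dc_cd [simp]: "dc (cd x) = x"
  by (rule cd_inj) simp

text \<open>Only one argument is foreseen; further parameters are packed into tuples. The rules in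
  \<open>cmp_intros\<close> follow the syntax of definitions, so that computability of a compound
  notion is derived by introduction rules alone.\<close>

definition cmp :: "('a :: cod \<Rightarrow> 'b :: cod) \<Rightarrow> bool" where
  "cmp f \<longleftrightarrow> (\<exists>p. \<forall>x. ev p [cd x] (cd (f x)))"

named_theorems cmp_intros

lemma cmp_recn1: "recn 1 (\<lambda>xs. g (xs ! 0)) \<Longrightarrow> (\<And>x. g (cd x) = cd (f x)) \<Longrightarrow> cmp f"
proof -
  assume "recn 1 (\<lambda>xs. g (xs ! 0))" and g: "\<And>x. g (cd x) = cd (f x)"
  then obtain p where p: "\<forall>xs. length xs = 1 \<longrightarrow> ev p xs (g (xs ! 0))" unfolding recn_def by blast
  have "ev p [cd x] (cd (f x))" for x using p[rule_format, of "[cd x]"] g by simp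
  then show ?thesis unfolding cmp_def by blast
qed

lemma cmp_id [cmp_intros]: "cmp (\<lambda>x. x)"
  by (rule cmp_recn1[of "\<lambda>x. x"]) (auto intro: recn_nth)

lemma recn_const: "recn k (\<lambda>xs. c)"
  by (induction c) (auto intro: recn_zero recn_Suc)

lemma cmp_const [cmp_intros]: "cmp (\<lambda>x. c)"
  by (rule cmp_recn1[of "\<lambda>x. cd c"]) (auto intro: recn_const)

lemma cmp_comp: "cmp g \<Longrightarrow> cmp f \<Longrightarrow> cmp (\<lambda>x. g (f x))"
  unfolding cmp_def
proof (elim exE)
  fix p q assume "\<forall>x. ev p [cd x] (cd (g x))" "\<forall>x. ev q [cd x] (cd (f x))"
  then have "ev (Cn p [q]) [cd x] (cd (g (f x)))" for x
    by (auto intro!: ev_Cn[where ys = "[cd (f x)]"])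
  then show "\<exists>p. \<forall>x. ev p [cd x] (cd (g (f x)))" by blast
qed

lemma cmp_recn_comp2:
  assumes "recn 2 (\<lambda>xs. h (xs ! 0) (xs ! 1))" "cmp f" "cmp g"
    and "\<And>x. h (cd (f x)) (cd (g x)) = cd (F x)"
  shows "cmp F"
proof -
  obtain p q r where p: "\<forall>xs. length xs = 2 \<longrightarrow> ev p xs (h (xs ! 0) (xs ! 1))"
    and q: "\<forall>x. ev q [cd x] (cd (f x))" and r: "\<forall>x. ev r [cd x] (cd (g x))"
    using assms unfolding recn_def cmp_def by auto
  have "ev (Cn p [q, r]) [cd x] (cd (F x))" for x
    using q r p[rule_format, of "[cd (f x), cd (g x)]"] assms(4)[of x]
    by (auto intro!: ev_Cn[where ys = "[cd (f x), cd (g x)]"])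
  then show ?thesis unfolding cmp_def by blast
qed

lemma cmp_pair [cmp_intros]: "cmp f \<Longrightarrow> cmp g \<Longrightarrow> cmp (\<lambda>x. (f x, g x))"
  by (rule cmp_recn_comp2[of "\<lambda>a b. prod_encode (a, b)" f g]) (auto simp: cd_prod_def intro: recn_pair recn_nth_small)

lemma cmp_fst [cmp_intros]: "cmp f \<Longrightarrow> cmp (\<lambda>x. fst (f x))"
  by (rule cmp_comp[of fst]) (rule cmp_recn1[where g = "\<lambda>x. fst (prod_decode x)"], auto simp: cd_prod_def recn_unpair[simplified])

lemma cmp_snd [cmp_intros]: "cmp f \<Longrightarrow> cmp (\<lambda>x. snd (f x))"
  by (rule cmp_comp[of snd]) (rule cmp_recn1[where g = "\<lambda>x. snd (prod_decode x)"], auto simp: cd_prod_def recn_unpair[simplified])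

lemma cmp_comp2: "cmp (\<lambda>p. g (fst p) (snd p)) \<Longrightarrow> cmp f \<Longrightarrow> cmp h \<Longrightarrow> cmp (\<lambda>x. g (f x) (h x))"
  using cmp_comp[of "\<lambda>p. g (fst p) (snd p)" "\<lambda>x. (f x, h x)"] by (simp add: cmp_pair)

lemma cmp_comp3: "cmp (\<lambda>p. g (fst p) (fst (snd p)) (snd (snd p))) \<Longrightarrow> cmp f \<Longrightarrow> cmp h \<Longrightarrow> cmp k
   \<Longrightarrow> cmp (\<lambda>x. g (f x) (h x) (k x))"
  using cmp_comp[of "\<lambda>p. g (fst p) (fst (snd p)) (snd (snd p))" "\<lambda>x. (f x, h x, k x)"]
  by (simp add: cmp_pair)

lemma cmp_comp4: "cmp (\<lambda>p. g (fst p) (fst (snd p)) (fst (snd (snd p))) (snd (snd (snd p))))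
   \<Longrightarrow> cmp f \<Longrightarrow> cmp h \<Longrightarrow> cmp k \<Longrightarrow> cmp l \<Longrightarrow> cmp (\<lambda>x. g (f x) (h x) (k x) (l x))"
  using cmp_comp[of "\<lambda>p. g (fst p) (fst (snd p)) (fst (snd (snd p))) (snd (snd (snd p)))"
      "\<lambda>x. (f x, h x, k x, l x)"]
  by (simp add: cmp_pair)

lemma cmp_cd [cmp_intros]: "cmp f \<Longrightarrow> cmp (\<lambda>x. cd (f x))"
  unfolding cmp_def cd_nat_def by simp

lemma cmp_dc [cmp_intros]: "cmp f \<Longrightarrow> cmp (\<lambda>x. dc (f x))"
  unfolding cmp_def cd_nat_def by simp

lemma cmp_Suc [cmp_intros]: "cmp f \<Longrightarrow> cmp (\<lambda>x. Suc (f x))"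
  by (rule cmp_comp[of Suc]) (rule cmp_recn1[where g = Suc], auto simp: cd_nat_def intro: recn_Suc recn_nth_small)

lemma cmp_add [cmp_intros]: "cmp f \<Longrightarrow> cmp g \<Longrightarrow> cmp (\<lambda>x. f x + g x :: nat)"
  by (rule cmp_recn_comp2[of "(+)" f g]) (auto simp: cd_nat_def intro: recn_add recn_nth_small)

lemma cmp_mult [cmp_intros]: "cmp f \<Longrightarrow> cmp g \<Longrightarrow> cmp (\<lambda>x. f x * g x :: nat)"
  by (rule cmp_recn_comp2[of times f g]) (auto simp: cd_nat_def intro: recn_mult recn_nth_small)

lemma cmp_diff [cmp_intros]: "cmp f \<Longrightarrow> cmp g \<Longrightarrow> cmp (\<lambda>x. f x - g x :: nat)"
  by (rule cmp_recn_comp2[of "(-)" f g]) (auto simp: cd_nat_def intro: recn_diff recn_nth_small)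

lemma cmp_less [cmp_intros]:
  assumes "cmp f" "cmp g" shows "cmp (\<lambda>x. f x < (g x :: nat))"
proof (rule cmp_recn_comp2[of "\<lambda>a b. 1 - (1 - (b - a))" f g])
  show "recn 2 (\<lambda>xs. 1 - (1 - (xs ! 1 - xs ! 0)))"
    using recn_diff[OF recn_const[of 2 1] recn_diff[OF recn_const[of 2 1] recn_diff[OF recn_nth_small(2,1)]]] by simp
qed (auto simp: cd_nat_def cd_bool_def assms)

lemma cmp_not [cmp_intros]: "cmp P \<Longrightarrow> cmp (\<lambda>x. \<not> P x)"
  by (rule cmp_comp[of Not], rule cmp_recn1[of "\<lambda>x. 1 - x"])
    (auto simp: cd_bool_def intro: recn_diff recn_const recn_nth_small)

lemma cmp_conj [cmp_intros]: "cmp P \<Longrightarrow> cmp Q \<Longrightarrow> cmp (\<lambda>x. P x \<and> Q x)"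
  by (rule cmp_recn_comp2[of times P Q]) (auto simp: cd_bool_def intro: recn_mult recn_nth_small)

lemma cmp_disj [cmp_intros]: "cmp P \<Longrightarrow> cmp Q \<Longrightarrow> cmp (\<lambda>x. P x \<or> Q x)"
  using cmp_not[OF cmp_conj[OF cmp_not cmp_not], of P Q] by simp

lemma cmp_imp [cmp_intros]: "cmp P \<Longrightarrow> cmp Q \<Longrightarrow> cmp (\<lambda>x. P x \<longrightarrow> Q x)"
  using cmp_disj[OF cmp_not, of P Q] by simp

lemma cmp_le [cmp_intros]: "cmp f \<Longrightarrow> cmp g \<Longrightarrow> cmp (\<lambda>x. f x \<le> (g x :: nat))"
  using cmp_not[OF cmp_less, of g f] by (simp add: not_less)

lemma cmp_eq [cmp_intros]:
  fixes f g :: "'a :: cod \<Rightarrow> 'b :: cod"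
  assumes "cmp f" "cmp g" shows "cmp (\<lambda>x. f x = g x)"
proof -
  have "cmp (\<lambda>x. cd (f x) \<le> cd (g x) \<and> cd (g x) \<le> cd (f x))"
    by (intro cmp_conj cmp_le cmp_cd assms)
  then show ?thesis by (simp add: order_eq_iff[symmetric] cd_eq_iff)
qed

lemma cmp_if [cmp_intros]:
  assumes "cmp P" "cmp f" "cmp g" shows "cmp (\<lambda>x. if P x then f x else g x)"
proof -
  obtain c p q r where c: "\<forall>xs. length xs = 3 \<longrightarrow> ev c xs (if xs ! 0 = 0 then xs ! 1 else xs ! 2)"
    and p: "\<forall>x. ev p [cd x] (cd (P x))" and q: "\<forall>x. ev q [cd x] (cd (f x))"
    and r: "\<forall>x. ev r [cd x] (cd (g x))"
    using assms recn_if0 unfolding recn_def cmp_def by auto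
  have "ev (Cn c [p, r, q]) [cd x] (cd (if P x then f x else g x))" for x
    by (rule ev_Cn[where ys = "[cd (P x), cd (g x), cd (f x)]"])
      (use p q r c[rule_format, of "[cd (P x), cd (g x), cd (f x)]"] in \<open>auto simp: cd_bool_def split: if_splits\<close>)
  then show ?thesis unfolding cmp_def by blast
qed

lemma ex_pair_prog: "\<exists>p. \<forall>a b. ev p [a, b] (prod_encode (a, b))"
proof -
  obtain p where "\<forall>xs. length xs = 2 \<longrightarrow> ev p xs (prod_encode (xs ! 0, xs ! 1))"
    using recn_pair[OF recn_nth recn_nth, of 0 2 1] unfolding recn_def by auto
  then have "ev p [a, b] (prod_encode (a, b))" for a b by (metis One_nat_def length_Cons list.size(3) nth_Cons_0 nth_Cons_Suc numeral_2_eq_2)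
  then show ?thesis by blast
qed

lemma cmp_rec_nat [cmp_intros]:
  fixes g :: "'a :: cod \<Rightarrow> nat \<Rightarrow> 'b :: cod \<Rightarrow> 'b"
  assumes f: "cmp f" and n: "cmp n" and g: "cmp (\<lambda>p. g (fst p) (fst (snd p)) (snd (snd p)))"
  shows "cmp (\<lambda>x. rec_nat (f x) (\<lambda>i r. g x i r) (n x))"
proof -
  obtain pr pf pn pg where pr: "\<forall>a b. ev pr [a, b] (prod_encode (a, b))"
    and pf: "\<forall>x. ev pf [cd x] (cd (f x))" and pn: "\<forall>x. ev pn [cd x] (cd (n x))"
    and pg: "\<forall>p. ev pg [cd p] (cd (g (fst p) (fst (snd p)) (snd (snd p))))"
    using assms ex_pair_prog unfolding cmp_def by auto
  \<comment> \<open>\<open>Pr\<close> hands its step the list of counter, previous value and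
    parameter, whereas \<open>pg\<close> expects the single code of
    \<open>(x, i, r)\<close>.\<close>
  define st where "st = Cn pg [Cn pr [Pj 2, Cn pr [Pj 0, Pj 1]]]"
  have pj: "ev (Pj 0) (a # xs) a" "ev (Pj 1) (a # b # xs) b" "ev (Pj 2) (a # b # c # xs) c" for a b c xs
    using ev_Pj[of 0 "a # xs"] ev_Pj[of 1 "a # b # xs"] ev_Pj[of 2 "a # b # c # xs"] by auto
  have st: "ev st [i, cd r, cd x] (cd (g x i r))" for i r x
  proof -
    have "ev (Cn pr [Pj 0, Pj 1]) [i, cd r, cd x] (prod_encode (i, cd r))"
      by (rule ev_Cn2[OF pj(1) pj(2)]) (rule pr[rule_format])
    then have "ev (Cn pr [Pj 2, Cn pr [Pj 0, Pj 1]]) [i, cd r, cd x] (prod_encode (cd x, prod_encode (i, cd r)))"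
      by (rule ev_Cn2[OF pj(3)]) (rule pr[rule_format])
    then show ?thesis unfolding st_def
      by (rule ev_Cn1) (use pg[rule_format, of "(x, i, r)"] in \<open>simp add: cd_prod_def cd_nat_def\<close>)
  qed
  have "ev (Pr pf st) [m, cd x] (cd (rec_nat (f x) (\<lambda>i r. g x i r) m))" for m x
    by (induction m) (auto intro: ev_Pr0 ev_PrS st simp: pf)
  then have "ev (Cn (Pr pf st) [pn, Pj 0]) [cd x] (cd (rec_nat (f x) (\<lambda>i r. g x i r) (n x)))" for x
    using ev_Cn2[OF pn[rule_format, of x, unfolded cd_nat_def] pj(1)] by simp
  then show ?thesis unfolding cmp_def by blast
qed

text \<open>Existence for every parameter keeps the minimisation total. The test is negated because
  \<open>Mn\<close> searches for the value 0, which codes falsity.\<close>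

lemma cmp_LEAST [cmp_intros]:
  assumes P: "cmp (\<lambda>p. P (fst p) (snd p))" and ex: "\<And>x. \<exists>n. P x n"
  shows "cmp (\<lambda>x :: 'a :: cod. LEAST n :: nat. P x n)"
proof -
  obtain pr p where pr: "\<forall>a b. ev pr [a, b] (prod_encode (a, b))"
    and p: "\<forall>x. ev p [cd x] (cd (\<not> P (fst x) (snd x)))"
    using cmp_not[OF P] ex_pair_prog unfolding cmp_def by auto
  define q where "q = Cn p [Cn pr [Pj 1, Pj 0]]"
  have pj: "ev (Pj 0) (a # xs) a" "ev (Pj 1) (a # b # xs) b" for a b xs
    using ev_Pj[of 0 "a # xs"] ev_Pj[of 1 "a # b # xs"] by auto
  have q: "ev q [n, cd x] (of_bool (\<not> P x n))" for n x
  proof -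
    have "ev (Cn pr [Pj 1, Pj 0]) [n, cd x] (prod_encode (cd x, n))"
      by (rule ev_Cn2[OF pj(2) pj(1)]) (rule pr[rule_format])
    then show ?thesis unfolding q_def
      by (rule ev_Cn1) (use p[rule_format, of "(x, n)"] in \<open>simp add: cd_prod_def cd_nat_def cd_bool_def\<close>)
  qed
  have "ev (Mn q) [cd x] (LEAST n. P x n)" for x
  proof (rule ev_Mn)
    have "P x (LEAST n. P x n)" by (rule LeastI_ex) (rule ex)
    then show "ev q [LEAST n. P x n, cd x] 0" using q[of "LEAST n. P x n" x] by simp
    show "\<forall>m<LEAST n. P x n. \<exists>k. ev q [m, cd x] (Suc k)"
      using not_less_Least q by (metis of_bool_eq(2) One_nat_def)
  qed
  then show ?thesis unfolding cmp_def cd_nat_def by blast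
qed

lemma cmp_case_prod [cmp_intros]:
  assumes "cmp (\<lambda>x. g x (fst (f x)) (snd (f x)))"
  shows "cmp (\<lambda>x. case f x of (a, b) \<Rightarrow> g x a b)"
  using assms by (simp add: case_prod_beta)

lemma cmp_Let [cmp_intros]:
  assumes "cmp f" "cmp (\<lambda>p. g (fst p) (snd p))"
  shows "cmp (\<lambda>x. let a = f x in g x a)"
  unfolding Let_def by (rule cmp_comp2[OF assms(2) cmp_id assms(1)])

lemma cmp_prod_encode [cmp_intros]: "cmp f \<Longrightarrow> cmp (\<lambda>x. prod_encode (f x))"
  using cmp_cd[of f] by (simp add: cd_prod_def cd_nat_def case_prod_beta)

lemma cmp_prod_decode [cmp_intros]: "cmp f \<Longrightarrow> cmp (\<lambda>x. prod_decode (f x))"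
proof -
  have cd: "cd p = prod_encode p" for p :: "nat \<times> nat"
    by (cases p) (simp add: cd_prod_def cd_nat_def)
  have "prod_decode n = dc n" for n
    by (rule cd_inj) (simp only: cd_dc, simp only: cd prod_decode_inverse)
  then show "cmp f \<Longrightarrow> cmp (\<lambda>x. prod_decode (f x))" using cmp_dc by simp
qed

lemma cmp_case_nat [cmp_intros]:
  assumes "cmp f" "cmp n" "cmp (\<lambda>p. g (fst p) (snd p))"
  shows "cmp (\<lambda>x. case n x of 0 \<Rightarrow> f x | Suc i \<Rightarrow> g x i)"
proof -
  have "cmp (\<lambda>x. if n x = 0 then f x else g x (n x - 1))"
    by (intro cmp_intros assms cmp_comp2[OF assms(3)])
  then show ?thesis by (rule back_subst[of cmp]) (auto split: nat.split)
qed

section \<open>Computable list operations and bounded quantifiers\<close>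

lemma cmp_Nil_Cons [cmp_intros]: "cmp f \<Longrightarrow> cmp l \<Longrightarrow> cmp (\<lambda>x. f x # l x)"
  by (rule cmp_recn_comp2[of "\<lambda>a b. Suc (prod_encode (a, b))" f l])
    (auto simp: cd_list_simps intro: recn_Suc[OF recn_pair[OF recn_nth_small(1,2)]])

lemma cmp_tl [cmp_intros]: "cmp l \<Longrightarrow> cmp (\<lambda>x. tl (l x))"
proof (rule cmp_comp[of tl])
  have "recn 1 (\<lambda>xs. snd (prod_decode (xs ! 0 - 1)) * (1 - (1 - xs ! 0)))"
    by (intro recn_mult recn_diff recn_const recn_nth recn_comp1[OF recn_unpair(2)]) auto
  then show "cmp tl"
    by (rule cmp_recn1) (auto simp: cd_list_simps split: list.split, case_tac x, auto simp: cd_list_simps)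
qed

lemma cmp_hd: "cmp d \<Longrightarrow> cmp l \<Longrightarrow> cmp (\<lambda>x. case l x of [] \<Rightarrow> d x | a # _ \<Rightarrow> a)"
proof -
  assume d: "cmp d" and l: "cmp l"
  have 1: "recn 2 (\<lambda>xs. (1 - xs ! 1) * xs ! 0 + (1 - (1 - xs ! 1)) * fst (prod_decode (xs ! 1 - 1)))"
    by (intro recn_add recn_mult recn_diff recn_const recn_nth recn_comp1[OF recn_unpair(1)]) auto
  show ?thesis
    by (rule cmp_recn_comp2[OF 1 d l]) (auto simp: cd_list_simps split: list.split)
qed

lemma cmp_null [cmp_intros]: "cmp l \<Longrightarrow> cmp (\<lambda>x. l x = [])"
  by (rule cmp_eq) (auto intro: cmp_intros)

lemma cmp_case_list [cmp_intros]:
  fixes l :: "'a :: cod \<Rightarrow> 'b :: cod list"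
  assumes f: "cmp f" and l: "cmp l" and g: "cmp (\<lambda>p. g (fst p) (fst (snd p)) (snd (snd p)))"
  shows "cmp (\<lambda>x. case l x of [] \<Rightarrow> f x | a # as \<Rightarrow> g x a as)"
proof -
  have "cmp (\<lambda>x. if l x = [] then f x else
     g x (case l x of [] \<Rightarrow> undefined | a # _ \<Rightarrow> a) (tl (l x)))"
    by (intro cmp_if cmp_null f l cmp_comp3[OF g] cmp_hd cmp_tl cmp_id cmp_const)
  then show ?thesis by (rule back_subst[of cmp]) (auto split: list.split)
qed

lemma length_le_cd: "length xs \<le> cd xs"
proof (induction xs)
  case (Cons a xs)
  have "cd xs \<le> prod_encode (cd a, cd xs)" by (rule le_prod_encode_2)
  then show ?case using Cons by (simp add: cd_list_simps)
qed (simp add: cd_list_simps)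

text \<open>The list is consumed by iterating \<open>tl\<close> next to an accumulator,
  \<open>cd (l x)\<close> times. This suffices because a list is never longer than its code, and
  iterations on the empty list change nothing.\<close>

lemma cmp_fold [cmp_intros]:
  fixes l :: "'a :: cod \<Rightarrow> 'b :: cod list" and z :: "'a \<Rightarrow> 'c :: cod"
  assumes g: "cmp (\<lambda>p. g (fst p) (fst (snd p)) (snd (snd p)))" and l: "cmp l" and z: "cmp z"
  shows "cmp (\<lambda>x. fold (\<lambda>a r. g x a r) (l x) (z x))"
proof -
  define h where "h x = rec_nat (l x, z x) (\<lambda>i r. (tl (fst r),
     case fst r of [] \<Rightarrow> snd r | a # _ \<Rightarrow> g x a (snd r))) (cd (l x))" for x
  have *: "rec_nat (xs, y) (\<lambda>i r. (tl (fst r),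
     case fst r of [] \<Rightarrow> snd r | a # _ \<Rightarrow> g x a (snd r))) n = (drop n xs, fold (g x) (take n xs) y)" for xs y n x
  proof (induction n)
    case (Suc n)
    show ?case
    proof (cases "n < length xs")
      case True
      then have "drop n xs = xs ! n # drop (Suc n) xs" by (simp add: Cons_nth_drop_Suc)
      then show ?thesis using Suc True by (simp add: take_Suc_conv_app_nth)
    qed (use Suc in auto)
  qed auto
  have "cmp (\<lambda>x. snd (h x))"
    unfolding h_def by (intro cmp_intros l z cmp_comp3[OF g])
  moreover have "snd (h x) = fold (\<lambda>a r. g x a r) (l x) (z x)" for x
    unfolding h_def * by (simp add: length_le_cd)
  ultimately show ?thesis by simp
qed

lemma cmp_rev [cmp_intros]: "cmp l \<Longrightarrow> cmp (\<lambda>x. rev (l x))"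
proof -
  assume l: "cmp l"
  have e: "rev xs = fold (\<lambda>a r. a # r) xs []" for xs :: "'b list" by (simp add: fold_Cons_rev)
  show ?thesis unfolding e by (intro cmp_intros l)
qed

lemma cmp_foldr [cmp_intros]:
  assumes g: "cmp (\<lambda>p. g (fst p) (fst (snd p)) (snd (snd p)))" and l: "cmp l" and z: "cmp z"
  shows "cmp (\<lambda>x. foldr (\<lambda>a r. g x a r) (l x) (z x))"
  unfolding foldr_conv_fold by (intro cmp_intros assms)

lemma cmp_append [cmp_intros]: "cmp l \<Longrightarrow> cmp m \<Longrightarrow> cmp (\<lambda>x. l x @ m x)"
proof -
  assume l: "cmp l" "cmp m"
  have e: "xs @ ys = foldr (\<lambda>a r. a # r) xs ys" for xs ys :: "'b list" by (induction xs) auto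
  show ?thesis unfolding e by (intro cmp_intros l)
qed

lemma cmp_map [cmp_intros]:
  fixes f :: "'a :: cod \<Rightarrow> 'c :: cod \<Rightarrow> 'd :: cod"
  assumes "cmp (\<lambda>p. f (fst p) (snd p))" "cmp l"
  shows "cmp (\<lambda>x. map (\<lambda>a. f x a) (l x))"
proof -
  have e: "map h xs = foldr (\<lambda>a r. h a # r) xs []" for h :: "'c \<Rightarrow> 'd" and xs by (induction xs) auto
  show ?thesis unfolding e by (intro cmp_intros cmp_comp2[OF assms(1)] assms)
qed

lemma cmp_length [cmp_intros]: "cmp l \<Longrightarrow> cmp (\<lambda>x. length (l x))"
proof -
  assume l: "cmp l"
  have e: "length xs = foldr (\<lambda>a r. Suc r) xs 0" for xs :: "'b list" by (induction xs) auto
  show ?thesis unfolding e by (intro cmp_intros l)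
qed

lemma cmp_concat [cmp_intros]: "cmp l \<Longrightarrow> cmp (\<lambda>x. concat (l x))"
proof -
  assume l: "cmp l"
  have e: "concat xs = foldr (\<lambda>a r. a @ r) xs []" for xs :: "'b list list" by (induction xs) auto
  show ?thesis unfolding e by (intro cmp_intros l)
qed

lemma cmp_upt [cmp_intros]: "cmp n \<Longrightarrow> cmp (\<lambda>x. [0..<n x])"
proof -
  assume n: "cmp n"
  have e: "[0..<m] = rec_nat [] (\<lambda>i r. r @ [i]) m" for m by (induction m) auto
  show ?thesis unfolding e by (intro cmp_intros n)
qed

lemma cmp_ball_set [cmp_intros]:
  assumes "cmp (\<lambda>p. P (fst p) (snd p))" "cmp l"
  shows "cmp (\<lambda>x. \<forall>a\<in>set (l x). P x a)"
proof -
  have e: "(\<forall>a\<in>set xs. Q a) \<longleftrightarrow> foldr (\<lambda>a r. Q a \<and> r) xs True" for Q :: "'b \<Rightarrow> bool" and xs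
    by (induction xs) auto
  show ?thesis unfolding e by (intro cmp_intros cmp_comp2[OF assms(1)] assms)
qed

lemma cmp_bex_set [cmp_intros]:
  assumes "cmp (\<lambda>p. P (fst p) (snd p))" "cmp l"
  shows "cmp (\<lambda>x. \<exists>a\<in>set (l x). P x a)"
  using cmp_not[OF cmp_ball_set[OF cmp_not[OF assms(1)] assms(2)]] by simp

lemma cmp_mem [cmp_intros]:
  assumes "cmp f" "cmp l" shows "cmp (\<lambda>x. f x \<in> set (l x))"
proof -
  have "cmp (\<lambda>x. \<exists>a\<in>set (l x). f x = a)"
    by (intro cmp_intros assms cmp_comp[OF assms(1)])
  then show ?thesis by simp
qed

lemma cmp_all_less [cmp_intros]:
  fixes n :: "'a :: cod \<Rightarrow> nat"
  assumes "cmp (\<lambda>p. P (fst p) (snd p))" "cmp n"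
  shows "cmp (\<lambda>x. \<forall>i<n x. P x i)"
proof -
  have "cmp (\<lambda>x. \<forall>i\<in>set [0..<n x]. P x i)" by (intro cmp_intros assms)
  then show ?thesis by (simp add: Ball_def)
qed

lemma cmp_ex_less [cmp_intros]:
  fixes n :: "'a :: cod \<Rightarrow> nat"
  assumes "cmp (\<lambda>p. P (fst p) (snd p))" "cmp n"
  shows "cmp (\<lambda>x. \<exists>i<n x. P x i)"
  using cmp_not[OF cmp_all_less[OF cmp_not[OF assms(1)] assms(2)]] by simp

lemma cmp_drop [cmp_intros]: "cmp n \<Longrightarrow> cmp l \<Longrightarrow> cmp (\<lambda>x. drop (n x) (l x))"
proof -
  assume a: "cmp n" "cmp l"
  have e: "drop m xs = rec_nat xs (\<lambda>i r. tl r) m" for m and xs :: "'b list"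
    by (induction m) (auto simp: drop_Suc drop_tl)
  show ?thesis unfolding e by (intro cmp_intros a)
qed

text \<open>Indexing with a default: the value of \<open>xs ! i\<close> beyond the end is
  unspecified, so computability could not be shown for it.\<close>

definition nthd :: "'a \<Rightarrow> 'a list \<Rightarrow> nat \<Rightarrow> 'a" where
  "nthd d xs i = (if i < length xs then xs ! i else d)"

lemma cmp_nthd [cmp_intros]:
  assumes "cmp d" "cmp l" "cmp i" shows "cmp (\<lambda>x. nthd (d x) (l x) (i x))"
proof -
  have "nthd d xs i = (case drop i xs of [] \<Rightarrow> d | a # _ \<Rightarrow> a)" for d :: 'b and xs i
  proof (cases "i < length xs")
    case True
    then have "drop i xs = xs ! i # drop (Suc i) xs" by (simp add: Cons_nth_drop_Suc)
    then show ?thesis using True by (simp add: nthd_def)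
  qed (simp add: nthd_def)
  then show ?thesis by (simp only:) (intro cmp_intros assms cmp_comp[OF assms(1)])
qed

lemma cmp_take [cmp_intros]: "cmp n \<Longrightarrow> cmp l \<Longrightarrow> cmp (\<lambda>x. take (n x) (l x))"
proof -
  assume a: "cmp n" "cmp l"
  have e: "take m xs = rev (drop (length xs - m) (rev xs))" for m and xs :: "'b list"
    by (cases "m \<le> length xs") (simp_all add: drop_rev)
  show ?thesis unfolding e by (intro cmp_intros a)
qed

text \<open>Course-of-values recursion, reduced to primitive recursion on the table of all earlier
  values. It is made for recursion over codes, where the recursive calls go to smaller numbers that
  are not predecessors.\<close>

lemma cmp_cov:
  fixes f :: "'a :: cod \<Rightarrow> nat \<Rightarrow> 'b :: cod"
  assumes f: "\<And>x n. f x n = G x n (map (f x) [0..<n])"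
    and G: "cmp (\<lambda>p. G (fst p) (fst (snd p)) (snd (snd p)))"
    and x: "cmp x" and n: "cmp n"
  shows "cmp (\<lambda>u. f (x u) (n u))"
proof -
  have h: "rec_nat [] (\<lambda>i r. r @ [G x i r]) n = map (f x) [0..<n]" for x n
    by (induction n) (auto simp: f[symmetric])
  have eq: "(\<lambda>p. f (fst p) (snd p))
    = (\<lambda>p. G (fst p) (snd p) (rec_nat [] (\<lambda>i r. r @ [G (fst p) i r]) (snd p)))"
    unfolding h by (rule ext) (rule f)
  have "cmp (\<lambda>p. f (fst p) (snd p))"
    unfolding eq by (intro cmp_intros cmp_comp3[OF G])
  then show ?thesis by (rule cmp_comp2[OF _ x n])
qed

lemma computable_set_iff: "computable_set S \<longleftrightarrow> cmp (\<lambda>x. x \<in> S)"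
  unfolding computable_set_def phi_total_iff[where f = "\<lambda>x. if x \<in> S then 1 else 0"] cmp_def
    cd_nat_def cd_bool_def of_bool_def ..

lemma computable_fun_iff: "computable_fun f \<longleftrightarrow> cmp f"
  unfolding computable_fun_def phi_total_iff cmp_def cd_nat_def ..

section \<open>The universal relation and the arithmetical hierarchy\<close>

text \<open>A positive tag makes a pair strictly larger than its second component; recursion over
  program codes and term codes terminates for this reason.\<close>

lemma snd_prod_decode_less: "fst (prod_decode e) > 0 \<Longrightarrow> snd (prod_decode e) < e"
proof -
  assume a: "fst (prod_decode e) > 0"
  obtain t r where tr: "prod_decode e = (t, r)" by force
  then have "e = prod_encode (t, r)" by (metis prod_decode_inverse)
  moreover have "n \<le> triangle n" for n by (induction n) auto
  then have "t + r \<le> triangle (t + r)" .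
  ultimately show ?thesis using a tr by (simp add: prod_encode_def)
qed

lemma fst_prod_decode_le: "fst (prod_decode e) \<le> e"
  by (metis le_prod_encode_1 prod.collapse prod_decode_inverse)

lemma snd_prod_decode_le: "snd (prod_decode e) \<le> e"
  by (metis le_prod_encode_2 prod.collapse prod_decode_inverse)

lemma cd_nat_list: "cd (xs :: nat list) = list_encode xs"
  by (simp add: cd_list_def cd_nat_def)

lemma list_encode_dc: "list_encode (dc g) = g"
  using cd_dc[of g, where 'a = "nat list"] by (simp add: cd_nat_list)

lemma dc_list_encode: "dc (list_encode xs) = xs"
  using dc_cd[of xs] by (simp add: cd_nat_list)

lemma mem_dc_le: "x \<in> set (dc g :: nat list) \<Longrightarrow> x \<le> g"
proof -
  have "x \<in> set xs \<Longrightarrow> x \<le> list_encode xs" for xs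
  proof (induction xs)
    case (Cons a xs)
    have "a \<le> prod_encode (a, list_encode xs)" "list_encode xs \<le> prod_encode (a, list_encode xs)"
      by (rule le_prod_encode_1 le_prod_encode_2)+
    then show ?case using Cons by auto
  qed simp
  then show "x \<in> set (dc g :: nat list) \<Longrightarrow> x \<le> g" using list_encode_dc by metis
qed

text \<open>Evaluating \<open>Pr f g\<close> at 0 never runs \<open>g\<close>. A derivation
  therefore contains no evidence that the second component codes a program, and this has to be
  tested separately.\<close>

definition isp :: "nat \<Rightarrow> bool" where "isp e \<longleftrightarrow> (\<exists>p. enc p = e)"

lemma isp_enc [simp]: "isp (enc p)"
  unfolding isp_def by (rule exI) (rule refl)

lemma isp_iff:
  "isp e \<longleftrightarrow> (let t = fst (prod_decode e); r = snd (prod_decode e);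
      f = fst (prod_decode r); g = snd (prod_decode r) in
    (t = 0 \<and> r = 0) \<or> (t = 1 \<and> r = 0) \<or> t = 2 \<or> (t = 3 \<and> isp f \<and> (\<forall>x\<in>set (dc g). isp x))
    \<or> (t = 4 \<and> isp f \<and> isp g) \<or> (t = 5 \<and> isp r))" (is "_ \<longleftrightarrow> ?R")
proof
  assume "isp e"
  then obtain p where p: "e = enc p" unfolding isp_def by blast
  show ?R unfolding p Let_def by (cases p) (simp_all add: dc_list_encode)
next
  obtain t r where tr: "prod_decode e = (t, r)" by force
  then have e: "e = prod_encode (t, r)" by (metis prod_decode_inverse)
  obtain f g where fg: "prod_decode r = (f, g)" by force
  then have r: "r = prod_encode (f, g)" by (metis prod_decode_inverse)
  assume ?R
  then consider "t = 0" "r = 0" | "t = 1" "r = 0" | "t = 2" | "t = 3" "isp f" "\<forall>x\<in>set (dc g). isp x"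
    | "t = 4" "isp f" "isp g" | "t = 5" "isp r"
    unfolding Let_def by (auto simp: tr fg)
  then show "isp e"
  proof cases
    case 1 then show ?thesis using e unfolding isp_def by (intro exI[of _ Zr]) simp
  next
    case 2 then show ?thesis using e unfolding isp_def by (intro exI[of _ Sc]) simp
  next
    case 3 then show ?thesis using e unfolding isp_def by (intro exI[of _ "Pj r"]) simp
  next
    case 4
    then obtain p where p: "enc p = f" unfolding isp_def by blast
    have "\<forall>x\<in>set (dc g). \<exists>q. x = enc q"
    proof
      fix x :: nat assume "x \<in> set (dc g)"
      then obtain q where "enc q = x" using 4(3) unfolding isp_def by blast
      then show "\<exists>q. x = enc q" by (intro exI[of _ q]) simp
    qed
    then obtain gs where gs: "dc g = map enc gs" unfolding ex_map_conv[symmetric] by (rule exE)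
    have "enc (Cn p gs) = e" using 4 e r p gs[symmetric] list_encode_dc[of g] by simp
    then show ?thesis unfolding isp_def by blast
  next
    case 5
    then obtain p q where "enc p = f" "enc q = g" unfolding isp_def by blast
    then show ?thesis using e r 5 unfolding isp_def by (intro exI[of _ "Pr p q"]) simp
  next
    case 6
    then obtain p where "enc p = r" unfolding isp_def by blast
    then show ?thesis using e 6 unfolding isp_def by (intro exI[of _ "Mn p"]) simp
  qed
qed

lemma cmp_isp [cmp_intros]: "cmp n \<Longrightarrow> cmp (\<lambda>x. isp (n x))"
proof (rule cmp_cov[where x = "\<lambda>x. 0 :: nat" and f = "\<lambda>x. isp" and G = "\<lambda>x e h.
    let t = fst (prod_decode e); r = snd (prod_decode e);
      f = fst (prod_decode r); g = snd (prod_decode r) in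
    (t = 0 \<and> r = 0) \<or> (t = 1 \<and> r = 0) \<or> t = 2 \<or> (t = 3 \<and> nthd False h f \<and> (\<forall>x\<in>set (dc g). nthd False h x))
    \<or> (t = 4 \<and> nthd False h f \<and> nthd False h g) \<or> (t = 5 \<and> nthd False h r)"])
  fix e :: nat
  let ?h = "map isp [0..<e]"
  define t where "t = fst (prod_decode e)"
  define r where "r = snd (prod_decode e)"
  have r: "r < e" if "t > 0" using snd_prod_decode_less that unfolding t_def r_def by blast
  have 1: "nthd False ?h x = isp x" if "t > 0" "x \<le> r" for x
    using r that by (simp add: nthd_def)
  have 2: "\<forall>x\<in>set (dc (snd (prod_decode r))). x \<le> r"
    using mem_dc_le snd_prod_decode_le le_trans by blast
  show "isp e = (let t = fst (prod_decode e); r = snd (prod_decode e);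
      f = fst (prod_decode r); g = snd (prod_decode r) in
    (t = 0 \<and> r = 0) \<or> (t = 1 \<and> r = 0) \<or> t = 2 \<or> (t = 3 \<and> nthd False ?h f \<and> (\<forall>x\<in>set (dc g). nthd False ?h x))
    \<or> (t = 4 \<and> nthd False ?h f \<and> nthd False ?h g) \<or> (t = 5 \<and> nthd False ?h r))"
    unfolding isp_iff[of e] Let_def t_def[symmetric] r_def[symmetric]
    using 1 2 fst_prod_decode_le[of r] snd_prod_decode_le[of r] by auto
qed (unfold Let_def, (intro cmp_intros | assumption)+)

section \<open>Runs of programs as finite derivations\<close>

type_synonym fact = "nat \<times> nat list \<times> nat"

text \<open>A fact \<open>(e, xs, y)\<close> says that the program coded by \<open>e\<close> returns \<open>y\<close> on \<open>xs\<close>;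
  a derivation is a list of facts, each of which follows from the ones after it.\<close>

definition just :: "fact \<Rightarrow> fact list \<Rightarrow> bool" where
  "just F h = (let e = fst F; xs = fst (snd F); y = snd (snd F);
      t = fst (prod_decode e); r = snd (prod_decode e);
      f = fst (prod_decode r); g = snd (prod_decode r) in
    if t = 0 then r = 0 \<and> y = 0
    else if t = 1 then r = 0 \<and> xs \<noteq> [] \<and> y = Suc (nthd 0 xs 0)
    else if t = 2 then r < length xs \<and> y = nthd 0 xs r
    else if t = 3 then (\<exists>F'\<in>set h. fst F' = f \<and> snd (snd F') = y
        \<and> length (fst (snd F')) = length (dc g :: nat list)
        \<and> (\<forall>i<length (dc g :: nat list). (nthd 0 (dc g) i, xs, nthd 0 (fst (snd F')) i) \<in> set h))
    else if t = 4 then xs \<noteq> [] \<and> (if nthd 0 xs 0 = 0 then isp g \<and> (f, tl xs, y) \<in> set h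
        else \<exists>F'\<in>set h. fst F' = e \<and> fst (snd F') = (nthd 0 xs 0 - 1) # tl xs
          \<and> (g, (nthd 0 xs 0 - 1) # snd (snd F') # tl xs, y) \<in> set h)
    else if t = 5 then (r, y # xs, 0) \<in> set h
        \<and> (\<forall>m<y. \<exists>F'\<in>set h. fst F' = r \<and> fst (snd F') = m # xs \<and> 0 < snd (snd F'))
    else False)"

text \<open>Only facts further down the list may be cited. This excludes circular justification, and
  concatenations of derivations are derivations.\<close>

definition okd :: "fact list \<Rightarrow> bool" where
  "okd d \<longleftrightarrow> (\<forall>i<length d. just (nthd (0, [], 0) d i) (drop (Suc i) d))"

lemma cmp_just: "cmp (\<lambda>p. just (fst p) (snd p))"
  unfolding just_def Let_def by (intro cmp_intros)

lemma cmp_okd [cmp_intros]: "cmp d \<Longrightarrow> cmp (\<lambda>x. okd (d x))"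
proof -
  assume d: "cmp d"
  show ?thesis unfolding okd_def by (intro cmp_intros cmp_comp2[OF cmp_just] cmp_comp[OF d] d)
qed

lemma okd_Cons: "okd (F # h) \<longleftrightarrow> just F h \<and> okd h"
  unfolding okd_def by (simp add: All_less_Suc2 nthd_def)

text \<open>The list of cited facts occurs only positively in \<open>just\<close>.\<close>

lemma just_mono: "just F h \<Longrightarrow> set h \<subseteq> set h' \<Longrightarrow> just F h'"
  unfolding just_def Let_def by (simp only: split: if_splits; blast)

lemma okd_append: "okd d \<Longrightarrow> okd d' \<Longrightarrow> okd (d @ d')"
proof (induction d)
  case (Cons F h)
  then show ?case using just_mono[of F h "h @ d'"] by (simp add: okd_Cons)
qed simp

definition sound :: "fact \<Rightarrow> bool" where
  "sound F \<longleftrightarrow> (\<exists>p. enc p = fst F \<and> ev p (fst (snd F)) (snd (snd F)))"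

text \<open>The tag of the code selects the constructor; the programs behind the cited facts are
  then assembled into one with the required code.\<close>

lemma just_sound:
  assumes "\<forall>F'\<in>set h. sound F'" "just F h" shows "sound F"
proof -
  obtain e xs y where F: "F = (e, xs, y)" by (cases F) auto
  obtain t r where tr: "prod_decode e = (t, r)" by force
  then have e: "e = prod_encode (t, r)" by (metis prod_decode_inverse)
  obtain f g where fg: "prod_decode r = (f, g)" by force
  then have r: "r = prod_encode (f, g)" by (metis prod_decode_inverse)
  have S: "\<exists>p. enc p = e' \<and> ev p xs' y'" if "(e', xs', y') \<in> set h" for e' xs' y'
    using bspec[OF assms(1) that] unfolding sound_def by simp
  note J = assms(2)[unfolded just_def Let_def F fst_conv snd_conv, unfolded tr fst_conv snd_conv,
      unfolded fg fst_conv snd_conv]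
  show ?thesis
  proof (cases "t = 0")
    case True
    then show ?thesis using J F e unfolding sound_def
      by (intro exI[of _ Zr]) (auto intro: ev_Zr)
  next
    case t0: False
    show ?thesis
    proof (cases "t = 1")
      case True
      then show ?thesis using J F e unfolding sound_def
        by (intro exI[of _ Sc]) (cases xs, auto intro: ev_Sc simp: nthd_def)
    next
      case t1: False
      show ?thesis
      proof (cases "t = 2")
        case True
        then show ?thesis using J F e ev_Pj[of r xs] unfolding sound_def
          by (intro exI[of _ "Pj r"]) (auto simp: nthd_def)
      next
        case t2: False
        show ?thesis
        proof (cases "t = 3")
          case True
          define gl where "gl = (dc g :: nat list)"
          have "\<exists>F'\<in>set h. fst F' = f \<and> snd (snd F') = y \<and> length (fst (snd F')) = length gl
            \<and> (\<forall>i<length gl. (nthd 0 gl i, xs, nthd 0 (fst (snd F')) i) \<in> set h)"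
            using J True unfolding gl_def by simp
          then obtain F' where F': "F' \<in> set h" "fst F' = f" "snd (snd F') = y" "length (fst (snd F')) = length gl"
            "\<forall>i<length gl. (nthd 0 gl i, xs, nthd 0 (fst (snd F')) i) \<in> set h" by blast
          define ys where "ys = fst (snd F')"
          have ys: "(f, ys, y) \<in> set h" "length ys = length gl"
            "\<And>i. i < length gl \<Longrightarrow> (gl ! i, xs, ys ! i) \<in> set h"
            using F' unfolding ys_def by (auto simp: nthd_def)
          obtain p where p: "enc p = f" "ev p ys y" using S[OF ys(1)] by blast
          have "\<forall>i. \<exists>q. i < length gl \<longrightarrow> enc q = gl ! i \<and> ev q xs (ys ! i)"
            using S[OF ys(3)] by blast
          then obtain q where q: "\<And>i. i < length gl \<Longrightarrow> enc (q i) = gl ! i \<and> ev (q i) xs (ys ! i)"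
            by metis
          define gs where "gs = map q [0..<length gl]"
          have "map enc gs = gl" unfolding gs_def by (rule nth_equalityI) (auto simp: q)
          then have "enc (Cn p gs) = e"
            using True e r p list_encode_dc[of g] by (simp add: gl_def)
          moreover have "ev (Cn p gs) xs y"
            by (rule ev_Cn[OF _ p(2)]) (auto simp: list_all2_conv_all_nth gs_def ys q)
          ultimately show ?thesis using F unfolding sound_def by (intro exI[of _ "Cn p gs"]) simp
        next
          case t3: False
          show ?thesis
          proof (cases "t = 4")
            case True
            with J have "xs \<noteq> []" by simp
            then obtain n zs where xs: "xs = n # zs" by (cases xs) auto
            show ?thesis
            proof (cases n)
              case 0
              then have J4: "isp g \<and> (f, zs, y) \<in> set h" using J True xs by (simp add: nthd_def)
              then have "(f, zs, y) \<in> set h" ..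
              moreover obtain q where "enc q = g" using J4 unfolding isp_def by blast
              moreover obtain p where "enc p = f" "ev p zs y" using S calculation(1) by blast
              ultimately have "enc (Pr p q) = e" "ev (Pr p q) xs y" using True e r xs 0 by (auto intro: ev_Pr0)
              then show ?thesis using F unfolding sound_def by (intro exI[of _ "Pr p q"]) simp
            next
              case (Suc m)
              then have "\<exists>F'\<in>set h. fst F' = e \<and> fst (snd F') = m # zs \<and> (g, m # snd (snd F') # zs, y) \<in> set h"
                using J True xs by (simp add: nthd_def)
              then obtain F' where F': "F' \<in> set h" "fst F' = e" "fst (snd F') = m # zs"
                "(g, m # snd (snd F') # zs, y) \<in> set h" by blast
              define w where "w = snd (snd F')"
              have w: "(e, m # zs, w) \<in> set h" "(g, m # w # zs, y) \<in> set h"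
              proof -
                have "F' = (e, m # zs, w)" using F'(2,3) unfolding w_def by (simp add: prod_eq_iff)
                then show "(e, m # zs, w) \<in> set h" "(g, m # w # zs, y) \<in> set h"
                  using F'(1,4) by simp_all
              qed
              obtain p where p: "enc p = e" "ev p (m # zs) w" using S[OF w(1)] by blast
              obtain q where q: "enc q = g" "ev q (m # w # zs) y" using S[OF w(2)] by blast
              \<comment> \<open>The fact cited for \<open>e\<close> itself yields some program with
                code \<open>e\<close>. Its tag forces it to be a \<open>Pr\<close>, and injectivity
                of \<open>enc\<close> identifies its step with the program found for
                \<open>g\<close>.\<close>
              obtain p1 p2 where p12: "p = Pr p1 p2" "enc p2 = g"
                using p(1) True e r by (cases p) auto
              then have "p2 = q" using q by (intro enc_inject) simp
              then have "ev p xs y" using p12 p q xs Suc by (auto intro: ev_PrS)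
              then show ?thesis using p F unfolding sound_def by auto
            qed
          next
            case t4: False
            have t5: "t = 5" using J t0 t1 t2 t3 t4 by (simp split: if_splits)
            have J5: "(r, y # xs, 0) \<in> set h
                \<and> (\<forall>m<y. \<exists>F'\<in>set h. fst F' = r \<and> fst (snd F') = m # xs \<and> 0 < snd (snd F'))"
              using J t5 by simp
            then have a: "(r, y # xs, 0) \<in> set h" ..
            have b: "\<exists>k>0. (r, m # xs, k) \<in> set h" if m: "m < y" for m
            proof -
              obtain F' where "F' \<in> set h" "fst F' = r" "fst (snd F') = m # xs" "0 < snd (snd F')"
                using J5 m by blast
              then show ?thesis by (intro exI[of _ "snd (snd F')"]) (cases F', auto)
            qed
            obtain p where p: "enc p = r" "ev p (y # xs) 0" using S[OF a] by blast
            have "\<exists>k. ev p (m # xs) (Suc k)" if m: "m < y" for m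
            proof -
              obtain k where k: "k > 0" "(r, m # xs, k) \<in> set h" using b[OF m] by blast
              obtain q where "enc q = r" "ev q (m # xs) k" using S[OF k(2)] by blast
              then show ?thesis using p(1) k(1) enc_inject[of p q] by (cases k) auto
            qed
            then have "ev (Mn p) xs y" using p by (auto intro: ev_Mn)
            then show ?thesis using p t5 e F unfolding sound_def by (intro exI[of _ "Mn p"]) auto
          qed
        qed
      qed
    qed
  qed
qed

definition Der :: "fact \<Rightarrow> bool" where "Der F \<longleftrightarrow> (\<exists>d. okd d \<and> F \<in> set d)"

lemma Der_sound: "Der F \<Longrightarrow> sound F"
proof -
  have "okd d \<Longrightarrow> \<forall>F\<in>set d. sound F" for d
    by (induction d) (auto simp: okd_Cons intro: just_sound)
  then show "Der F \<Longrightarrow> sound F" unfolding Der_def by blast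
qed

lemma Der_finite:
  assumes "finite Fs" "\<forall>F\<in>Fs. Der F" shows "\<exists>d. okd d \<and> Fs \<subseteq> set d"
  using assms
proof (induction Fs rule: finite_induct)
  case empty
  then show ?case by (intro exI[of _ "[]"]) (simp add: okd_def)
next
  case (insert F Fs)
  then obtain d d' where "okd d" "Fs \<subseteq> set d" "okd d'" "F \<in> set d'" unfolding Der_def by auto
  then show ?case by (intro exI[of _ "d @ d'"]) (auto intro: okd_append)
qed

text \<open>Derivations of the finitely many premises are concatenated and the new fact is put in
  front.\<close>

lemma Der_step:
  assumes "finite Fs" "\<forall>F\<in>Fs. Der F" "\<And>h. Fs \<subseteq> set h \<Longrightarrow> just F h" shows "Der F"
proof -
  obtain d where "okd d" "Fs \<subseteq> set d" using Der_finite assms by blast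
  then show ?thesis unfolding Der_def using assms(3)[of d]
    by (intro exI[of _ "F # d"]) (simp add: okd_Cons)
qed

lemma ev_Der: "ev p xs y \<Longrightarrow> Der (enc p, xs, y)"
proof (induction rule: ev.induct)
  case (ev_Zr xs)
  show ?case by (rule Der_step[of "{}"]) (auto simp: just_def)
next
  case (ev_Sc x xs)
  show ?case by (rule Der_step[of "{}"]) (auto simp: just_def nthd_def)
next
  case (ev_Pj i xs)
  then show ?case by (intro Der_step[of "{}"]) (auto simp: just_def nthd_def)
next
  case (ev_Cn xs gs ys f z)
  have len: "length gs = length ys" and a: "\<And>i. i < length gs \<Longrightarrow> Der (enc (gs ! i), xs, ys ! i)"
    using ev_Cn.IH(1) by (auto simp: list_all2_conv_all_nth)
  show ?case
  proof (rule Der_step[of "insert (enc f, ys, z) ((\<lambda>i. (enc (gs ! i), xs, ys ! i)) ` {..<length gs})"])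
    fix h assume h: "insert (enc f, ys, z) ((\<lambda>i. (enc (gs ! i), xs, ys ! i)) ` {..<length gs}) \<subseteq> set h"
    have "(enc (gs ! i), xs, ys ! i) \<in> set h" if "i < length gs" for i
      using h that by blast
    then show "just (enc (Cn f gs), xs, z) h" using h len
      by (auto simp: just_def Let_def dc_list_encode nthd_def intro!: bexI[of _ "(enc f, ys, z)"])
  qed (use a ev_Cn.IH(2) in auto)
next
  case (ev_Pr0 f xs y g)
  then show ?case
    by (intro Der_step[of "{(enc f, xs, y)}"]) (auto simp: just_def Let_def nthd_def isp_def)
next
  case (ev_PrS f g n xs y z)
  show ?case
  proof (rule Der_step[of "{(enc (Pr f g), n # xs, y), (enc g, n # y # xs, z)}"])
    fix h assume h: "{(enc (Pr f g), n # xs, y), (enc g, n # y # xs, z)} \<subseteq> set h"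
    then show "just (enc (Pr f g), Suc n # xs, z) h"
      by (auto simp: just_def Let_def nthd_def intro!: bexI[of _ "(enc (Pr f g), n # xs, y)"])
  qed (use ev_PrS.IH in auto)
next
  case (ev_Mn f n xs)
  from ev_Mn.IH(2) obtain k where k: "\<And>m. m < n \<Longrightarrow> Der (enc f, m # xs, Suc (k m))" by metis
  show ?case
  proof (rule Der_step[of "insert (enc f, n # xs, 0) ((\<lambda>m. (enc f, m # xs, Suc (k m))) ` {..<n})"])
    fix h assume h: "insert (enc f, n # xs, 0) ((\<lambda>m. (enc f, m # xs, Suc (k m))) ` {..<n}) \<subseteq> set h"
    have "\<exists>F'\<in>set h. fst F' = enc f \<and> fst (snd F') = m # xs \<and> 0 < snd (snd F')" if "m < n" for m
      using h that by (intro bexI[of _ "(enc f, m # xs, Suc (k m))"]) auto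
    then show "just (enc (Mn f), xs, n) h" using h by (auto simp: just_def Let_def)
  qed (use k ev_Mn.IH(1) in auto)
qed

text \<open>Kleene's predicate with the output as an argument: \<open>n\<close> codes a derivation
  that contains the fact.\<close>

definition TT :: "nat \<Rightarrow> nat \<Rightarrow> nat \<Rightarrow> nat \<Rightarrow> bool" where
  "TT a x v n \<longleftrightarrow> okd (dc n) \<and> (a, [x], v) \<in> set (dc n)"

lemma cmp_TT [cmp_intros]:
  "cmp a \<Longrightarrow> cmp x \<Longrightarrow> cmp v \<Longrightarrow> cmp n \<Longrightarrow> cmp (\<lambda>u. TT (a u) (x u) (v u) (n u))"
  unfolding TT_def by (intro cmp_intros)

lemma phi_TT: "phi a x = Some v \<longleftrightarrow> (\<exists>n. TT a x v n)"
proof -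
  have "(\<exists>n. TT a x v n) \<longleftrightarrow> Der (a, [x], v)"
  proof
    assume "Der (a, [x], v)"
    then obtain d where "okd d" "(a, [x], v) \<in> set d" unfolding Der_def by blast
    then have "TT a x v (cd d)" unfolding TT_def by simp
    then show "\<exists>n. TT a x v n" ..
  qed (auto simp: TT_def Der_def)
  also have "\<dots> \<longleftrightarrow> (\<exists>p. enc p = a \<and> ev p [x] v)"
    using Der_sound[of "(a, [x], v)"] ev_Der unfolding sound_def by auto
  finally show ?thesis by (simp add: phi_iff)
qed

text \<open>The parameter is hard-wired by composing one fixed program with the program for the
  constant \<open>n\<close>, which applies \<open>Sc\<close> to \<open>Zr\<close> \<open>n\<close>
  times. Its code is computed from \<open>n\<close> by recursion.\<close>

lemma smn:
  fixes F :: "nat \<Rightarrow> nat \<Rightarrow> 'b :: cod"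
  assumes "cmp (\<lambda>p. F (fst p) (snd p))"
  shows "\<exists>f. computable_fun f \<and> (\<forall>n x. phi (f n) x = Some (cd (F n x)))"
proof -
  obtain p where p: "\<forall>q :: nat \<times> nat. ev p [cd q] (cd (F (fst q) (snd q)))"
    using assms unfolding cmp_def by blast
  obtain pr where pr: "\<forall>a b. ev pr [a, b] (prod_encode (a, b))" using ex_pair_prog by blast
  define c where "c = rec_nat Zr (\<lambda>i r. Cn Sc [r])"
  have c: "ev (c n) xs n" for n xs
    by (induction n) (auto simp: c_def intro: ev_Zr ev_Cn1 ev_Sc)
  have c_enc: "enc (c n) = rec_nat (enc Zr) (\<lambda>i r. prod_encode (3, prod_encode (enc Sc, Suc (prod_encode (r, 0))))) n" for n
    by (induction n) (auto simp: c_def)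
  define f where "f n = enc (Cn p [Cn pr [c n, Pj 0]])" for n
  have "cmp f" unfolding f_def enc.simps c_enc list.map list_encode.simps
    by (intro cmp_intros)
  moreover have "phi (f n) x = Some (cd (F n x))" for n x
  proof -
    have "ev (Pj 0) [x] x" using ev_Pj[of 0 "[x]"] by simp
    then have "ev (Cn pr [c n, Pj 0]) [x] (prod_encode (n, x))"
      by (rule ev_Cn2[OF c]) (rule pr[rule_format])
    then have "ev (Cn p [Cn pr [c n, Pj 0]]) [x] (cd (F n x))"
      by (rule ev_Cn1) (use p[rule_format, of "(n, x)"] in \<open>simp add: cd_prod_def cd_nat_def\<close>)
    then show ?thesis unfolding f_def phi_iff by blast
  qed
  ultimately show ?thesis unfolding computable_fun_iff by blast
qed

lemma ex_dc: "(\<exists>n. Q (dc n)) \<longleftrightarrow> (\<exists>y. Q y)" and all_dc: "(\<forall>n. Q (dc n)) \<longleftrightarrow> (\<forall>y. Q y)"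
proof -
  have "Q (dc (cd y)) = Q y" for y by simp
  then show "(\<exists>n. Q (dc n)) \<longleftrightarrow> (\<exists>y. Q y)" "(\<forall>n. Q (dc n)) \<longleftrightarrow> (\<forall>y. Q y)" by blast+
qed

section \<open>Quantifier prefixes and the arithmetical classes\<close>

lemma sigma_SucI: "- R \<in> sigma_cls n \<Longrightarrow> {x. \<exists>y. prod_encode (x, y) \<in> R} \<in> sigma_cls (Suc n)"
  by auto

lemma sigma1I:
  assumes "cmp (\<lambda>p. P (fst p) (snd p))"
  shows "{x. \<exists>y :: 'b :: bcod. P x y} \<in> sigma_cls 1"
proof -
  have "- {w. P (fst (prod_decode w)) (dc (snd (prod_decode w)))} \<in> sigma_cls 0"
    by (simp add: computable_set_iff) (intro cmp_intros cmp_comp2[OF assms])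
  from sigma_SucI[OF this] show ?thesis by (simp add: ex_dc[of "P _"])
qed

lemma sigma2I:
  assumes "cmp (\<lambda>p. P (fst p) (fst (snd p)) (snd (snd p)))"
  shows "{x. \<exists>y :: 'b :: bcod. \<forall>z :: 'c :: bcod. P x y z} \<in> sigma_cls 2"
proof -
  have "{w. \<exists>z :: 'c. \<not> P (fst (prod_decode w)) (dc (snd (prod_decode w)) :: 'b) z} \<in> sigma_cls 1"
    by (rule sigma1I) (intro cmp_intros cmp_comp3[OF assms])
  then have "- {w. \<forall>z :: 'c. P (fst (prod_decode w)) (dc (snd (prod_decode w)) :: 'b) z} \<in> sigma_cls 1"
    by (rule back_subst[of "\<lambda>S. S \<in> _"]) auto
  from sigma_SucI[OF this] have "{x. \<exists>y. \<forall>z. P x (dc y) z} \<in> sigma_cls 2"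
    by (simp add: numeral_2_eq_2)
  then show ?thesis by (simp only: ex_dc[of "\<lambda>y. \<forall>z. P _ y z"])
qed

lemma pi2I:
  assumes "cmp (\<lambda>p. P (fst p) (fst (snd p)) (snd (snd p)))"
  shows "{x. \<forall>y :: 'b :: bcod. \<exists>z :: 'c :: bcod. P x y z} \<in> pi_cls 2"
proof -
  have "{x. \<exists>y :: 'b. \<forall>z :: 'c. \<not> P x y z} \<in> sigma_cls 2"
    by (rule sigma2I) (intro cmp_intros cmp_comp3[OF assms])
  moreover have "{x. \<exists>y :: 'b. \<forall>z :: 'c. \<not> P x y z} = - {x. \<forall>y :: 'b. \<exists>z :: 'c. P x y z}" by auto
  ultimately show ?thesis unfolding pi_cls_def by simp
qed

lemma pi3I:
  assumes "cmp (\<lambda>p. P (fst p) (fst (snd p)) (fst (snd (snd p))) (snd (snd (snd p))))"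
  shows "{x. \<forall>y :: 'b :: bcod. \<exists>z :: 'c :: bcod. \<forall>w :: 'd :: bcod. P x y z w} \<in> pi_cls 3"
proof -
  have "{v. \<exists>z :: 'c. \<forall>w :: 'd. P (fst (prod_decode v)) (dc (snd (prod_decode v)) :: 'b) z w} \<in> sigma_cls 2"
    by (rule sigma2I) (intro cmp_intros cmp_comp4[OF assms])
  then have "- {v. \<not> (\<exists>z :: 'c. \<forall>w :: 'd. P (fst (prod_decode v)) (dc (snd (prod_decode v)) :: 'b) z w)} \<in> sigma_cls 2"
    by (rule back_subst[of "\<lambda>S. S \<in> _"]) auto
  from sigma_SucI[OF this] have "{x. \<exists>y. \<not> (\<exists>z :: 'c. \<forall>w :: 'd. P x (dc y :: 'b) z w)} \<in> sigma_cls 3"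
    by (simp add: numeral_3_eq_3 numeral_2_eq_2)
  moreover have "{x. \<exists>y. \<not> (\<exists>z :: 'c. \<forall>w :: 'd. P x (dc y :: 'b) z w)}
      = - {x. \<forall>y :: 'b. \<exists>z :: 'c. \<forall>w :: 'd. P x y z w}"
    by (auto simp only: ex_dc[of "\<lambda>y. \<not> (\<exists>z :: 'c. \<forall>w :: 'd. P _ y z w)"])
  ultimately show ?thesis unfolding pi_cls_def by simp
qed

text \<open>For "some \<open>y\<close> satisfies \<open>Q x y z\<close> for all \<open>z\<close>",
  the candidate \<open>u x t\<close> is the least \<open>y\<close> not refuted by any
  \<open>z < t\<close>. It never decreases, so it changes finitely often iff some \<open>y\<close>
  is never refuted; \<open>D\<close> marks the changes.\<close>

lemma sigma2_finite:
  assumes "S \<in> sigma_cls 2"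
  shows "\<exists>D :: nat \<Rightarrow> nat \<Rightarrow> bool. cmp (\<lambda>p. D (fst p) (snd p)) \<and> (\<forall>x. x \<in> S \<longleftrightarrow> finite {t. D x t})"
proof -
  obtain R R' where R: "S = {x. \<exists>y. prod_encode (x, y) \<in> R}" "- R = {x. \<exists>y. prod_encode (x, y) \<in> R'}"
    "computable_set (- R')"
    using assms by (auto simp: numeral_2_eq_2)
  define Q where "Q x y z \<longleftrightarrow> prod_encode (prod_encode (x, y), z) \<in> - R'" for x y z
  have Qc: "cmp (\<lambda>w. w \<in> - R')" using R(3) by (simp only: computable_set_iff)
  have S: "x \<in> S \<longleftrightarrow> (\<exists>y. \<forall>z. Q x y z)" for x
    using R(1,2) unfolding Q_def by blast
  \<comment> \<open>The alternative \<open>y = t\<close> guarantees that a least number exists and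
    bounds the candidate by the stage.\<close>
  define u where "u x t = (LEAST y. y = t \<or> (\<forall>z<t. Q x y z))" for x t
  have ex: "\<exists>y. y = t \<or> (\<forall>z<t. Q x y z)" for x t by blast
  have uc: "cmp (\<lambda>p. u (fst p) (snd p))"
    unfolding u_def Q_def by (intro cmp_intros cmp_comp[OF Qc]) blast
  have u: "u x t = t \<or> (\<forall>z<t. Q x (u x t) z)" for x t
    unfolding u_def by (rule LeastI_ex) (rule ex)
  have le: "u x t \<le> y" if "y = t \<or> (\<forall>z<t. Q x y z)" for x t y
    unfolding u_def by (rule Least_le) (rule that)
  have mono1: "u x t \<le> u x (Suc t)" for x t
  proof (cases "u x (Suc t) = Suc t")
    case True then show ?thesis using le[of t t x] by simp
  next
    case False
    then have "\<forall>z<Suc t. Q x (u x (Suc t)) z" using u by blast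
    then show ?thesis by (intro le) auto
  qed
  have mono: "s \<le> t \<Longrightarrow> u x s \<le> u x t" for x s t
    using lift_Suc_mono_le[of "u x"] mono1 by blast
  define D where "D x t \<longleftrightarrow> u x (Suc t) \<noteq> u x t" for x t
  have "cmp (\<lambda>p. D (fst p) (snd p))" unfolding D_def
    by (intro cmp_intros cmp_comp2[OF uc])
  moreover have "x \<in> S \<longleftrightarrow> finite {t. D x t}" for x
  proof
    assume "x \<in> S"
    then obtain y where y: "\<forall>z. Q x y z" using S by blast
    have "inj_on (\<lambda>t. u x (Suc t)) {t. D x t}"
    proof (rule linorder_inj_onI)
      fix s t assume "s < t" "s \<in> {t. D x t}" "t \<in> {t. D x t}"
      then have "u x (Suc s) \<le> u x t" "u x t < u x (Suc t)"
        using mono[of "Suc s" t x] mono1[of x t] unfolding D_def by auto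
      then show "u x (Suc s) \<noteq> u x (Suc t)" by simp
    qed auto
    moreover have "(\<lambda>t. u x (Suc t)) ` {t. D x t} \<subseteq> {..y}" using le y by auto
    ultimately show "finite {t. D x t}" by (meson finite_atMost inj_on_finite)
  next
    assume "finite {t. D x t}"
    then obtain t0 where t0: "\<And>t. D x t \<Longrightarrow> t < t0" using finite_nat_set_iff_bounded by auto
    have c: "u x (t0 + k) = u x t0" for k
    proof (induction k)
      case (Suc k)
      then show ?case using t0[of "t0 + k"] unfolding D_def by auto
    qed simp
    have "Q x (u x t0) z" for z
    proof -
      \<comment> \<open>Beyond \<open>z\<close>, so that the candidate has passed the test at
        \<open>z\<close>, and beyond the limit value, so that the default \<open>y = t\<close> is
        excluded.\<close>
      define t where "t = t0 + (z + Suc (u x t0))"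
      have "u x t = u x t0" unfolding t_def by (rule c)
      then show ?thesis using u[of x t] by (auto simp: t_def)
    qed
    then show "x \<in> S" using S by blast
  qed
  ultimately show ?thesis by blast
qed

section \<open>Folding over term codes\<close>

text \<open>The codes are those of \<open>code_tm\<close>; a number whose tag is not one of 3, 4, 5 is a leaf,
  so every number is a code.\<close>

function tfold :: "(nat \<Rightarrow> nat \<Rightarrow> 'b) \<Rightarrow> ('b \<Rightarrow> 'b) \<Rightarrow> ('b \<Rightarrow> 'b \<Rightarrow> 'b) \<Rightarrow> ('b \<Rightarrow> 'b \<Rightarrow> 'b) \<Rightarrow> nat \<Rightarrow> 'b" where
  "tfold lf ng ad mu e = (let t = fst (prod_decode e); r = snd (prod_decode e);
      f = fst (prod_decode r); g = snd (prod_decode r) in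
    if t = 3 then ad (tfold lf ng ad mu f) (tfold lf ng ad mu g)
    else if t = 4 then mu (tfold lf ng ad mu f) (tfold lf ng ad mu g)
    else if t = 5 then ng (tfold lf ng ad mu r) else lf t r)"
  by auto
termination
  by (relation "measure (\<lambda>(_, _, _, _, e). e)")
    (auto intro!: le_less_trans[OF fst_prod_decode_le snd_prod_decode_less]
      le_less_trans[OF snd_prod_decode_le snd_prod_decode_less] snd_prod_decode_less)

declare tfold.simps [simp del]

definition tvar :: "nat \<Rightarrow> nat" where "tvar i = prod_encode (0, i)"
definition tzero :: nat where "tzero = prod_encode (1, 0)"
definition tone :: nat where "tone = prod_encode (2, 0)"
definition tadd :: "nat \<Rightarrow> nat \<Rightarrow> nat" where "tadd a b = prod_encode (3, prod_encode (a, b))"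
definition tmul :: "nat \<Rightarrow> nat \<Rightarrow> nat" where "tmul a b = prod_encode (4, prod_encode (a, b))"
definition tneg :: "nat \<Rightarrow> nat" where "tneg a = prod_encode (5, a)"

lemmas term_defs = tvar_def tzero_def tone_def tadd_def tmul_def tneg_def

lemma cmp_terms [cmp_intros]:
  "cmp f \<Longrightarrow> cmp (\<lambda>x. tvar (f x))" "cmp f \<Longrightarrow> cmp (\<lambda>x. tneg (f x))"
  "cmp f \<Longrightarrow> cmp g \<Longrightarrow> cmp (\<lambda>x. tadd (f x) (g x))" "cmp f \<Longrightarrow> cmp g \<Longrightarrow> cmp (\<lambda>x. tmul (f x) (g x))"
  unfolding term_defs by (intro cmp_intros; assumption)+

lemma tfold_simps [simp]:
  "tfold lf ng ad mu (tvar i) = lf 0 i"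
  "tfold lf ng ad mu tzero = lf 1 0"
  "tfold lf ng ad mu tone = lf 2 0"
  "tfold lf ng ad mu (tadd a b) = ad (tfold lf ng ad mu a) (tfold lf ng ad mu b)"
  "tfold lf ng ad mu (tmul a b) = mu (tfold lf ng ad mu a) (tfold lf ng ad mu b)"
  "tfold lf ng ad mu (tneg a) = ng (tfold lf ng ad mu a)"
  by (simp_all add: term_defs tfold.simps[of _ _ _ _ "prod_encode _"] Let_def)

lemma tfold_leaf: "t \<notin> {3, 4, 5} \<Longrightarrow> tfold lf ng ad mu (prod_encode (t, r)) = lf t r"
  by (simp add: tfold.simps[of _ _ _ _ "prod_encode _"] Let_def)

lemma term_induct [case_names leaf add mul neg]:
  assumes "\<And>t r. t \<notin> {3, 4, 5} \<Longrightarrow> P (prod_encode (t, r))"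
    and "\<And>a b. P a \<Longrightarrow> P b \<Longrightarrow> P (tadd a b)" "\<And>a b. P a \<Longrightarrow> P b \<Longrightarrow> P (tmul a b)"
    and "\<And>a. P a \<Longrightarrow> P (tneg a)"
  shows "P e"
proof (induction e rule: less_induct)
  case (less e)
  obtain t r where tr: "prod_decode e = (t, r)" by force
  then have e: "e = prod_encode (t, r)" by (metis prod_decode_inverse)
  obtain f g where fg: "prod_decode r = (f, g)" by force
  then have r: "r = prod_encode (f, g)" by (metis prod_decode_inverse)
  have re: "r < e" if "t > 0" using snd_prod_decode_less[of e] tr that by simp
  have fr: "f \<le> r" "g \<le> r" using fst_prod_decode_le[of r] snd_prod_decode_le[of r] fg by auto
  consider "t \<notin> {3, 4, 5}" | "t = 3" | "t = 4" | "t = 5" by blast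
  then show ?case
  proof cases
    case 1 then show ?thesis using assms(1) e by simp
  next
    case 2
    then have "P f" "P g" using less re fr by auto
    then show ?thesis using assms(2) 2 e r by (simp add: tadd_def)
  next
    case 3
    then have "P f" "P g" using less re fr by auto
    then show ?thesis using assms(3) 3 e r by (simp add: tmul_def)
  next
    case 4
    then have "P r" using less re by auto
    then show ?thesis using assms(4) 4 e by (simp add: tneg_def)
  qed
qed

text \<open>Subterms have smaller codes, so a fold is a course-of-values recursion.\<close>

lemma cmp_tfold [cmp_intros]:
  fixes lf :: "'a :: cod \<Rightarrow> nat \<Rightarrow> nat \<Rightarrow> 'b :: cod"
  assumes lf: "cmp (\<lambda>p. lf (fst p) (fst (snd p)) (snd (snd p)))"
    and ng: "cmp (\<lambda>p. ng (fst p) (snd p))"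
    and ad: "cmp (\<lambda>p. ad (fst p) (fst (snd p)) (snd (snd p)))"
    and mu: "cmp (\<lambda>p. mu (fst p) (fst (snd p)) (snd (snd p)))"
    and e: "cmp e"
  shows "cmp (\<lambda>x. tfold (\<lambda>t r. lf x t r) (\<lambda>a. ng x a) (\<lambda>a b. ad x a b) (\<lambda>a b. mu x a b) (e x))"
proof (rule cmp_cov[where x = "\<lambda>x. x" and n = e and f = "\<lambda>x. tfold (lf x) (ng x) (ad x) (mu x)"
      and G = "\<lambda>x e h. let t = fst (prod_decode e); r = snd (prod_decode e);
      f = fst (prod_decode r); g = snd (prod_decode r); d = lf x 0 0 in
    if t = 3 then ad x (nthd d h f) (nthd d h g)
    else if t = 4 then mu x (nthd d h f) (nthd d h g)
    else if t = 5 then ng x (nthd d h r) else lf x t r"])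
  fix x e
  let ?F = "tfold (lf x) (ng x) (ad x) (mu x)"
  define t where "t = fst (prod_decode e)"
  define r where "r = snd (prod_decode e)"
  have r: "r < e" if "t > 0" using snd_prod_decode_less that unfolding t_def r_def by blast
  have 1: "nthd d (map ?F [0..<e]) y = ?F y" if "t > 0" "y \<le> r" for y d
    using r that by (simp add: nthd_def)
  show "?F e = (let t = fst (prod_decode e); r = snd (prod_decode e);
      f = fst (prod_decode r); g = snd (prod_decode r); d = lf x 0 0 in
    if t = 3 then ad x (nthd d (map ?F [0..<e]) f) (nthd d (map ?F [0..<e]) g)
    else if t = 4 then mu x (nthd d (map ?F [0..<e]) f) (nthd d (map ?F [0..<e]) g)
    else if t = 5 then ng x (nthd d (map ?F [0..<e]) r) else lf x t r)"
    unfolding tfold.simps[of _ _ _ _ e] Let_def t_def[symmetric] r_def[symmetric]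
    using 1 fst_prod_decode_le[of r] snd_prod_decode_le[of r] by simp
next
  show "cmp (\<lambda>p. let t = fst (prod_decode (fst (snd p))); r = snd (prod_decode (fst (snd p)));
      f = fst (prod_decode r); g = snd (prod_decode r); d = lf (fst p) 0 0 in
    if t = 3 then ad (fst p) (nthd d (snd (snd p)) f) (nthd d (snd (snd p)) g)
    else if t = 4 then mu (fst p) (nthd d (snd (snd p)) f) (nthd d (snd (snd p)) g)
    else if t = 5 then ng (fst p) (nthd d (snd (snd p)) r) else lf (fst p) t r)"
    unfolding Let_def by (intro cmp_intros cmp_comp3[OF lf] cmp_comp3[OF ad] cmp_comp3[OF mu] cmp_comp2[OF ng])
qed (intro cmp_intros e)+

section \<open>Embedding Archimedean real closed fields into the reals\<close>

definition emb :: "ostr \<Rightarrow> (nat \<Rightarrow> real) \<Rightarrow> bool" where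
  "emb A h \<longleftrightarrow> wf_str A \<and> inj_on h (s_carrier A) \<and> h (s_zero A) = 0 \<and> h (s_one A) = 1
    \<and> (\<forall>x\<in>s_carrier A. \<forall>y\<in>s_carrier A. h (s_add A x y) = h x + h y \<and> h (s_mul A x y) = h x * h y
        \<and> (s_less A x y \<longleftrightarrow> h x < h y))
    \<and> (\<forall>x\<in>s_carrier A. h (s_neg A x) = - h x)"

locale arch_of =
  fixes A :: ostr
  assumes ofA: "ordered_field_str A" and archA: "archimedean_str A"
begin

abbreviation C where "C \<equiv> s_carrier A"
abbreviation ad (infixl "\<oplus>" 65) where "x \<oplus> y \<equiv> s_add A x y"
abbreviation mu (infixl "\<otimes>" 70) where "x \<otimes> y \<equiv> s_mul A x y"
abbreviation ng where "ng x \<equiv> s_neg A x"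
abbreviation lt (infix "\<prec>" 50) where "x \<prec> y \<equiv> s_less A x y"
abbreviation z where "z \<equiv> s_zero A"
abbreviation u where "u \<equiv> s_one A"
abbreviation nel where "nel \<equiv> nat_el A"

lemma wf: "wf_str A" using ofA unfolding ordered_field_str_def by blast

lemma closed [simp]: "z \<in> C" "u \<in> C" "x \<in> C \<Longrightarrow> y \<in> C \<Longrightarrow> x \<oplus> y \<in> C"
  "x \<in> C \<Longrightarrow> y \<in> C \<Longrightarrow> x \<otimes> y \<in> C" "x \<in> C \<Longrightarrow> ng x \<in> C"
  using wf unfolding wf_str_def by auto

lemma axs:
  "\<forall>x\<in>C. \<forall>y\<in>C. \<forall>w\<in>C. (x \<oplus> y) \<oplus> w = x \<oplus> (y \<oplus> w) \<and> (x \<otimes> y) \<otimes> w = x \<otimes> (y \<otimes> w)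
     \<and> x \<otimes> (y \<oplus> w) = x \<otimes> y \<oplus> x \<otimes> w"
  "\<forall>x\<in>C. \<forall>y\<in>C. x \<oplus> y = y \<oplus> x \<and> x \<otimes> y = y \<otimes> x"
  "\<forall>x\<in>C. x \<oplus> z = x \<and> x \<otimes> u = x \<and> x \<oplus> ng x = z"
  "z \<noteq> u"
  "\<forall>x\<in>C. x \<noteq> z \<longrightarrow> (\<exists>y\<in>C. x \<otimes> y = u)"
  "\<forall>x\<in>C. \<not> x \<prec> x"
  "\<forall>x\<in>C. \<forall>y\<in>C. \<forall>w\<in>C. x \<prec> y \<longrightarrow> y \<prec> w \<longrightarrow> x \<prec> w"
  "\<forall>x\<in>C. \<forall>y\<in>C. x \<prec> y \<or> x = y \<or> y \<prec> x"
  "\<forall>x\<in>C. \<forall>y\<in>C. \<forall>w\<in>C. x \<prec> y \<longrightarrow> x \<oplus> w \<prec> y \<oplus> w"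
  "\<forall>x\<in>C. \<forall>y\<in>C. z \<prec> x \<longrightarrow> z \<prec> y \<longrightarrow> z \<prec> x \<otimes> y"
  using ofA unfolding ordered_field_str_def Let_def by - (elim conjE, assumption)+

lemma add_assoc: "x \<in> C \<Longrightarrow> y \<in> C \<Longrightarrow> w \<in> C \<Longrightarrow> (x \<oplus> y) \<oplus> w = x \<oplus> (y \<oplus> w)"
  by (rule axs(1)[rule_format, THEN conjunct1])
lemma distl: "x \<in> C \<Longrightarrow> y \<in> C \<Longrightarrow> w \<in> C \<Longrightarrow> x \<otimes> (y \<oplus> w) = x \<otimes> y \<oplus> x \<otimes> w"
  by (rule axs(1)[rule_format, THEN conjunct2, THEN conjunct2])
lemma add_comm: "x \<in> C \<Longrightarrow> y \<in> C \<Longrightarrow> x \<oplus> y = y \<oplus> x"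
  by (rule axs(2)[rule_format, THEN conjunct1])
lemma mul_comm: "x \<in> C \<Longrightarrow> y \<in> C \<Longrightarrow> x \<otimes> y = y \<otimes> x"
  by (rule axs(2)[rule_format, THEN conjunct2])
lemma add_z [simp]: "x \<in> C \<Longrightarrow> x \<oplus> z = x"
  by (rule axs(3)[rule_format, THEN conjunct1])
lemma mul_u [simp]: "x \<in> C \<Longrightarrow> x \<otimes> u = x"
  by (rule axs(3)[rule_format, THEN conjunct2, THEN conjunct1])
lemma add_ng [simp]: "x \<in> C \<Longrightarrow> x \<oplus> ng x = z"
  by (rule axs(3)[rule_format, THEN conjunct2, THEN conjunct2])
lemmas zu = axs(4)
lemmas inv = axs(5)[rule_format]
lemmas irr = axs(6)[rule_format]
lemmas trans = axs(7)[rule_format]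
lemmas total = axs(8)[rule_format]
lemmas add_mono = axs(9)[rule_format]
lemmas mul_pos = axs(10)[rule_format]

lemma add_lcomm: "x \<in> C \<Longrightarrow> y \<in> C \<Longrightarrow> w \<in> C \<Longrightarrow> x \<oplus> (y \<oplus> w) = y \<oplus> (x \<oplus> w)"
  using add_assoc[of x y w] add_assoc[of y x w] add_comm[of x y] by simp

lemmas acs = add_assoc add_comm add_lcomm

lemma z_add [simp]: "x \<in> C \<Longrightarrow> z \<oplus> x = x"
  using add_comm[of z x] by simp

definition le (infix "\<preceq>" 50) where "x \<preceq> y \<longleftrightarrow> x \<prec> y \<or> x = y"

lemma not_lt: "x \<in> C \<Longrightarrow> y \<in> C \<Longrightarrow> \<not> x \<prec> y \<longleftrightarrow> y \<preceq> x"
  unfolding le_def using total irr trans by blast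

lemma add_mono2: "x \<in> C \<Longrightarrow> y \<in> C \<Longrightarrow> v \<in> C \<Longrightarrow> w \<in> C \<Longrightarrow> x \<prec> y \<Longrightarrow> v \<preceq> w \<Longrightarrow> x \<oplus> v \<prec> y \<oplus> w"
  unfolding le_def using add_mono[of x y v] add_mono[of v w y] add_comm[of v y] add_comm[of w y]
    trans[of "x \<oplus> v" "y \<oplus> v" "y \<oplus> w"] by auto

lemma add_mono3: "x \<in> C \<Longrightarrow> y \<in> C \<Longrightarrow> v \<in> C \<Longrightarrow> w \<in> C \<Longrightarrow> x \<preceq> y \<Longrightarrow> v \<preceq> w \<Longrightarrow> x \<oplus> v \<preceq> y \<oplus> w"
  using add_mono2[of x y v w] add_mono[of v w y] add_comm[of v y] add_comm[of w y] unfolding le_def by auto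

text \<open>The multiple \<open>k x\<close>. Comparing such multiples with \<open>nel\<close>
  suffices to express rational cuts without division.\<close>

fun nsm :: "nat \<Rightarrow> nat \<Rightarrow> nat" where
  "nsm 0 x = z" | "nsm (Suc k) x = nsm k x \<oplus> x"

lemma nel_nsm: "nel k = nsm k u" by (induction k) auto

lemma nsmC [simp]: "x \<in> C \<Longrightarrow> nsm k x \<in> C" by (induction k) auto

lemma nelC [simp]: "nel k \<in> C" by (simp add: nel_nsm)

lemma nsm_plus: "x \<in> C \<Longrightarrow> nsm (k + l) x = nsm k x \<oplus> nsm l x"
  by (induction l) (auto simp: add_assoc)

lemma nsm_dist: "x \<in> C \<Longrightarrow> y \<in> C \<Longrightarrow> nsm k (x \<oplus> y) = nsm k x \<oplus> nsm k y"
  by (induction k) (auto simp: acs)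

lemma nsm_z [simp]: "nsm k z = z" by (induction k) auto

lemma nsm_mult: "x \<in> C \<Longrightarrow> nsm (k * l) x = nsm k (nsm l x)"
proof (induction k)
  case (Suc k)
  then show ?case using nsm_plus[of x l "k * l"] add_comm by simp
qed simp

lemma nsm_le: "x \<in> C \<Longrightarrow> y \<in> C \<Longrightarrow> x \<preceq> y \<Longrightarrow> nsm k x \<preceq> nsm k y"
  by (induction k) (auto simp: add_mono3, auto simp: le_def)

lemma nsm_lt: "x \<in> C \<Longrightarrow> y \<in> C \<Longrightarrow> x \<prec> y \<Longrightarrow> k > 0 \<Longrightarrow> nsm k x \<prec> nsm k y"
proof (cases k)
  case (Suc l)
  assume a: "x \<in> C" "y \<in> C" "x \<prec> y"
  then have "nsm l x \<preceq> nsm l y" using nsm_le unfolding le_def by blast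
  then show ?thesis using a add_mono2[of x y "nsm l x" "nsm l y"] Suc
    by (simp add: add_comm)
qed simp

text \<open>Otherwise \<open>-1\<close> would be positive, hence also its square, although
  \<open>-1\<close> and its square add up to 0.\<close>

lemma z_less_u: "z \<prec> u"
proof (rule ccontr)
  assume "\<not> z \<prec> u"
  then have "u \<prec> z" using total[of z u] zu by auto
  then have n: "z \<prec> ng u" using add_mono[of u z "ng u"] by simp
  then have p: "z \<prec> ng u \<otimes> ng u" using mul_pos by simp
  have "ng u \<otimes> z \<oplus> ng u \<otimes> z = ng u \<otimes> z" using distl[of "ng u" z z] by simp
  then have "ng u \<otimes> z = z" using add_assoc[of "ng u \<otimes> z" "ng u \<otimes> z" "ng (ng u \<otimes> z)"] by simp
  then have "ng u \<oplus> ng u \<otimes> ng u = z" using distl[of "ng u" u "ng u"] by simp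
  moreover have "z \<prec> ng u \<oplus> ng u \<otimes> ng u"
    using add_mono2[of z "ng u" z "ng u \<otimes> ng u"] n p by (simp add: le_def)
  ultimately show False using irr by simp
qed

lemma nel_plus: "nel (k + l) = nel k \<oplus> nel l" by (simp add: nel_nsm nsm_plus)

lemma nel_mult: "nel (k * l) = nsm k (nel l)" by (simp add: nel_nsm nsm_mult)

lemma nel_less: "nel k \<prec> nel l \<longleftrightarrow> k < l"
proof -
  have 1: "nel k \<prec> nel l" if "k < l" for k l
  proof -
    have "z \<prec> nel (l - k)" using nsm_lt[of z u "l - k"] z_less_u that by (simp add: nel_nsm)
    then have "z \<oplus> nel k \<prec> nel (l - k) \<oplus> nel k" by (intro add_mono) simp_all
    then show ?thesis using nel_plus[of "l - k" k] that by simp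
  qed
  show ?thesis using 1[of k l] 1[of l k] irr[of "nel k"] trans[of "nel k" "nel l" "nel k"]
    by (cases k l rule: linorder_cases) auto
qed

text \<open>The rational \<open>(p - q) / m\<close> lies below \<open>x\<close>, written without
  subtraction and division.\<close>

definition Q where "Q x p q m \<longleftrightarrow> nel p \<prec> nsm m x \<oplus> nel q"

text \<open>Both comparisons are brought to the common denominator \<open>m * m'\<close>. The
  multiple of \<open>x\<close> then drops out, leaving an inequality between natural
  numbers.\<close>

lemma Q_less:
  assumes x: "x \<in> C" and m: "m > 0" "m' > 0" and Q: "Q x p q m" "\<not> Q x p' q' m'"
  shows "(real p - real q) / real m < (real p' - real q') / real m'"
proof -
  have 1: "nel p \<prec> nsm m x \<oplus> nel q" and 2: "nsm m' x \<oplus> nel q' \<preceq> nel p'"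
    using Q x unfolding Q_def by (auto simp: not_lt)
  have a: "nel (m' * p) \<prec> nsm (m' * m) x \<oplus> nel (m' * q)"
    using nsm_lt[OF _ _ 1 m(2)] x by (simp add: nsm_dist nsm_mult nel_mult)
  have b: "nsm (m * m') x \<oplus> nel (m * q') \<preceq> nel (m * p')"
    using nsm_le[OF _ _ 2, of m] x by (simp add: nsm_dist nsm_mult nel_mult)
  have b': "nsm (m' * m) x \<oplus> nel (m * q') \<preceq> nel (m * p')" using b by (simp add: mult.commute)
  have "nel (m' * p) \<oplus> nel (m * q') \<prec> nsm (m' * m) x \<oplus> nel (m' * q) \<oplus> nel (m * q')"
    using add_mono[OF _ _ _ a] x by simp
  moreover have "nsm (m' * m) x \<oplus> nel (m' * q) \<oplus> nel (m * q')
      = (nsm (m' * m) x \<oplus> nel (m * q')) \<oplus> nel (m' * q)"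
    using x by (simp add: acs)
  ultimately have c: "nel (m' * p) \<oplus> nel (m * q') \<prec> (nsm (m' * m) x \<oplus> nel (m * q')) \<oplus> nel (m' * q)" by simp
  have d: "(nsm (m' * m) x \<oplus> nel (m * q')) \<oplus> nel (m' * q) \<preceq> nel (m * p') \<oplus> nel (m' * q)"
    using add_mono3[OF _ _ _ _ b', of "nel (m' * q)" "nel (m' * q)"] x by (simp add: le_def)
  have "nel (m' * p) \<oplus> nel (m * q') \<prec> nel (m * p') \<oplus> nel (m' * q)"
    using c d trans[OF _ _ _ c, of "nel (m * p') \<oplus> nel (m' * q)"] x unfolding le_def by auto
  then have "m' * p + m * q' < m * p' + m' * q" unfolding nel_plus[symmetric] nel_less .
  then have "real (m' * p + m * q') < real (m * p' + m' * q)" by (simp only: of_nat_less_iff)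
  then show ?thesis using m by (simp add: field_simps)
qed

lemma Q_bounds: assumes "x \<in> C" shows "\<exists>n. Q x 0 n 1" "\<exists>n. \<not> Q x n 0 m"
proof -
  obtain n where "ng x \<prec> nel n"
    using bspec[OF archA[unfolded archimedean_str_def], of "ng x"] assms by auto
  then have "z \<prec> x \<oplus> nel n"
    using add_mono[of "ng x" "nel n" x] assms by (simp add: add_comm)
  then show "\<exists>n. Q x 0 n 1" using assms by (auto simp: Q_def)
  obtain n where "nsm m x \<prec> nel n"
    using bspec[OF archA[unfolded archimedean_str_def], of "nsm m x"] assms by auto
  then have "\<not> nel n \<prec> nsm m x" using trans[of "nsm m x" "nel n" "nsm m x"] irr assms by auto
  then show "\<exists>n. \<not> Q x n 0 m" using assms by (auto simp: Q_def)
qed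

text \<open>Hoelder's embedding: the supremum of the rationals below \<open>x\<close>.\<close>

definition h where "h x = Sup {(real p - real q) / real m | p q m. m > 0 \<and> Q x p q m}"

lemma Q_h: assumes x: "x \<in> C" and m: "m > 0"
  shows "Q x p q m \<Longrightarrow> (real p - real q) / real m \<le> h x" "\<not> Q x p q m \<Longrightarrow> h x \<le> (real p - real q) / real m"
proof -
  let ?S = "{(real p - real q) / real m | p q m. m > 0 \<and> Q x p q m}"
  obtain n k where n: "Q x 0 n 1" and k: "\<not> Q x k 0 1" using Q_bounds[OF x] by blast
  have "(real 0 - real n) / real 1 \<in> ?S" using n by blast
  then have ne: "?S \<noteq> {}" by blast
  have ub: "y \<le> (real p' - real q') / real m'" if "y \<in> ?S" "m' > 0" "\<not> Q x p' q' m'" for y p' q' m'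
    using that Q_less[OF x] by (auto intro: less_imp_le)
  have "bdd_above ?S" using ub[OF _ _ k] by (intro bdd_aboveI) auto
  then show "Q x p q m \<Longrightarrow> (real p - real q) / real m \<le> h x"
    unfolding h_def using m by (intro cSup_upper) auto
  show "\<not> Q x p q m \<Longrightarrow> h x \<le> (real p - real q) / real m"
    unfolding h_def using ub m by (intro cSup_least[OF ne]) auto
qed

lemma Q_approx: assumes x: "x \<in> C" and m: "m > 0"
  shows "\<exists>p q. Q x p q m \<and> \<not> Q x (Suc p) q m"
proof -
  obtain n where "Q x 0 n 1" using Q_bounds[OF x] by blast
  then have "z \<prec> x \<oplus> nel n" using x by (simp add: Q_def)
  then have "nsm m z \<prec> nsm m (x \<oplus> nel n)" using x m by (intro nsm_lt) auto
  then have 0: "Q x 0 (m * n) m" using x by (simp add: Q_def nsm_dist nel_mult)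
  obtain k where "\<not> Q x k 0 m" using Q_bounds[OF x] by blast
  then have "nsm m x \<preceq> nel k" using x by (simp add: Q_def not_lt)
  then have "nsm m x \<oplus> nel (m * n) \<preceq> nel (k + m * n)"
    unfolding nel_plus using x by (intro add_mono3) (auto simp: le_def)
  then have 1: "\<not> Q x (k + m * n) (m * n) m" using x by (simp add: Q_def not_lt)
  \<comment> \<open>The first numerator that is not below \<open>x\<close> is a successor because 0
    is below; its predecessor traps \<open>x\<close> in an interval of length
    \<open>1 / m\<close>.\<close>
  define P where "P p \<longleftrightarrow> \<not> Q x p (m * n) m" for p
  have "P (LEAST p. P p)" using 1 unfolding P_def by (rule LeastI)
  moreover have "(LEAST p. P p) \<noteq> 0" using 0 calculation unfolding P_def by metis
  then obtain p where p: "(LEAST p. P p) = Suc p" using not0_implies_Suc by blast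
  then have "\<not> P p" using not_less_Least[of p P] by simp
  ultimately show ?thesis unfolding p unfolding P_def by blast
qed

text \<open>Intervals of length \<open>1 / m\<close> around \<open>x\<close> and \<open>y\<close>
  add up to one of length \<open>2 / m\<close> around the sum, for every \<open>m\<close>.\<close>

lemma h_add: assumes x: "x \<in> C" and y: "y \<in> C" shows "h (x \<oplus> y) = h x + h y"
proof -
  have "\<bar>h (x \<oplus> y) - (h x + h y)\<bar> \<le> 2 / real m" if m: "m > 0" for m :: nat
  proof -
    obtain p q where p: "Q x p q m" "\<not> Q x (Suc p) q m" using Q_approx[OF x m] by blast
    obtain p' q' where p': "Q y p' q' m" "\<not> Q y (Suc p') q' m" using Q_approx[OF y m] by blast
    have e: "nsm m (x \<oplus> y) \<oplus> nel (q + q') = (nsm m x \<oplus> nel q) \<oplus> (nsm m y \<oplus> nel q')"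
      using x y by (simp add: nsm_dist nel_plus acs)
    have "nel p \<oplus> nel p' \<prec> (nsm m x \<oplus> nel q) \<oplus> (nsm m y \<oplus> nel q')"
      using p(1) p'(1) x y unfolding Q_def by (intro add_mono2) (auto simp: le_def)
    then have 1: "Q (x \<oplus> y) (p + p') (q + q') m" unfolding Q_def e by (simp add: nel_plus)
    have "(nsm m x \<oplus> nel q) \<oplus> (nsm m y \<oplus> nel q') \<preceq> nel (Suc p) \<oplus> nel (Suc p')"
      using p(2) p'(2) x y unfolding Q_def by (intro add_mono3) (auto simp: not_lt simp del: nat_el.simps)
    then have 2: "\<not> Q (x \<oplus> y) (Suc p + Suc p') (q + q') m"
      unfolding Q_def e using x y by (simp add: not_lt nel_plus[symmetric] del: nat_el.simps)
    define a where "a = (real p - real q) / real m"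
    define b where "b = (real p' - real q') / real m"
    define c where "c = 1 / real m"
    have e: "(real (Suc p) - real q) / real m = a + c" "(real (Suc p') - real q') / real m = b + c"
      "(real (p + p') - real (q + q')) / real m = a + b"
      "(real (Suc p + Suc p') - real (q + q')) / real m = a + b + 2 * c"
      unfolding a_def b_def c_def using m
      by (auto simp: add_divide_distrib diff_divide_distrib)
    have "a \<le> h x" "h x \<le> a + c" "b \<le> h y" "h y \<le> b + c"
      using Q_h(1)[OF x m p(1)] Q_h(2)[OF x m p(2)] Q_h(1)[OF y m p'(1)] Q_h(2)[OF y m p'(2)]
      unfolding e a_def[symmetric] b_def[symmetric] by - assumption+
    moreover have "a + b \<le> h (x \<oplus> y)" "h (x \<oplus> y) \<le> a + b + 2 * c"
      using Q_h(1)[OF _ m 1] Q_h(2)[OF _ m 2] x y unfolding e by simp_all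
    ultimately have "\<bar>h (x \<oplus> y) - (h x + h y)\<bar> \<le> 2 * c" by linarith
    then show ?thesis by (simp add: c_def)
  qed
  then have b: "\<bar>h (x \<oplus> y) - (h x + h y)\<bar> \<le> 2 / real (Suc n)" for n by blast
  show ?thesis
  proof (rule ccontr)
    assume "h (x \<oplus> y) \<noteq> h x + h y"
    then have "\<bar>h (x \<oplus> y) - (h x + h y)\<bar> / 2 > 0" by simp
    then obtain n where "inverse (real (Suc n)) < \<bar>h (x \<oplus> y) - (h x + h y)\<bar> / 2"
      using reals_Archimedean by blast
    then show False using b[of n] by (simp add: field_simps)
  qed
qed

lemma h_z: "h z = 0" using h_add[of z z] by simp

lemma mul_z: "x \<in> C \<Longrightarrow> h (x \<otimes> z) = 0"
  using distl[of x z z] h_add[of "x \<otimes> z" "x \<otimes> z"] by simp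

lemma lt_mul: assumes c: "x \<in> C" "y \<in> C" "w \<in> C" and "x \<prec> y" "z \<prec> w" shows "x \<otimes> w \<prec> y \<otimes> w"
proof -
  define d where "d = y \<oplus> ng x"
  have d: "d \<in> C" "z \<prec> d" using assms add_mono[of x y "ng x"] by (auto simp: d_def)
  have "x \<oplus> d = y" using c by (simp add: d_def add_lcomm[of x y "ng x"])
  then have "y \<otimes> w = x \<otimes> w \<oplus> d \<otimes> w"
    using c d distl[of w x d] by (simp add: mul_comm)
  moreover have "z \<oplus> x \<otimes> w \<prec> d \<otimes> w \<oplus> x \<otimes> w" using mul_pos[of d w] c d assms by (intro add_mono) auto
  ultimately show ?thesis using c d by (simp add: add_comm)
qed

text \<open>The Archimedean property is applied to the inverse of \<open>w\<close>: if it is below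
  \<open>n\<close>, then \<open>1 < n w\<close> and \<open>w\<close> is at least
  \<open>1 / n\<close>.\<close>

lemma h_pos: assumes w: "w \<in> C" "z \<prec> w" shows "h w > 0"
proof -
  have "w \<noteq> z" using w irr by auto
  then obtain v where v: "v \<in> C" "w \<otimes> v = u" using inv w by blast
  obtain n where n: "v \<prec> nel n" using archA v unfolding archimedean_str_def by auto
  have e: "nel k \<otimes> w = nsm k w" for k
  proof (induction k)
    case 0
    have "w \<otimes> z \<oplus> w \<otimes> z = w \<otimes> z" using distl[of w z z] w by simp
    then have "w \<otimes> z = z" using add_assoc[of "w \<otimes> z" "w \<otimes> z" "ng (w \<otimes> z)"] w by simp
    then show ?case using w by (simp add: mul_comm)
  next
    case (Suc k)
    then show ?case using w distl[of w "nel k" u] by (simp add: mul_comm)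
  qed
  have "v \<otimes> w \<prec> nel n \<otimes> w" using n v w by (intro lt_mul) auto
  then have 1: "u \<prec> nsm n w" using v w e by (simp add: mul_comm)
  have n0: "n > 0"
  proof (rule ccontr)
    assume "\<not> n > 0"
    then show False using 1 z_less_u trans[of u z u] irr by auto
  qed
  have "Q w 1 0 n" using 1 w by (simp add: Q_def)
  then have "(real 1 - real 0) / real n \<le> h w" using Q_h(1)[OF w(1) n0, of 1 0] by simp
  moreover have "0 < (real 1 - real 0) / real n" using n0 by simp
  ultimately show ?thesis by linarith
qed

lemma h_ng: "x \<in> C \<Longrightarrow> h (ng x) = - h x"
  using h_add[of x "ng x"] h_z by simp

lemma h_less: assumes c: "x \<in> C" "y \<in> C" shows "x \<prec> y \<longleftrightarrow> h x < h y"
proof -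
  have 1: "h x < h y" if "x \<prec> y" "x \<in> C" "y \<in> C" for x y
  proof -
    have "z \<prec> y \<oplus> ng x" using add_mono[of x y "ng x"] that by simp
    then show ?thesis using h_pos[of "y \<oplus> ng x"] that h_add[of y "ng x"] h_ng by simp
  qed
  show ?thesis using total[OF c] 1[of x y] 1[of y x] c by auto
qed

lemma h_u: "h u = 1"
proof -
  have Qu: "Q u p q m \<longleftrightarrow> p < m + q" for p q m
    by (simp add: Q_def nel_nsm[symmetric] nel_plus[symmetric] nel_less)
  have "h u \<le> 1" using Q_h(2)[of u 1 1 0] Qu by simp
  moreover have "1 - 1 / real (Suc n) \<le> h u" for n
    using Q_h(1)[of u "Suc n" "Suc n" 1] Qu[of "Suc n" 1 "Suc n"] by (simp add: field_simps)
  moreover have "h u \<ge> 1"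
  proof (rule ccontr)
    assume "\<not> h u \<ge> 1"
    then have "1 - h u > 0" by simp
    then obtain n where "inverse (real (Suc n)) < 1 - h u" using reals_Archimedean by blast
    then show False using calculation(2)[of n] by (simp add: field_simps)
  qed
  ultimately show ?thesis by simp
qed

text \<open>Additivity, monotonicity and the value at the unit determine on which side of every
  rational \<open>g x\<close> lies. This uniqueness is what proves that \<open>h\<close> is
  multiplicative.\<close>

lemma add_order_unique:
  assumes add: "\<And>x y. x \<in> C \<Longrightarrow> y \<in> C \<Longrightarrow> g (x \<oplus> y) = g x + g y"
    and less: "\<And>x y. x \<in> C \<Longrightarrow> y \<in> C \<Longrightarrow> x \<prec> y \<Longrightarrow> g x < (g y :: real)" and gu: "g u = 1" and x: "x \<in> C"
  shows "g x = h x"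
proof (rule ccontr)
  have gz: "g z = 0" using add[of z z] by simp
  have gn: "y \<in> C \<Longrightarrow> g (nsm k y) = real k * g y" for k y
    by (induction k) (auto simp: gz add algebra_simps)
  have Q: "Q x p q m \<longleftrightarrow> real p < real m * g x + real q" for p q m
  proof -
    have "g (nel p) = real p" "g (nsm m x \<oplus> nel q) = real m * g x + real q"
      using x gn gu add by (auto simp: nel_nsm)
    then show ?thesis unfolding Q_def using less[of "nel p" "nsm m x \<oplus> nel q"] less[of "nsm m x \<oplus> nel q" "nel p"]
      total[of "nel p" "nsm m x \<oplus> nel q"] x by auto
  qed
  assume "g x \<noteq> h x"
  then have "min (g x) (h x) < max (g x) (h x)" by (auto simp: min_def max_def)
  then obtain r where r: "r \<in> \<rat>" "min (g x) (h x) < r" "r < max (g x) (h x)"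
    using Rats_dense_in_real[of "min (g x) (h x)" "max (g x) (h x)"] by blast
  obtain i :: int and m :: nat where im: "r = real_of_int i / real m" "m > 0"
    using Rats_cases'[OF r(1)] by (metis of_nat_0_less_iff of_int_of_nat_eq zero_less_imp_eq_int)
  obtain p q :: nat where pq: "i = int p - int q" by (metis int_diff_cases)
  have rr: "r = (real p - real q) / real m" using im pq by simp
  have "real p - real q = r * real m" using rr im(2) by simp
  then have "real p < real m * g x + real q \<longleftrightarrow> r * real m < g x * real m" by (auto simp: algebra_simps)
  then have "real p < real m * g x + real q \<longleftrightarrow> r < g x" using im(2) by simp
  then show False using Q[of p q m] Q_h[OF x im(2), of p q] r rr by (auto simp: min_def max_def split: if_splits)
qed

text \<open>For positive \<open>w\<close>, dividing \<open>h (x w)\<close> by \<open>h w\<close>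
  gives an additive monotone map that sends the unit to 1, hence \<open>h\<close> itself. Negative
  \<open>w\<close> are treated through \<open>- w\<close>.\<close>

lemma h_mul: assumes x: "x \<in> C" and w: "w \<in> C" shows "h (x \<otimes> w) = h x * h w"
proof -
  have pos: "h (x \<otimes> w) = h x * h w" if w: "w \<in> C" "z \<prec> w" for w
  proof -
    have hw: "h w > 0" using h_pos w by blast
    have "h (x \<otimes> w) / h w = h x"
    proof (rule add_order_unique[where g = "\<lambda>x. h (x \<otimes> w) / h w", OF _ _ _ x])
      fix x y assume c: "x \<in> C" "y \<in> C"
      have "(x \<oplus> y) \<otimes> w = x \<otimes> w \<oplus> y \<otimes> w" using c w distl[of w x y] by (simp add: mul_comm)
      then show "h ((x \<oplus> y) \<otimes> w) / h w = h (x \<otimes> w) / h w + h (y \<otimes> w) / h w"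
        using c w h_add by (simp add: add_divide_distrib)
      assume "x \<prec> y"
      then show "h (x \<otimes> w) / h w < h (y \<otimes> w) / h w"
        using lt_mul[of x y w] h_less c w hw by (simp add: divide_strict_right_mono)
    next
      have "u \<otimes> w = w" using mul_comm[of u w] w by simp
      then show "h (u \<otimes> w) / h w = 1" using hw by simp
    qed
    then show ?thesis using hw by (simp add: field_simps)
  qed
  consider "z \<prec> w" | "w = z" | "w \<prec> z" using total[of z w] w by auto
  then show ?thesis
  proof cases
    case 1 then show ?thesis using pos w by blast
  next
    case 2 then show ?thesis using mul_z[OF x] h_z by simp
  next
    case 3
    then have "z \<prec> ng w" using add_mono[of w z "ng w"] w by simp
    then have "h (x \<otimes> ng w) = h x * h (ng w)" using pos w by simp
    moreover have "x \<otimes> w \<oplus> x \<otimes> ng w = x \<otimes> z" using distl[of x w "ng w"] x w by simp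
    then have "h (x \<otimes> w) + h (x \<otimes> ng w) = 0"
      using h_add[of "x \<otimes> w" "x \<otimes> ng w"] mul_z[OF x] x w by simp
    ultimately show ?thesis using h_ng w by simp
  qed
qed

lemma emb_h: "emb A h"
proof -
  have "inj_on h C"
  proof (rule inj_onI)
    fix x y assume "x \<in> C" "y \<in> C" "h x = h y"
    then show "x = y" using total[of x y] h_less[of x y] h_less[of y x] by auto
  qed
  then show ?thesis unfolding emb_def using wf h_z h_u h_add h_mul h_less h_ng by simp
qed

end

section \<open>Real closed subsets of the reals; isomorphism as equality of images\<close>

definition rcf_set :: "real set \<Rightarrow> bool" where
  "rcf_set F \<longleftrightarrow> 0 \<in> F \<and> 1 \<in> F \<and> (\<forall>x\<in>F. \<forall>y\<in>F. x + y \<in> F \<and> x * y \<in> F) \<and> (\<forall>x\<in>F. - x \<in> F)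
    \<and> (\<forall>x\<in>F. x \<noteq> 0 \<longrightarrow> inverse x \<in> F) \<and> (\<forall>x\<in>F. x > 0 \<longrightarrow> sqrt x \<in> F)
    \<and> (\<forall>p. (\<forall>i. coeff p i \<in> F) \<and> odd (degree p) \<longrightarrow> (\<exists>x\<in>F. poly p x = 0))"

lemma emb_hev:
  assumes "emb A h" "set cs \<subseteq> s_carrier A" "x \<in> s_carrier A"
  shows "hev A cs x \<in> s_carrier A \<and> h (hev A cs x) = poly (Poly (map h cs)) (h x)"
  using assms(2)
proof (induction cs)
  case Nil
  then show ?case using assms(1) unfolding emb_def wf_str_def by simp
next
  case (Cons c cs)
  then show ?case using assms unfolding emb_def wf_str_def by simp
qed

lemma emb_nat_el: "emb A h \<Longrightarrow> nat_el A n \<in> s_carrier A \<and> h (nat_el A n) = real n"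
  by (induction n) (auto simp: emb_def wf_str_def)

lemma rcf_set_emb:
  assumes e: "emb A h" and a: "arch_rcf A" shows "rcf_set (h ` s_carrier A)"
proof -
  let ?C = "s_carrier A"
  have of: "ordered_field_str A"
    and sq: "\<forall>x\<in>?C. s_less A (s_zero A) x \<longrightarrow> (\<exists>y\<in>?C. s_mul A y y = x)"
    and od: "\<forall>cs. set cs \<subseteq> ?C \<and> cs \<noteq> [] \<and> last cs \<noteq> s_zero A \<and> odd (length cs - 1)
       \<longrightarrow> (\<exists>x\<in>?C. hev A cs x = s_zero A)"
    using a[unfolded arch_rcf_def real_closed_str_def] by - (elim conjE, assumption)+
  have inv: "\<forall>x\<in>?C. x \<noteq> s_zero A \<longrightarrow> (\<exists>y\<in>?C. s_mul A x y = s_one A)"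
    using of[unfolded ordered_field_str_def Let_def] by - (elim conjE, assumption)
  have ops: "h (s_zero A) = 0" "h (s_one A) = 1" "\<And>x y. x \<in> ?C \<Longrightarrow> y \<in> ?C \<Longrightarrow> h (s_add A x y) = h x + h y"
    "\<And>x y. x \<in> ?C \<Longrightarrow> y \<in> ?C \<Longrightarrow> h (s_mul A x y) = h x * h y" "\<And>x. x \<in> ?C \<Longrightarrow> h (s_neg A x) = - h x"
    "\<And>x y. x \<in> ?C \<Longrightarrow> y \<in> ?C \<Longrightarrow> s_less A x y \<longleftrightarrow> h x < h y"
    and inj: "inj_on h ?C"
    using e unfolding emb_def by auto
  have cl: "s_zero A \<in> ?C" "s_one A \<in> ?C" "\<And>x y. x \<in> ?C \<Longrightarrow> y \<in> ?C \<Longrightarrow> s_add A x y \<in> ?C"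
    "\<And>x y. x \<in> ?C \<Longrightarrow> y \<in> ?C \<Longrightarrow> s_mul A x y \<in> ?C" "\<And>x. x \<in> ?C \<Longrightarrow> s_neg A x \<in> ?C"
    using e unfolding emb_def wf_str_def by auto
  show ?thesis unfolding rcf_set_def
  proof (intro conjI ballI allI impI)
    show "0 \<in> h ` ?C" by (rule image_eqI[of _ _ "s_zero A"]) (simp_all add: ops cl)
    show "1 \<in> h ` ?C" by (rule image_eqI[of _ _ "s_one A"]) (simp_all add: ops cl)
  next
    fix x y assume "x \<in> h ` ?C" "y \<in> h ` ?C"
    then obtain a b where ab: "a \<in> ?C" "b \<in> ?C" "x = h a" "y = h b" by blast
    show "x + y \<in> h ` ?C" by (rule image_eqI[of _ _ "s_add A a b"]) (simp_all add: ab ops cl)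
    show "x * y \<in> h ` ?C" by (rule image_eqI[of _ _ "s_mul A a b"]) (simp_all add: ab ops cl)
  next
    fix x assume "x \<in> h ` ?C"
    then obtain a where a: "a \<in> ?C" "x = h a" by blast
    then have "- x = h (s_neg A a)" using ops(5) by simp
    then show "- x \<in> h ` ?C" using cl(5) a by blast
  next
    fix x assume x: "x \<in> h ` ?C" "x \<noteq> 0"
    then obtain a where a: "a \<in> ?C" "x = h a" by blast
    then have "a \<noteq> s_zero A" using x ops(1) by auto
    then obtain b where b: "b \<in> ?C" "s_mul A a b = s_one A"
      using inv a(1) by blast
    then have "x * h b = 1" using ops(2) ops(4)[OF a(1) b(1)] a by simp
    then have "inverse x = h b" by (rule inverse_unique)
    then show "inverse x \<in> h ` ?C" using b(1) by blast
  next
    fix x assume x: "x \<in> h ` ?C" "x > 0"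
    then obtain a where a: "a \<in> ?C" "x = h a" by blast
    then have "s_less A (s_zero A) a" using ops(1,6) cl x by simp
    then obtain b where b: "b \<in> ?C" "s_mul A b b = a" using sq a(1) by blast
    then have "x = (h b)\<^sup>2" using ops(4)[of b b] a by (simp add: power2_eq_square)
    then have "sqrt x = \<bar>h b\<bar>" by simp
    then have "sqrt x = h b \<or> sqrt x = h (s_neg A b)" using ops(5) b by auto
    then show "sqrt x \<in> h ` ?C" using b cl by auto
  next
    fix p assume p: "(\<forall>i. coeff p i \<in> h ` ?C) \<and> odd (degree p)"
    define cs where "cs = map (inv_into ?C h) (coeffs p)"
    have "set (coeffs p) \<subseteq> h ` ?C" using p by (auto simp: coeffs_def)
    then have im: "c \<in> h ` ?C" if "c \<in> set (coeffs p)" for c using that by blast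
    have cs: "map h cs = coeffs p" "set cs \<subseteq> ?C"
      unfolding cs_def using f_inv_into_f[OF im] inv_into_into[OF im] by (auto intro!: map_idI)
    have "p \<noteq> 0" using p by auto
    then have len: "length cs = Suc (degree p)" using length_coeffs_degree[of p] arg_cong[OF cs(1), of length] by simp
    then have ne: "cs \<noteq> []" by auto
    have "h (last cs) = lead_coeff p"
      using \<open>p \<noteq> 0\<close> last_map[OF ne, of h] cs(1) last_coeffs_eq_coeff_degree[of p] by simp
    then have "last cs \<noteq> s_zero A" using ops(1) \<open>p \<noteq> 0\<close> by auto
    then obtain x where x: "x \<in> ?C" "hev A cs x = s_zero A"
      using od[rule_format, of cs] cs(2) ne len p by auto
    then have "poly p (h x) = 0" using emb_hev[OF e cs(2) x(1)] cs(1) ops(1) by simp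
    then show "\<exists>x\<in>h ` ?C. poly p x = 0" using x by blast
  qed
qed

lemma arch_rcf_embI:
  assumes e: "emb A h" and r: "rcf_set (h ` s_carrier A)" shows "arch_rcf A"
proof -
  let ?C = "s_carrier A"
  have wf: "wf_str A" and ops: "h (s_zero A) = 0" "h (s_one A) = 1" "\<And>x y. x \<in> ?C \<Longrightarrow> y \<in> ?C \<Longrightarrow> h (s_add A x y) = h x + h y"
    "\<And>x y. x \<in> ?C \<Longrightarrow> y \<in> ?C \<Longrightarrow> h (s_mul A x y) = h x * h y" "\<And>x. x \<in> ?C \<Longrightarrow> h (s_neg A x) = - h x"
    and less: "\<And>x y. x \<in> ?C \<Longrightarrow> y \<in> ?C \<Longrightarrow> s_less A x y \<longleftrightarrow> h x < h y"
    and inj: "inj_on h ?C"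
    using e unfolding emb_def by auto
  have cl: "s_zero A \<in> ?C" "s_one A \<in> ?C" "\<And>x y. x \<in> ?C \<Longrightarrow> y \<in> ?C \<Longrightarrow> s_add A x y \<in> ?C"
    "\<And>x y. x \<in> ?C \<Longrightarrow> y \<in> ?C \<Longrightarrow> s_mul A x y \<in> ?C" "\<And>x. x \<in> ?C \<Longrightarrow> s_neg A x \<in> ?C"
    using wf unfolding wf_str_def by auto
  have eq: "x = y \<longleftrightarrow> h x = h y" if "x \<in> ?C" "y \<in> ?C" for x y
    using inj that by (auto dest: inj_onD)
  have eqI: "h x = h y \<Longrightarrow> x \<in> ?C \<Longrightarrow> y \<in> ?C \<Longrightarrow> x = y" for x y using eq by blast
  have "ordered_field_str A"
    unfolding ordered_field_str_def Let_def
  proof (intro conjI ballI impI wf)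
    show "s_zero A \<noteq> s_one A" using ops(1,2) by auto
  next
    fix x assume x: "x \<in> ?C" "x \<noteq> s_zero A"
    then have "h x \<noteq> 0" using eq cl(1) ops(1) by metis
    then have "inverse (h x) \<in> h ` ?C" using r x unfolding rcf_set_def by blast
    then obtain y where y: "y \<in> ?C" "h y = inverse (h x)" by (metis imageE)
    then have "s_mul A x y = s_one A" using x \<open>h x \<noteq> 0\<close> by (intro eqI) (auto simp: ops cl)
    then show "\<exists>y\<in>?C. s_mul A x y = s_one A" using y by blast
  next
    fix x y assume "x \<in> ?C" "y \<in> ?C"
    then show "s_less A x y \<or> x = y \<or> s_less A y x" using less eq[of x y] by auto
  qed (auto simp: less ops cl algebra_simps intro!: eqI)
  moreover have "\<exists>y\<in>?C. s_mul A y y = x" if x: "x \<in> ?C" "s_less A (s_zero A) x" for x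
  proof -
    have "h x > 0" using x less ops cl by auto
    then have "sqrt (h x) \<in> h ` ?C" using r x unfolding rcf_set_def by blast
    then obtain y where y: "y \<in> ?C" "h y = sqrt (h x)" by (metis imageE)
    then have "s_mul A y y = x" using x \<open>h x > 0\<close> by (intro eqI) (auto simp: ops cl)
    then show ?thesis using y by blast
  qed
  moreover have "\<exists>x\<in>?C. hev A cs x = s_zero A"
    if cs: "set cs \<subseteq> ?C" "cs \<noteq> []" "last cs \<noteq> s_zero A" "odd (length cs - 1)" for cs
  proof -
    define p where "p = Poly (map h cs)"
    have "last cs \<in> ?C" using cs(1,2) last_in_set by blast
    then have "h (last cs) \<noteq> 0" using cs(3) eq[of "last cs" "s_zero A"] cl(1) ops(1) by simp
    \<comment> \<open>A nonzero last entry leaves no trailing zeros to strip, so the length of the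
      list gives the degree.\<close>
    then have "coeffs p = map h cs" unfolding p_def using cs(2)
      by (simp add: strip_while_idem no_trailing_unfold last_map)
    then have "degree p = length cs - 1" by (simp add: degree_eq_length_coeffs)
    moreover have "coeff p i \<in> h ` ?C" for i
    proof -
      have "0 \<in> h ` ?C" using ops(1) cl(1) by (metis imageI)
      then show ?thesis using cs(1) nth_mem[of i cs] by (simp add: p_def coeff_Poly_eq nth_default_def subset_iff)
    qed
    ultimately obtain y where "y \<in> h ` ?C" "poly p y = 0" using r cs(4) unfolding rcf_set_def by metis
    then obtain x where x: "x \<in> ?C" "poly p (h x) = 0" by blast
    then have "hev A cs x = s_zero A"
      using emb_hev[OF e cs(1) x(1)] cl(1) ops(1) by (intro eqI) (auto simp: p_def)
    then show ?thesis using x by blast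
  qed
  moreover have "archimedean_str A" unfolding archimedean_str_def
  proof
    fix x assume x: "x \<in> ?C"
    obtain n where "h x < real n" using reals_Archimedean2 by blast
    then have "s_less A x (nat_el A n)" using emb_nat_el[OF e, of n] less x by simp
    then show "\<exists>n. s_less A x (nat_el A n)" by blast
  qed
  ultimately show ?thesis unfolding arch_rcf_def real_closed_str_def by blast
qed

lemma arch_rcf_emb: "arch_rcf A \<Longrightarrow> \<exists>h. emb A h"
proof -
  assume "arch_rcf A"
  then interpret arch_of A unfolding arch_rcf_def real_closed_str_def by unfold_locales auto
  show ?thesis using emb_h by blast
qed

lemma iso_emb:
  assumes eA: "emb A g" and wB: "wf_str B" and iso: "bij_betw f (s_carrier B) (s_carrier A)
     \<and> f (s_zero B) = s_zero A \<and> f (s_one B) = s_one A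
     \<and> (\<forall>x\<in>s_carrier B. \<forall>y\<in>s_carrier B.
          f (s_add B x y) = s_add A (f x) (f y) \<and> f (s_mul B x y) = s_mul A (f x) (f y)
          \<and> (s_less B x y \<longleftrightarrow> s_less A (f x) (f y)))
     \<and> (\<forall>x\<in>s_carrier B. f (s_neg B x) = s_neg A (f x))"
  shows "emb B (\<lambda>x. g (f x))" "(\<lambda>x. g (f x)) ` s_carrier B = g ` s_carrier A"
proof -
  have f: "bij_betw f (s_carrier B) (s_carrier A)"
    "f (s_zero B) = s_zero A" "f (s_one B) = s_one A"
    "\<forall>x\<in>s_carrier B. \<forall>y\<in>s_carrier B.
          f (s_add B x y) = s_add A (f x) (f y) \<and> f (s_mul B x y) = s_mul A (f x) (f y)
          \<and> (s_less B x y \<longleftrightarrow> s_less A (f x) (f y))"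
    "\<forall>x\<in>s_carrier B. f (s_neg B x) = s_neg A (f x)"
    using iso by - (elim conjE, assumption)+
  have fC: "f x \<in> s_carrier A" if "x \<in> s_carrier B" for x using f(1) that by (auto simp: bij_betw_def)
  have "inj_on (\<lambda>x. g (f x)) (s_carrier B)"
    using comp_inj_on[of f "s_carrier B" g] f(1) eA unfolding emb_def bij_betw_def comp_def by simp
  then show "emb B (\<lambda>x. g (f x))"
    using eA wB f fC unfolding emb_def by simp
  show "(\<lambda>x. g (f x)) ` s_carrier B = g ` s_carrier A"
    using f(1) unfolding bij_betw_def by (metis image_image)
qed

text \<open>The isomorphism is \<open>h\<close> followed by the inverse of \<open>g\<close>; each of
  its properties is checked after applying the injective \<open>g\<close>.\<close>

lemma isoI_emb:
  assumes eA: "emb A g" and eB: "emb B h" and im: "h ` s_carrier B = g ` s_carrier A" shows "iso B A"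
proof -
  define f where "f x = inv_into (s_carrier A) g (h x)" for x
  have gf: "g (f x) = h x" "f x \<in> s_carrier A" if "x \<in> s_carrier B" for x
    using that im unfolding f_def by (auto intro!: f_inv_into_f inv_into_into)
  have inj: "inj_on g (s_carrier A)" "inj_on h (s_carrier B)" using eA eB unfolding emb_def by auto
  have eqI: "g x = g y \<Longrightarrow> x \<in> s_carrier A \<Longrightarrow> y \<in> s_carrier A \<Longrightarrow> x = y" for x y
    using inj(1) by (auto dest: inj_onD)
  have clA: "s_zero A \<in> s_carrier A" "s_one A \<in> s_carrier A" "\<And>x y. x \<in> s_carrier A \<Longrightarrow> y \<in> s_carrier A \<Longrightarrow> s_add A x y \<in> s_carrier A \<and> s_mul A x y \<in> s_carrier A" "\<And>x. x \<in> s_carrier A \<Longrightarrow> s_neg A x \<in> s_carrier A"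
    and clB: "s_zero B \<in> s_carrier B" "s_one B \<in> s_carrier B" "\<And>x y. x \<in> s_carrier B \<Longrightarrow> y \<in> s_carrier B \<Longrightarrow> s_add B x y \<in> s_carrier B \<and> s_mul B x y \<in> s_carrier B" "\<And>x. x \<in> s_carrier B \<Longrightarrow> s_neg B x \<in> s_carrier B"
    using eA eB unfolding emb_def wf_str_def by auto
  have oA: "g (s_zero A) = 0" "g (s_one A) = 1"
    "\<And>x y. x \<in> s_carrier A \<Longrightarrow> y \<in> s_carrier A \<Longrightarrow> g (s_add A x y) = g x + g y"
    "\<And>x y. x \<in> s_carrier A \<Longrightarrow> y \<in> s_carrier A \<Longrightarrow> g (s_mul A x y) = g x * g y"
    "\<And>x y. x \<in> s_carrier A \<Longrightarrow> y \<in> s_carrier A \<Longrightarrow> s_less A x y \<longleftrightarrow> g x < g y"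
    "\<And>x. x \<in> s_carrier A \<Longrightarrow> g (s_neg A x) = - g x"
    using eA unfolding emb_def by auto
  have oB: "h (s_zero B) = 0" "h (s_one B) = 1"
    "\<And>x y. x \<in> s_carrier B \<Longrightarrow> y \<in> s_carrier B \<Longrightarrow> h (s_add B x y) = h x + h y"
    "\<And>x y. x \<in> s_carrier B \<Longrightarrow> y \<in> s_carrier B \<Longrightarrow> h (s_mul B x y) = h x * h y"
    "\<And>x y. x \<in> s_carrier B \<Longrightarrow> y \<in> s_carrier B \<Longrightarrow> s_less B x y \<longleftrightarrow> h x < h y"
    "\<And>x. x \<in> s_carrier B \<Longrightarrow> h (s_neg B x) = - h x"
    using eB unfolding emb_def by auto
  have b1: "bij_betw f (s_carrier B) (s_carrier A)"
  proof (rule bij_betwI')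
    fix x y assume c: "x \<in> s_carrier B" "y \<in> s_carrier B"
    show "(f x = f y) = (x = y)"
    proof
      assume "f x = f y"
      then have "h x = h y" using gf(1)[OF c(1)] gf(1)[OF c(2)] by simp
      then show "x = y" using c by (rule inj_onD[OF inj(2)])
    qed simp
  next
    fix x assume x: "x \<in> s_carrier A"
    then have "g x \<in> h ` s_carrier B" using im by simp
    then obtain y where y: "y \<in> s_carrier B" "g x = h y" by blast
    have "x = f y" by (rule eqI) (simp_all add: gf y x)
    then show "\<exists>y\<in>s_carrier B. x = f y" using y(1) by blast
  qed (use gf in auto)
  have z1: "f (s_zero B) = s_zero A" by (rule eqI) (simp_all add: gf clA clB oA oB)
  have o1: "f (s_one B) = s_one A" by (rule eqI) (simp_all add: gf clA clB oA oB)
  have op: "f (s_add B x y) = s_add A (f x) (f y) \<and> f (s_mul B x y) = s_mul A (f x) (f y)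
          \<and> (s_less B x y \<longleftrightarrow> s_less A (f x) (f y))" if "x \<in> s_carrier B" "y \<in> s_carrier B" for x y
    by (intro conjI eqI) (simp_all add: that gf clA clB oA oB)
  have n1: "f (s_neg B x) = s_neg A (f x)" if "x \<in> s_carrier B" for x
    by (rule eqI) (simp_all add: that gf clA clB oA oB)
  have op': "\<forall>x\<in>s_carrier B. \<forall>y\<in>s_carrier B.
          f (s_add B x y) = s_add A (f x) (f y) \<and> f (s_mul B x y) = s_mul A (f x) (f y)
          \<and> (s_less B x y \<longleftrightarrow> s_less A (f x) (f y))"
    by (intro ballI) (rule op)
  have n1': "\<forall>x\<in>s_carrier B. f (s_neg B x) = s_neg A (f x)" by (intro ballI) (rule n1)
  show ?thesis unfolding iso_def
    by (rule exI[of _ f], rule conjI[OF b1], rule conjI[OF z1], rule conjI[OF o1], rule conjI[OF op' n1'])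
qed

text \<open>An isomorphism followed by \<open>g\<close> is an embedding with the same image, and
  equal images give an isomorphism. The index set becomes a condition on sets of reals.\<close>

lemma I_str_eq:
  assumes a: "arch_rcf A" and eA: "emb A g"
  shows "I_str A = {a. \<exists>B h. arch_rcf B \<and> emb B h \<and> is_index a B \<and> h ` s_carrier B = g ` s_carrier A}"
proof (intro equalityI subsetI)
  fix a assume "a \<in> I_str A"
  then have "\<exists>B. wf_str B \<and> iso B A \<and> is_index a B" unfolding I_str_def by simp
  then obtain B where BB: "wf_str B \<and> iso B A \<and> is_index a B" by (rule exE)
  have B: "wf_str B" "is_index a B" and "iso B A" using BB by simp_all
  from this(3)[unfolded iso_def] obtain f where f: "bij_betw f (s_carrier B) (s_carrier A)
     \<and> f (s_zero B) = s_zero A \<and> f (s_one B) = s_one A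
     \<and> (\<forall>x\<in>s_carrier B. \<forall>y\<in>s_carrier B.
          f (s_add B x y) = s_add A (f x) (f y) \<and> f (s_mul B x y) = s_mul A (f x) (f y)
          \<and> (s_less B x y \<longleftrightarrow> s_less A (f x) (f y)))
     \<and> (\<forall>x\<in>s_carrier B. f (s_neg B x) = s_neg A (f x))"
    by (rule exE)
  note e = iso_emb[OF eA B(1) f]
  have "arch_rcf B" by (intro arch_rcf_embI[OF e(1)]) (simp only: e(2) rcf_set_emb[OF eA assms(1)])
  then show "a \<in> {a. \<exists>B h. arch_rcf B \<and> emb B h \<and> is_index a B \<and> h ` s_carrier B = g ` s_carrier A}"
    using e B(2) by (intro CollectI exI[of _ B] exI[of _ "\<lambda>x. g (f x)"] conjI)
next
  fix a assume "a \<in> {a. \<exists>B h. arch_rcf B \<and> emb B h \<and> is_index a B \<and> h ` s_carrier B = g ` s_carrier A}"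
  then have "\<exists>B h. arch_rcf B \<and> emb B h \<and> is_index a B \<and> h ` s_carrier B = g ` s_carrier A" by simp
  then obtain B where "\<exists>h. arch_rcf B \<and> emb B h \<and> is_index a B \<and> h ` s_carrier B = g ` s_carrier A"
    by (rule exE)
  then obtain h where BB: "arch_rcf B \<and> emb B h \<and> is_index a B \<and> h ` s_carrier B = g ` s_carrier A"
    by (rule exE)
  have B: "emb B h" "is_index a B" "h ` s_carrier B = g ` s_carrier A" using BB by simp_all
  have "wf_str B" using B(1) unfolding emb_def by (rule conjunct1)
  then show "a \<in> I_str A" unfolding I_str_def using isoI_emb[OF eA B(1,3)] B(2)
    by (intro CollectI exI[of _ B] conjI)
qed

section \<open>Algebraic dependence of real numbers\<close>

text \<open>Polymorphic because Laplace's argument below needs subfields of the complex numbers as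
  well.\<close>

definition sfield :: "'a :: field set \<Rightarrow> bool" where
  "sfield K \<longleftrightarrow> 0 \<in> K \<and> 1 \<in> K \<and> (\<forall>x\<in>K. \<forall>y\<in>K. x + y \<in> K \<and> x * y \<in> K) \<and> (\<forall>x\<in>K. - x \<in> K)
    \<and> (\<forall>x\<in>K. x \<noteq> 0 \<longrightarrow> inverse x \<in> K)"

lemma sfieldD:
  assumes "sfield K"
  shows "0 \<in> K" "1 \<in> K" "x \<in> K \<Longrightarrow> y \<in> K \<Longrightarrow> x + y \<in> K" "x \<in> K \<Longrightarrow> y \<in> K \<Longrightarrow> x * y \<in> K"
    "x \<in> K \<Longrightarrow> - x \<in> K" "x \<in> K \<Longrightarrow> x \<noteq> 0 \<Longrightarrow> inverse x \<in> K"
    "x \<in> K \<Longrightarrow> y \<in> K \<Longrightarrow> x - y \<in> K" "x \<in> K \<Longrightarrow> y \<in> K \<Longrightarrow> x / y \<in> K"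
proof -
  note K = assms[unfolded sfield_def]
  show 1: "0 \<in> K" "1 \<in> K" "\<And>x y. x \<in> K \<Longrightarrow> y \<in> K \<Longrightarrow> x + y \<in> K"
    "\<And>x y. x \<in> K \<Longrightarrow> y \<in> K \<Longrightarrow> x * y \<in> K" "\<And>x. x \<in> K \<Longrightarrow> - x \<in> K"
    "\<And>x. x \<in> K \<Longrightarrow> x \<noteq> 0 \<Longrightarrow> inverse x \<in> K"
    using K by blast+
  show "x \<in> K \<Longrightarrow> y \<in> K \<Longrightarrow> x - y \<in> K" using 1(3)[of x "- y"] 1(5) by simp
  show "x \<in> K \<Longrightarrow> y \<in> K \<Longrightarrow> x / y \<in> K" using 1(1) 1(4)[of x "inverse y"] 1(6)
    by (cases "y = 0") (simp_all add: divide_inverse)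
qed

lemma sum_closed: "0 \<in> K \<Longrightarrow> (\<And>x y. x \<in> K \<Longrightarrow> y \<in> K \<Longrightarrow> x + y \<in> K) \<Longrightarrow> (\<And>i. i \<in> I \<Longrightarrow> f i \<in> K) \<Longrightarrow> sum f I \<in> K"
  by (induction I rule: infinite_finite_induct) auto

lemma power_closed: "1 \<in> K \<Longrightarrow> (\<And>x y. x \<in> K \<Longrightarrow> y \<in> K \<Longrightarrow> x * y \<in> K) \<Longrightarrow> x \<in> K \<Longrightarrow> x ^ n \<in> K"
  by (induction n) auto

lemma poly_closed:
  fixes K :: "'a :: comm_ring_1 set"
  assumes "0 \<in> K" "1 \<in> K" "\<And>x y. x \<in> K \<Longrightarrow> y \<in> K \<Longrightarrow> x + y \<in> K" "\<And>x y. x \<in> K \<Longrightarrow> y \<in> K \<Longrightarrow> x * y \<in> K"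
    and "\<And>i. coeff p i \<in> K" "x \<in> K"
  shows "poly p x \<in> K"
  unfolding poly_altdef by (rule sum_closed) (auto intro!: assms power_closed)

lemma poly_upto: "degree p \<le> n \<Longrightarrow> poly p (x :: 'a :: comm_ring_1) = (\<Sum>i\<le>n. coeff p i * x ^ i)"
  unfolding poly_altdef by (rule sum.mono_neutral_left) (auto simp: coeff_eq_0)

definition algb :: "real set \<Rightarrow> real \<Rightarrow> bool" where
  "algb K y \<longleftrightarrow> (\<exists>p. p \<noteq> 0 \<and> (\<forall>i. coeff p i \<in> K) \<and> poly p y = 0)"

lemma algb_mono: "algb K y \<Longrightarrow> K \<subseteq> L \<Longrightarrow> algb L y"
  unfolding algb_def by blast

text \<open>Gaussian elimination: more vectors than coordinates are dependent, by induction on the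
  set of coordinates.\<close>

lemma lin_dependent:
  assumes K: "sfield K" and I: "finite I" and "finite J" "card I < card J"
    and "\<And>i j. v j i \<in> K"
  shows "\<exists>c. (\<forall>j. c j \<in> K) \<and> (\<exists>j\<in>J. c j \<noteq> 0) \<and> (\<forall>i\<in>I. (\<Sum>j\<in>J. c j * v j i) = 0)"
  using I assms(3-)
proof (induction I arbitrary: J v rule: finite_induct)
  case empty
  then have "J \<noteq> {}" by auto
  then show ?case using sfieldD(2)[OF K] by (intro exI[of _ "\<lambda>_. 1"]) auto
next
  case (insert a I)
  show ?case
  proof (cases "\<forall>j\<in>J. v j a = 0")
    case True
    have "card I < card J" using insert by simp
    then obtain c where c: "\<forall>j. c j \<in> K" "\<exists>j\<in>J. c j \<noteq> 0" "\<forall>i\<in>I. (\<Sum>j\<in>J. c j * v j i) = 0"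
      using insert.IH[of J v, OF insert.prems(1) _ insert.prems(3)] by blast
    have "(\<Sum>j\<in>J. c j * v j a) = 0" using True by simp
    then show ?thesis using c by (intro exI[of _ c]) auto
  next
    case False
    then obtain m where m: "m \<in> J" "v m a \<noteq> 0" by blast
    define J' where "J' = J - {m}"
    \<comment> \<open>Subtracting a multiple of the pivot vector \<open>v m\<close> makes coordinate
      \<open>a\<close> vanish in all remaining vectors.\<close>
    define w where "w j i = v j i - v j a / v m a * v m i" for j i
    have "card I < card J'" "finite J'" unfolding J'_def using insert m by auto
    moreover have "w j i \<in> K" for j i unfolding w_def
      using insert.prems(3) by (intro sfieldD(4,7,8)[OF K])
    ultimately obtain c where c: "\<forall>j. c j \<in> K" "\<exists>j\<in>J'. c j \<noteq> 0" "\<forall>i\<in>I. (\<Sum>j\<in>J'. c j * w j i) = 0"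
      using insert.IH[of J' w] by blast
    \<comment> \<open>The coefficient of the pivot is determined by the requirement in coordinate
      \<open>a\<close>.\<close>
    define c' where "c' = c(m := - (\<Sum>j\<in>J'. c j * v j a) / v m a)"
    have sp: "(\<Sum>j\<in>J. c' j * v j i) = (\<Sum>j\<in>J'. c j * w j i)" for i
    proof -
      have "(\<Sum>j\<in>J. c' j * v j i) = c' m * v m i + (\<Sum>j\<in>J'. c' j * v j i)"
        unfolding J'_def by (rule sum.remove[OF insert.prems(1) m(1)])
      also have "(\<Sum>j\<in>J'. c' j * v j i) = (\<Sum>j\<in>J'. c j * v j i)"
        by (rule sum.cong) (auto simp: c'_def J'_def)
      also have "c' m * v m i = - (\<Sum>j\<in>J'. c j * (v j a / v m a * v m i))"
        unfolding c'_def by (simp add: sum_distrib_right sum_divide_distrib mult.assoc)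
      finally show ?thesis unfolding w_def by (simp add: right_diff_distrib sum_subtractf)
    qed
    have "\<forall>i\<in>insert a I. (\<Sum>j\<in>J. c' j * v j i) = 0"
      unfolding sp using c(3) m by (auto simp: w_def)
    moreover have "\<forall>j. c' j \<in> K" unfolding c'_def using c(1) insert.prems(3)
      by (auto intro!: sfieldD[OF K] sum_closed)
    moreover have "\<exists>j\<in>J. c' j \<noteq> 0" using c(2) unfolding c'_def J'_def by auto
    ultimately show ?thesis by blast
  qed
qed

text \<open>Finite dimension without a basis: \<open>E\<close> lies in the span of finitely many
  reals, which may themselves be outside \<open>E\<close>.\<close>

definition fin_over :: "real set \<Rightarrow> real set \<Rightarrow> bool" where
  "fin_over K E \<longleftrightarrow> (\<exists>(I :: nat set) w. finite I \<and> (\<forall>x\<in>E. \<exists>k. (\<forall>i. k i \<in> K) \<and> x = (\<Sum>i\<in>I. k i * w i)))"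

text \<open>One more power of \<open>y\<close> than there are spanning elements: the powers are
  linearly dependent, and a dependence is a polynomial with root \<open>y\<close>.\<close>

lemma fin_over_algb:
  assumes K: "sfield K" and E: "fin_over K E" and y: "\<And>n :: nat. y ^ n \<in> E"
  shows "algb K y"
proof -
  obtain I :: "nat set" and w where I: "finite I" "\<forall>x\<in>E. \<exists>k. (\<forall>i. k i \<in> K) \<and> x = (\<Sum>i\<in>I. k i * w i)"
    using E unfolding fin_over_def by blast
  have "\<forall>n. \<exists>k. (\<forall>i. k i \<in> K) \<and> y ^ n = (\<Sum>i\<in>I. k i * w i)" using I(2) y by blast
  then obtain v where v: "\<And>n i. v n i \<in> K" "\<And>n. y ^ n = (\<Sum>i\<in>I. v n i * w i)" by metis
  obtain c where c: "\<forall>j. c j \<in> K" "\<exists>j\<in>{..card I}. c j \<noteq> 0" "\<forall>i\<in>I. (\<Sum>j\<in>{..card I}. c j * v j i) = 0"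
    using lin_dependent[OF K I(1), of "{..card I}" v] v(1) by auto
  define p where "p = (\<Sum>j\<le>card I. monom (c j) j)"
  have cp: "coeff p j = (if j \<le> card I then c j else 0)" for j
    unfolding p_def by (simp add: coeff_sum)
  have "poly p y = (\<Sum>j\<le>card I. c j * (\<Sum>i\<in>I. v j i * w i))"
    unfolding p_def by (simp add: poly_sum poly_monom v(2))
  also have "\<dots> = (\<Sum>j\<le>card I. \<Sum>i\<in>I. c j * (v j i * w i))" by (simp add: sum_distrib_left)
  also have "\<dots> = (\<Sum>i\<in>I. \<Sum>j\<le>card I. c j * (v j i * w i))" by (rule sum.swap)
  also have "\<dots> = (\<Sum>i\<in>I. (\<Sum>j\<le>card I. c j * v j i) * w i)" by (simp add: sum_distrib_right mult.assoc)
  also have "\<dots> = 0" using c(3) by simp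
  finally have "poly p y = 0" .
  moreover have "p \<noteq> 0" using c(2) cp by (metis atMost_iff coeff_0)
  moreover have "\<forall>j. coeff p j \<in> K" using c(1) cp sfieldD(1)[OF K] by simp
  ultimately show ?thesis unfolding algb_def by blast
qed

text \<open>Dividing a polynomial of \<open>y \<noteq> 0\<close> by powers of the variable makes the
  constant term \<open>a\<close> nonzero. Then \<open>a + y r(y) = 0\<close> exhibits the inverse of
  \<open>y\<close> inside the ring.\<close>

lemma subring_algb_sfield:
  assumes K: "sfield K" and KE: "K \<subseteq> E" and add: "\<And>x y. x \<in> E \<Longrightarrow> y \<in> E \<Longrightarrow> x + y \<in> E"
    and mul: "\<And>x y. x \<in> E \<Longrightarrow> y \<in> E \<Longrightarrow> x * y \<in> E" and alg: "\<And>x. x \<in> E \<Longrightarrow> algb K x"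
  shows "sfield E"
proof -
  have 01: "0 \<in> E" "1 \<in> E" "- 1 \<in> E" using sfieldD[OF K] KE by auto
  have neg: "- x \<in> E" if "x \<in> E" for x using mul[OF 01(3) that] by simp
  have "inverse y \<in> E" if y: "y \<in> E" "y \<noteq> 0" for y
  proof -
    have red: "\<exists>q. (\<forall>i. coeff q i \<in> K) \<and> coeff q 0 \<noteq> 0 \<and> poly q y = 0"
      if "p \<noteq> 0" "\<forall>i. coeff p i \<in> K" "poly p y = 0" for p
      using that
    proof (induction p)
      case (pCons a p)
      show ?case
      proof (cases "a = 0")
        case True
        then have "p \<noteq> 0" "poly p y = 0" using pCons.prems y by auto
        moreover have "\<forall>i. coeff p i \<in> K"
        proof
          fix i show "coeff p i \<in> K" using pCons.prems(2)[rule_format, of "Suc i"] by simp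
        qed
        ultimately show ?thesis by (intro pCons.IH)
      next
        case False
        then show ?thesis using pCons.prems by (intro exI[of _ "pCons a p"]) simp
      qed
    qed simp
    obtain p where "p \<noteq> 0" "\<forall>i. coeff p i \<in> K" "poly p y = 0" using alg[OF y(1)] unfolding algb_def by blast
    from red[OF this] obtain q where q: "\<forall>i. coeff q i \<in> K" "coeff q 0 \<noteq> 0" "poly q y = 0" by blast
    obtain a r where ar: "q = pCons a r" by (cases q)
    have a: "a \<noteq> 0" "a \<in> K" using q(2) q(1)[rule_format, of 0] ar by simp_all
    have "coeff r i \<in> E" for i using q(1)[rule_format, of "Suc i"] KE ar by auto
    then have r: "poly r y \<in> E" using 01 add mul y by (intro poly_closed) auto
    have "a + y * poly r y = 0" using q(3) ar by simp
    then have "y * (- poly r y * inverse a) = 1" using a by (simp add: field_simps)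
    then have "inverse y = - poly r y * inverse a" by (rule inverse_unique)
    then show ?thesis using mul neg r sfieldD(6)[OF K a(2) a(1)] KE by auto
  qed
  then show ?thesis unfolding sfield_def using 01 add mul neg by simp
qed

text \<open>\<open>E(y)\<close> is the span over \<open>E\<close> of the powers of \<open>y\<close>
  below the degree of a polynomial of \<open>y\<close>: a ring because the next power can be
  reduced, and a field by \<open>subring_algb_sfield\<close>.\<close>

lemma adjoin:
  assumes K: "sfield K" and E: "sfield E" and KE: "K \<subseteq> E" and fin: "fin_over K E" and y: "algb E y"
  shows "\<exists>E'. sfield E' \<and> E \<subseteq> E' \<and> y \<in> E' \<and> fin_over K E'"
proof -
  note Ec = sfieldD[OF E]
  obtain p where p: "p \<noteq> 0" "\<forall>i. coeff p i \<in> E" "poly p y = 0" using y unfolding algb_def by blast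
  define d where "d = degree p"
  define S where "S = {(\<Sum>i<d. k i * y ^ i) | k. \<forall>i :: nat. k i \<in> E}"
  have S_add: "a + b \<in> S" if ab: "a \<in> S" "b \<in> S" for a b
  proof -
    obtain k l where "a = (\<Sum>i<d. k i * y ^ i)" "b = (\<Sum>i<d. l i * y ^ i)" "\<forall>i. k i \<in> E" "\<forall>i. l i \<in> E"
      using ab unfolding S_def by blast
    then show ?thesis unfolding S_def using Ec(3)
      by (intro CollectI exI[of _ "\<lambda>i. k i + l i"]) (simp add: sum.distrib distrib_right)
  qed
  have S_smul: "c * b \<in> S" if cb: "c \<in> E" "b \<in> S" for c b
  proof -
    obtain l where "b = (\<Sum>i<d. l i * y ^ i)" "\<forall>i. l i \<in> E" using cb unfolding S_def by blast
    then show ?thesis unfolding S_def using Ec(4) cb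
      by (intro CollectI exI[of _ "\<lambda>i. c * l i"]) (simp add: sum_distrib_left mult.assoc)
  qed
  have S_0: "0 \<in> S" unfolding S_def using Ec(1) by (intro CollectI exI[of _ "\<lambda>_. 0"]) simp
  have S_sum: "(\<Sum>i\<in>I. f i) \<in> S" if "\<And>i. i \<in> I \<Longrightarrow> f i \<in> S" for f and I :: "nat set"
    using S_0 S_add that by (rule sum_closed)
  have S_low: "y ^ i \<in> S" if "i < d" for i
    unfolding S_def using Ec(1,2) that
    by (intro CollectI exI[of _ "\<lambda>j. if j = i then 1 else 0"]) (simp add: if_distrib[of "\<lambda>x. x * _"] cong: if_cong)
  have S_top: "y ^ d \<in> S"
  proof -
    have "coeff p d \<noteq> 0" using p(1) by (simp add: d_def)
    have "poly p y = (\<Sum>i<d. coeff p i * y ^ i) + coeff p d * y ^ d"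
      unfolding poly_altdef d_def[symmetric] by (simp add: lessThan_Suc_atMost[symmetric])
    then have yd: "y ^ d = - inverse (coeff p d) * (\<Sum>i<d. coeff p i * y ^ i)"
      using p(3) \<open>coeff p d \<noteq> 0\<close> by (simp add: field_simps add_eq_0_iff2)
    have "(\<Sum>i<d. coeff p i * y ^ i) \<in> S" by (intro S_sum S_smul S_low) (use p(2) in auto)
    moreover have "- inverse (coeff p d) \<in> E" using Ec(5,6) p(2) \<open>coeff p d \<noteq> 0\<close> by blast
    ultimately show ?thesis unfolding yd by (intro S_smul)
  qed
  have S_y: "y * b \<in> S" if b: "b \<in> S" for b
  proof -
    obtain l where l: "b = (\<Sum>i<d. l i * y ^ i)" "\<forall>i. l i \<in> E" using b unfolding S_def by blast
    have "y * b = (\<Sum>i<d. l i * y ^ Suc i)" unfolding l(1) by (simp add: sum_distrib_left mult.left_commute)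
    also have "\<dots> \<in> S"
    proof (intro S_sum S_smul)
      fix i assume "i \<in> {..<d}"
      then show "y ^ Suc i \<in> S" using S_low[of "Suc i"] S_top by (cases "Suc i = d") auto
    qed (use l(2) in blast)
    finally show ?thesis .
  qed
  have d0: "d > 0"
  proof (rule ccontr)
    assume "\<not> d > 0"
    then obtain a where "p = [:a:]" unfolding d_def using degree_eq_zeroE[of p] by auto
    then show False using p(1,3) by simp
  qed
  have S_E: "c \<in> S" if "c \<in> E" for c using S_smul[OF that S_low[OF d0]] by simp
  have S_pow: "y ^ n * b \<in> S" if "b \<in> S" for n b
    using that by (induction n) (auto simp: mult.assoc S_y)
  have S_mul: "a * b \<in> S" if ab: "a \<in> S" "b \<in> S" for a b
  proof -
    obtain l where l: "a = (\<Sum>i<d. l i * y ^ i)" "\<forall>i. l i \<in> E" using ab unfolding S_def by blast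
    have "a * b = (\<Sum>i<d. l i * (y ^ i * b))" unfolding l(1) by (simp add: sum_distrib_right mult.assoc)
    moreover have "l i * (y ^ i * b) \<in> S" for i using l(2) by (intro S_smul S_pow ab(2)) blast
    ultimately show ?thesis using S_sum by simp
  qed
  have S_y1: "y \<in> S" using S_y[OF S_low[OF d0]] by simp
  have fS: "fin_over E S" unfolding fin_over_def S_def
    by (intro exI[of _ "{..<d}"] exI[of _ "\<lambda>i. y ^ i"]) auto
  have pow: "x ^ n \<in> S" if "x \<in> S" for x n
    using S_E[OF Ec(2)] S_mul that by (rule power_closed)
  have "sfield S"
  proof (rule subring_algb_sfield[OF E _ S_add S_mul])
    fix x assume "x \<in> S"
    then show "algb E x" by (intro fin_over_algb[OF E fS] pow)
  qed (use S_E in auto)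
  moreover have "fin_over K S"
  proof -
    obtain I :: "nat set" and w where I: "finite I" "\<forall>x\<in>E. \<exists>k. (\<forall>i. k i \<in> K) \<and> x = (\<Sum>i\<in>I. k i * w i)"
      using fin unfolding fin_over_def by blast
    \<comment> \<open>The products of both spanning families span the tower; pairs are coded since
      \<open>fin_over\<close> uses numbers as indices.\<close>
    define I' where "I' = prod_encode ` (I \<times> {..<d})"
    define w' where "w' n = w (fst (prod_decode n)) * y ^ snd (prod_decode n)" for n
    have "\<exists>k. (\<forall>i. k i \<in> K) \<and> x = (\<Sum>i\<in>I'. k i * w' i)" if x: "x \<in> S" for x
    proof -
      obtain l where l: "x = (\<Sum>j<d. l j * y ^ j)" "\<forall>j. l j \<in> E" using x unfolding S_def by blast
      have "\<forall>j. \<exists>k. (\<forall>i. k i \<in> K) \<and> l j = (\<Sum>i\<in>I. k i * w i)" using I(2) l(2) by blast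
      then obtain k where k: "\<And>j i. k j i \<in> K" "\<And>j. l j = (\<Sum>i\<in>I. k j i * w i)" by metis
      define k' where "k' n = k (snd (prod_decode n)) (fst (prod_decode n))" for n
      have "(\<Sum>n\<in>I'. k' n * w' n) = (\<Sum>(i, j)\<in>I \<times> {..<d}. k j i * (w i * y ^ j))"
        unfolding I'_def by (subst sum.reindex) (auto simp: inj_prod_encode k'_def w'_def intro!: sum.cong)
      also have "\<dots> = (\<Sum>i\<in>I. \<Sum>j<d. k j i * (w i * y ^ j))" by (simp add: sum.cartesian_product)
      also have "\<dots> = (\<Sum>j<d. \<Sum>i\<in>I. k j i * (w i * y ^ j))" by (rule sum.swap)
      also have "\<dots> = x" unfolding l(1) k(2) by (simp add: sum_distrib_right mult.assoc)
      finally show ?thesis using k(1) by (intro exI[of _ k']) (simp add: k'_def)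
    qed
    then show ?thesis unfolding fin_over_def using I(1)
      by (intro exI[of _ I'] exI[of _ w']) (auto simp: I'_def)
  qed
  ultimately show ?thesis using S_E S_y1 by blast
qed

lemma fin_over_refl: "sfield K \<Longrightarrow> fin_over K K"
  unfolding fin_over_def
  by (intro exI[of _ "{0}"] exI[of _ "\<lambda>_. 1"]) (auto intro!: exI[of _ "\<lambda>_. _"])

lemma adjoin_finite:
  assumes K: "sfield K" and "finite U" "\<And>u. u \<in> U \<Longrightarrow> algb K u"
  shows "\<exists>E. sfield E \<and> K \<subseteq> E \<and> U \<subseteq> E \<and> fin_over K E"
  using assms(2,3)
proof (induction U rule: finite_induct)
  case empty
  then show ?case using K fin_over_refl by blast
next
  case (insert u U)
  then obtain E where E: "sfield E" "K \<subseteq> E" "U \<subseteq> E" "fin_over K E" by auto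
  have "algb E u" using insert.prems[of u] algb_mono[OF _ E(2)] by simp
  from adjoin[OF K E(1,2,4) this] show ?case using E(2,3) by blast
qed

lemma fin_over_mem_algb: "sfield K \<Longrightarrow> sfield E \<Longrightarrow> fin_over K E \<Longrightarrow> x \<in> E \<Longrightarrow> algb K x"
  by (rule fin_over_algb) (auto intro: power_closed sfieldD)

text \<open>Adjoining the finitely many coefficients and then \<open>y\<close> stays finite over
  \<open>K\<close>, and everything finite over \<open>K\<close> is algebraic.\<close>

lemma algb_trans:
  assumes K: "sfield K" and y: "algb {x. algb K x} y"
  shows "algb K y"
proof -
  obtain p where p: "p \<noteq> 0" "\<forall>i. algb K (coeff p i)" "poly p y = 0" using y unfolding algb_def[of "{x. algb K x}"] by blast
  obtain E where E: "sfield E" "K \<subseteq> E" "set (coeffs p) \<subseteq> E" "fin_over K E"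
  proof -
    have "algb K u" if "u \<in> set (coeffs p)" for u using that p(1,2) by (auto simp: coeffs_def)
    from adjoin_finite[OF K finite_set this] show ?thesis using that by blast
  qed
  have "coeff p i \<in> E" for i
    using E(3) sfieldD(1)[OF E(1)] coeff_in_coeffs[of p i] p(1) by (cases "i \<le> degree p") (auto simp: coeff_eq_0)
  then have "algb E y" unfolding algb_def using p by blast
  from adjoin[OF K E(1,2,4) this] show ?thesis using fin_over_mem_algb[OF K] by blast
qed

lemma algb_sfield: assumes K: "sfield K" shows "sfield {x. algb K x}"
proof -
  have ex: "\<exists>E. sfield E \<and> x \<in> E \<and> y \<in> E \<and> (\<forall>z\<in>E. algb K z)" if xy: "algb K x" "algb K y" for x y
  proof -
    have "algb K u" if "u \<in> {x, y}" for u using that xy by blast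
    then obtain E where E: "sfield E" "K \<subseteq> E" "{x, y} \<subseteq> E" "fin_over K E"
      using adjoin_finite[OF K, of "{x, y}"] by blast
    then show ?thesis using fin_over_mem_algb[OF K E(1,4)] by blast
  qed
  have K_alg: "algb K x" if "x \<in> K" for x
    using fin_over_mem_algb[OF K K fin_over_refl[OF K] that] .
  show ?thesis
  proof (rule subring_algb_sfield[OF K])
    fix x y assume "x \<in> {x. algb K x}" "y \<in> {x. algb K x}"
    then obtain E where "sfield E" "x \<in> E" "y \<in> E" "\<forall>z\<in>E. algb K z" using ex by blast
    then show "x + y \<in> {x. algb K x}" "x * y \<in> {x. algb K x}" using sfieldD(3,4) by blast+
  qed (use K_alg in auto)
qed

section \<open>Algebraic closure in the reals as a closure operator with exchange\<close>

inductive_set rg :: "real set \<Rightarrow> real set" for S where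
  rg_base: "x \<in> S \<Longrightarrow> x \<in> rg S"
| rg_one: "1 \<in> rg S"
| rg_neg: "x \<in> rg S \<Longrightarrow> - x \<in> rg S"
| rg_add: "x \<in> rg S \<Longrightarrow> y \<in> rg S \<Longrightarrow> x + y \<in> rg S"
| rg_mul: "x \<in> rg S \<Longrightarrow> y \<in> rg S \<Longrightarrow> x * y \<in> rg S"

lemma rg_zero: "0 \<in> rg S" using rg_add[OF rg_one rg_neg[OF rg_one]] by simp

lemma rg_least: "x \<in> rg S \<Longrightarrow> sfield K \<Longrightarrow> S \<subseteq> K \<Longrightarrow> x \<in> K"
  by (induction rule: rg.induct) (auto intro: sfieldD)

lemma rg_mono: "x \<in> rg S \<Longrightarrow> S \<subseteq> T \<Longrightarrow> x \<in> rg T"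
  by (induction rule: rg.induct) (auto intro: rg.intros)

text \<open>The real algebraic numbers over the field generated by \<open>S\<close>. Coefficients
  come from the generated ring, whose elements are values of terms; by \<open>cl_frc\<close> the
  fraction field gives the same closure.\<close>

definition cl :: "real set \<Rightarrow> real set" where "cl S = {y. algb (rg S) y}"

definition frc :: "real set \<Rightarrow> real set" where "frc S = {a / b | a b. a \<in> rg S \<and> b \<in> rg S \<and> b \<noteq> 0}"

lemma frcI: "a \<in> rg S \<Longrightarrow> b \<in> rg S \<Longrightarrow> b \<noteq> 0 \<Longrightarrow> a / b \<in> frc S"
  unfolding frc_def by blast

lemma rg_frc: "rg S \<subseteq> frc S"
  using frcI[OF _ rg_one] by fastforce

lemma sfield_frc: "sfield (frc S)"
  unfolding sfield_def
proof (intro conjI ballI impI)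
  show "0 \<in> frc S" "1 \<in> frc S" using rg_frc rg_zero rg_one by blast+
next
  fix x y assume "x \<in> frc S" "y \<in> frc S"
  then obtain a b c d where x: "x = a / b" "a \<in> rg S" "b \<in> rg S" "b \<noteq> 0"
    and y: "y = c / d" "c \<in> rg S" "d \<in> rg S" "d \<noteq> 0" unfolding frc_def by blast
  have "x + y = (a * d + c * b) / (b * d)" "x * y = (a * c) / (b * d)" using x y by (simp_all add: field_simps)
  then show "x + y \<in> frc S" "x * y \<in> frc S" using x y by (auto intro!: frcI rg_add rg_mul)
next
  fix x assume "x \<in> frc S"
  then obtain a b where x: "x = a / b" "a \<in> rg S" "b \<in> rg S" "b \<noteq> 0" unfolding frc_def by blast
  have "- x = (- a) / b" using x by simp
  also have "\<dots> \<in> frc S" using x by (intro frcI rg_neg)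
  finally show "- x \<in> frc S" .
  assume "x \<noteq> 0"
  then have "inverse x = b / a" "a \<noteq> 0" using x by auto
  then show "inverse x \<in> frc S" using x by (auto intro!: frcI)
qed

text \<open>A common denominator of the coefficients is multiplied in.\<close>

lemma algb_frc: "algb (frc S) y \<longleftrightarrow> algb (rg S) y"
proof
  assume "algb (frc S) y"
  then obtain p where p: "p \<noteq> 0" "\<forall>i. coeff p i \<in> frc S" "poly p y = 0" unfolding algb_def by blast
  have "\<exists>d\<in>rg S. d \<noteq> 0 \<and> (\<forall>i<n. d * coeff p i \<in> rg S)" for n
  proof (induction n)
    case 0 then show ?case using rg_one by (intro bexI[of _ 1]) auto
  next
    case (Suc n)
    then obtain d where d: "d \<in> rg S" "d \<noteq> 0" "\<forall>i<n. d * coeff p i \<in> rg S" by blast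
    obtain a b where ab: "coeff p n = a / b" "a \<in> rg S" "b \<in> rg S" "b \<noteq> 0"
      using p(2) unfolding frc_def by blast
    show ?case
    proof (intro bexI[of _ "b * d"] conjI allI impI)
      fix i assume "i < Suc n"
      then show "b * d * coeff p i \<in> rg S"
        using rg_mul[OF ab(3), of "d * coeff p i"] d rg_mul[OF d(1) ab(2)] ab
        by (cases "i = n") (auto simp: mult.assoc)
    qed (use ab d rg_mul in auto)
  qed
  from this[of "Suc (degree p)"] obtain d where d: "d \<noteq> 0" "\<forall>i<Suc (degree p). d * coeff p i \<in> rg S"
    by blast
  have "coeff (smult d p) i \<in> rg S" for i
    using d(2) rg_zero by (cases "i \<le> degree p") (auto simp: coeff_eq_0)
  then show "algb (rg S) y" unfolding algb_def using p d(1) by (intro exI[of _ "smult d p"]) simp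
qed (use algb_mono rg_frc in blast)

lemma cl_frc: "cl S = {y. algb (frc S) y}"
  unfolding cl_def algb_frc ..

lemma cl_sfield: "sfield (cl S)"
  unfolding cl_frc by (rule algb_sfield[OF sfield_frc])

lemma algb_mem: "0 \<in> K \<Longrightarrow> 1 \<in> K \<Longrightarrow> - y \<in> K \<Longrightarrow> algb K y"
  unfolding algb_def by (intro exI[of _ "[:- y, 1:]"]) (auto simp: coeff_pCons split: nat.split)

lemma cl_incl: "S \<subseteq> cl S"
  unfolding cl_def using algb_mem[OF rg_zero rg_one rg_neg[OF rg_base]] by blast

lemma cl_mono: "S \<subseteq> T \<Longrightarrow> cl S \<subseteq> cl T"
  unfolding cl_def using rg_mono algb_mono[of "rg S" _ "rg T"] by blast

lemma cl_algb: "algb (cl S) y \<Longrightarrow> y \<in> cl S"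
  unfolding cl_frc using algb_trans[OF sfield_frc] by simp

lemma cl_least: "S \<subseteq> cl T \<Longrightarrow> cl S \<subseteq> cl T"
proof
  fix y assume S: "S \<subseteq> cl T" and "y \<in> cl S"
  then have "algb (rg S) y" unfolding cl_def by simp
  moreover have "rg S \<subseteq> cl T" using rg_least[OF _ cl_sfield S] by blast
  ultimately show "y \<in> cl T" by (intro cl_algb) (rule algb_mono)
qed

lemma rg_insert: "x \<in> rg (insert a S) \<Longrightarrow> \<exists>q. (\<forall>i. coeff q i \<in> rg S) \<and> x = poly q a"
proof (induction rule: rg.induct)
  case (rg_base x)
  then consider "x = a" | "x \<in> S" by blast
  then show ?case
  proof cases
    case 1
    then show ?thesis by (intro exI[of _ "[:0, 1:]"]) (auto simp: coeff_pCons rg_zero rg.rg_one split: nat.split)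
  next
    case 2
    then show ?thesis by (intro exI[of _ "[:x:]"]) (auto simp: coeff_pCons rg_zero rg.rg_base split: nat.split)
  qed
next
  case rg_one
  show ?case by (intro exI[of _ 1]) (auto simp: coeff_1 rg_zero rg.rg_one)
next
  case (rg_neg x)
  then obtain q where "\<forall>i. coeff q i \<in> rg S" "x = poly q a" by blast
  then show ?case by (intro exI[of _ "- q"]) (auto intro: rg.rg_neg)
next
  case (rg_add x y)
  then obtain q r where "\<forall>i. coeff q i \<in> rg S" "x = poly q a" "\<forall>i. coeff r i \<in> rg S" "y = poly r a" by blast
  then show ?case by (intro exI[of _ "q + r"]) (auto intro: rg.rg_add)
next
  case (rg_mul x y)
  then obtain q r where "\<forall>i. coeff q i \<in> rg S" "x = poly q a" "\<forall>i. coeff r i \<in> rg S" "y = poly r a" by blast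
  then show ?case
    by (intro exI[of _ "q * r"]) (auto simp: coeff_mult intro!: sum_closed rg_zero rg.rg_add rg.rg_mul)
qed

text \<open>A polynomial in \<open>y\<close> whose coefficients are polynomials in \<open>a\<close>
  is rearranged by powers of \<open>a\<close>: this gives \<open>s\<close>, with coefficients
  \<open>r j\<close> evaluated at \<open>y\<close>, and \<open>a\<close> as a root.\<close>

lemma exchange:
  assumes y: "y \<in> cl (insert a S)" and ny: "y \<notin> cl S"
  shows "a \<in> cl (insert y S)"
proof -
  obtain p where p: "p \<noteq> 0" "\<forall>i. coeff p i \<in> rg (insert a S)" "poly p y = 0"
    using y unfolding cl_def algb_def by blast
  have "\<forall>i. \<exists>q. (\<forall>j. coeff q j \<in> rg S) \<and> coeff p i = poly q a" using rg_insert p(2) by blast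
  then obtain q where q: "\<And>i j. coeff (q i) j \<in> rg S" "\<And>i. coeff p i = poly (q i) a" by metis
  define n where "n = degree p"
  define m where "m = Max (insert 0 ((\<lambda>i. degree (q i)) ` {..n}))"
  have m: "degree (q i) \<le> m" if "i \<le> n" for i unfolding m_def using that by (intro Max_ge) auto
  define r where "r j = (\<Sum>i\<le>n. monom (coeff (q i) j) i)" for j
  have cr: "coeff (r j) i = (if i \<le> n then coeff (q i) j else 0)" for j i
    unfolding r_def by (simp add: coeff_sum)
  define s where "s = (\<Sum>j\<le>m. monom (poly (r j) y) j)"
  have cs: "coeff s j = (if j \<le> m then poly (r j) y else 0)" for j
    unfolding s_def by (simp add: coeff_sum)
  have qa: "poly (q i) a = (\<Sum>j\<le>m. coeff (q i) j * a ^ j)" if "i \<le> n" for i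
    using poly_upto[OF m[OF that]] by simp
  have "poly s a = (\<Sum>j\<le>m. (\<Sum>i\<le>n. coeff (q i) j * y ^ i) * a ^ j)"
    unfolding s_def r_def by (simp add: poly_sum poly_monom)
  also have "\<dots> = (\<Sum>j\<le>m. \<Sum>i\<le>n. coeff (q i) j * y ^ i * a ^ j)" by (simp add: sum_distrib_right)
  also have "\<dots> = (\<Sum>i\<le>n. \<Sum>j\<le>m. coeff (q i) j * y ^ i * a ^ j)" by (rule sum.swap)
  also have "\<dots> = (\<Sum>i\<le>n. (\<Sum>j\<le>m. coeff (q i) j * a ^ j) * y ^ i)"
    unfolding sum_distrib_right by (intro sum.cong refl) (simp only: mult_ac)
  also have "\<dots> = poly p y" unfolding poly_altdef[of p] n_def[symmetric] using qa q(2) by simp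
  finally have "poly s a = 0" using p(3) by simp
  \<comment> \<open>The leading coefficient of \<open>p\<close> is the value of \<open>q n\<close>
    at \<open>a\<close>, so \<open>q n\<close> has a nonzero coefficient. The \<open>r j\<close>
    containing it is a nonzero polynomial over \<open>S\<close>, and its root cannot be
    \<open>y\<close>, which is transcendental over \<open>S\<close>.\<close>
  moreover have "s \<noteq> 0"
  proof -
    have "coeff p n \<noteq> 0" using p(1) by (simp add: n_def)
    then have "poly (q n) a \<noteq> 0" unfolding q(2) .
    then have "q n \<noteq> 0" by auto
    then obtain j where j: "coeff (q n) j \<noteq> 0" by (metis leading_coeff_0_iff)
    then have "coeff (r j) n \<noteq> 0" by (simp add: cr)
    then have "r j \<noteq> 0" by auto
    moreover have "\<forall>i. coeff (r j) i \<in> rg S" using cr q(1) rg_zero by simp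
    ultimately have "poly (r j) y \<noteq> 0" using ny unfolding cl_def algb_def by blast
    moreover have "j \<le> m" using j m[of n] le_degree[of "q n" j] by simp
    ultimately show ?thesis using cs by (metis coeff_0)
  qed
  moreover have "coeff s j \<in> rg (insert y S)" for j
  proof -
    have "coeff (r j) i \<in> rg (insert y S)" for i j using cr q(1) rg_zero rg_mono[of _ S "insert y S"] by simp blast
    then have "poly (r j) y \<in> rg (insert y S)"
      by (intro poly_closed) (auto intro: rg.intros rg_zero)
    then show ?thesis using cs rg_zero by simp
  qed
  ultimately show ?thesis unfolding cl_def algb_def by blast
qed

text \<open>Among the elements of \<open>Z\<close>, added one by one, the one that first brings
  \<open>y\<close> into the closure can be exchanged for \<open>y\<close>.\<close>

lemma exchange_finite:
  assumes "finite Z" "y \<in> cl (T \<union> Z)" "y \<notin> cl T"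
  shows "\<exists>z\<in>Z. z \<in> cl (insert y T \<union> (Z - {z}))"
  using assms
proof (induction Z rule: finite_induct)
  case (insert z Z)
  show ?case
  proof (cases "y \<in> cl (T \<union> Z)")
    case True
    then obtain u where u: "u \<in> Z" "u \<in> cl (insert y T \<union> (Z - {u}))"
      using insert.IH insert.prems(2) by blast
    have "cl (insert y T \<union> (Z - {u})) \<subseteq> cl (insert y T \<union> (insert z Z - {u}))" by (rule cl_mono) blast
    then have "u \<in> cl (insert y T \<union> (insert z Z - {u}))" using u(2) by (rule subsetD)
    then show ?thesis using u(1) by (intro bexI[of _ u]) simp_all
  next
    case False
    have "z \<in> cl (insert y (T \<union> Z))" using insert.prems(1) False by - (rule exchange, simp_all)
    moreover have "insert y (T \<union> Z) = insert y T \<union> (insert z Z - {z})" using insert.hyps by blast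
    ultimately show ?thesis by (intro bexI[of _ z]) simp_all
  qed
qed simp

text \<open>The sequential form of independence fits both induction along the list and the
  enumeration of generators by index.\<close>

definition cl_indep :: "real list \<Rightarrow> bool" where
  "cl_indep ys \<longleftrightarrow> (\<forall>i<length ys. ys ! i \<notin> cl (set (take i ys)))"

text \<open>Steinitz replacement: each of the first \<open>k\<close> members of \<open>ys\<close>
  replaces one element of \<open>X\<close>, and the result still generates \<open>X\<close>.\<close>

lemma cl_indep_length:
  assumes X: "finite X" and ys: "set ys \<subseteq> cl X" "cl_indep ys"
  shows "length ys \<le> card X"
proof -
  have "\<exists>Z. finite Z \<and> card Z + k = card X \<and> X \<subseteq> cl (set (take k ys) \<union> Z)" if "k \<le> length ys" for k
    using that
  proof (induction k)
    case 0 then show ?case using X cl_incl by (intro exI[of _ X]) auto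
  next
    case (Suc k)
    then obtain Z where Z: "finite Z" "card Z + k = card X" "X \<subseteq> cl (set (take k ys) \<union> Z)" by auto
    let ?T = "set (take k ys)"
    have k: "k < length ys" using Suc by simp
    have "ys ! k \<in> cl X" using ys(1) k by auto
    then have y: "ys ! k \<in> cl (?T \<union> Z)" using cl_least[OF Z(3)] by blast
    have ny: "ys ! k \<notin> cl ?T" using ys(2) k unfolding cl_indep_def by blast
    obtain z where z: "z \<in> Z" "z \<in> cl (insert (ys ! k) ?T \<union> (Z - {z}))"
      using exchange_finite[OF Z(1) y ny] by blast
    have T': "set (take (Suc k) ys) = insert (ys ! k) ?T" using k by (simp add: take_Suc_conv_app_nth)
    have "?T \<union> Z \<subseteq> cl (insert (ys ! k) ?T \<union> (Z - {z}))"
      using cl_incl[of "insert (ys ! k) ?T \<union> (Z - {z})"] z(2) by blast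
    then have "X \<subseteq> cl (set (take (Suc k) ys) \<union> (Z - {z}))"
      unfolding T' by (rule order_trans[OF Z(3) cl_least])
    moreover have "card (Z - {z}) + Suc k = card X" using Z(1,2) z(1) card_Suc_Diff1[of Z z] by simp
    ultimately show ?case using Z(1) by (intro exI[of _ "Z - {z}"]) auto
  qed
  from this[of "length ys"] show ?thesis by auto
qed

section \<open>Real closed subfields of the reals are relatively algebraically closed\<close>

abbreviation mpoly :: "complex list \<Rightarrow> complex poly" where
  "mpoly as \<equiv> (\<Prod>a\<leftarrow>as. [:- a, 1:])"

definition psum :: "complex list \<Rightarrow> nat \<Rightarrow> complex" where
  "psum as n = (\<Sum>a\<leftarrow>as. a ^ n)"

lemma degree_mpoly: "degree (mpoly as) = length as" and monic_mpoly: "lead_coeff (mpoly as) = 1"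
proof -
  have "mpoly as \<noteq> 0 \<and> degree (mpoly as) = length as \<and> lead_coeff (mpoly as) = 1"
  proof (induction as)
    case (Cons a as)
    then show ?case using coeff_mult_degree_sum[of "[:- a, 1:]" "mpoly as"]
      by (auto simp: degree_mult_eq simp del: mult_pCons_left)
  qed simp
  then show "degree (mpoly as) = length as" "lead_coeff (mpoly as) = 1" by auto
qed

lemma poly_mpoly_root: "poly (mpoly as) z = 0 \<longleftrightarrow> z \<in> set as"
  by (induction as) (auto simp: algebra_simps simp del: mult_pCons_left)

text \<open>The reversed polynomial as a power series. Its logarithmic derivative generates the
  power sums, which turns Newton's identities into a comparison of coefficients.\<close>

definition rfps :: "complex list \<Rightarrow> complex fps" where
  "rfps as = (\<Prod>a\<leftarrow>as. 1 - fps_const a * fps_X)"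

lemma rfps_deriv: "fps_deriv (rfps as) = - rfps as * Abs_fps (\<lambda>n. psum as (Suc n))"
proof (induction as)
  case Nil
  have "Abs_fps (\<lambda>n. psum [] (Suc n)) = 0" by (rule fps_ext) (simp add: psum_def)
  then show ?case by (simp add: rfps_def)
next
  case (Cons a as)
  define G where "G = Abs_fps (\<lambda>n. a ^ Suc n)"
  define H where "H = Abs_fps (\<lambda>n. psum as (Suc n))"
  have G: "(1 - fps_const a * fps_X) * G = fps_const a"
  proof (rule fps_ext)
    fix n
    show "((1 - fps_const a * fps_X) * G) $ n = fps_const a $ n"
      unfolding G_def by (cases n) (simp_all add: left_diff_distrib mult.assoc fps_X_mult_nth del: fps_const_neg)
  qed
  have sum: "Abs_fps (\<lambda>n. psum (a # as) (Suc n)) = G + H"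
    unfolding G_def H_def by (rule fps_ext) (simp add: psum_def)
  have e: "rfps (a # as) = (1 - fps_const a * fps_X) * rfps as" by (simp add: rfps_def)
  have "fps_deriv (rfps (a # as)) = (1 - fps_const a * fps_X) * fps_deriv (rfps as) - fps_const a * rfps as"
    unfolding e by (simp add: algebra_simps)
  also have "\<dots> = - ((1 - fps_const a * fps_X) * rfps as) * H - ((1 - fps_const a * fps_X) * G) * rfps as"
    unfolding Cons.IH H_def[symmetric] G by (simp add: algebra_simps)
  also have "\<dots> = - rfps (a # as) * (G + H)" unfolding e by (simp add: algebra_simps)
  finally show ?case unfolding sum .
qed

lemma rfps_nth0: "rfps as $ 0 = 1"
  unfolding rfps_def by (induction as) simp_all

lemma newton: "of_nat (Suc n) * rfps as $ Suc n = - (\<Sum>i\<le>n. rfps as $ i * psum as (Suc (n - i)))"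
proof -
  have "fps_deriv (rfps as) $ n = (- rfps as * Abs_fps (\<lambda>n. psum as (Suc n))) $ n"
    by (simp only: rfps_deriv)
  then show ?thesis by (simp add: fps_mult_nth sum_negf atLeast0AtMost)
qed

lemma rfps_poly: "rfps as = fps_of_poly (reflect_poly (mpoly as))"
proof -
  have "reflect_poly [:- a, 1:] = [:1, - a:]" for a :: complex
    by (simp add: reflect_poly_def cCons_def)
  moreover have "fps_of_poly [:1, - a:] = 1 - fps_const a * fps_X" for a :: complex
    by (simp add: fps_of_poly_pCons fps_const_neg[symmetric] del: fps_const_neg)
  ultimately have e: "fps_of_poly (reflect_poly [:- a, 1:]) = 1 - fps_const a * fps_X" for a :: complex by simp
  show ?thesis unfolding rfps_def
    by (induction as) (simp_all add: reflect_poly_mult fps_of_poly_mult e del: mult_pCons_left)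
qed

lemma rfps_nth: "rfps as $ n = (if n \<le> length as then coeff (mpoly as) (length as - n) else 0)"
  unfolding rfps_poly by (simp add: coeff_reflect_poly degree_mpoly)

text \<open>Newton's identities are solved for the highest power sum, whose factor is the constant
  coefficient 1. Together with the converse \<open>coeff_closed\<close> this does the work of the
  theorem on symmetric polynomials.\<close>

lemma psum_closed:
  assumes K: "sfield K" and c: "\<And>i. coeff (mpoly as) i \<in> K" shows "psum as n \<in> K"
proof (induction n rule: less_induct)
  case (less n)
  have r: "rfps as $ i \<in> K" for i using c sfieldD(1)[OF K] by (simp add: rfps_nth)
  show ?case
  proof (cases n)
    case 0
    have "(of_nat m :: complex) \<in> K" for m by (induction m) (auto intro: sfieldD[OF K])
    then show ?thesis using 0 by (simp add: psum_def map_replicate_const sum_list_replicate)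
  next
    case (Suc m)
    have nn: "(of_nat m :: complex) \<in> K" for m by (induction m) (auto intro: sfieldD[OF K])
    have e: "(\<Sum>i\<le>m. rfps as $ i * psum as (Suc (m - i)))
      = psum as n + (\<Sum>i\<in>{..m} - {0}. rfps as $ i * psum as (Suc (m - i)))"
      using sum.remove[of "{..m}" 0 "\<lambda>i. rfps as $ i * psum as (Suc (m - i))"] by (simp add: rfps_nth0 Suc)
    have "psum as n = - (of_nat (Suc m) * rfps as $ Suc m)
      - (\<Sum>i\<in>{..m} - {0}. rfps as $ i * psum as (Suc (m - i)))"
      unfolding newton e by simp
    also have "\<dots> \<in> K"
    proof (intro sfieldD(4,5,7)[OF K] sum_closed r nn)
      fix i assume "i \<in> {..m} - {0}"
      then show "psum as (Suc (m - i)) \<in> K" using less Suc by auto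
    qed (auto intro: sfieldD[OF K])
    finally show ?thesis .
  qed
qed

text \<open>The same identities are solved for the coefficient; its factor \<open>n + 1\<close> is
  invertible in the field.\<close>

lemma coeff_closed:
  assumes K: "sfield K" and p: "\<And>n. psum as n \<in> K" shows "coeff (mpoly as) i \<in> K"
proof -
  have nn: "(of_nat m :: complex) \<in> K" for m by (induction m) (auto intro: sfieldD[OF K])
  have r: "rfps as $ n \<in> K" for n
  proof (induction n rule: less_induct)
    case (less n)
    show ?case
    proof (cases n)
      case 0 then show ?thesis using sfieldD(2)[OF K] by (simp add: rfps_nth0)
    next
      case (Suc m)
      have "rfps as $ n = - (\<Sum>i\<le>m. rfps as $ i * psum as (Suc (m - i))) / of_nat (Suc m)"
        using newton[of m as] Suc by (simp add: field_simps del: of_nat_Suc)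
      also have "\<dots> \<in> K"
        by (intro sfieldD(4,5,8)[OF K] sum_closed p nn) (use less Suc in \<open>auto intro: sfieldD[OF K]\<close>)
      finally show ?thesis .
    qed
  qed
  show ?thesis
  proof (cases "i \<le> length as")
    case True
    then have "coeff (mpoly as) i = rfps as $ (length as - i)" by (simp add: rfps_nth)
    then show ?thesis using r by simp
  next
    case False
    then show ?thesis using sfieldD(1)[OF K] by (simp add: coeff_eq_0 degree_mpoly)
  qed
qed

section \<open>Symmetric expressions in pairs of roots\<close>

fun prs :: "('a \<Rightarrow> 'a \<Rightarrow> 'b) \<Rightarrow> 'a list \<Rightarrow> 'b list" where
  "prs f [] = []"
| "prs f (a # as) = map (f a) as @ prs f as"

text \<open>There are \<open>n (n - 1) / 2\<close> pairs of positions; this form avoids division and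
  subtraction.\<close>

lemma length_prs: "2 * length (prs f as) + length as = length as * length as"
  by (induction as) auto

lemma set_prs: "c \<in> set (prs f as) \<Longrightarrow> \<exists>a\<in>set as. \<exists>b\<in>set as. c = f a b"
  by (induction as) auto

lemma sum_prs:
  fixes g :: "'a \<Rightarrow> 'a \<Rightarrow> complex"
  assumes "\<And>a b. g a b = g b a"
  shows "2 * sum_list (prs g as) + (\<Sum>a\<leftarrow>as. g a a) = (\<Sum>a\<leftarrow>as. \<Sum>b\<leftarrow>as. g a b)"
proof (induction as)
  case (Cons a as)
  have "(\<Sum>x\<leftarrow>as. g x a) = (\<Sum>b\<leftarrow>as. g a b)" using assms[of _ a] by simp
  then show ?case using Cons by (simp add: sum_list_addf algebra_simps)
qed simp

lemma map_prs: "map h (prs f as) = prs (\<lambda>a b. h (f a b)) as"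
  by (induction as) auto

text \<open>The sum over unordered pairs is half of the sum over all ordered pairs without the
  diagonal, and both of these expand into power sums of \<open>as\<close>.\<close>

lemma psum_prs_closed:
  fixes t :: complex
  assumes K: "sfield K" and t: "t \<in> K" and p: "\<And>n. psum as n \<in> K"
  shows "psum (prs (\<lambda>a b. a + b + t * (a * b)) as) n \<in> K"
proof -
  let ?f = "\<lambda>a b. a + b + t * (a * b)"
  \<comment> \<open>The extra factors \<open>a ^ i\<close> and \<open>b ^ j\<close> absorb what
    splits off when one factor of the power is multiplied out.\<close>
  have 1: "(\<Sum>a\<leftarrow>as. \<Sum>b\<leftarrow>as. ?f a b ^ n * a ^ i * b ^ j) \<in> K" for n i j
  proof (induction n arbitrary: i j)
    case 0
    have "(\<Sum>a\<leftarrow>as. \<Sum>b\<leftarrow>as. ?f a b ^ 0 * a ^ i * b ^ j) = psum as i * psum as j"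
      by (simp add: psum_def sum_list_const_mult sum_list_mult_const)
    then show ?case using sfieldD(4)[OF K p p] by simp
  next
    case (Suc n)
    have "(\<Sum>a\<leftarrow>as. \<Sum>b\<leftarrow>as. ?f a b ^ Suc n * a ^ i * b ^ j)
      = (\<Sum>a\<leftarrow>as. \<Sum>b\<leftarrow>as. ?f a b ^ n * a ^ Suc i * b ^ j + ?f a b ^ n * a ^ i * b ^ Suc j
         + t * (?f a b ^ n * a ^ Suc i * b ^ Suc j))"
      by (intro arg_cong[where f = sum_list] map_cong refl) (simp add: algebra_simps)
    also have "\<dots> = (\<Sum>a\<leftarrow>as. \<Sum>b\<leftarrow>as. ?f a b ^ n * a ^ Suc i * b ^ j)
      + (\<Sum>a\<leftarrow>as. \<Sum>b\<leftarrow>as. ?f a b ^ n * a ^ i * b ^ Suc j)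
      + t * (\<Sum>a\<leftarrow>as. \<Sum>b\<leftarrow>as. ?f a b ^ n * a ^ Suc i * b ^ Suc j)"
      by (simp only: sum_list_addf sum_list_const_mult)
    also have "\<dots> \<in> K" using Suc[of "Suc i" j] Suc[of i "Suc j"] Suc[of "Suc i" "Suc j"]
      by (intro sfieldD(3,4)[OF K] t)
    finally show ?case .
  qed
  have 2: "(\<Sum>a\<leftarrow>as. ?f a a ^ n * a ^ i) \<in> K" for n i
  proof (induction n arbitrary: i)
    case 0 then show ?case using p[of i] by (simp add: psum_def)
  next
    case (Suc n)
    have "(\<Sum>a\<leftarrow>as. ?f a a ^ Suc n * a ^ i)
      = (\<Sum>a\<leftarrow>as. ?f a a ^ n * a ^ Suc i + ?f a a ^ n * a ^ Suc i + t * (?f a a ^ n * a ^ Suc (Suc i)))"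
      by (intro arg_cong[where f = sum_list] map_cong refl) (simp add: algebra_simps)
    also have "\<dots> = (\<Sum>a\<leftarrow>as. ?f a a ^ n * a ^ Suc i) + (\<Sum>a\<leftarrow>as. ?f a a ^ n * a ^ Suc i)
      + t * (\<Sum>a\<leftarrow>as. ?f a a ^ n * a ^ Suc (Suc i))"
      by (simp only: sum_list_addf sum_list_const_mult)
    also have "\<dots> \<in> K" using Suc[of "Suc i"] Suc[of "Suc (Suc i)"] by (intro sfieldD(3,4)[OF K] t)
    finally show ?case .
  qed
  have "2 * psum (prs ?f as) n + (\<Sum>a\<leftarrow>as. ?f a a ^ n) = (\<Sum>a\<leftarrow>as. \<Sum>b\<leftarrow>as. ?f a b ^ n)"
    unfolding psum_def map_prs by (rule sum_prs) (simp add: algebra_simps)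
  then have eq: "psum (prs ?f as) n = ((\<Sum>a\<leftarrow>as. \<Sum>b\<leftarrow>as. ?f a b ^ n) - (\<Sum>a\<leftarrow>as. ?f a a ^ n)) / 2"
    by (simp add: field_simps)
  have two: "(2 :: complex) \<in> K" using sfieldD(3)[OF K sfieldD(2)[OF K] sfieldD(2)[OF K]] by simp
  have A: "(\<Sum>a\<leftarrow>as. \<Sum>b\<leftarrow>as. ?f a b ^ n) \<in> K" using 1[of n 0 0] by (simp only: power_0 mult_1_right)
  have B: "(\<Sum>a\<leftarrow>as. ?f a a ^ n) \<in> K" using 2[of n 0] by (simp only: power_0 mult_1_right)
  show ?thesis unfolding eq by (rule sfieldD(8)[OF K sfieldD(7)[OF K A B] two])
qed

lemma poly_of_real: "poly (map_poly of_real q) (of_real x) = complex_of_real (poly q x)"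
  by (induction q) (simp_all add: map_poly_pCons)

lemma two_power_odd: "n > 0 \<Longrightarrow> \<exists>k m. n = 2 ^ k * m \<and> odd (m :: nat)"
proof (induction n rule: less_induct)
  case (less n)
  show ?case
  proof (cases "odd n")
    case True then show ?thesis by (intro exI[of _ 0] exI[of _ n]) simp
  next
    case False
    then obtain n' where n': "n = 2 * n'" by (auto elim: evenE)
    then obtain k m where "n' = 2 ^ k * m" "odd m" using less by (metis less_add_same_cancel1 mult_2 nat_0_less_mult_iff)
    then show ?thesis using n' by (intro exI[of _ "Suc k"] exI[of _ m]) simp
  qed
qed

section \<open>Laplace's argument over a real closed subfield\<close>

context
  fixes F :: "real set" assumes F: "rcf_set F"
begin

lemma F_sfield: "sfield F"
  using F unfolding rcf_set_def sfield_def by simp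

lemmas Fc = sfieldD[OF F_sfield]

lemma F_sqrt: "x \<in> F \<Longrightarrow> x \<ge> 0 \<Longrightarrow> sqrt x \<in> F"
  using F Fc(1) unfolding rcf_set_def by (cases "x = 0") simp_all

lemma F_half: "x \<in> F \<Longrightarrow> x / 2 \<in> F"
  using Fc(8)[of x 2] Fc(3)[OF Fc(2) Fc(2)] by simp

definition Fr :: "complex set" where "Fr = of_real ` F"
definition Fi :: "complex set" where "Fi = {z. Re z \<in> F \<and> Im z \<in> F}"

lemma Fr_sfield: "sfield Fr"
proof -
  have I: "of_real x \<in> Fr" if "x \<in> F" for x using that unfolding Fr_def by blast
  show ?thesis unfolding sfield_def
  proof (intro conjI ballI impI)
    show "0 \<in> Fr" "1 \<in> Fr" using I[OF Fc(1)] I[OF Fc(2)] by simp_all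
  next
    fix x y assume "x \<in> Fr" "y \<in> Fr"
    then obtain a b where "a \<in> F" "b \<in> F" "x = of_real a" "y = of_real b" unfolding Fr_def by blast
    then show "x + y \<in> Fr" "x * y \<in> Fr" using I[OF Fc(3)[of a b]] I[OF Fc(4)[of a b]] by simp_all
  next
    fix x assume "x \<in> Fr"
    then obtain a where "a \<in> F" "x = of_real a" unfolding Fr_def by blast
    then show "- x \<in> Fr" "x \<noteq> 0 \<Longrightarrow> inverse x \<in> Fr"
      using I[OF Fc(5)[of a]] I[OF Fc(6)[of a]] by (simp_all add: of_real_inverse)
  qed
qed

lemma Fi_sfield: "sfield Fi"
  unfolding sfield_def
proof (intro conjI ballI impI)
  show "0 \<in> Fi" "1 \<in> Fi" unfolding Fi_def using Fc(1,2) by simp_all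
next
  fix x y assume "x \<in> Fi" "y \<in> Fi"
  then have "Re x \<in> F" "Im x \<in> F" "Re y \<in> F" "Im y \<in> F" unfolding Fi_def by auto
  then show "x + y \<in> Fi" "x * y \<in> Fi" unfolding Fi_def by (simp_all add: Fc(3,4,7))
next
  fix x assume "x \<in> Fi"
  then have x: "Re x \<in> F" "Im x \<in> F" unfolding Fi_def by auto
  then show "- x \<in> Fi" unfolding Fi_def by (simp add: Fc(5))
  have n: "(Re x)\<^sup>2 + (Im x)\<^sup>2 \<in> F" unfolding power2_eq_square using x by (intro Fc(3) Fc(4))
  have "Re x / ((Re x)\<^sup>2 + (Im x)\<^sup>2) \<in> F" by (rule Fc(8)[OF x(1) n])
  moreover have "- Im x / ((Re x)\<^sup>2 + (Im x)\<^sup>2) \<in> F" by (rule Fc(8)[OF Fc(5)[OF x(2)] n])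
  ultimately show "inverse x \<in> Fi" unfolding Fi_def by simp
qed

lemmas Fic = sfieldD[OF Fi_sfield]

lemma Fi_csqrt: assumes "z \<in> Fi" shows "csqrt z \<in> Fi"
proof -
  have z: "Re z \<in> F" "Im z \<in> F" using assms unfolding Fi_def by auto
  have m: "cmod z \<in> F" unfolding cmod_def power2_eq_square
    using z by (intro F_sqrt Fc(3) Fc(4)) auto
  have "sqrt ((cmod z + Re z) / 2) \<in> F" "sqrt ((cmod z - Re z) / 2) \<in> F"
    using m z abs_Re_le_cmod[of z] by (auto intro!: F_sqrt F_half Fc(3,7))
  moreover have "(if Im z = 0 then 1 else sgn (Im z)) \<in> F"
    using Fc(2,5) by (auto simp: sgn_if)
  ultimately show ?thesis unfolding Fi_def using Fc(4) by simp
qed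

text \<open>\<open>a\<close> is a root of \<open>T^2 - (a + b) T + a b\<close>, and
  \<open>Fi\<close> is closed under square roots.\<close>

lemma Fi_quadratic:
  assumes "a + b \<in> Fi" "a * b \<in> Fi" shows "a \<in> Fi"
proof -
  define w where "w = csqrt ((a + b)\<^sup>2 - 4 * (a * b))"
  have 2: "(2 :: complex) \<in> Fi" using Fic(3)[OF Fic(2) Fic(2)] by simp
  then have 4: "(4 :: complex) \<in> Fi" using Fic(3)[OF 2 2] by simp
  have w: "w \<in> Fi" unfolding w_def power2_eq_square 
    by (intro Fi_csqrt Fic(7)[OF Fic(4)[OF assms(1) assms(1)] Fic(4)[OF 4 assms(2)]])
  have "w\<^sup>2 = (a - b)\<^sup>2" unfolding w_def power2_csqrt by (simp add: power2_eq_square algebra_simps)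
  then have "a - b = w \<or> a - b = - w" by (metis power2_eq_iff)
  then have "a = (a + b + w) / 2 \<or> a = (a + b - w) / 2" by (auto simp: field_simps)
  moreover have "(a + b + w) / 2 \<in> Fi" "(a + b - w) / 2 \<in> Fi"
    using assms w 2 Fic(8)[OF Fic(3)[of "a + b" w]] Fic(8)[OF Fic(7)[of "a + b" w]] by auto
  ultimately show ?thesis by metis
qed

lemma real_root_in:
  assumes "\<And>i. coeff p i \<in> Fr" "odd (degree p)" shows "\<exists>z\<in>Fi. poly p z = 0"
proof -
  define q where "q = map_poly Re p"
  have cq: "coeff q i = Re (coeff p i)" for i unfolding q_def by (simp add: coeff_map_poly)
  have cp: "coeff p i = of_real (coeff q i)" "coeff q i \<in> F" for i
    using assms(1)[of i] unfolding cq Fr_def by auto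
  have pq: "p = map_poly of_real q" by (rule poly_eqI) (simp add: coeff_map_poly cp(1))
  then have "degree p = degree q" by (simp add: degree_map_poly)
  then have "odd (degree q)" using assms(2) by simp
  then obtain x where x: "x \<in> F" "poly q x = 0" using F cp(2) unfolding rcf_set_def by blast
  have "poly p (of_real x) = of_real (poly q x)" unfolding pq by (rule poly_of_real)
  then show ?thesis using x Fc(1) by (intro bexI[of _ "of_real x"]) (auto simp: Fi_def)
qed

text \<open>Induction on the exponent of 2 in the degree. The polynomial with roots
  \<open>a + b + t a b\<close>, over pairs of roots of \<open>p\<close>, has coefficients in
  \<open>Fr\<close> by the power sums, and its degree has one factor 2 less. So for every natural
  \<open>t\<close> one such expression lies in \<open>Fi\<close>.\<close>

lemma laplace:
  assumes "\<And>i. coeff p i \<in> Fr" "degree p = 2 ^ k * m" "odd m"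
  shows "\<exists>z\<in>Fi. poly p z = 0"
  using assms
proof (induction k arbitrary: p m)
  case 0
  then show ?case by (intro real_root_in) auto
next
  case (Suc k)
  have p0: "p \<noteq> 0" using Suc.prems(2,3) by auto
  obtain A where A: "p = smult (lead_coeff p) (\<Prod>x\<in>#A. [:- x, 1:])" "size A = degree p"
    using alg_closed_imp_factorization[OF p0] by blast
  obtain as where as: "mset as = A" using ex_mset by blast
  have mp: "p = smult (lead_coeff p) (mpoly as)"
    using A(1) unfolding as[symmetric] by (simp add: prod_mset_prod_list flip: mset_map)
  have len: "length as = 2 * (2 ^ k * m)" using A(2) as Suc.prems(2) by (metis mult.assoc power_Suc size_mset)
  have "coeff (mpoly as) i = coeff p i / lead_coeff p" for i
    using arg_cong[OF mp, of "\<lambda>q. coeff q i"] p0 by simp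
  then have c: "coeff (mpoly as) i \<in> Fr" for i using Suc.prems(1) sfieldD(8)[OF Fr_sfield] by simp
  have ps: "psum as n \<in> Fr" for n using psum_closed[OF Fr_sfield c] .
  have nF: "of_nat t \<in> Fr" for t by (induction t) (auto intro: sfieldD[OF Fr_sfield])
  have ex: "\<exists>a b. a \<in> set as \<and> b \<in> set as \<and> a + b + of_nat t * (a * b) \<in> Fi" for t
  proof -
    let ?l = "prs (\<lambda>a b. a + b + of_nat t * (a * b)) as"
    have "2 * length ?l + length as = length as * length as" by (rule length_prs)
    then have "2 * length ?l + 2 * (2 ^ k * m) = 2 * (2 ^ k * m) * (2 * (2 ^ k * m))" unfolding len .
    then have "length ?l + 2 ^ k * m = 2 ^ k * m * (2 * (2 ^ k * m))" by simp
    then have "length ?l = 2 ^ k * m * (2 * (2 ^ k * m)) - 2 ^ k * m" by simp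
    then have "length ?l = 2 ^ k * m * (2 * (2 ^ k * m) - 1)" by (simp add: diff_mult_distrib2)
    then have "length ?l = 2 ^ k * (m * (2 * (2 ^ k * m) - 1))" by (simp only: mult.assoc)
    moreover have "odd (m * (2 * (2 ^ k * m) - 1))"
    proof -
      have "m > 0" using Suc.prems(3) by (simp add: odd_pos)
      then have "2 ^ k * m > 0" by simp
      then have "odd (2 * (2 ^ k * m) - 1)" by (cases "2 ^ k * m") auto
      then show ?thesis using Suc.prems(3) by simp
    qed
    moreover have "coeff (mpoly ?l) i \<in> Fr" for i
      by (rule coeff_closed[OF Fr_sfield psum_prs_closed[OF Fr_sfield nF ps]])
    ultimately obtain z where "z \<in> Fi" "poly (mpoly ?l) z = 0"
      using Suc.IH[of "mpoly ?l" "m * (2 * (2 ^ k * m) - 1)"] unfolding degree_mpoly by blast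
    then show ?thesis using set_prs[of z _ as] unfolding poly_mpoly_root by blast
  qed
  define ab where "ab t = (SOME c. fst c \<in> set as \<and> snd c \<in> set as \<and> fst c + snd c + of_nat t * (fst c * snd c) \<in> Fi)" for t :: nat
  have ab: "fst (ab t) \<in> set as \<and> snd (ab t) \<in> set as \<and> fst (ab t) + snd (ab t) + of_nat t * (fst (ab t) * snd (ab t)) \<in> Fi" for t
  proof -
    obtain a b where "a \<in> set as \<and> b \<in> set as \<and> a + b + of_nat t * (a * b) \<in> Fi" using ex by blast
    then have "\<exists>c. fst c \<in> set as \<and> snd c \<in> set as \<and> fst c + snd c + of_nat t * (fst c * snd c) \<in> Fi"
      by (intro exI[of _ "(a, b)"]) simp
    then show ?thesis unfolding ab_def by (rule someI_ex)
  qed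
  have "finite (range ab)"
  proof (rule finite_subset)
    show "range ab \<subseteq> set as \<times> set as"
    proof
      fix c assume "c \<in> range ab"
      then obtain t where "c = ab t" by blast
      then show "c \<in> set as \<times> set as" using ab[of t] by (simp add: mem_Times_iff)
    qed
  qed simp
  \<comment> \<open>Infinitely many parameters but finitely many pairs: one pair serves two
    parameters, which makes \<open>a b\<close> and \<open>a + b\<close> computable in
    \<open>Fi\<close>.\<close>
  then have "\<not> inj ab" using finite_imageD infinite_UNIV_nat by blast
  then obtain s t where st: "s \<noteq> t" "ab s = ab t" unfolding inj_def by blast
  obtain a b where e: "ab s = (a, b)" by force
  have 1: "a \<in> set as" "a + b + of_nat s * (a * b) \<in> Fi" "a + b + of_nat t * (a * b) \<in> Fi"
    using ab[of s] ab[of t] unfolding st(2)[symmetric] e by simp_all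
  have d: "(of_nat s - of_nat t :: complex) \<noteq> 0" using st(1) by simp
  have nFi: "of_nat t \<in> Fi" for t by (induction t) (auto intro: Fic)
  have "a * b = ((a + b + of_nat s * (a * b)) - (a + b + of_nat t * (a * b))) / (of_nat s - of_nat t)"
    using d by (simp add: left_diff_distrib[symmetric])
  then have 2: "a * b \<in> Fi" using 1(2,3) nFi Fic(7,8) by metis
  have "a + b = (a + b + of_nat s * (a * b)) - of_nat s * (a * b)" by simp
  then have "a + b \<in> Fi" using 1(2) 2 nFi Fic(4,7) by metis
  then have "a \<in> Fi" using 2 by (rule Fi_quadratic)
  moreover have "poly p a = 0" using 1(1) poly_mpoly_root[of as a] by (subst mp) simp
  ultimately show ?case by blast
qed

text \<open>Long division that keeps track of the coefficients; as the divisor is monic, they never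
  leave \<open>F\<close>.\<close>

lemma F_division:
  assumes "\<And>i. coeff p i \<in> F" "\<And>i. coeff c i \<in> F" "lead_coeff c = 1"
  shows "\<exists>q r. (\<forall>i. coeff q i \<in> F) \<and> (\<forall>i. coeff r i \<in> F) \<and> p = c * q + r \<and> (r = 0 \<or> degree r < degree c)"
  using assms(1)
proof (induction "degree p" arbitrary: p rule: less_induct)
  case less
  show ?case
  proof (cases "p = 0 \<or> degree p < degree c")
    case True
    then show ?thesis using less.prems Fc(1) by (intro exI[of _ 0] exI[of _ p]) auto
  next
    case False
    define t where "t = monom (lead_coeff p) (degree p - degree c)"
    define p' where "p' = p - c * t"
    have tF: "coeff t i \<in> F" for i unfolding t_def using less.prems Fc(1) by simp
    have ctF: "coeff (c * t) i \<in> F" for i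
      unfolding coeff_mult using assms(2) tF Fc by (intro sum_closed) auto
    have p'F: "coeff p' i \<in> F" for i unfolding p'_def using less.prems ctF Fc(7) by simp
    have "c \<noteq> 0" "t \<noteq> 0" using assms(3) False by (auto simp: t_def)
    then have "degree (c * t) = degree p" using False by (simp add: degree_mult_eq t_def degree_monom_eq)
    moreover have "lead_coeff (c * t) = lead_coeff p"
      using False by (simp add: lead_coeff_mult assms(3) t_def degree_monom_eq)
    ultimately have "coeff p' (degree p) = 0" "degree p' \<le> degree p"
      unfolding p'_def using degree_diff_le[of p "degree p" "c * t"] by simp_all
    then have dp: "p' = 0 \<or> degree p' < degree p" by (metis leading_coeff_0_iff le_neq_implies_less)
    have "\<exists>q r. (\<forall>i. coeff q i \<in> F) \<and> (\<forall>i. coeff r i \<in> F) \<and> p' = c * q + r \<and> (r = 0 \<or> degree r < degree c)"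
    proof (cases "p' = 0")
      case True then show ?thesis using Fc(1) by (intro exI[of _ 0]) simp
    next
      case False then show ?thesis using less.hyps[of p'] dp p'F by blast
    qed
    then obtain q r where qr: "\<forall>i. coeff q i \<in> F" "\<forall>i. coeff r i \<in> F" "p' = c * q + r" "r = 0 \<or> degree r < degree c"
      by blast
    have "p = c * (q + t) + r" using qr(3) unfolding p'_def by (simp add: algebra_simps)
    moreover have "\<forall>i. coeff (q + t) i \<in> F" using qr(1) tF Fc(3) by simp
    ultimately show ?thesis using qr by blast
  qed
qed

text \<open>A root \<open>z\<close> of \<open>p\<close> in \<open>F(i)\<close> splits off a linear
  or quadratic factor over \<open>F\<close>. The real root \<open>x\<close> is then the root of the
  linear factor or a root of the quotient, which has smaller degree.\<close>

theorem rcf_set_root: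
  assumes "p \<noteq> 0" "\<And>i. coeff p i \<in> F" "poly p x = 0"
  shows "x \<in> F"
  using assms
proof (induction "degree p" arbitrary: p rule: less_induct)
  case less
  have d: "degree p > 0"
  proof (rule ccontr)
    assume "\<not> degree p > 0"
    then obtain a where "p = [:a:]" using degree_eq_zeroE[of p] by auto
    then show False using less.prems by simp
  qed
  define P where "P = map_poly complex_of_real p"
  have cP: "coeff P i = of_real (coeff p i)" for i unfolding P_def by (simp add: coeff_map_poly)
  have dP: "degree P = degree p" unfolding P_def by (simp add: degree_map_poly)
  obtain k m where km: "degree p = 2 ^ k * m" "odd m"
    using two_power_odd[OF d] by blast
  obtain z where z: "z \<in> Fi" "poly P z = 0"
    using laplace[of P k m] km less.prems(2) dP cP unfolding Fr_def by auto
  have zF: "Re z \<in> F" "Im z \<in> F" using z(1) unfolding Fi_def by auto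
  have Pz: "poly P (of_real y) = of_real (poly p y)" for y unfolding P_def by (rule poly_of_real)
  show ?case
  proof (cases "Im z = 0")
    case True
    define c where "c = [:- Re z, 1:]"
    have "coeff c i \<in> F" for i unfolding c_def using zF Fc by (auto simp: coeff_pCons split: nat.split)
    then obtain q r where qr: "\<forall>i. coeff q i \<in> F" "p = c * q + r" "r = 0 \<or> degree r < degree c"
      using F_division[OF less.prems(2), of c] unfolding c_def by auto
    have "degree r = 0" using qr(3) by (auto simp: c_def)
    then obtain a where a: "r = [:a:]" using degree_eq_zeroE by blast
    have "z = of_real (Re z)" using True by (simp add: complex_eq_iff)
    then have "poly p (Re z) = 0" using z(2) Pz[of "Re z"] by simp
    then have "r = 0" using a unfolding qr(2) c_def by simp
    then have p: "p = c * q" using qr(2) by simp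
    then have "x = Re z \<or> poly q x = 0" using less.prems(3) by (auto simp: c_def)
    moreover have "q \<noteq> 0" using p less.prems(1) by auto
    moreover from this have "degree q < degree p" unfolding p by (subst degree_mult_eq) (auto simp: c_def)
    ultimately show ?thesis using less.hyps[of q] qr(1) zF by blast
  next
    case False
    \<comment> \<open>The product of \<open>X - z\<close> and \<open>X - cnj z\<close>. It equals
      \<open>(X - Re z)^2 + (Im z)^2\<close>, so it has no real root.\<close>
    define c where "c = [:(Re z)\<^sup>2 + (Im z)\<^sup>2, - (2 * Re z), 1:]"
    have "2 \<in> F" using Fc(3)[OF Fc(2) Fc(2)] by simp
    then have "- (2 * Re z) \<in> F" using zF by (intro Fc(4) Fc(5))
    moreover have "(Re z)\<^sup>2 + (Im z)\<^sup>2 \<in> F" unfolding power2_eq_square using zF by (intro Fc(3) Fc(4))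
    ultimately have "coeff c i \<in> F" for i unfolding c_def using Fc(1,2) by (auto simp: coeff_pCons split: nat.split)
    then obtain q r where qr: "\<forall>i. coeff q i \<in> F" "p = c * q + r" "r = 0 \<or> degree r < degree c"
      using F_division[OF less.prems(2), of c] unfolding c_def by auto
    have "degree r \<le> 1" using qr(3) by (auto simp: c_def)
    have "r = [:coeff r 0, coeff r 1:]"
    proof (rule poly_eqI)
      fix n show "coeff r n = coeff [:coeff r 0, coeff r 1:] n"
        using \<open>degree r \<le> 1\<close> by (auto simp: coeff_pCons coeff_eq_0 split: nat.split)
    qed
    then obtain u v where uv: "r = [:u, v:]" by blast
    define C where "C = map_poly complex_of_real c"
    have "P = C * map_poly of_real q + map_poly of_real r"
      unfolding P_def C_def qr(2) by (rule poly_eqI) (simp add: coeff_map_poly coeff_mult)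
    moreover have "poly C z = 0"
    proof -
      have "C = [:of_real ((Re z)\<^sup>2 + (Im z)\<^sup>2), of_real (- (2 * Re z)), 1:]"
        unfolding C_def c_def by (simp add: map_poly_pCons)
      then show ?thesis by (simp add: complex_eq_iff power2_eq_square algebra_simps)
    qed
    moreover have "map_poly complex_of_real r = [:of_real u, of_real v:]" unfolding uv by (simp add: map_poly_pCons)
    ultimately have "of_real u + z * of_real v = 0" using z(2) by simp
    then have "v = 0 \<and> u = 0" using False by (auto simp: complex_eq_iff)
    then have p: "p = c * q" using qr(2) uv by simp
    have "poly c x = (x - Re z)\<^sup>2 + (Im z)\<^sup>2" unfolding c_def by (simp add: power2_eq_square algebra_simps)
    moreover have "(Im z)\<^sup>2 > 0" using False by simp
    ultimately have "poly c x \<noteq> 0" by (metis add_nonneg_pos less_irrefl zero_le_power2)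
    then have "poly q x = 0" using less.prems(3) p by simp
    moreover have "q \<noteq> 0" using p less.prems(1) by auto
    moreover from this have "degree q < degree p" unfolding p by (subst degree_mult_eq) (auto simp: c_def)
    ultimately show ?thesis using less.hyps[of q] qr(1) by blast
  qed
qed

text \<open>With this, a real closed field is the closure of any of its maximal independent lists,
  so that the abstract closure describes it completely.\<close>

lemma cl_rcf_set: assumes "S \<subseteq> F" shows "cl S \<subseteq> F"
proof
  fix y assume "y \<in> cl S"
  then obtain p where p: "p \<noteq> 0" "\<forall>i. coeff p i \<in> rg S" "poly p y = 0" unfolding cl_def algb_def by blast
  have "coeff p i \<in> F" for i using p(2) rg_least[OF _ F_sfield assms] by blast
  then show "y \<in> F" using rcf_set_root p by blast
qed

end

section \<open>Transcendence degree\<close>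

definition mv :: "nat list \<Rightarrow> real list \<Rightarrow> real" where
  "mv e rs = (\<Prod>t<length rs. rs ! t ^ (e ! t))"

definition rps :: "(int \<times> nat list) list \<Rightarrow> real list \<Rightarrow> real" where
  "rps ps rs = (\<Sum>p\<leftarrow>ps. of_int (fst p) * mv (snd p) rs)"

lemma mv_Cons: "mv (k # e) (r # rs) = r ^ k * mv e rs"
  unfolding mv_def length_Cons prod.lessThan_Suc_shift by simp

lemma mv_snoc: "length e = length rs \<Longrightarrow> mv (e @ [j]) (rs @ [r]) = mv e rs * r ^ j"
proof -
  assume l: "length e = length rs"
  have "(\<Prod>t<length rs. (rs @ [r]) ! t ^ ((e @ [j]) ! t)) = (\<Prod>t<length rs. rs ! t ^ (e ! t))"
    using l by (intro prod.cong) (auto simp: nth_append)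
  then show ?thesis unfolding mv_def using l by (simp add: nth_append)
qed

lemma emb_pow_el: "emb A h \<Longrightarrow> x \<in> s_carrier A \<Longrightarrow> pow_el A x k \<in> s_carrier A \<and> h (pow_el A x k) = h x ^ k"
  by (induction k) (auto simp: emb_def wf_str_def)

lemma emb_mono_el:
  assumes e: "emb A h" and "length es = length xs" "set xs \<subseteq> s_carrier A"
  shows "mono_el A es xs \<in> s_carrier A \<and> h (mono_el A es xs) = mv es (map h xs)"
  using assms(2,3)
proof (induction es xs rule: list_induct2)
  case Nil
  then show ?case using e by (simp add: mono_el_def mv_def emb_def wf_str_def)
next
  case (Cons k es x xs)
  have 1: "mono_el A (k # es) (x # xs) = s_mul A (pow_el A x k) (mono_el A es xs)"
    by (simp add: mono_el_def)
  have 2: "pow_el A x k \<in> s_carrier A \<and> h (pow_el A x k) = h x ^ k" using emb_pow_el[OF e] Cons.prems by simp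
  have 3: "mono_el A es xs \<in> s_carrier A \<and> h (mono_el A es xs) = mv es (map h xs)" using Cons by simp
  show ?case unfolding 1 using 2 3 e by (simp add: mv_Cons emb_def wf_str_def)
qed

lemma emb_int_el: "emb A h \<Longrightarrow> int_el A k \<in> s_carrier A \<and> h (int_el A k) = of_int k"
  using emb_nat_el[of A h "nat k"] emb_nat_el[of A h "nat (- k)"]
  by (auto simp: int_el_def emb_def wf_str_def)

lemma emb_peval:
  assumes e: "emb A h" and "\<forall>p\<in>set ps. length (snd p) = length xs" "set xs \<subseteq> s_carrier A"
  shows "peval A ps xs \<in> s_carrier A \<and> h (peval A ps xs) = rps ps (map h xs)"
  using assms(2)
proof (induction ps)
  case Nil
  then show ?case using e by (simp add: peval_def rps_def emb_def wf_str_def)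
next
  case (Cons p ps)
  obtain c es where p: "p = (c, es)" by force
  have 1: "peval A (p # ps) xs = s_add A (s_mul A (int_el A c) (mono_el A es xs)) (peval A ps xs)"
    by (simp add: peval_def p)
  have 2: "mono_el A es xs \<in> s_carrier A \<and> h (mono_el A es xs) = mv es (map h xs)"
    using emb_mono_el[OF e] Cons.prems assms(3) p by simp
  have 3: "peval A ps xs \<in> s_carrier A \<and> h (peval A ps xs) = rps ps (map h xs)" using Cons by simp
  have 4: "int_el A c \<in> s_carrier A \<and> h (int_el A c) = of_int c" by (rule emb_int_el[OF e])
  have cl: "x \<in> s_carrier A \<Longrightarrow> y \<in> s_carrier A \<Longrightarrow> s_add A x y \<in> s_carrier A \<and> s_mul A x y \<in> s_carrier A
      \<and> h (s_add A x y) = h x + h y \<and> h (s_mul A x y) = h x * h y" for x y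
    using e by (simp add: emb_def wf_str_def)
  have 5: "s_mul A (int_el A c) (mono_el A es xs) \<in> s_carrier A"
    "h (s_mul A (int_el A c) (mono_el A es xs)) = of_int c * mv es (map h xs)"
    using cl[of "int_el A c" "mono_el A es xs"] 2 4 by auto
  show ?case unfolding 1 using cl[OF 5(1), of "peval A ps xs"] 3 5(2) by (simp add: rps_def p)
qed

lemma rg_of_int: "of_int k \<in> rg S"
proof -
  have n: "of_nat n \<in> rg S" for n by (induction n) (auto intro: rg_zero rg_one rg_add)
  show ?thesis using n[of "nat k"] rg_neg[OF n[of "nat (- k)"]] by (cases "k \<ge> 0") auto
qed

lemma mv_rg: assumes "set rs \<subseteq> S" shows "mv e rs \<in> rg S"
proof -
  have pw: "x ^ k \<in> rg S" if "x \<in> rg S" for x and k :: nat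
    using that by (induction k) (auto intro: rg_one rg_mul)
  have "(\<Prod>t\<in>T. rs ! t ^ (e ! t)) \<in> rg S" if "finite T" "T \<subseteq> {..<length rs}" for T
    using that
  proof (induction T rule: finite_induct)
    case (insert t T)
    then have "rs ! t \<in> S" using assms by auto
    then show ?case using insert pw[OF rg_base] by (auto intro: rg_mul)
  qed (simp add: rg_one)
  then show ?thesis unfolding mv_def by simp
qed

lemma rps_rg: "set rs \<subseteq> S \<Longrightarrow> rps ps rs \<in> rg S"
  unfolding rps_def by (induction ps) (auto intro: rg_zero rg_add rg_mul rg_of_int mv_rg)

text \<open>The coefficient of the \<open>j\<close>-th power of the last variable, as a polynomial
  in the others.\<close>

definition sub :: "nat \<Rightarrow> (int \<times> nat list) list \<Rightarrow> (int \<times> nat list) list" where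
  "sub j ps = map (\<lambda>p. (fst p, butlast (snd p))) (filter (\<lambda>p. last (snd p) = j) ps)"

lemma rps_snoc:
  assumes "\<forall>p\<in>set ps. length (snd p) = Suc (length rs)" "\<forall>p\<in>set ps. last (snd p) \<le> N"
  shows "rps ps (rs @ [r]) = (\<Sum>j\<le>N. rps (sub j ps) rs * r ^ j)"
  using assms
proof (induction ps)
  case Nil then show ?case by (simp add: rps_def sub_def)
next
  case (Cons p ps)
  define j0 where "j0 = last (snd p)"
  define m where "m = of_int (fst p) * mv (butlast (snd p)) rs"
  have ne: "snd p \<noteq> []" using Cons.prems(1) by auto
  have e: "snd p = butlast (snd p) @ [j0]" unfolding j0_def using ne by simp
  have "mv (snd p) (rs @ [r]) = mv (butlast (snd p)) rs * r ^ j0"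
    by (subst e) (rule mv_snoc, use Cons.prems(1) in simp)
  then have 1: "rps (p # ps) (rs @ [r]) = m * r ^ j0 + rps ps (rs @ [r])" by (simp add: rps_def m_def)
  have 2: "rps (sub j (p # ps)) rs = (if j = j0 then m else 0) + rps (sub j ps) rs" for j
    by (auto simp: rps_def sub_def m_def j0_def)
  have "(\<Sum>j\<le>N. rps (sub j (p # ps)) rs * r ^ j) = (\<Sum>j\<le>N. (if j = j0 then m * r ^ j else 0)) + (\<Sum>j\<le>N. rps (sub j ps) rs * r ^ j)"
    unfolding 2 sum.distrib[symmetric] by (intro sum.cong) (auto simp: distrib_right)
  also have "(\<Sum>j\<le>N. (if j = j0 then m * r ^ j else 0)) = m * r ^ j0" using Cons.prems(2) by (simp add: j0_def)
  finally show ?case using 1 Cons by simp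
qed

lemma nonzero_poly_iff: "nonzero_poly n ps \<longleftrightarrow> distinct (map snd ps) \<and> (\<forall>p\<in>set ps. length (snd p) = n) \<and> (\<exists>p\<in>set ps. fst p \<noteq> 0)"
  unfolding nonzero_poly_def by (auto simp: case_prod_beta)

lemma cl_indep_butlast: "cl_indep (rs @ [r]) \<Longrightarrow> cl_indep rs \<and> r \<notin> cl (set rs)"
proof -
  assume a: "cl_indep (rs @ [r])"
  have "rs ! i \<notin> cl (set (take i rs))" if "i < length rs" for i
    using a[unfolded cl_indep_def, rule_format, of i] that by (simp add: nth_append)
  moreover have "r \<notin> cl (set rs)" using a[unfolded cl_indep_def, rule_format, of "length rs"] by simp
  ultimately show ?thesis unfolding cl_indep_def by blast
qed

text \<open>Seen as a polynomial in the last variable, \<open>ps\<close> has a coefficient that is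
  nonzero by induction; the last number is transcendental over the others.\<close>

lemma rps_nonzero: "cl_indep rs \<Longrightarrow> nonzero_poly (length rs) ps \<Longrightarrow> rps ps rs \<noteq> 0"
proof (induction rs arbitrary: ps rule: rev_induct)
  case Nil
  then have d: "distinct (map snd ps)" "\<forall>p\<in>set ps. snd p = []" "\<exists>p\<in>set ps. fst p \<noteq> 0"
    unfolding nonzero_poly_iff by auto
  obtain p ps' where ps: "ps = p # ps'" using d(3) by (cases ps) auto
  have "ps' = []" using d(1,2) ps by (cases ps') auto
  then show ?case using d ps by (simp add: rps_def mv_def)
next
  case (snoc r rs)
  have ind: "cl_indep rs" "r \<notin> cl (set rs)" using cl_indep_butlast[OF snoc.prems(1)] by auto
  have d: "distinct (map snd ps)" "\<forall>p\<in>set ps. length (snd p) = Suc (length rs)" "\<exists>p\<in>set ps. fst p \<noteq> 0"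
    using snoc.prems(2) unfolding nonzero_poly_iff by auto
  define N where "N = Max (insert 0 ((\<lambda>p. last (snd p)) ` set ps))"
  have N: "\<forall>p\<in>set ps. last (snd p) \<le> N" unfolding N_def by auto
  obtain p0 where p0: "p0 \<in> set ps" "fst p0 \<noteq> 0" using d(3) by blast
  define j where "j = last (snd p0)"
  have "nonzero_poly (length rs) (sub j ps)"
    unfolding nonzero_poly_iff
  proof (intro conjI)
    have "distinct ps" using d(1) by (simp add: distinct_map)
    moreover have "inj_on (\<lambda>p. butlast (snd p)) (set (filter (\<lambda>p. last (snd p) = j) ps))"
    proof (rule inj_onI)
      fix p q assume pq: "p \<in> set (filter (\<lambda>p. last (snd p) = j) ps)" "q \<in> set (filter (\<lambda>p. last (snd p) = j) ps)"
        "butlast (snd p) = butlast (snd q)"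
      have "snd p \<noteq> []" "snd q \<noteq> []" using pq d(2) by auto
      moreover have "last (snd p) = last (snd q)" using pq by simp
      ultimately have "snd p = snd q" using pq(3) by (metis append_butlast_last_id)
      then show "p = q" using d(1) pq by (simp add: distinct_map inj_on_def)
    qed
    ultimately show "distinct (map snd (sub j ps))" unfolding sub_def by (simp add: distinct_map comp_def)
    show "\<forall>p\<in>set (sub j ps). length (snd p) = length rs" unfolding sub_def using d(2) by auto
    show "\<exists>p\<in>set (sub j ps). fst p \<noteq> 0" 
      by (rule bexI[of _ "(fst p0, butlast (snd p0))"]) (use p0 in \<open>auto simp: sub_def j_def intro!: image_eqI[of _ _ p0]\<close>)
  qed
  then have nz: "rps (sub j ps) rs \<noteq> 0" using snoc.IH ind(1) by blast
  define P where "P = (\<Sum>i\<le>N. monom (rps (sub i ps) rs) i)"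
  have cP: "coeff P i = (if i \<le> N then rps (sub i ps) rs else 0)" for i unfolding P_def by (simp add: coeff_sum)
  have "j \<le> N" using N p0 j_def by blast
  then have "P \<noteq> 0" using nz cP[of j] by auto
  moreover have "coeff P i \<in> rg (set rs)" for i unfolding cP using rps_rg[of rs "set rs"] rg_zero by simp
  ultimately have "poly P r \<noteq> 0" using ind(2) unfolding cl_def algb_def by blast
  moreover have "rps ps (rs @ [r]) = poly P r"
    unfolding rps_snoc[OF d(2) N] P_def by (simp add: poly_sum poly_monom)
  ultimately show ?case by simp
qed

text \<open>\<open>x\<close> as an integer polynomial in the first \<open>i\<close> numbers;
  exponent vectors are padded with zeros to full length, so that adjoining a variable changes only
  entry \<open>i\<close>.\<close>

definition repr :: "real list \<Rightarrow> nat \<Rightarrow> real \<Rightarrow> nat list set \<Rightarrow> (nat list \<Rightarrow> int) \<Rightarrow> bool" where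
  "repr rs i x E C \<longleftrightarrow> finite E \<and> (\<forall>e\<in>E. length e = length rs \<and> (\<forall>t. i \<le> t \<and> t < length rs \<longrightarrow> e ! t = 0))
     \<and> x = (\<Sum>e\<in>E. of_int (C e) * mv e rs)"

lemma mv_update:
  assumes "length e = length rs" "i < length rs" "e ! i = 0"
  shows "mv (e[i := j]) rs = mv e rs * (rs ! i) ^ j"
proof -
  have "mv (e[i := j]) rs = (\<Prod>t<length rs. rs ! t ^ (e ! t) * (if t = i then (rs ! i) ^ j else 1))"
    unfolding mv_def using assms by (intro prod.cong) (auto simp: nth_list_update)
  also have "\<dots> = mv e rs * (\<Prod>t<length rs. if t = i then (rs ! i) ^ j else 1)"
    unfolding mv_def by (rule prod.distrib)
  also have "(\<Prod>t<length rs. if t = i then (rs ! i) ^ j else 1) = (rs ! i) ^ j" using assms(2) by simp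
  finally show ?thesis .
qed

text \<open>Multiplication by the \<open>j\<close>-th power of the new number writes
  \<open>j\<close> into entry \<open>i\<close>. The supports for different \<open>j\<close> are
  disjoint, so nothing cancels and a nonzero coefficient survives.\<close>

lemma repr_poly:
  assumes i: "i < length rs" and c: "\<And>j. j \<le> d \<Longrightarrow> repr rs i (c j) (E j) (C j)"
  shows "\<exists>E' C'. repr rs (Suc i) (\<Sum>j\<le>d. c j * (rs ! i) ^ j) E' C' \<and> ((\<exists>j\<le>d. c j \<noteq> 0) \<longrightarrow> (\<exists>e\<in>E'. C' e \<noteq> 0))"
proof -
  define U where "U j = (\<lambda>e. e[i := j]) ` E j" for j
  define E' where "E' = (\<Union>j\<le>d. U j)"
  \<comment> \<open>Entry \<open>i\<close> tells from which coefficient of the outer polynomial the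
    monomial comes.\<close>
  define C' where "C' e = C (e ! i) (e[i := 0])" for e
  have Ej: "finite (E j)" "\<And>e. e \<in> E j \<Longrightarrow> length e = length rs" "\<And>e. e \<in> E j \<Longrightarrow> e ! i = 0"
    "\<And>e t. e \<in> E j \<Longrightarrow> i \<le> t \<Longrightarrow> t < length rs \<Longrightarrow> e ! t = 0"
    "c j = (\<Sum>e\<in>E j. of_int (C j e) * mv e rs)" if "j \<le> d" for j
    using c[OF that] i unfolding repr_def by auto
  have Ui: "e ! i = j" if "e \<in> U j" "j \<le> d" for e j using that Ej(2)[OF that(2)] i unfolding U_def by auto
  have C'U: "C' (e[i := j]) = C j e" if "e \<in> E j" "j \<le> d" for e j
    unfolding C'_def using Ej(2)[OF that(2,1)] Ej(3)[OF that(2,1)] i list_update_id[of e i] by simp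
  have inj: "inj_on (\<lambda>e. e[i := j]) (E j)" if "j \<le> d" for j
  proof (rule inj_onI)
    fix e f assume ef: "e \<in> E j" "f \<in> E j" "e[i := j] = f[i := j]"
    then have "(e[i := j])[i := 0] = (f[i := j])[i := 0]" by simp
    then show "e = f" using Ej(3)[OF that ef(1)] Ej(3)[OF that ef(2)] by (metis list_update_id list_update_overwrite)
  qed
  have s1: "(\<Sum>e\<in>U j. of_int (C' e) * mv e rs) = c j * (rs ! i) ^ j" if j: "j \<le> d" for j
  proof -
    have "(\<Sum>e\<in>U j. of_int (C' e) * mv e rs) = (\<Sum>e\<in>E j. of_int (C' (e[i := j])) * mv (e[i := j]) rs)"
      unfolding U_def by (subst sum.reindex[OF inj[OF j]]) simp
    also have "\<dots> = (\<Sum>e\<in>E j. of_int (C j e) * mv e rs * (rs ! i) ^ j)"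
      using C'U[OF _ j] mv_update[OF Ej(2)[OF j] i Ej(3)[OF j]] by (intro sum.cong) auto
    also have "\<dots> = c j * (rs ! i) ^ j" unfolding Ej(5)[OF j] by (simp add: sum_distrib_right)
    finally show ?thesis .
  qed
  have "(\<Sum>e\<in>E'. of_int (C' e) * mv e rs) = (\<Sum>j\<le>d. \<Sum>e\<in>U j. of_int (C' e) * mv e rs)"
    unfolding E'_def
  proof (rule sum.UNION_disjoint)
    show "\<forall>j\<in>{..d}. finite (U j)" unfolding U_def using Ej(1) by simp
    show "\<forall>j\<in>{..d}. \<forall>k\<in>{..d}. j \<noteq> k \<longrightarrow> U j \<inter> U k = {}"
    proof (intro ballI impI)
      fix j k assume jk: "j \<in> {..d}" "k \<in> {..d}" "j \<noteq> k"
      then show "U j \<inter> U k = {}" using Ui[of _ j] Ui[of _ k] by auto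
    qed
  qed simp
  also have "\<dots> = (\<Sum>j\<le>d. c j * (rs ! i) ^ j)" using s1 by simp
  finally have "repr rs (Suc i) (\<Sum>j\<le>d. c j * (rs ! i) ^ j) E' C'"
    unfolding repr_def E'_def U_def using Ej(1,2,4) by (auto simp: nth_list_update)
  moreover have "\<exists>e\<in>E'. C' e \<noteq> 0" if "\<exists>j\<le>d. c j \<noteq> 0"
  proof -
    obtain j where j: "j \<le> d" "c j \<noteq> 0" using \<open>\<exists>j\<le>d. c j \<noteq> 0\<close> by blast
    have "\<exists>e\<in>E j. of_int (C j e) * mv e rs \<noteq> 0"
    proof (rule ccontr)
      assume "\<not> ?thesis"
      then have "c j = 0" unfolding Ej(5)[OF j(1)] by (intro sum.neutral) simp
      then show False using j by simp
    qed
    then obtain e where e: "e \<in> E j" "C j e \<noteq> 0" by auto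
    have "e[i := j] \<in> E'" unfolding E'_def U_def using e j by auto
    then show ?thesis using C'U[OF e(1) j(1)] e(2) by (intro bexI[of _ "e[i := j]"]) simp_all
  qed
  ultimately show ?thesis by blast
qed

lemma repr_rg: "i \<le> length rs \<Longrightarrow> x \<in> rg (set (take i rs)) \<Longrightarrow> \<exists>E C. repr rs i x E C"
proof (induction i arbitrary: x)
  case 0
  have "\<exists>k. x = of_int k" if "x \<in> rg {}" for x
    using that
  proof (induction rule: rg.induct)
    case rg_one show ?case by (intro exI[of _ 1]) simp
  next
    case (rg_neg x) then show ?case by (metis of_int_minus)
  next
    case (rg_add x y) then show ?case by (metis of_int_add)
  next
    case (rg_mul x y) then show ?case by (metis of_int_mult)
  qed simp
  then obtain k where "x = of_int k" using 0 by auto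
  then show ?case unfolding repr_def
    by (intro exI[of _ "{replicate (length rs) 0}"] exI[of _ "\<lambda>_. k"]) (auto simp: mv_def)
next
  case (Suc i)
  have "set (take (Suc i) rs) = insert (rs ! i) (set (take i rs))" using Suc.prems(1) by (simp add: take_Suc_conv_app_nth)
  then obtain q where q: "\<forall>j. coeff q j \<in> rg (set (take i rs))" "x = poly q (rs ! i)"
    using rg_insert[of x "rs ! i" "set (take i rs)"] Suc.prems(2) by auto
  have "\<forall>j. \<exists>E C. repr rs i (coeff q j) E C" using Suc.IH Suc.prems(1) q(1) by simp
  then obtain E C where "\<And>j. repr rs i (coeff q j) (E j) (C j)" by metis
  then show ?case unfolding q(2) poly_altdef
    using repr_poly[of i rs "degree q" "coeff q" E C] Suc.prems(1) by auto
qed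

lemma not_cl_indep_poly:
  assumes "\<not> cl_indep rs" shows "\<exists>ps. nonzero_poly (length rs) ps \<and> rps ps rs = 0"
proof -
  obtain i where i: "i < length rs" "rs ! i \<in> cl (set (take i rs))" using assms unfolding cl_indep_def by blast
  obtain p where p: "p \<noteq> 0" "\<forall>j. coeff p j \<in> rg (set (take i rs))" "poly p (rs ! i) = 0"
    using i(2) unfolding cl_def algb_def by blast
  have "\<forall>j. \<exists>E C. repr rs i (coeff p j) E C" using repr_rg i(1) p(2) by simp
  then obtain E C where "\<And>j. repr rs i (coeff p j) (E j) (C j)" by metis
  then obtain E' C' where E': "repr rs (Suc i) (\<Sum>j\<le>degree p. coeff p j * (rs ! i) ^ j) E' C'"
    "(\<exists>j\<le>degree p. coeff p j \<noteq> 0) \<longrightarrow> (\<exists>e\<in>E'. C' e \<noteq> 0)"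
    using repr_poly[OF i(1), of "degree p" "coeff p" E C] by blast
  have "coeff p (degree p) \<noteq> 0" using p(1) by simp
  then have nz: "\<exists>e\<in>E'. C' e \<noteq> 0" using E'(2) by blast
  have fin: "finite E'" and len: "\<forall>e\<in>E'. length e = length rs"
    and sum: "(\<Sum>e\<in>E'. of_int (C' e) * mv e rs) = 0"
    using E'(1) p(3) unfolding repr_def poly_altdef by auto
  obtain es where es: "set es = E'" "distinct es" using finite_distinct_list[OF fin] by blast
  define ps where "ps = map (\<lambda>e. (C' e, e)) es"
  have "nonzero_poly (length rs) ps" unfolding nonzero_poly_iff ps_def
    using es nz len by (auto simp: comp_def)
  moreover have "rps ps rs = 0"
    unfolding rps_def ps_def using sum es by (simp add: comp_def sum_list_distinct_conv_sum_set)
  ultimately show ?thesis by blast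
qed

lemma cl_indep_distinct: "cl_indep ys \<Longrightarrow> distinct ys"
proof (induction ys rule: rev_induct)
  case (snoc y ys)
  have a: "cl_indep ys \<and> y \<notin> cl (set ys)" by (rule cl_indep_butlast[OF snoc.prems])
  then have "y \<notin> set ys" using cl_incl[of "set ys"] by blast
  then show ?case using snoc.IH a by simp
qed simp

text \<open>Independence by integer polynomials does not depend on the order of the list,
  independence by successive closures apparently does; the two directions pass through
  \<open>rps_nonzero\<close> and \<open>not_cl_indep_poly\<close>.\<close>

lemma alg_indep_iff:
  assumes e: "emb A h" and xs: "set xs \<subseteq> s_carrier A"
  shows "alg_indep A xs \<longleftrightarrow> cl_indep (map h xs)"
proof -
  have inj: "inj_on h (s_carrier A)" and z: "h (s_zero A) = 0" "s_zero A \<in> s_carrier A"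
    using e unfolding emb_def wf_str_def by auto
  have pe: "peval A ps xs = s_zero A \<longleftrightarrow> rps ps (map h xs) = 0" if "nonzero_poly (length xs) ps" for ps
  proof -
    have a: "peval A ps xs \<in> s_carrier A" "h (peval A ps xs) = rps ps (map h xs)"
      using emb_peval[OF e _ xs, of ps] that unfolding nonzero_poly_iff by auto
    show ?thesis
    proof
      assume "rps ps (map h xs) = 0"
      then show "peval A ps xs = s_zero A" using a z by (intro inj_onD[OF inj]) auto
    qed (use a z in auto)
  qed
  show ?thesis
  proof
    assume a: "alg_indep A xs"
    show "cl_indep (map h xs)"
    proof (rule ccontr)
      assume "\<not> cl_indep (map h xs)"
      then obtain ps where "nonzero_poly (length xs) ps" "rps ps (map h xs) = 0"
        using not_cl_indep_poly[of "map h xs"] by auto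
      then show False using a pe unfolding alg_indep_def by blast
    qed
  next
    assume c: "cl_indep (map h xs)"
    have "distinct xs" using cl_indep_distinct[OF c] by (simp add: distinct_map)
    moreover have "peval A ps xs \<noteq> s_zero A" if "nonzero_poly (length xs) ps" for ps
      using rps_nonzero[OF c, of ps] that pe by simp
    ultimately show "alg_indep A xs" unfolding alg_indep_def using xs by blast
  qed
qed

context
  fixes A h assumes e: "emb A h" and r: "arch_rcf A"
begin

abbreviation FA where "FA \<equiv> h ` s_carrier A"

lemma cl_FA: "S \<subseteq> FA \<Longrightarrow> cl S \<subseteq> FA"
  by (rule cl_rcf_set[OF rcf_set_emb[OF e r]])

lemma trdeg_ge: assumes ys: "set ys \<subseteq> FA" "cl_indep ys" shows "enat (length ys) \<le> trdeg A"
proof -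
  define xs where "xs = map (inv_into (s_carrier A) h) ys"
  have im: "y \<in> FA" if "y \<in> set ys" for y using ys(1) that by blast
  have xs: "map h xs = ys" "set xs \<subseteq> s_carrier A"
    unfolding xs_def using f_inv_into_f[OF im] inv_into_into[OF im] by (auto intro!: map_idI)
  have "alg_indep A xs" using alg_indep_iff[OF e xs(2)] xs(1) ys(2) by simp
  moreover have "length xs = length ys" unfolding xs_def by simp
  ultimately show ?thesis unfolding trdeg_def by (intro Sup_upper) (metis (mono_tags, lifting) CollectI)
qed

lemma trdeg_le: assumes "\<And>ys. set ys \<subseteq> FA \<Longrightarrow> cl_indep ys \<Longrightarrow> length ys \<le> n" shows "trdeg A \<le> enat n"
  unfolding trdeg_def
proof (rule Sup_least)
  fix k assume "k \<in> {enat (length xs) |xs. alg_indep A xs}"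
  then obtain xs where xs: "k = enat (length xs)" "alg_indep A xs" by blast
  have c: "set xs \<subseteq> s_carrier A" using xs(2) unfolding alg_indep_def by blast
  have "length (map h xs) \<le> n" using c alg_indep_iff[OF e c] xs(2) by (intro assms) auto
  then show "k \<le> enat n" using xs(1) by simp
qed

lemma trdeg_zero: assumes "trdeg A = 0" shows "FA = cl {}"
proof
  show "cl {} \<subseteq> FA" by (rule cl_FA) simp
  show "FA \<subseteq> cl {}"
  proof
    fix y assume y: "y \<in> FA"
    show "y \<in> cl {}"
    proof (rule ccontr)
      assume "y \<notin> cl {}"
      then have "cl_indep [y]" unfolding cl_indep_def by simp
      from trdeg_ge[OF _ this] y assms show False by (simp add: enat_0_iff)
    qed
  qed
qed

text \<open>An independent list of greatest length generates, since any element outside its closure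
  could be appended.\<close>

lemma trdeg_finite: assumes "trdeg A \<noteq> \<infinity>" "trdeg A \<noteq> 0"
  shows "\<exists>xs. xs \<noteq> [] \<and> set xs \<subseteq> FA \<and> cl_indep xs \<and> FA = cl (set xs)
    \<and> (\<forall>ys. set ys \<subseteq> FA \<longrightarrow> cl_indep ys \<longrightarrow> length ys \<le> length xs)"
proof -
  obtain n where n: "trdeg A = enat n" using assms(1) by auto
  define P where "P xs \<longleftrightarrow> set xs \<subseteq> FA \<and> cl_indep xs" for xs
  have P0: "P []" unfolding P_def cl_indep_def by simp
  have bound: "\<forall>ys. P ys \<longrightarrow> length ys \<le> n" using trdeg_ge n unfolding P_def by force
  obtain xs where xs: "P xs" "\<forall>ys. P ys \<longrightarrow> length ys \<le> length xs"
    using ex_has_greatest_nat[of P "[]" length "Suc n", OF P0] bound by (metis le_imp_less_Suc)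
  have "xs \<noteq> []"
  proof
    assume "xs = []"
    then have "trdeg A \<le> enat 0" using xs(2) unfolding P_def by (intro trdeg_le) auto
    then show False using assms(2) by (simp add: enat_0 flip: zero_enat_def)
  qed
  moreover have "FA = cl (set xs)"
  proof
    show "cl (set xs) \<subseteq> FA" using xs(1) unfolding P_def by (intro cl_FA) simp
    show "FA \<subseteq> cl (set xs)"
    proof
      fix y assume y: "y \<in> FA"
      show "y \<in> cl (set xs)"
      proof (rule ccontr)
        assume ny: "y \<notin> cl (set xs)"
        have "cl_indep (xs @ [y])" unfolding cl_indep_def
        proof (intro allI impI)
          fix i assume "i < length (xs @ [y])"
          then consider "i < length xs" | "i = length xs" by force
          then show "(xs @ [y]) ! i \<notin> cl (set (take i (xs @ [y])))"
            using xs(1) ny unfolding P_def cl_indep_def by cases (auto simp: nth_append)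
        qed
        then have "P (xs @ [y])" using xs(1) y unfolding P_def by simp
        then show False using xs(2) by fastforce
      qed
    qed
  qed
  ultimately show ?thesis using xs unfolding P_def by blast
qed

lemma trdeg_infinite: assumes "trdeg A = \<infinity>" "finite X" shows "FA \<noteq> cl X"
proof
  assume "FA = cl X"
  then have "trdeg A \<le> enat (card X)" using cl_indep_length[OF assms(2)] by (intro trdeg_le) auto
  then show False using assms(1) by simp
qed

end

section \<open>Rational ball arithmetic\<close>

text \<open>The triple \<open>(p, n, d)\<close> stands for \<open>(p - n) / (d + 1)\<close>. Every
  triple of natural numbers is legitimate, so the type is bijectively coded and needs neither signs
  nor a side condition on denominators.\<close>

type_synonym q = "nat \<times> nat \<times> nat"

definition qv :: "q \<Rightarrow> real" where
  "qv r = (real (fst r) - real (fst (snd r))) / (real (snd (snd r)) + 1)"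

text \<open>The last component is the product of the denominators minus 1, expanded to avoid
  subtraction.\<close>

definition qadd :: "q \<Rightarrow> q \<Rightarrow> q" where
  "qadd a b = (fst a * Suc (snd (snd b)) + fst b * Suc (snd (snd a)),
     fst (snd a) * Suc (snd (snd b)) + fst (snd b) * Suc (snd (snd a)),
     snd (snd a) * snd (snd b) + snd (snd a) + snd (snd b))"

definition qmul :: "q \<Rightarrow> q \<Rightarrow> q" where
  "qmul a b = (fst a * fst b + fst (snd a) * fst (snd b), fst a * fst (snd b) + fst (snd a) * fst b,
     snd (snd a) * snd (snd b) + snd (snd a) + snd (snd b))"

definition qneg :: "q \<Rightarrow> q" where "qneg a = (fst (snd a), fst a, snd (snd a))"

definition qabs :: "q \<Rightarrow> q" where "qabs a = (if fst a < fst (snd a) then qneg a else a)"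

definition qlt :: "q \<Rightarrow> q \<Rightarrow> bool" where
  "qlt a b \<longleftrightarrow> fst a * Suc (snd (snd b)) + fst (snd b) * Suc (snd (snd a))
     < fst b * Suc (snd (snd a)) + fst (snd a) * Suc (snd (snd b))"

definition qn :: "nat \<Rightarrow> q" where "qn k = (k, 0, 0)"

lemma qv_qadd [simp]: "qv (qadd a b) = qv a + qv b"
proof -
  define A B x y where "A = real (snd (snd a)) + 1" and "B = real (snd (snd b)) + 1"
    and "x = real (fst a) - real (fst (snd a))" and "y = real (fst b) - real (fst (snd b))"
  have nz: "A \<noteq> 0" "B \<noteq> 0" unfolding A_def B_def by linarith+
  have d: "real (snd (snd a) * snd (snd b) + snd (snd a) + snd (snd b)) + 1 = A * B"
    unfolding A_def B_def by (simp add: algebra_simps)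
  have n: "real (fst a * Suc (snd (snd b)) + fst b * Suc (snd (snd a)))
      - real (fst (snd a) * Suc (snd (snd b)) + fst (snd b) * Suc (snd (snd a))) = x * B + y * A"
    unfolding A_def B_def x_def y_def by (simp add: algebra_simps)
  have "qv (qadd a b) = (x * B + y * A) / (A * B)"
    unfolding qv_def qadd_def fst_conv snd_conv d n ..
  also have "\<dots> = x / A + y / B" using nz by (simp add: field_simps)
  finally show ?thesis unfolding qv_def A_def B_def x_def y_def .
qed

lemma qv_qmul [simp]: "qv (qmul a b) = qv a * qv b"
proof -
  have "real (snd (snd a) * snd (snd b) + snd (snd a) + snd (snd b)) + 1
      = (real (snd (snd a)) + 1) * (real (snd (snd b)) + 1)" by (simp add: algebra_simps)
  then show ?thesis unfolding qv_def qmul_def fst_conv snd_conv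
    by (simp only: times_divide_times_eq) (simp add: algebra_simps)
qed

lemma qv_qneg [simp]: "qv (qneg a) = - qv a"
  unfolding qv_def qneg_def fst_conv snd_conv by (simp add: minus_divide_left)

lemma qv_qabs [simp]: "qv (qabs a) = \<bar>qv a\<bar>"
proof -
  have p: "real (snd (snd a)) + 1 > 0" by linarith
  show ?thesis
  proof (cases "fst a < fst (snd a)")
    case True
    then have "real (fst a) - real (fst (snd a)) < 0" by simp
    then have "qv a < 0" unfolding qv_def using p by (simp only: divide_less_0_iff) simp
    then show ?thesis using True by (simp add: qabs_def)
  next
    case False
    then have "real (fst a) - real (fst (snd a)) \<ge> 0" by simp
    then have "qv a \<ge> 0" unfolding qv_def using p by (simp only: zero_le_divide_iff) simp
    then show ?thesis using False by (simp add: qabs_def)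
  qed
qed

lemma qlt_iff: "qlt a b \<longleftrightarrow> qv a < qv b"
proof -
  have p: "real (snd (snd a)) + 1 > 0" "real (snd (snd b)) + 1 > 0" by linarith+
  have "qlt a b \<longleftrightarrow> real (fst a * Suc (snd (snd b)) + fst (snd b) * Suc (snd (snd a)))
     < real (fst b * Suc (snd (snd a)) + fst (snd a) * Suc (snd (snd b)))"
    unfolding qlt_def of_nat_less_iff ..
  also have "\<dots> \<longleftrightarrow> (real (fst a) - real (fst (snd a))) * (real (snd (snd b)) + 1)
      < (real (fst b) - real (fst (snd b))) * (real (snd (snd a)) + 1)" by (simp add: algebra_simps)
  also have "\<dots> \<longleftrightarrow> qv a < qv b" unfolding qv_def using p by (simp add: divide_less_eq less_divide_eq)
  finally show ?thesis .
qed

lemma qv_qn [simp]: "qv (qn k) = real k"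
  by (simp add: qv_def qn_def)

lemma qv_dense: assumes "x < y" shows "\<exists>r. x < qv r \<and> qv r < y"
proof -
  obtain r where r: "r \<in> \<rat>" "x < r" "r < y" using Rats_dense_in_real[OF assms] by blast
  obtain i :: int and m :: nat where im: "r = real_of_int i / real m" "m > 0"
    using Rats_cases'[OF r(1)] by (metis of_nat_0_less_iff of_int_of_nat_eq zero_less_imp_eq_int)
  obtain p n :: nat where pn: "i = int p - int n" by (metis int_diff_cases)
  have "qv (p, n, m - 1) = r" using im pn by (simp add: qv_def of_nat_diff)
  then show ?thesis using r by metis
qed

lemma cmp_q [cmp_intros]:
  "cmp f \<Longrightarrow> cmp g \<Longrightarrow> cmp (\<lambda>x. qadd (f x) (g x))" "cmp f \<Longrightarrow> cmp g \<Longrightarrow> cmp (\<lambda>x. qmul (f x) (g x))"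
  "cmp f \<Longrightarrow> cmp (\<lambda>x. qneg (f x))" "cmp f \<Longrightarrow> cmp (\<lambda>x. qabs (f x))"
  "cmp f \<Longrightarrow> cmp g \<Longrightarrow> cmp (\<lambda>x. qlt (f x) (g x))" "cmp k \<Longrightarrow> cmp (\<lambda>x. qn (k x))"
  unfolding qadd_def qmul_def qneg_def qabs_def qlt_def qn_def by (intro cmp_intros; assumption)+

section \<open>Balls with rational midpoint and radius\<close>

type_synonym b = "q \<times> q"

definition inb :: "b \<Rightarrow> real \<Rightarrow> bool" where "inb B x \<longleftrightarrow> \<bar>x - qv (fst B)\<bar> \<le> qv (snd B)"

definition badd :: "b \<Rightarrow> b \<Rightarrow> b" where "badd A B = (qadd (fst A) (fst B), qadd (snd A) (snd B))"
definition bneg :: "b \<Rightarrow> b" where "bneg A = (qneg (fst A), snd A)"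
text \<open>The radius comes from
  \<open>x y - a b = a (y - b) + b (x - a) + (x - a) (y - b)\<close>.\<close>

definition bmul :: "b \<Rightarrow> b \<Rightarrow> b" where
  "bmul A B = (qmul (fst A) (fst B),
     qadd (qadd (qmul (qabs (fst A)) (snd B)) (qmul (qabs (fst B)) (snd A))) (qmul (snd A) (snd B)))"
definition bpos :: "b \<Rightarrow> bool" where "bpos A \<longleftrightarrow> qlt (snd A) (fst A)"

lemma inb_badd: "inb A x \<Longrightarrow> inb B y \<Longrightarrow> inb (badd A B) (x + y)"
  unfolding inb_def badd_def fst_conv snd_conv qv_qadd by linarith

lemma inb_bneg: "inb A x \<Longrightarrow> inb (bneg A) (- x)"
  unfolding inb_def bneg_def fst_conv snd_conv qv_qneg by linarith

lemma inb_bmul: assumes "inb A x" "inb B y" shows "inb (bmul A B) (x * y)"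
proof -
  define a b r s where "a = qv (fst A)" and "b = qv (fst B)" and "r = qv (snd A)" and "s = qv (snd B)"
  have x: "\<bar>x - a\<bar> \<le> r" and y: "\<bar>y - b\<bar> \<le> s" using assms by (simp_all add: inb_def a_def b_def r_def s_def)
  have "x * y - a * b = a * (y - b) + b * (x - a) + (x - a) * (y - b)" by (simp add: algebra_simps)
  then have "\<bar>x * y - a * b\<bar> \<le> \<bar>a * (y - b)\<bar> + \<bar>b * (x - a)\<bar> + \<bar>(x - a) * (y - b)\<bar>" by linarith
  also have "\<dots> \<le> \<bar>a\<bar> * s + \<bar>b\<bar> * r + r * s"
    unfolding abs_mult using x y by (intro add_mono mult_mono) auto
  finally show ?thesis by (simp add: inb_def bmul_def a_def b_def r_def s_def)
qed

lemma bpos_inb: "bpos B \<Longrightarrow> inb B x \<Longrightarrow> x > 0"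
  unfolding bpos_def inb_def qlt_iff by linarith

lemma cmp_b [cmp_intros]:
  "cmp f \<Longrightarrow> cmp g \<Longrightarrow> cmp (\<lambda>x. badd (f x) (g x))" "cmp f \<Longrightarrow> cmp g \<Longrightarrow> cmp (\<lambda>x. bmul (f x) (g x))"
  "cmp f \<Longrightarrow> cmp (\<lambda>x. bneg (f x))" "cmp f \<Longrightarrow> cmp (\<lambda>x. bpos (f x))"
  unfolding badd_def bmul_def bneg_def bpos_def by (intro cmp_intros; assumption)+

text \<open>Term codes double as integer polynomials in the variables \<open>x 0\<close>,
  \<open>x 1\<close> and so on. Leaves with an unknown tag count as 0, so every number has a
  value.\<close>

definition pv :: "(nat \<Rightarrow> real) \<Rightarrow> nat \<Rightarrow> real" where
  "pv x e = tfold (\<lambda>t r. if t = 0 then x r else if t = 2 then 1 else 0) uminus (+) times e"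

lemma pv_simps [simp]:
  "pv x (tvar i) = x i" "pv x tzero = 0" "pv x tone = 1" "pv x (tadd a b) = pv x a + pv x b"
  "pv x (tmul a b) = pv x a * pv x b" "pv x (tneg a) = - pv x a"
  unfolding pv_def by simp_all

lemma pv_leaf: "t \<notin> {3, 4, 5} \<Longrightarrow> pv x (prod_encode (t, r)) = (if t = 0 then x r else if t = 2 then 1 else 0)"
  unfolding pv_def by (simp add: tfold_leaf)

definition beval :: "(nat \<Rightarrow> b) \<Rightarrow> nat \<Rightarrow> b" where
  "beval env e = tfold (\<lambda>t r. if t = 0 then env r else if t = 2 then (qn 1, qn 0) else (qn 0, qn 0)) bneg badd bmul e"

lemma beval_simps [simp]:
  "beval E (tadd a b) = badd (beval E a) (beval E b)"
  "beval E (tmul a b) = bmul (beval E a) (beval E b)" "beval E (tneg a) = bneg (beval E a)"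
  unfolding beval_def by simp_all

lemma beval_leaf: "t \<notin> {3, 4, 5} \<Longrightarrow> beval E (prod_encode (t, r)) =
    (if t = 0 then E r else if t = 2 then (qn 1, qn 0) else (qn 0, qn 0))"
  unfolding beval_def by (simp add: tfold_leaf)

lemma inb_beval: assumes "\<And>i. inb (E i) (x i)" shows "inb (beval E e) (pv x e)"
proof (induction e rule: term_induct)
  case (leaf t r)
  then show ?case using assms[of r] by (simp add: beval_leaf pv_leaf inb_def)
next
  case (add a b) then show ?case by (simp add: inb_badd)
next
  case (mul a b) then show ?case by (simp add: inb_bmul)
next
  case (neg a) then show ?case by (simp add: inb_bneg)
qed

text \<open>Convergence is kept apart from containment \<open>inb\<close>: containment makes a
  positive test sound, convergence makes it succeed eventually.\<close>

definition bconv :: "(nat \<Rightarrow> b) \<Rightarrow> real \<Rightarrow> bool" where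
  "bconv B x \<longleftrightarrow> (\<lambda>s. qv (fst (B s))) \<longlonglongrightarrow> x \<and> (\<lambda>s. qv (snd (B s))) \<longlonglongrightarrow> 0"

lemma bconv_const: "bconv (\<lambda>s. (c, qn 0)) (qv c)"
  unfolding bconv_def by simp

lemma bconv_beval: assumes "\<And>i. bconv (\<lambda>s. E s i) (x i)" shows "bconv (\<lambda>s. beval (E s) e) (pv x e)"
proof (induction e rule: term_induct)
  case (leaf t r)
  then show ?case using assms[of r] bconv_const[of "qn 1"] bconv_const[of "qn 0"] by (simp add: beval_leaf pv_leaf)
next
  case (add a b)
  then show ?case unfolding bconv_def by (auto simp: badd_def intro!: tendsto_eq_intros)
next
  case (mul a b)
  have 1: "(\<lambda>s. qv (fst (beval (E s) a))) \<longlonglongrightarrow> pv x a" "(\<lambda>s. qv (snd (beval (E s) a))) \<longlonglongrightarrow> 0"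
    "(\<lambda>s. qv (fst (beval (E s) b))) \<longlonglongrightarrow> pv x b" "(\<lambda>s. qv (snd (beval (E s) b))) \<longlonglongrightarrow> 0"
    using mul unfolding bconv_def by auto
  have "(\<lambda>s. \<bar>qv (fst (beval (E s) a))\<bar> * qv (snd (beval (E s) b)) + \<bar>qv (fst (beval (E s) b))\<bar> * qv (snd (beval (E s) a))
      + qv (snd (beval (E s) a)) * qv (snd (beval (E s) b))) \<longlonglongrightarrow> \<bar>pv x a\<bar> * 0 + \<bar>pv x b\<bar> * 0 + 0 * 0"
    by (intro tendsto_intros 1)
  moreover have "(\<lambda>s. qv (fst (beval (E s) a)) * qv (fst (beval (E s) b))) \<longlonglongrightarrow> pv x a * pv x b"
    by (intro tendsto_intros 1)
  ultimately show ?case unfolding bconv_def by (simp add: bmul_def)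
next
  case (neg a)
  then show ?case unfolding bconv_def by (auto simp: bneg_def intro!: tendsto_eq_intros)
qed

lemma bconv_bpos: assumes "bconv B x" "x > 0" shows "eventually (\<lambda>s. bpos (B s)) sequentially"
proof -
  have "(\<lambda>s. qv (fst (B s)) - qv (snd (B s))) \<longlonglongrightarrow> x - 0"
    using assms(1) unfolding bconv_def by (intro tendsto_intros) auto
  then have "eventually (\<lambda>s. qv (fst (B s)) - qv (snd (B s)) > 0) sequentially"
    using assms(2) by (intro order_tendstoD(1)) auto
  then show ?thesis by eventually_elim (simp add: bpos_def qlt_iff)
qed

lemma bconv_bneg: "bconv B x \<Longrightarrow> bconv (\<lambda>s. bneg (B s)) (- x)"
  unfolding bconv_def by (auto simp: bneg_def intro!: tendsto_eq_intros)

lemma cmp_beval [cmp_intros]: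
  assumes "cmp (\<lambda>p. env (fst p) (snd p))" "cmp e"
  shows "cmp (\<lambda>x. beval (\<lambda>i. env x i) (e x))"
  unfolding beval_def by (intro cmp_intros cmp_comp2[OF assms(1)] assms(2))

section \<open>Term codes as polynomials\<close>

text \<open>The derivative in variable 0. The fold carries the term along with its derivative,
  because the product rule needs the undifferentiated factors.\<close>

definition tder :: "nat \<Rightarrow> nat" where
  "tder e = snd (tfold (\<lambda>t r. (prod_encode (t, r), if t = 0 \<and> r = 0 then tone else tzero))
     (\<lambda>a. (tneg (fst a), tneg (snd a))) (\<lambda>a b. (tadd (fst a) (fst b), tadd (snd a) (snd b)))
     (\<lambda>a b. (tmul (fst a) (fst b), tadd (tmul (snd a) (fst b)) (tmul (fst a) (snd b)))) e)"

lemma cmp_tder [cmp_intros]: "cmp e \<Longrightarrow> cmp (\<lambda>x. tder (e x))"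
  unfolding tder_def by (intro cmp_intros)

lemma tder_deriv: "((\<lambda>y. pv (case_nat y x) e) has_real_derivative pv (case_nat y x) (tder e)) (at y)"
proof -
  let ?F = "tfold (\<lambda>t r. (prod_encode (t, r), if t = 0 \<and> r = 0 then tone else tzero))
     (\<lambda>a. (tneg (fst a), tneg (snd a))) (\<lambda>a b. (tadd (fst a) (fst b), tadd (snd a) (snd b)))
     (\<lambda>a b. (tmul (fst a) (fst b), tadd (tmul (snd a) (fst b)) (tmul (fst a) (snd b))))"
  have "fst (?F e) = e \<and> ((\<lambda>y. pv (case_nat y x) e) has_real_derivative pv (case_nat y x) (snd (?F e))) (at y)"
  proof (induction e rule: term_induct)
    case (leaf t r)
    show ?case
    proof (cases "t = 0 \<and> r = 0")
      case True
      then show ?thesis by (auto simp: tfold_leaf pv_leaf)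
    next
      case False
      have "pv (case_nat y x) (prod_encode (t, r)) = pv (case_nat 0 x) (prod_encode (t, r))" for y
        using leaf False by (auto simp: pv_leaf split: nat.split)
      then have "(\<lambda>y. pv (case_nat y x) (prod_encode (t, r))) = (\<lambda>y. pv (case_nat 0 x) (prod_encode (t, r)))" by blast
      then show ?thesis using leaf False by (auto simp: tfold_leaf)
    qed
  next
    case (add a b) then show ?case by (auto intro!: derivative_eq_intros)
  next
    case (mul a b) then show ?case by (auto intro!: derivative_eq_intros)
  next
    case (neg a) then show ?case by (auto intro!: derivative_eq_intros)
  qed
  then show ?thesis unfolding tder_def by blast
qed

definition tnum :: "nat \<Rightarrow> nat" where "tnum p = rec_nat tzero (\<lambda>_ r. tadd r tone) p"

lemma cmp_tnum [cmp_intros]: "cmp p \<Longrightarrow> cmp (\<lambda>x. tnum (p x))"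
  unfolding tnum_def by (intro cmp_intros)

lemma pv_tnum [simp]: "pv x (tnum p) = real p"
  unfolding tnum_def by (induction p) auto

text \<open>Numerically the same as \<open>tvar m\<close>, but in the role of a name, i.e. an index
  of a variable. Tag 0 marks generator names, all other tags mark root names.\<close>

definition nvar :: "nat \<Rightarrow> nat" where "nvar m = prod_encode (0, m)"

lemma cmp_nvar [cmp_intros]: "cmp f \<Longrightarrow> cmp (\<lambda>x. nvar (f x))"
  unfolding nvar_def by (intro cmp_intros)

text \<open>Translates the local variables of a root term into names: the unknown becomes name
  \<open>k\<close>, variable \<open>m + 1\<close> becomes the name of generator
  \<open>m\<close>.\<close>

definition tsub :: "nat \<Rightarrow> nat \<Rightarrow> nat" where
  "tsub k e = tfold (\<lambda>t r. if t = 0 then (case r of 0 \<Rightarrow> tvar k | Suc m \<Rightarrow> tvar (nvar m)) else prod_encode (t, r)) tneg tadd tmul e"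

lemma cmp_tsub [cmp_intros]: "cmp k \<Longrightarrow> cmp e \<Longrightarrow> cmp (\<lambda>x. tsub (k x) (e x))"
proof -
  assume k: "cmp k" and e: "cmp e"
  show ?thesis unfolding tsub_def by (intro cmp_intros e cmp_comp[OF k])
qed

lemma pv_tsub: "pv x (tsub k e) = pv (case_nat (x k) (\<lambda>m. x (nvar m))) e"
  unfolding tsub_def
  by (induction e rule: term_induct) (auto simp: tfold_leaf pv_leaf split: nat.split)

section \<open>Deciding whether a term code is the zero polynomial\<close>

definition dg :: "nat \<Rightarrow> nat" where "dg e = tfold (\<lambda>t r. 1) (\<lambda>a. a) (+) (+) e"

text \<open>Integer evaluation at natural arguments, with integers as differences of a pair.\<close>

definition iev :: "nat list \<Rightarrow> nat \<Rightarrow> nat \<times> nat" where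
  "iev l e = tfold (\<lambda>t r. if t = 0 then (nthd 0 l r, 0) else if t = 2 then (1, 0) else (0, 0))
     (\<lambda>a. (snd a, fst a)) (\<lambda>a b. (fst a + fst b, snd a + snd b))
     (\<lambda>a b. (fst a * fst b + snd a * snd b, fst a * snd b + snd a * fst b)) e"

text \<open>A grid test: each variable runs through one value more than the degree bound
  \<open>dg e\<close>. Variables with index above \<open>e\<close> do not occur in \<open>e\<close>,
  whence the length \<open>Suc e\<close>.\<close>

definition zt :: "nat \<Rightarrow> bool" where
  "zt e \<longleftrightarrow> (\<forall>l\<in>set (List.n_lists (Suc e) [0..<Suc (dg e)]). fst (iev l e) = snd (iev l e))"

lemma cmp_n_lists [cmp_intros]: "cmp k \<Longrightarrow> cmp l \<Longrightarrow> cmp (\<lambda>x. List.n_lists (k x) (l x))"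
proof -
  assume k: "cmp k" and l: "cmp l"
  have e: "List.n_lists n xs = rec_nat [[]] (\<lambda>_ r. concat (map (\<lambda>ys. map (\<lambda>y. y # ys) xs) r)) n" for n and xs :: "'b list"
    by (induction n) auto
  show ?thesis unfolding e by (intro cmp_intros k cmp_comp[OF l])
qed

lemma cmp_zt [cmp_intros]: "cmp e \<Longrightarrow> cmp (\<lambda>x. zt (e x))"
proof -
  assume e: "cmp e"
  show ?thesis unfolding zt_def iev_def dg_def by (intro cmp_intros e cmp_comp[OF e])
qed

lemma iev_pv: "real (fst (iev l e)) - real (snd (iev l e)) = pv (\<lambda>i. real (nthd 0 l i)) e"
  unfolding iev_def
  by (induction e rule: term_induct) (auto simp: tfold_leaf pv_leaf algebra_simps)

lemma pv_cong: "(\<And>i. i \<le> e \<Longrightarrow> x i = y i) \<Longrightarrow> pv x e = pv y e"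
proof (induction e rule: term_induct)
  case (leaf t r)
  have "x r = y r" by (rule leaf(2)) (rule le_prod_encode_2)
  then show ?case using leaf(1) by (simp add: pv_leaf)
next
  case (add a b)
  have "a \<le> tadd a b" "b \<le> tadd a b" unfolding tadd_def
    by (meson le_prod_encode_1 le_prod_encode_2 le_trans)+
  then show ?case using add by simp
next
  case (mul a b)
  have "a \<le> tmul a b" "b \<le> tmul a b" unfolding tmul_def
    by (meson le_prod_encode_1 le_prod_encode_2 le_trans)+
  then show ?case using mul by simp
next
  case (neg a)
  have "a \<le> tneg a" unfolding tneg_def by (rule le_prod_encode_2)
  then show ?case using neg by simp
qed

lemma pv_poly: "\<exists>p. degree p \<le> dg e \<and> (\<forall>y. pv (x(j := y)) e = poly p y)"
proof (induction e rule: term_induct)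
  case (leaf t r)
  show ?case
  proof (cases "t = 0 \<and> r = j")
    case True
    then show ?thesis by (intro exI[of _ "[:0, 1:]"]) (auto simp: dg_def tfold_leaf pv_leaf)
  next
    case False
    then show ?thesis using leaf
      by (intro exI[of _ "[:if t = 0 then x r else if t = 2 then 1 else 0:]"]) (auto simp: pv_leaf)
  qed
next
  case (add a b)
  then obtain p q where "degree p \<le> dg a" "\<forall>y. pv (x(j := y)) a = poly p y"
    "degree q \<le> dg b" "\<forall>y. pv (x(j := y)) b = poly q y" by blast
  then show ?case by (intro exI[of _ "p + q"]) (auto simp: dg_def intro!: degree_add_le simp del: fun_upd_apply)
next
  case (mul a b)
  then obtain p q where "degree p \<le> dg a" "\<forall>y. pv (x(j := y)) a = poly p y"
    "degree q \<le> dg b" "\<forall>y. pv (x(j := y)) b = poly q y" by blast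
  then show ?case using degree_mult_le[of p q] by (intro exI[of _ "p * q"]) (auto simp: dg_def simp del: fun_upd_apply)
next
  case (neg a)
  then obtain p where "degree p \<le> dg a" "\<forall>y. pv (x(j := y)) a = poly p y" by blast
  then show ?case by (intro exI[of _ "- p"]) (auto simp: dg_def simp del: fun_upd_apply)
qed

lemma zt_iff: "zt e \<longleftrightarrow> (\<forall>x. pv x e = 0)"
proof
  assume z: "zt e"
  define D where "D = dg e"
  have g: "pv x e = 0" if x: "\<And>i. x i \<in> real ` {..D}" for x
  proof -
    have "\<forall>i. \<exists>k. k \<le> D \<and> x i = real k" using x by (metis atMost_iff imageE)
    then obtain k where k: "\<And>i. k i \<le> D" "\<And>i. x i = real (k i)" by metis
    define l where "l = map k [0..<Suc e]"
    have "length l = Suc e" "set l \<subseteq> {..D}" unfolding l_def using k(1) by auto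
    then have "l \<in> set (List.n_lists (Suc e) [0..<Suc D])" unfolding set_n_lists by (auto simp del: upt_Suc)
    then have "fst (iev l e) = snd (iev l e)" using z unfolding zt_def D_def by blast
    then have "pv (\<lambda>i. real (nthd 0 l i)) e = 0" using iev_pv[of l e] by simp
    moreover have "pv x e = pv (\<lambda>i. real (nthd 0 l i)) e"
      by (rule pv_cong) (auto simp: k(2) l_def nthd_def simp del: upt_Suc)
    ultimately show ?thesis by simp
  qed
  \<comment> \<open>The variables are freed from the grid one at a time: in each of them the value
    is a polynomial of degree at most \<open>D\<close> with \<open>D + 1\<close> zeros.\<close>
  have m: "pv x e = 0" if "\<And>i. m \<le> i \<Longrightarrow> x i \<in> real ` {..D}" for m x
    using that
  proof (induction m arbitrary: x)
    case 0 then show ?case using g by simp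
  next
    case (Suc m)
    obtain p where p: "degree p \<le> D" "\<And>y. pv (x(m := y)) e = poly p y" using pv_poly[of e x m] D_def by blast
    have r: "poly p y = 0" if "y \<in> real ` {..D}" for y
    proof -
      have "pv (x(m := y)) e = 0" by (rule Suc.IH) (use Suc.prems that in auto)
      then show ?thesis using p(2) by simp
    qed
    have "p = 0"
    proof (rule ccontr)
      assume "p \<noteq> 0"
      then have "card {y. poly p y = 0} \<le> D" "finite {y. poly p y = 0}" using card_poly_roots_bound[of p] p(1) poly_roots_finite by auto
      moreover have "real ` {..D} \<subseteq> {y. poly p y = 0}" using r by auto
      ultimately have "card (real ` {..D}) \<le> D" by (meson card_mono le_trans)
      then show False by (simp add: card_image)
    qed
    then show ?case using p(2)[of "x m"] by simp
  qed
  show "\<forall>x. pv x e = 0"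
  proof
    fix x
    have "pv x e = pv (\<lambda>i. if i \<le> e then x i else 0) e" by (rule pv_cong) simp
    also have "\<dots> = 0" by (rule m[of "Suc e"]) (auto intro!: image_eqI[of _ _ 0])
    finally show "pv x e = 0" .
  qed
next
  assume "\<forall>x. pv x e = 0"
  then show "zt e" unfolding zt_def using iev_pv by (metis eq_iff_diff_eq_0 of_nat_eq_iff)
qed

section \<open>Certificates for polynomial identities at a point\<close>

type_synonym pfun = "(nat \<Rightarrow> real) \<Rightarrow> real"

text \<open>Integer polynomials in the variables from \<open>V\<close>, taken as functions of the
  assignment, so that polynomial identities are plain equations of functions.\<close>

inductive_set pf :: "nat set \<Rightarrow> pfun set" for V where
  pf_var: "v \<in> V \<Longrightarrow> (\<lambda>x. x v) \<in> pf V"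
| pf_zero: "(\<lambda>x. 0) \<in> pf V"
| pf_one: "(\<lambda>x. 1) \<in> pf V"
| pf_neg: "f \<in> pf V \<Longrightarrow> (\<lambda>x. - f x) \<in> pf V"
| pf_add: "f \<in> pf V \<Longrightarrow> g \<in> pf V \<Longrightarrow> (\<lambda>x. f x + g x) \<in> pf V"
| pf_mul: "f \<in> pf V \<Longrightarrow> g \<in> pf V \<Longrightarrow> (\<lambda>x. f x * g x) \<in> pf V"

lemma pf_mono: "f \<in> pf V \<Longrightarrow> V \<subseteq> W \<Longrightarrow> f \<in> pf W"
  by (induction rule: pf.induct) (auto intro: pf.intros)

lemma pf_power: "f \<in> pf V \<Longrightarrow> (\<lambda>x. f x ^ n) \<in> pf V"
  by (induction n) (auto intro: pf.intros)

lemma pf_sum: "(\<And>i. i \<in> I \<Longrightarrow> f i \<in> pf V) \<Longrightarrow> (\<lambda>x. \<Sum>i\<in>I. f i x) \<in> pf V"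
  by (induction I rule: infinite_finite_induct) (auto intro: pf.intros)

lemma pf_code: "f \<in> pf V \<Longrightarrow> \<exists>e. \<forall>x. pv x e = f x"
proof (induction rule: pf.induct)
  case (pf_var v) then show ?case by (intro exI[of _ "tvar v"]) simp
next
  case pf_zero then show ?case by (intro exI[of _ tzero]) simp
next
  case pf_one then show ?case by (intro exI[of _ tone]) simp
next
  case (pf_neg f) then show ?case by (metis pv_simps(6))
next
  case (pf_add f g) then show ?case by (metis pv_simps(4))
next
  case (pf_mul f g) then show ?case by (metis pv_simps(5))
qed

lemma pv_pf: "(\<And>i. i \<le> e \<Longrightarrow> i \<in> V) \<Longrightarrow> (\<lambda>x. pv x e) \<in> pf V"
proof (induction e rule: term_induct)
  case (leaf t r)
  have "r \<le> prod_encode (t, r)" by (rule le_prod_encode_2)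
  then have "(\<lambda>x. x r) \<in> pf V" using leaf(2) by (intro pf_var) simp
  then show ?case using leaf(1) by (cases "t = 0"; cases "t = 2") (auto simp: pv_leaf intro: pf_zero pf_one)
next
  case (add a b)
  have "a \<le> tadd a b" "b \<le> tadd a b" unfolding tadd_def
    by (meson le_prod_encode_1 le_prod_encode_2 le_trans)+
  then show ?case using add by (auto intro!: pf.intros)
next
  case (mul a b)
  have "a \<le> tmul a b" "b \<le> tmul a b" unfolding tmul_def
    by (meson le_prod_encode_1 le_prod_encode_2 le_trans)+
  then show ?case using mul by (auto intro!: pf.intros)
next
  case (neg a)
  have "a \<le> tneg a" unfolding tneg_def by (rule le_prod_encode_2)
  then show ?case using neg by (auto intro!: pf.intros)
qed

lemma pf_upd: "f \<in> pf V \<Longrightarrow> v \<notin> V \<Longrightarrow> f (x(v := t)) = f x"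
  by (induction rule: pf.induct) auto

lemma pf_rg: "f \<in> pf V \<Longrightarrow> f x \<in> rg (x ` V)"
  by (induction rule: pf.induct) (auto intro: rg.intros rg_zero)

text \<open>Polynomials in one more variable whose coefficients are polynomial functions over
  \<open>V\<close>. The bound \<open>m\<close> is formal: at a given assignment the actual degree
  may be smaller.\<close>

definition PP :: "nat set \<Rightarrow> nat \<Rightarrow> ((nat \<Rightarrow> real) \<Rightarrow> real poly) set" where
  "PP V m = {P. (\<forall>j. (\<lambda>x. coeff (P x) j) \<in> pf V) \<and> (\<forall>x. \<forall>j\<ge>m. coeff (P x) j = 0)}"

lemma PP_add: "P \<in> PP V m \<Longrightarrow> Q \<in> PP V m \<Longrightarrow> (\<lambda>x. P x + Q x) \<in> PP V m"
  unfolding PP_def by (auto intro: pf.intros)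

lemma PP_minus: "P \<in> PP V m \<Longrightarrow> (\<lambda>x. - P x) \<in> PP V m"
  unfolding PP_def by (auto intro: pf.intros)

lemma PP_smult: "f \<in> pf V \<Longrightarrow> P \<in> PP V m \<Longrightarrow> (\<lambda>x. smult (f x) (P x)) \<in> PP V m"
  unfolding PP_def by (auto intro: pf.intros)

lemma PP_le: "P \<in> PP V m \<Longrightarrow> m \<le> k \<Longrightarrow> P \<in> PP V k"
  unfolding PP_def by auto

lemma PP_mult: assumes "P \<in> PP V m" "Q \<in> PP V k" shows "(\<lambda>x. P x * Q x) \<in> PP V (m + k)"
proof -
  have "(\<lambda>x. coeff (P x * Q x) j) \<in> pf V" for j
    unfolding coeff_mult using assms unfolding PP_def by (intro pf_sum pf_mul) auto
  moreover have "coeff (P x * Q x) j = 0" if "j \<ge> m + k" for x j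
    unfolding coeff_mult
  proof (rule sum.neutral, intro ballI)
    fix i assume "i \<in> {..j}"
    then have "i \<ge> m \<or> j - i \<ge> k" using that by auto
    then show "coeff (P x) i * coeff (Q x) (j - i) = 0" using assms unfolding PP_def by auto
  qed
  ultimately show ?thesis unfolding PP_def by blast
qed

lemma PP_monom: "f \<in> pf V \<Longrightarrow> (\<lambda>x. monom (f x) k) \<in> PP V (Suc k)"
proof -
  assume f: "f \<in> pf V"
  have "(\<lambda>x. coeff (monom (f x) k) j) \<in> pf V" for j using f by (cases "k = j") (auto intro: pf_zero)
  then show ?thesis unfolding PP_def by auto
qed

lemma PP_poly: "P \<in> PP V m \<Longrightarrow> poly (P x) t = (\<Sum>j<m. coeff (P x) j * t ^ j)"
proof -
  assume P: "P \<in> PP V m"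
  have "poly (P x) t = (\<Sum>j\<le>degree (P x) + m. coeff (P x) j * t ^ j)" by (rule poly_upto) simp
  also have "\<dots> = (\<Sum>j<m. coeff (P x) j * t ^ j)"
    by (rule sum.mono_neutral_right) (use P in \<open>auto simp: PP_def\<close>)
  finally show ?thesis .
qed

lemma PP_pf: assumes "P \<in> PP V m" "V \<subseteq> W" "v \<in> W" shows "(\<lambda>x. poly (P x) (x v)) \<in> pf W"
proof -
  have "(\<lambda>x. \<Sum>j<m. coeff (P x) j * x v ^ j) \<in> pf W"
    using assms pf_mono[OF _ assms(2)] unfolding PP_def by (intro pf_sum pf_mul pf_power pf_var) auto
  then show ?thesis using PP_poly[OF assms(1)] by simp
qed

lemma pf_insert_PP: "f \<in> pf (insert v V) \<Longrightarrow> \<exists>P m. P \<in> PP V m \<and> (\<forall>x. f x = poly (P x) (x v))"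
proof (induction rule: pf.induct)
  case (pf_var w)
  show ?case
  proof (cases "w = v")
    case True
    then show ?thesis using PP_monom[OF pf_one, where k = 1 and V = V]
      by (intro exI[of _ "\<lambda>x. monom 1 1"] exI[of _ 2]) (auto simp: poly_monom numeral_2_eq_2)
  next
    case False
    then show ?thesis using pf_var PP_monom[OF pf.pf_var[of w V], of 0]
      by (intro exI[of _ "\<lambda>x. monom (x w) 0"] exI[of _ 1]) (auto simp: poly_monom)
  qed
next
  case pf_zero
  show ?case using PP_monom[OF pf.pf_zero, where k = 0 and V = V] by (intro exI[of _ "\<lambda>x. monom 0 0"] exI[of _ 1]) (auto simp: poly_monom)
next
  case pf_one
  show ?case using PP_monom[OF pf.pf_one, where k = 0 and V = V] by (intro exI[of _ "\<lambda>x. monom 1 0"] exI[of _ 1]) (auto simp: poly_monom)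
next
  case (pf_neg f)
  then obtain P m where "P \<in> PP V m" "\<forall>x. f x = poly (P x) (x v)" by blast
  then show ?case using PP_minus by (intro exI[of _ "\<lambda>x. - P x"] exI[of _ m]) auto
next
  case (pf_add f g)
  then obtain P m Q k where P: "P \<in> PP V m" "\<forall>x. f x = poly (P x) (x v)" "Q \<in> PP V k" "\<forall>x. g x = poly (Q x) (x v)" by blast
  have "(\<lambda>x. P x + Q x) \<in> PP V (m + k)" by (intro PP_add PP_le[OF P(1)] PP_le[OF P(3)]) simp_all
  then show ?case using P by (intro exI[of _ "\<lambda>x. P x + Q x"] exI[of _ "m + k"]) auto
next
  case (pf_mul f g)
  then obtain P m Q k where P: "P \<in> PP V m" "\<forall>x. f x = poly (P x) (x v)" "Q \<in> PP V k" "\<forall>x. g x = poly (Q x) (x v)" by blast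
  then show ?case using PP_mult[OF P(1,3)] by (intro exI[of _ "\<lambda>x. P x * Q x"] exI[of _ "m + k"]) auto
qed

lemma PP_upd: assumes "P \<in> PP V m" "v \<notin> V" shows "P (x(v := t)) = P x"
proof (rule poly_eqI)
  fix j
  have "(\<lambda>x. coeff (P x) j) \<in> pf V" using assms(1) unfolding PP_def by blast
  from pf_upd[OF this assms(2)] show "coeff (P (x(v := t))) j = coeff (P x) j" .
qed

text \<open>Pseudo-division: the formal leading coefficient of \<open>mu\<close> cannot be inverted,
  so a power of it multiplies the dividend.\<close>

lemma PP_division:
  assumes mu: "mu \<in> PP V (Suc e)" and P: "P \<in> PP V m"
  shows "\<exists>a Q r k. Q \<in> PP V k \<and> r \<in> PP V e \<and> (\<forall>x. smult (coeff (mu x) e ^ a) (P x) = mu x * Q x + r x)"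
  using P
proof (induction m arbitrary: P)
  case 0
  then have "P \<in> PP V e" by (rule PP_le) simp
  moreover have "(\<lambda>x. 0) \<in> PP V 0" unfolding PP_def by (auto intro: pf_zero)
  ultimately show ?case by (intro exI[of _ 0] exI[of _ "\<lambda>x. 0"] exI[of _ P] exI[of _ "0 :: nat"]) simp
next
  case (Suc m)
  show ?case
  proof (cases "Suc m \<le> e")
    case True
    then have "P \<in> PP V e" by (rule PP_le[OF Suc.prems])
    moreover have "(\<lambda>x. 0) \<in> PP V 0" unfolding PP_def by (auto intro: pf_zero)
    ultimately show ?thesis by (intro exI[of _ 0] exI[of _ "\<lambda>x. 0"] exI[of _ P] exI[of _ "0 :: nat"]) simp
  next
    case False
    define l where "l x = coeff (mu x) e" for x
    have lp: "l \<in> pf V" using mu unfolding l_def PP_def by simp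
    have cp: "(\<lambda>x. coeff (P x) m) \<in> pf V" using Suc.prems unfolding PP_def by simp
    define T where "T x = monom (coeff (P x) m) (m - e)" for x
    have T: "T \<in> PP V (Suc (m - e))" unfolding T_def by (rule PP_monom[OF cp])
    define P' where "P' x = smult (l x) (P x) + - (T x * mu x)" for x
    have "(\<lambda>x. T x * mu x) \<in> PP V (Suc (Suc m))" using False by (intro PP_le[OF PP_mult[OF T mu]]) simp
    moreover have "(\<lambda>x. smult (l x) (P x)) \<in> PP V (Suc (Suc m))" using PP_smult[OF lp Suc.prems] by (rule PP_le) simp
    ultimately have P2: "P' \<in> PP V (Suc (Suc m))" unfolding P'_def by (intro PP_add PP_minus)
    have "coeff (P' x) j = 0" if "j \<ge> m" for x j
    proof -
      have Pj: "coeff (P x) j = (if j = m then coeff (P x) m else 0)" 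
      proof (cases "j = m")
        case False
        then have "j \<ge> Suc m" using that by simp
        then show ?thesis using Suc.prems False unfolding PP_def by simp
      qed simp
      have "coeff (T x * mu x) j = coeff (P x) m * coeff (mu x) (j - (m - e))"
        unfolding T_def using that by (simp add: coeff_monom_mult)
      moreover have "coeff (mu x) (j - (m - e)) = (if j = m then l x else 0)"
      proof (cases "j = m")
        case True then show ?thesis using False by (simp add: l_def)
      next
        case False
        then have "j - (m - e) \<ge> Suc e" using that \<open>\<not> Suc m \<le> e\<close> by simp
        then show ?thesis using False mu unfolding PP_def by simp
      qed
      ultimately show ?thesis unfolding P'_def using Pj by simp
    qed
    then have "\<forall>x. \<forall>j\<ge>m. coeff (P' x) j = 0" by blast
    then have "P' \<in> PP V m" using P2 unfolding PP_def by blast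
    from Suc.IH[OF this] obtain a Q r k where QR: "Q \<in> PP V k" "r \<in> PP V e"
      "\<forall>x. smult (coeff (mu x) e ^ a) (P' x) = mu x * Q x + r x" by (elim exE conjE)
    define Q' where "Q' x = Q x + smult (l x ^ a) (T x)" for x
    have "Q' \<in> PP V (k + Suc (m - e))" unfolding Q'_def
      by (intro PP_add PP_smult pf_power lp PP_le[OF QR(1)] PP_le[OF T]) simp_all
    moreover have "smult (coeff (mu x) e ^ Suc a) (P x) = mu x * Q' x + r x" for x
    proof -
      have "smult (l x) (P x) = P' x + T x * mu x" unfolding P'_def by simp
      then have 1: "smult (l x ^ a) (smult (l x) (P x)) = smult (l x ^ a) (P' x) + smult (l x ^ a) (T x * mu x)"
        by (simp only: smult_add_right)
      have "smult (l x ^ Suc a) (P x) = smult (l x ^ a) (smult (l x) (P x))"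
        by (simp add: mult.commute)
      also note 1
      also have "smult (l x ^ a) (P' x) = mu x * Q x + r x" using QR(3)[rule_format, of x] unfolding l_def .
      also have "smult (l x ^ a) (T x * mu x) = mu x * smult (l x ^ a) (T x)"
        unfolding mult_smult_right by (simp only: mult.commute)
      finally have "smult (l x ^ Suc a) (P x) = mu x * Q x + r x + mu x * smult (l x ^ a) (T x)" .
      then show ?thesis unfolding Q'_def l_def[symmetric] by (simp only: distrib_left add_ac)
    qed
    ultimately show ?thesis using QR(2)
      by (intro exI[of _ "Suc a"] exI[of _ Q'] exI[of _ r] exI[of _ "k + Suc (m - e)"] conjI allI)
  qed
qed

section \<open>Vanishing at a point modulo an ideal of relations\<close>

locale relations =
  fixes x0 :: "nat \<Rightarrow> real" and R :: "nat \<Rightarrow> pfun"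
  assumes R_pf: "R v \<in> pf UNIV"
begin

text \<open>The ideal generated by all \<open>R v\<close>, built one multiple at a time so that
  cofactors can be read off as a list.\<close>

inductive_set J :: "pfun set" where
  J_zero: "(\<lambda>x. 0) \<in> J"
| J_add: "f \<in> J \<Longrightarrow> Q \<in> pf UNIV \<Longrightarrow> (\<lambda>x. f x + Q x * R v x) \<in> J"

lemma J_sum: "g \<in> J \<Longrightarrow> f \<in> J \<Longrightarrow> (\<lambda>x. f x + g x) \<in> J"
proof (induction rule: J.induct)
  case (J_add g Q v)
  then have "(\<lambda>x. (f x + g x) + Q x * R v x) \<in> J" by (intro J.J_add) auto
  then show ?case by (simp add: add.assoc)
qed simp

lemma J_mul: "f \<in> J \<Longrightarrow> h \<in> pf UNIV \<Longrightarrow> (\<lambda>x. h x * f x) \<in> J"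
proof (induction rule: J.induct)
  case J_zero then show ?case using J.J_zero by simp
next
  case (J_add f Q v)
  then have "(\<lambda>x. h x * f x + (h x * Q x) * R v x) \<in> J" by (intro J.J_add pf_mul) auto
  then show ?case by (simp add: distrib_left mult.assoc)
qed

text \<open>The function is zero modulo \<open>J\<close> after localising at the point: some
  multiple by an \<open>L\<close> not vanishing at \<open>x0\<close> lies in the ideal.\<close>

definition cert :: "pfun \<Rightarrow> bool" where
  "cert f \<longleftrightarrow> (\<exists>L\<in>pf UNIV. L x0 \<noteq> 0 \<and> (\<lambda>x. L x * f x) \<in> J)"

lemma cert_zero: "cert (\<lambda>x. 0)"
  unfolding cert_def using J_zero by (intro bexI[OF _ pf_one]) auto

lemma cert_R: "cert (R v)"
  unfolding cert_def using J_add[OF J_zero pf_one, of v] by (intro bexI[OF _ pf_one]) auto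

lemma cert_mul: assumes "cert f" "h \<in> pf UNIV" shows "cert (\<lambda>x. h x * f x)"
proof -
  obtain L where L: "L \<in> pf UNIV" "L x0 \<noteq> 0" "(\<lambda>x. L x * f x) \<in> J" using assms unfolding cert_def by blast
  have "(\<lambda>x. L x * (h x * f x)) \<in> J" using J_mul[OF L(3) assms(2)] by (simp add: mult.left_commute)
  then show ?thesis unfolding cert_def using L by blast
qed

lemma cert_add: assumes "cert f" "cert g" shows "cert (\<lambda>x. f x + g x)"
proof -
  obtain L where L: "L \<in> pf UNIV" "L x0 \<noteq> 0" "(\<lambda>x. L x * f x) \<in> J" using assms unfolding cert_def by blast
  obtain M where M: "M \<in> pf UNIV" "M x0 \<noteq> 0" "(\<lambda>x. M x * g x) \<in> J" using assms unfolding cert_def by blast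
  have "(\<lambda>x. M x * (L x * f x) + L x * (M x * g x)) \<in> J"
    using J_mul[OF L(3) M(1)] J_mul[OF M(3) L(1)] by (rule J_sum[rotated])
  then have "(\<lambda>x. (L x * M x) * (f x + g x)) \<in> J" by (simp add: algebra_simps)
  then show ?thesis unfolding cert_def using pf_mul[OF L(1) M(1)] L(2) M(2) by (intro bexI[of _ "\<lambda>x. L x * M x"]) auto
qed

lemma cert_cancel: assumes "cert (\<lambda>x. h x * f x)" "h \<in> pf UNIV" "h x0 \<noteq> 0" shows "cert f"
proof -
  obtain L where L: "L \<in> pf UNIV" "L x0 \<noteq> 0" "(\<lambda>x. L x * (h x * f x)) \<in> J" using assms unfolding cert_def by blast
  then have "(\<lambda>x. (L x * h x) * f x) \<in> J" by (simp add: mult.assoc)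
  then show ?thesis unfolding cert_def using pf_mul[OF L(1) assms(2)] L(2) assms(3)
    by (intro bexI[of _ "\<lambda>x. L x * h x"]) auto
qed

definition Zp :: "nat set \<Rightarrow> bool" where "Zp V \<longleftrightarrow> (\<forall>f\<in>pf V. f x0 = 0 \<longrightarrow> cert f)"

lemma Zp_empty: "Zp {}"
  unfolding Zp_def
proof (intro ballI impI)
  fix f :: pfun assume f: "f \<in> pf {}" "f x0 = 0"
  have "f x = f x0" for x using f(1) by (induction rule: pf.induct) auto
  then have "f = (\<lambda>x. 0)" using f(2) by auto
  then show "cert f" using cert_zero by simp
qed

lemma Zp_antimono: "Zp V \<Longrightarrow> W \<subseteq> V \<Longrightarrow> Zp W"
  unfolding Zp_def using pf_mono by blast

text \<open>Coefficients that vanish at \<open>x0\<close> are certified one by one by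
  \<open>Zp V\<close>, and certified functions form an ideal.\<close>

lemma cert_poly:
  assumes Z: "Zp V" and P: "P \<in> PP V m" and 0: "P x0 = 0"
  shows "cert (\<lambda>x. poly (P x) (x v))"
proof -
  have c: "cert (\<lambda>x. coeff (P x) j)" for j using Z P 0 unfolding Zp_def PP_def by auto
  have "cert (\<lambda>x. \<Sum>j<k. x v ^ j * coeff (P x) j)" for k
  proof (induction k)
    case 0 then show ?case using cert_zero by simp
  next
    case (Suc k)
    have "cert (\<lambda>x. (\<Sum>j<k. x v ^ j * coeff (P x) j) + x v ^ k * coeff (P x) k)"
      using Suc by (intro cert_add cert_mul c pf_power pf_var) auto
    then show ?case by simp
  qed
  from this[of m] show ?thesis using PP_poly[OF P] by (simp add: mult.commute)
qed

text \<open>A variable with a transcendental value requires no relation: if the polynomial vanishes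
  at the point, all its coefficients do.\<close>

lemma Zp_trans:
  assumes Z: "Zp V" and v: "v \<notin> V" and tr: "x0 v \<notin> cl (x0 ` V)"
  shows "Zp (insert v V)"
  unfolding Zp_def
proof (intro ballI impI)
  fix f assume f: "f \<in> pf (insert v V)" "f x0 = 0"
  obtain P m where P: "P \<in> PP V m" "\<forall>x. f x = poly (P x) (x v)" using pf_insert_PP[OF f(1)] by blast
  have "coeff (P x0) j \<in> rg (x0 ` V)" for j
    using pf_rg[of "\<lambda>x. coeff (P x) j" V x0] P(1) unfolding PP_def by auto
  then have "P x0 = 0" using tr f(2) P(2) unfolding cl_def algb_def by auto
  then have "cert (\<lambda>x. poly (P x) (x v))" using Z P(1) by (intro cert_poly)
  moreover have "f = (\<lambda>x. poly (P x) (x v))" using P(2) by blast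
  ultimately show "cert f" by simp
qed

lemma Zp_alg:
  assumes Z: "Zp V" and v: "v \<notin> V" and Rv: "R v \<in> pf (insert v V)" "R v x0 = 0"
    and d: "((\<lambda>t. R v (x0(v := t))) has_real_derivative d) (at (x0 v))" "d \<noteq> 0"
  shows "Zp (insert v V)"
proof -
  define w where "w = x0 v"
  obtain PR mR where PR: "PR \<in> PP V mR" "\<forall>x. R v x = poly (PR x) (x v)" using pf_insert_PP[OF Rv(1)] by blast
  have "(\<lambda>t. R v (x0(v := t))) = (\<lambda>t. poly (PR x0) t)" using PR(2) PP_upd[OF PR(1) v] by auto
  then have "((\<lambda>t. poly (PR x0) t) has_real_derivative d) (at w)" using d(1) unfolding w_def by simp
  then have dd: "poly (pderiv (PR x0)) w = d" using poly_DERIV[of "PR x0" w] DERIV_unique by blast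
  have PRw: "poly (PR x0) w = 0" using Rv(2) PR(2) by (simp add: w_def)
  define good where "good e \<longleftrightarrow> (\<exists>mu\<in>PP V (Suc e). coeff (mu x0) e \<noteq> 0 \<and> poly (mu x0) w = 0)" for e
  \<comment> \<open>Dropping the formal coefficients above the actual degree at \<open>x0\<close>
    does not change the polynomial at \<open>x0\<close> and makes its formal leading coefficient
    nonzero there.\<close>
  have trunc: "good (degree (r x0))" if r: "r \<in> PP V m" "r x0 \<noteq> 0" "poly (r x0) w = 0" for r m
  proof -
    define e where "e = degree (r x0)"
    define mu where "mu x = poly_cutoff (Suc e) (r x)" for x
    have "(\<lambda>x. coeff (mu x) j) \<in> pf V" for j unfolding mu_def using r(1) unfolding PP_def
      by (cases "j < Suc e") (auto simp: coeff_poly_cutoff intro: pf_zero)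
    then have "mu \<in> PP V (Suc e)" unfolding PP_def by (auto simp: mu_def coeff_poly_cutoff)
    moreover have "mu x0 = r x0" unfolding mu_def
      by (rule poly_eqI) (auto simp: coeff_poly_cutoff e_def coeff_eq_0)
    ultimately show ?thesis unfolding good_def e_def[symmetric] using r by (intro bexI[of _ mu]) (auto simp: e_def)
  qed
  have "PR x0 \<noteq> 0" using dd d(2) by auto
  then have ex: "\<exists>e. good e" using trunc[OF PR(1) _ PRw] by blast
  define e where "e = (LEAST e. good e)"
  have "good e" unfolding e_def using ex by (rule LeastI_ex)
  then obtain mu where mu: "mu \<in> PP V (Suc e)" "coeff (mu x0) e \<noteq> 0" "poly (mu x0) w = 0" unfolding good_def by blast
  define l where "l x = coeff (mu x) e" for x
  have lpf: "l \<in> pf V" using mu(1) unfolding l_def PP_def by simp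
  then have lpU: "l \<in> pf UNIV" by (rule pf_mono) simp
  \<comment> \<open>Minimality of \<open>e\<close>: a remainder that still has the root
    \<open>w\<close> would otherwise yield a smaller good degree.\<close>
  have low: "r x0 = 0" if r: "r \<in> PP V e" "poly (r x0) w = 0" for r
  proof (rule ccontr)
    assume n: "r x0 \<noteq> 0"
    then have "good (degree (r x0))" using trunc r by blast
    then have "e \<le> degree (r x0)" unfolding e_def by (rule Least_le)
    then have "coeff (r x0) (degree (r x0)) = 0" using r(1) unfolding PP_def by blast
    then show False using n by simp
  qed
  have div: "\<exists>a Q r k. Q \<in> PP V k \<and> r \<in> PP V e \<and> r x0 = 0 \<and> (\<forall>x. smult (l x ^ a) (P x) = mu x * Q x + r x)"
    if P: "P \<in> PP V m" "poly (P x0) w = 0" for P m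
  proof -
    obtain a Q r k where QR: "Q \<in> PP V k" "r \<in> PP V e" "\<forall>x. smult (coeff (mu x) e ^ a) (P x) = mu x * Q x + r x"
      using PP_division[OF mu(1) P(1)] by blast
    have "poly (smult (coeff (mu x0) e ^ a) (P x0)) w = poly (mu x0 * Q x0 + r x0) w" using QR(3) by simp
    then have "poly (r x0) w = 0" using P(2) mu(3) by simp
    then show ?thesis using QR low unfolding l_def by blast
  qed
  obtain b Q2 r2 k2 where Q2: "Q2 \<in> PP V k2" "r2 \<in> PP V e" "r2 x0 = 0" "\<forall>x. smult (l x ^ b) (PR x) = mu x * Q2 x + r2 x"
    using div[OF PR(1) PRw] by blast
  \<comment> \<open>Differentiating at \<open>w\<close>, where \<open>mu\<close> vanishes, gives
    \<open>l^b d = mu'(w) Q2(w)\<close>. Since \<open>d\<close> and \<open>l\<close> are nonzero at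
    the point, the cofactor \<open>Q2\<close> is too, and it can be cancelled.\<close>
  have "pderiv (smult (l x0 ^ b) (PR x0)) = pderiv (mu x0 * Q2 x0)" using Q2(3,4) by simp
  then have "poly (pderiv (smult (l x0 ^ b) (PR x0))) w = poly (pderiv (mu x0 * Q2 x0)) w" by simp
  then have "l x0 ^ b * d = poly (pderiv (mu x0)) w * poly (Q2 x0) w"
    using dd mu(3) by (simp add: pderiv_smult pderiv_mult)
  then have q2: "poly (Q2 x0) w \<noteq> 0" using d(2) mu(2) by (auto simp: l_def)
  have e2: "poly (Q2 x) (x v) * poly (mu x) (x v) = l x ^ b * R v x + (- 1) * poly (r2 x) (x v)" for x
  proof -
    have "poly (smult (l x ^ b) (PR x)) (x v) = poly (mu x * Q2 x + r2 x) (x v)" using Q2(4) by simp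
    then show ?thesis using PR(2) by (simp add: algebra_simps)
  qed
  have pn: "(\<lambda>x. - 1) \<in> pf UNIV" using pf_neg[OF pf_one] .
  have "cert (\<lambda>x. l x ^ b * R v x + (- 1) * poly (r2 x) (x v))"
    by (intro cert_add cert_mul cert_R cert_poly[OF Z Q2(2,3)] pf_power lpU pn)
  then have "cert (\<lambda>x. poly (Q2 x) (x v) * poly (mu x) (x v))" unfolding e2 .
  then have cmu: "cert (\<lambda>x. poly (mu x) (x v))"
    by (rule cert_cancel) (use PP_pf[OF Q2(1), of UNIV v] q2 in \<open>auto simp: w_def\<close>)
  show ?thesis unfolding Zp_def
  proof (intro ballI impI)
    fix f assume f: "f \<in> pf (insert v V)" "f x0 = 0"
    obtain P m where P: "P \<in> PP V m" "\<forall>x. f x = poly (P x) (x v)" using pf_insert_PP[OF f(1)] by blast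
    have "poly (P x0) w = 0" using P(2) f(2) by (simp add: w_def)
    then obtain a Q r k where Q: "Q \<in> PP V k" "r \<in> PP V e" "r x0 = 0" "\<forall>x. smult (l x ^ a) (P x) = mu x * Q x + r x"
      using div[OF P(1)] by blast
    have e1: "l x ^ a * f x = poly (Q x) (x v) * poly (mu x) (x v) + poly (r x) (x v)" for x
    proof -
      have "poly (smult (l x ^ a) (P x)) (x v) = poly (mu x * Q x + r x) (x v)" using Q(4) by simp
      then show ?thesis using P(2) by (simp add: mult.commute)
    qed
    have "cert (\<lambda>x. poly (Q x) (x v) * poly (mu x) (x v) + poly (r x) (x v))"
      using PP_pf[OF Q(1), of UNIV v] by (intro cert_add cert_mul cmu cert_poly[OF Z Q(2,3)]) auto
    then have "cert (\<lambda>x. l x ^ a * f x)" unfolding e1 .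
    then show "cert f" by (rule cert_cancel) (use pf_power[OF lpU] mu(2) in \<open>auto simp: l_def\<close>)
  qed
qed

lemma J_code: "f \<in> J \<Longrightarrow> \<exists>l :: (nat \<times> nat) list. \<forall>x. f x = (\<Sum>p\<leftarrow>l. pv x (snd p) * R (fst p) x)"
proof (induction rule: J.induct)
  case J_zero then show ?case by (intro exI[of _ "[]"]) simp
next
  case (J_add f Q v)
  then obtain l :: "(nat \<times> nat) list" where l: "\<forall>x. f x = (\<Sum>p\<leftarrow>l. pv x (snd p) * R (fst p) x)" by blast
  obtain e where "\<forall>x. pv x e = Q x" using pf_code[OF J_add.hyps(2)] by blast
  then show ?case using l by (intro exI[of _ "(v, e) # l"]) simp
qed

end

section \<open>Names for the elements of a real closure\<close>

lemma bconvI: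
  assumes i: "\<And>s. inb (B s) x" and r: "(\<lambda>s. qv (snd (B s))) \<longlonglongrightarrow> 0"
  shows "bconv B x"
proof -
  have "(\<lambda>s. qv (fst (B s)) - x) \<longlonglongrightarrow> 0"
  proof (rule tendsto_0_le[OF r, where K = 1])
    have "norm (qv (fst (B s)) - x) \<le> norm (qv (snd (B s))) * 1" for s
      using i[of s] unfolding inb_def real_norm_def by linarith
    then show "\<forall>\<^sub>F s in sequentially. norm (qv (fst (B s)) - x) \<le> norm (qv (snd (B s))) * 1"
      by (intro always_eventually allI)
  qed
  then have "(\<lambda>s. qv (fst (B s))) \<longlonglongrightarrow> x" by (rule LIM_zero_cancel)
  then show ?thesis unfolding bconv_def using r by (rule conjI)
qed

lemma pv_pf_env: "(\<And>i. i \<le> e \<Longrightarrow> (\<lambda>x. E x i) \<in> pf W) \<Longrightarrow> (\<lambda>x. pv (E x) e) \<in> pf W"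
proof (induction e rule: term_induct)
  case (leaf t r)
  have "(\<lambda>x. E x r) \<in> pf W" by (rule leaf(2)) (rule le_prod_encode_2)
  then show ?case using leaf(1) pf_zero[of W] pf_one[of W] by (cases "t = 0"; cases "t = 2") (simp_all add: pv_leaf)
next
  case (add a b)
  have "a \<le> tadd a b" "b \<le> tadd a b" unfolding tadd_def
    by (meson le_prod_encode_1 le_prod_encode_2 le_trans)+
  then show ?case using add by (simp add: pf_add)
next
  case (mul a b)
  have "a \<le> tmul a b" "b \<le> tmul a b" unfolding tmul_def
    by (meson le_prod_encode_1 le_prod_encode_2 le_trans)+
  then show ?case using mul by (simp add: pf_mul)
next
  case (neg a)
  have "a \<le> tneg a" unfolding tneg_def by (rule le_prod_encode_2)
  then show ?case using neg by (simp add: pf_neg)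
qed

lemma pf_nat: "(\<lambda>x. real k) \<in> pf V"
proof (induction k)
  case 0 then show ?case by (simp add: pf_zero)
next
  case (Suc k)
  show ?case using pf_add[OF Suc pf_one] by (simp add: add.commute)
qed

lemma nat_sfield: "sfield K \<Longrightarrow> real k \<in> K"
proof (induction k)
  case 0 then show ?case by (simp add: sfieldD(1))
next
  case (Suc k)
  have "real k + 1 \<in> K" by (rule sfieldD(3)[OF Suc.prems Suc.IH[OF Suc.prems] sfieldD(2)[OF Suc.prems]])
  then show ?case by (simp add: add.commute)
qed

lemma qv_sfield: assumes "sfield K" shows "qv r \<in> K"
proof -
  have "real (snd (snd r)) + 1 \<in> K" using nat_sfield[OF assms, of "Suc (snd (snd r))"] by (simp add: add.commute)
  then show ?thesis unfolding qv_def by (rule sfieldD(8)[OF assms sfieldD(7)[OF assms nat_sfield[OF assms] nat_sfield[OF assms]]])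
qed

locale gen =
  fixes D :: "nat \<Rightarrow> nat \<Rightarrow> nat \<Rightarrow> bool" and ap :: "nat \<Rightarrow> nat \<Rightarrow> q" and rho :: "nat \<Rightarrow> real"
  assumes cmp_D: "cmp (\<lambda>p. D (fst p) (fst (snd p)) (snd (snd p)))"
    and cmp_ap: "cmp (\<lambda>p. ap (fst p) (snd p))"
    and ap: "\<bar>qv (ap i s) - rho i\<bar> \<le> 1 / (real s + 1)"
begin

text \<open>The generator name \<open>m\<close> codes \<open>(i, t)\<close>, the guess that \<open>t\<close> is the least bound of \<open>{u. D n i u}\<close>. The name denotes
  \<open>rho i\<close> if the guess is right; a wrong guess is refuted at some stage (\<open>dead\<close>), and the name then denotes the rational
  approximation of \<open>rho i\<close> at that stage.\<close>

definition G :: "nat \<Rightarrow> nat set" where "G n = {i. finite {t. D n i t}}"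
definition gi :: "nat \<Rightarrow> nat" where "gi m = fst (prod_decode m)"
definition gt :: "nat \<Rightarrow> nat" where "gt m = snd (prod_decode m)"

text \<open>Two refutations of the guess: the bound is not least, which is seen at once, or an
  element at or above it has appeared before stage \<open>s\<close>.\<close>

definition dead :: "nat \<Rightarrow> nat \<Rightarrow> nat \<Rightarrow> bool" where
  "dead n m s \<longleftrightarrow> (gt m \<noteq> 0 \<and> \<not> D n (gi m) (gt m - 1)) \<or> (\<exists>t<s. gt m \<le> t \<and> D n (gi m) t)"
definition ds :: "nat \<Rightarrow> nat \<Rightarrow> nat \<Rightarrow> nat" where "ds n m s = (LEAST u. dead n m u \<or> u = s)"
definition alive :: "nat \<Rightarrow> nat \<Rightarrow> bool" where "alive n m \<longleftrightarrow> (\<forall>s. \<not> dead n m s)"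
definition cv :: "nat \<Rightarrow> nat \<Rightarrow> real" where
  "cv n m = (if alive n m then rho (gi m) else qv (ap (gi m) (LEAST u. dead n m u)))"
text \<open>The radius is \<open>2 / (s + 1)\<close> and not \<open>1 / (s + 1)\<close>: should the
  name die at a later stage \<open>u\<close>, its value is the approximation of that stage, and both
  approximations deviate from \<open>rho\<close>.\<close>

definition gb :: "nat \<Rightarrow> nat \<Rightarrow> nat \<Rightarrow> b" where
  "gb n s m = (if dead n m s then (ap (gi m) (ds n m s), qn 0) else (ap (gi m) s, (2, 0, s)))"

lemma dead_mono: "dead n m s \<Longrightarrow> s \<le> t \<Longrightarrow> dead n m t"
  unfolding dead_def by fastforce

lemma ds_eq: assumes "dead n m s" shows "ds n m s = (LEAST u. dead n m u)"
proof -
  have "(dead n m u \<or> u = s) \<longleftrightarrow> dead n m u" for u using assms by blast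
  then show ?thesis unfolding ds_def by simp
qed

lemma inb_gb: "inb (gb n s m) (cv n m)"
proof (cases "dead n m s")
  case True
  then have "\<not> alive n m" unfolding alive_def by blast
  then show ?thesis using True by (simp add: gb_def cv_def inb_def ds_eq)
next
  case False
  have p: "real s + 1 > 0" by linarith
  have e: "qv (2, 0, s) = 2 / (real s + 1)" by (simp add: qv_def)
  show ?thesis
  proof (cases "alive n m")
    case True
    have "1 / (real s + 1) \<le> 2 / (real s + 1)" using p by (intro divide_right_mono) auto
    then show ?thesis using False True ap[of "gi m" s] e by (simp add: gb_def cv_def inb_def abs_minus_commute)
  next
    case na: False
    define u where "u = (LEAST u. dead n m u)"
    have "dead n m u" unfolding u_def using na LeastI_ex[of "dead n m"] unfolding alive_def by blast
    then have "s \<le> u" using False dead_mono[of n m u s] by (meson nat_le_linear)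
    then have "1 / (real u + 1) \<le> 1 / (real s + 1)" using p by (intro divide_left_mono) auto
    then have "\<bar>qv (ap (gi m) u) - qv (ap (gi m) s)\<bar> \<le> 1 / (real s + 1) + 1 / (real s + 1)"
      using ap[of "gi m" s] ap[of "gi m" u] by linarith
    also have "\<dots> = 2 / (real s + 1)" by simp
    finally show ?thesis using False na e by (simp add: gb_def cv_def inb_def u_def)
  qed
qed

lemma bconv_gb: "bconv (\<lambda>s. gb n s m) (cv n m)"
proof (rule bconvI[OF inb_gb])
  have z: "(\<lambda>s. 2 / (real s + 1)) \<longlonglongrightarrow> 0"
    using tendsto_mult[OF tendsto_const[of 2] LIMSEQ_inverse_real_of_nat] by (simp add: divide_inverse add.commute)
  show "(\<lambda>s. qv (snd (gb n s m))) \<longlonglongrightarrow> 0"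
    by (rule tendsto_0_le[OF z, where K = 1]) (auto simp: gb_def qv_def qn_def)
qed

lemma alive_iff: "alive n m \<longleftrightarrow> (gt m = 0 \<or> D n (gi m) (gt m - 1)) \<and> (\<forall>t\<ge>gt m. \<not> D n (gi m) t)"
proof
  assume a: "alive n m"
  have "\<not> D n (gi m) t" if "t \<ge> gt m" for t
    using a[unfolded alive_def, rule_format, of "Suc t"] that unfolding dead_def by auto
  then show "(gt m = 0 \<or> D n (gi m) (gt m - 1)) \<and> (\<forall>t\<ge>gt m. \<not> D n (gi m) t)"
    using a[unfolded alive_def, rule_format, of 0] unfolding dead_def by simp
next
  assume "(gt m = 0 \<or> D n (gi m) (gt m - 1)) \<and> (\<forall>t\<ge>gt m. \<not> D n (gi m) t)"
  then show "alive n m" unfolding alive_def dead_def by auto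
qed

lemma alive_G: assumes "alive n m" shows "gi m \<in> G n"
proof -
  have "{t. D n (gi m) t} \<subseteq> {..<gt m}" 
  proof
    fix t assume "t \<in> {t. D n (gi m) t}"
    then have "\<not> gt m \<le> t" using assms unfolding alive_iff by auto
    then show "t \<in> {..<gt m}" by simp
  qed
  then show ?thesis unfolding G_def using finite_subset by blast
qed

text \<open>Two living names of one generator would be dependent without any relation between them;
  uniqueness of the least bound rules this out.\<close>

lemma alive_unique: assumes "alive n m" "alive n m'" "gi m = gi m'" shows "m = m'"
proof -
  have "\<not> gt m < gt m'" if "alive n m" "alive n m'" "gi m = gi m'" for m m'
  proof
    assume l: "gt m < gt m'"
    then have "D n (gi m) (gt m' - 1)" using that unfolding alive_iff by auto
    then show False using that(1) l unfolding alive_iff by auto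
  qed
  then have "gt m = gt m'" using assms by (metis linorder_cases)
  then show ?thesis using assms(3) unfolding gi_def gt_def by (metis prod.collapse prod_decode_inverse)
qed

lemma G_alive: assumes "i \<in> G n" shows "\<exists>m. alive n m \<and> gi m = i"
proof -
  define b where "b = (LEAST b. \<forall>t\<ge>b. \<not> D n i t)"
  obtain b0 where "\<forall>t\<in>{t. D n i t}. t < b0" using assms unfolding G_def finite_nat_set_iff_bounded by blast
  then have "\<exists>b. \<forall>t\<ge>b. \<not> D n i t" by (intro exI[of _ b0]) auto
  then have b: "\<forall>t\<ge>b. \<not> D n i t" unfolding b_def by (rule LeastI_ex)
  have "b = 0 \<or> D n i (b - 1)"
  proof (rule ccontr)
    assume c: "\<not> (b = 0 \<or> D n i (b - 1))"
    have "\<not> D n i t" if "t \<ge> b - 1" for t using that b c by (cases "t = b - 1") auto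
    then have "(LEAST b. \<forall>t\<ge>b. \<not> D n i t) \<le> b - 1" by (intro Least_le) blast
    then have "b \<le> b - 1" unfolding b_def .
    moreover have "b \<noteq> 0" by (rule notI) (use c in simp)
    ultimately show False by arith
  qed
  then have "alive n (prod_encode (i, b))" unfolding alive_iff using b by (simp add: gi_def gt_def)
  then show ?thesis by (intro exI[of _ "prod_encode (i, b)"]) (simp add: gi_def)
qed

lemma cv_cl: "cv n m \<in> cl (rho ` G n)"
  unfolding cv_def using alive_G[of n m] cl_incl[of "rho ` G n"] qv_sfield[OF cl_sfield] by auto

text \<open>A root name \<open>u\<close> codes a term \<open>re u\<close>, whose variable 0 is the unknown and whose variable \<open>m + 1\<close> is the generator \<open>m\<close>,
  an interval from \<open>ra u\<close> to \<open>rb u\<close>, and a stage \<open>rs u\<close> before which ball arithmetic has verified that the term is strictly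
  increasing with a sign change there.\<close>

definition re :: "nat \<Rightarrow> nat" where "re u = fst (prod_decode u)"
definition rd :: "nat \<Rightarrow> q \<times> q \<times> nat" where "rd u = dc (snd (prod_decode u))"
abbreviation "ra u \<equiv> fst (rd u)"
abbreviation "rb u \<equiv> fst (snd (rd u))"
abbreviation "rs u \<equiv> snd (snd (rd u))"

definition ng1 :: "nat \<Rightarrow> nat \<Rightarrow> nat \<Rightarrow> q \<Rightarrow> bool" where
  "ng1 n s e a \<longleftrightarrow> bpos (bneg (beval (\<lambda>i. case_nat (a, qn 0) (gb n s) i) e))"
definition ps1 :: "nat \<Rightarrow> nat \<Rightarrow> nat \<Rightarrow> q \<Rightarrow> bool" where
  "ps1 n s e a \<longleftrightarrow> bpos (beval (\<lambda>i. case_nat (a, qn 0) (gb n s) i) e)"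
text \<open>The ball with midpoint \<open>a\<close> and radius \<open>c - a\<close> covers the
  interval from \<open>a\<close> to \<open>c\<close>, so a positive result bounds the derivative on
  the whole interval.\<close>

definition dr1 :: "nat \<Rightarrow> nat \<Rightarrow> nat \<Rightarrow> q \<Rightarrow> q \<Rightarrow> bool" where
  "dr1 n s e a c \<longleftrightarrow> bpos (beval (\<lambda>i. case_nat (a, qadd c (qneg a)) (gb n s) i) (tder e))"

abbreviation PQ :: "nat \<Rightarrow> nat \<Rightarrow> real \<Rightarrow> real" where
  "PQ n e y \<equiv> pv (case_nat y (cv n)) e"

lemma inb_env: "inb B y \<Longrightarrow> inb (beval (\<lambda>i. case_nat B (gb n s) i) e) (PQ n e y)"
  by (rule inb_beval) (auto split: nat.split intro: inb_gb)

lemma bconv_env: assumes "bconv B y" shows "bconv (\<lambda>s. beval (\<lambda>i. case_nat (B s) (gb n s) i) e) (PQ n e y)"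
proof (rule bconv_beval)
  fix i
  show "bconv (\<lambda>s. case i of 0 \<Rightarrow> B s | Suc j \<Rightarrow> gb n s j) (case i of 0 \<Rightarrow> y | Suc j \<Rightarrow> cv n j)"
    using assms bconv_gb by (cases i) auto
qed

lemma inb_pt: "inb (a, qn 0) (qv a)"
  by (simp add: inb_def)

lemma ng1_sound: "ng1 n s e a \<Longrightarrow> PQ n e (qv a) < 0"
  unfolding ng1_def using bpos_inb[OF _ inb_bneg[OF inb_env[OF inb_pt]]] by fastforce

lemma ps1_sound: "ps1 n s e a \<Longrightarrow> PQ n e (qv a) > 0"
  unfolding ps1_def using bpos_inb[OF _ inb_env[OF inb_pt]] by blast

lemma dr1_sound: "dr1 n s e a c \<Longrightarrow> qv a \<le> z \<Longrightarrow> z \<le> qv c \<Longrightarrow> PQ n (tder e) z > 0"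
  unfolding dr1_def by (rule bpos_inb, assumption, rule inb_env) (simp add: inb_def)

lemma ng1_ev: assumes "PQ n e (qv a) < 0" shows "eventually (\<lambda>s. ng1 n s e a) sequentially"
  unfolding ng1_def using assms by (intro bconv_bpos[OF bconv_bneg[OF bconv_env[OF bconv_const]]]) simp

lemma ps1_ev: assumes "PQ n e (qv a) > 0" shows "eventually (\<lambda>s. ps1 n s e a) sequentially"
  unfolding ps1_def using assms by (intro bconv_bpos[OF bconv_env[OF bconv_const]])

definition valid :: "nat \<Rightarrow> nat \<Rightarrow> bool" where
  "valid n u \<longleftrightarrow> qlt (ra u) (rb u) \<and> (\<exists>s<rs u. ng1 n s (re u) (ra u)) \<and> (\<exists>s<rs u. ps1 n s (re u) (rb u))
     \<and> (\<exists>s<rs u. dr1 n s (re u) (ra u) (rb u))"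

definition isrt :: "nat \<Rightarrow> nat \<Rightarrow> real \<Rightarrow> bool" where
  "isrt n u y \<longleftrightarrow> qv (ra u) < y \<and> y < qv (rb u) \<and> PQ n (re u) y = 0"

definition rt :: "nat \<Rightarrow> nat \<Rightarrow> real" where "rt n u = (THE y. isrt n u y)"

lemma valid_facts:
  assumes "valid n u"
  shows "qv (ra u) < qv (rb u)" "PQ n (re u) (qv (ra u)) < 0" "PQ n (re u) (qv (rb u)) > 0"
    "qv (ra u) \<le> z \<Longrightarrow> z \<le> qv (rb u) \<Longrightarrow> PQ n (tder (re u)) z > 0"
  using assms ng1_sound ps1_sound dr1_sound unfolding valid_def qlt_iff by blast+

lemma PQ_mono:
  assumes "y < z" and d: "\<And>t. y \<le> t \<Longrightarrow> t \<le> z \<Longrightarrow> PQ n (tder e) t > 0"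
  shows "PQ n e y < PQ n e z"
proof (rule DERIV_pos_imp_increasing[OF assms(1)])
  fix t assume "y \<le> t" "t \<le> z"
  then show "\<exists>d. ((\<lambda>y. PQ n e y) has_real_derivative d) (at t) \<and> 0 < d" using tder_deriv d by blast
qed

lemma valid_mono: assumes "valid n u" "qv (ra u) \<le> y" "y < z" "z \<le> qv (rb u)"
  shows "PQ n (re u) y < PQ n (re u) z"
proof (rule PQ_mono[OF assms(3)])
  fix t assume "y \<le> t" "t \<le> z"
  then have "qv (ra u) \<le> t" "t \<le> qv (rb u)" using assms(2,4) by linarith+
  then show "PQ n (tder (re u)) t > 0" by (rule valid_facts(4)[OF assms(1)])
qed

lemma ex_rt: assumes "valid n u" shows "\<exists>y. isrt n u y"
proof -
  have "\<exists>y\<ge>qv (ra u). y \<le> qv (rb u) \<and> PQ n (re u) y = 0"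
    using DERIV_isCont[OF tder_deriv[of "cv n" "re u"]] less_imp_le[OF valid_facts(1)[OF assms]]
      less_imp_le[OF valid_facts(2)[OF assms]] less_imp_le[OF valid_facts(3)[OF assms]] by (intro IVT allI impI)
  then obtain y where y: "qv (ra u) \<le> y" "y \<le> qv (rb u)" "PQ n (re u) y = 0" by blast
  moreover have "y \<noteq> qv (ra u)" "y \<noteq> qv (rb u)" using y(3) valid_facts(2,3)[OF assms] by auto
  ultimately have "isrt n u y" unfolding isrt_def by linarith
  then show ?thesis ..
qed

lemma isrt_unique: assumes "valid n u" "isrt n u y" "isrt n u z" shows "y = z"
proof -
  have "\<not> y < z" if i: "isrt n u y" "isrt n u z" for y z
  proof
    assume l: "y < z"
    have "PQ n (re u) y < PQ n (re u) z" by (rule valid_mono[OF assms(1) _ l]) (use i in \<open>simp_all add: isrt_def\<close>)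
    then show False using i by (simp add: isrt_def)
  qed
  from this[OF assms(2,3)] this[OF assms(3,2)] show ?thesis by linarith
qed

lemma rt: assumes "valid n u" shows "isrt n u (rt n u)"
proof -
  obtain y where y: "isrt n u y" using ex_rt[OF assms] ..
  show ?thesis unfolding rt_def by (rule theI[of "isrt n u", OF y]) (rule isrt_unique[OF assms _ y])
qed

lemma rt_eq: "valid n u \<Longrightarrow> isrt n u y \<Longrightarrow> rt n u = y"
  by (rule isrt_unique[OF _ rt])

lemma rtD: assumes "valid n u"
  shows "qv (ra u) < rt n u" "rt n u < qv (rb u)" "PQ n (re u) (rt n u) = 0"
  using rt[OF assms] unfolding isrt_def by auto

text \<open>A smaller interval on which ball arithmetic has seen the sign change at stage
  \<open>s\<close>; by monotonicity it contains the root.\<close>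

definition goodc :: "nat \<Rightarrow> nat \<Rightarrow> nat \<Rightarrow> q \<times> q \<Rightarrow> bool" where
  "goodc n s u c \<longleftrightarrow> qlt (fst c) (snd c) \<and> \<not> qlt (fst c) (ra u) \<and> \<not> qlt (rb u) (snd c)
     \<and> ng1 n s (re u) (fst c) \<and> ps1 n s (re u) (snd c)"
definition bll :: "q \<times> q \<Rightarrow> b" where "bll c = (fst c, qadd (snd c) (qneg (fst c)))"
text \<open>The smallest ball found among the first \<open>k\<close> candidate intervals, starting
  from the interval of the name. It always contains the root.\<close>

definition bestk :: "nat \<Rightarrow> nat \<Rightarrow> nat \<Rightarrow> nat \<Rightarrow> b" where
  "bestk n s u k = rec_nat (bll (ra u, rb u)) (\<lambda>i r. if goodc n s u (dc i) \<and> qlt (snd (bll (dc i))) (snd r)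
     then bll (dc i) else r) k"

lemma bestk_0: "bestk n s u 0 = bll (ra u, rb u)" unfolding bestk_def by simp
lemma bestk_Suc: "bestk n s u (Suc k) = (if goodc n s u (dc k) \<and> qlt (snd (bll (dc k))) (snd (bestk n s u k))
     then bll (dc k) else bestk n s u k)"
  unfolding bestk_def by simp

lemma bll_inb: "qv (fst c) \<le> y \<Longrightarrow> y \<le> qv (snd c) \<Longrightarrow> inb (bll c) y"
  unfolding inb_def bll_def by simp

lemma goodc_sound: assumes v: "valid n u" and g: "goodc n s u c"
  shows "qv (fst c) \<le> rt n u \<and> rt n u \<le> qv (snd c)"
proof -
  have l: "qv (fst c) < qv (snd c)" using g unfolding goodc_def qlt_iff by blast
  have a: "qv (ra u) \<le> qv (fst c)" "qv (snd c) \<le> qv (rb u)" "ng1 n s (re u) (fst c)" "ps1 n s (re u) (snd c)"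
    using g unfolding goodc_def qlt_iff by simp_all
  note r = rtD[OF v]
  have "\<not> rt n u < qv (fst c)"
  proof
    assume h: "rt n u < qv (fst c)"
    have "PQ n (re u) (rt n u) < PQ n (re u) (qv (fst c))" by (rule valid_mono[OF v _ h]) (use r a l in linarith)+
    then show False using r(3) ng1_sound[OF a(3)] by linarith
  qed
  moreover have "\<not> qv (snd c) < rt n u"
  proof
    assume h: "qv (snd c) < rt n u"
    have "PQ n (re u) (qv (snd c)) < PQ n (re u) (rt n u)" by (rule valid_mono[OF v _ h]) (use r a l in linarith)+
    then show False using r(3) ps1_sound[OF a(4)] by linarith
  qed
  ultimately show ?thesis by linarith
qed

lemma bestk_inb: assumes v: "valid n u" shows "inb (bestk n s u k) (rt n u)"
proof (induction k)
  case 0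
  show ?case unfolding bestk_0 using rtD[OF v] by (intro bll_inb) auto
next
  case (Suc k)
  show ?case
  proof (cases "goodc n s u (dc k) \<and> qlt (snd (bll (dc k))) (snd (bestk n s u k))")
    case True
    define c :: "q \<times> q" where "c = dc k"
    have g: "goodc n s u c" using True unfolding c_def by blast
    have "inb (bll c) (rt n u)" using goodc_sound[OF v g] by (intro bll_inb) auto
    then show ?thesis using True unfolding bestk_Suc c_def by simp
  next
    case False
    then show ?thesis using Suc unfolding bestk_Suc by (simp only: if_False)
  qed
qed

lemma bestk_antimono: "i \<le> k \<Longrightarrow> qv (snd (bestk n s u k)) \<le> qv (snd (bestk n s u i))"
proof (induction k rule: dec_induct)
  case (step k)
  have "qv (snd (bestk n s u (Suc k))) \<le> qv (snd (bestk n s u k))" unfolding bestk_Suc qlt_iff by auto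
  then show ?case using step by linarith
qed simp

lemma bestk_rad: assumes "goodc n s u c" "cd c < k" shows "qv (snd (bestk n s u k)) \<le> qv (snd c) - qv (fst c)"
proof -
  have "qv (snd (bestk n s u (Suc (cd c)))) \<le> qv (snd (bll c))"
    unfolding bestk_Suc dc_cd qlt_iff using assms(1) by auto
  moreover have "qv (snd (bll c)) = qv (snd c) - qv (fst c)" unfolding bll_def by simp
  ultimately show ?thesis using bestk_antimono[of "Suc (cd c)" k n s u] assms(2) by linarith
qed

text \<open>Rational ends close to the root have strict signs, which are verified from some stage
  on; later the candidate is also among those inspected.\<close>

lemma best_conv: assumes v: "valid n u" shows "bconv (\<lambda>s. bestk n s u s) (rt n u)"
proof (rule bconvI[OF bestk_inb[OF v]])
  show "(\<lambda>s. qv (snd (bestk n s u s))) \<longlonglongrightarrow> 0"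
  proof (rule order_tendstoI)
    fix a :: real assume "a < 0"
    moreover have "qv (snd (bestk n s u s)) \<ge> 0" for s using bestk_inb[OF v, of s s] unfolding inb_def by linarith
    ultimately show "\<forall>\<^sub>F s in sequentially. a < qv (snd (bestk n s u s))"
      by (intro always_eventually allI) (meson less_le_trans)
  next
    fix e :: real assume e: "0 < e"
    note r = rtD[OF v]
    have "max (qv (ra u)) (rt n u - e / 2) < rt n u" using r(1) e by simp
    from qv_dense[OF this] obtain a where "max (qv (ra u)) (rt n u - e / 2) < qv a \<and> qv a < rt n u" ..
    then have a: "qv (ra u) < qv a" "rt n u - e / 2 < qv a" "qv a < rt n u" by simp_all
    have "rt n u < min (qv (rb u)) (rt n u + e / 2)" using r(2) e by simp
    from qv_dense[OF this] obtain c where "rt n u < qv c \<and> qv c < min (qv (rb u)) (rt n u + e / 2)" ..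
    then have c: "rt n u < qv c" "qv c < qv (rb u)" "qv c < rt n u + e / 2" by simp_all
    have "PQ n (re u) (qv a) < PQ n (re u) (rt n u)" by (rule valid_mono[OF v]) (use a r in linarith)+
    then have "\<forall>\<^sub>F s in sequentially. ng1 n s (re u) a" unfolding r(3) by (rule ng1_ev)
    moreover have "PQ n (re u) (rt n u) < PQ n (re u) (qv c)" by (rule valid_mono[OF v]) (use c r in linarith)+
    then have "\<forall>\<^sub>F s in sequentially. ps1 n s (re u) c" unfolding r(3) by (rule ps1_ev)
    ultimately show "\<forall>\<^sub>F s in sequentially. qv (snd (bestk n s u s)) < e"
      using eventually_gt_at_top[of "cd (a, c)"]
    proof eventually_elim
      case (elim s)
      have "goodc n s u (a, c)" unfolding goodc_def qlt_iff fst_conv snd_conv not_less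
        using a c by (intro conjI elim) linarith+
      then have "qv (snd (bestk n s u s)) \<le> qv c - qv a" using bestk_rad[of n s u "(a, c)" s] elim by simp
      then show ?case using a c by linarith
    qed
  qed
qed

text \<open>Invalid root names denote 0, so that validity stays decidable and every number is a name.\<close>

definition X :: "nat \<Rightarrow> nat \<Rightarrow> real" where
  "X n k = (if fst (prod_decode k) = 0 then cv n (snd (prod_decode k))
     else if valid n (snd (prod_decode k)) then rt n (snd (prod_decode k)) else 0)"
definition nb :: "nat \<Rightarrow> nat \<Rightarrow> nat \<Rightarrow> b" where
  "nb n s k = (if fst (prod_decode k) = 0 then gb n s (snd (prod_decode k))
     else if valid n (snd (prod_decode k)) then bestk n s (snd (prod_decode k)) s else (qn 0, qn 0))"

lemma inb_nb: "inb (nb n s k) (X n k)"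
  unfolding nb_def X_def using inb_gb bestk_inb by (auto simp: inb_def[of "(qn 0, qn 0)"])

lemma bconv_nb: "bconv (\<lambda>s. nb n s k) (X n k)"
proof (cases "fst (prod_decode k) = 0")
  case True
  then show ?thesis unfolding nb_def X_def using bconv_gb by simp
next
  case False
  then show ?thesis unfolding nb_def X_def using best_conv bconv_const[of "qn 0"]
    by (cases "valid n (snd (prod_decode k))") auto
qed

lemma X_nvar: "X n (nvar m) = cv n m"
  unfolding X_def nvar_def by simp

text \<open>Separating variable 0 turns the term into a polynomial over the values of the
  generators; it is nonzero because it is negative at the left end.\<close>

lemma rt_cl: assumes v: "valid n u" shows "rt n u \<in> cl (rho ` G n)"
proof -
  define x where "x = case_nat (rt n u) (cv n)"
  have "(\<lambda>x. pv x (re u)) \<in> pf (insert 0 (UNIV - {0}))" by (rule pv_pf) auto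
  then obtain P m where P: "P \<in> PP (UNIV - {0}) m" "\<forall>x. pv x (re u) = poly (P x) (x 0)"
    using pf_insert_PP by blast
  have e: "PQ n (re u) t = poly (P x) t" for t
  proof -
    have "case_nat t (cv n) = x(0 := t)" unfolding x_def by (auto split: nat.split)
    then show ?thesis using P(2) PP_upd[OF P(1), of 0 x t] by simp
  qed
  have "P x \<noteq> 0" using e[of "qv (ra u)"] valid_facts(2)[OF v] by auto
  moreover have "poly (P x) (rt n u) = 0" using e[of "rt n u"] rtD(3)[OF v] by simp
  moreover have "coeff (P x) j \<in> cl (rho ` G n)" for j
  proof -
    have "(\<lambda>x. coeff (P x) j) \<in> pf (UNIV - {0})" using P(1) unfolding PP_def by blast
    then have "coeff (P x) j \<in> rg (x ` (UNIV - {0}))" using pf_rg[of "\<lambda>x. coeff (P x) j"] by simp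
    moreover have "x ` (UNIV - {0}) \<subseteq> cl (rho ` G n)"
    proof
      fix y assume "y \<in> x ` (UNIV - {0})"
      then obtain i where "y = x i" "i \<noteq> 0" by blast
      then show "y \<in> cl (rho ` G n)" unfolding x_def using cv_cl by (cases i) simp_all
    qed
    ultimately show ?thesis using rg_least[OF _ cl_sfield] by blast
  qed
  ultimately show ?thesis by (intro cl_algb) (auto simp: algb_def)
qed

lemma X_cl: "X n k \<in> cl (rho ` G n)"
  unfolding X_def using cv_cl rt_cl sfieldD(1)[OF cl_sfield] by auto

lemma rg_term: "c \<in> rg (rho ` G n) \<Longrightarrow> \<exists>e. \<forall>z. PQ n e z = c"
proof (induction rule: rg.induct)
  case (rg_base x)
  then obtain i where i: "i \<in> G n" "x = rho i" by blast
  then obtain m where "alive n m" "gi m = i" using G_alive by blast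
  then show ?case using i by (intro exI[of _ "tvar (Suc m)"]) (simp add: cv_def)
next
  case rg_one
  show ?case by (intro exI[of _ tone]) simp
next
  case (rg_neg x)
  then obtain e where "\<forall>z. PQ n e z = x" by blast
  then show ?case by (intro exI[of _ "tneg e"]) simp
next
  case (rg_add x y)
  then obtain e f where "\<forall>z. PQ n e z = x" "\<forall>z. PQ n f z = y" by blast
  then show ?case by (intro exI[of _ "tadd e f"]) simp
next
  case (rg_mul x y)
  then obtain e f where "\<forall>z. PQ n e z = x" "\<forall>z. PQ n f z = y" by blast
  then show ?case by (intro exI[of _ "tmul e f"]) simp
qed

lemma poly_term: "(\<And>i. coeff p i \<in> rg (rho ` G n)) \<Longrightarrow> \<exists>e. \<forall>z. PQ n e z = poly p z"
proof (induction p)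
  case 0
  show ?case by (intro exI[of _ tzero]) simp
next
  case (pCons a p)
  have "a \<in> rg (rho ` G n)" using pCons.prems[of 0] by simp
  moreover have "coeff p i \<in> rg (rho ` G n)" for i using pCons.prems[of "Suc i"] by simp
  ultimately obtain e f where "\<forall>z. PQ n e z = a" "\<forall>z. PQ n f z = poly p z"
    using rg_term pCons.IH by blast
  then show ?case by (intro exI[of _ "tadd e (tmul (tvar 0) f)"]) simp
qed

lemma rg_nat: "real k \<in> rg S"
proof (induction k)
  case 0 then show ?case by (simp add: rg_zero)
next
  case (Suc k)
  show ?case using rg_add[OF Suc rg_one] by (simp add: add.commute)
qed

text \<open>A polynomial of least degree with root \<open>y\<close> has a derivative that does not
  vanish at \<open>y\<close>; the sign is adjusted by negation.\<close>

lemma simple_root: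
  assumes "y \<in> cl S"
  shows "\<exists>p. (\<forall>i. coeff p i \<in> rg S) \<and> poly p y = 0 \<and> poly (pderiv p) y > 0"
proof -
  define ok where "ok p \<longleftrightarrow> p \<noteq> 0 \<and> (\<forall>i. coeff p i \<in> rg S) \<and> poly p y = 0" for p
  obtain p0 where "ok p0" using assms unfolding cl_def algb_def ok_def by auto
  from ex_has_least_nat[of ok, OF this, of degree] obtain p where p: "ok p"
    and m: "\<And>q. ok q \<Longrightarrow> degree p \<le> degree q" by auto
  have nz: "degree p \<noteq> 0"
  proof
    assume "degree p = 0"
    then obtain a where "p = [:a:]" by (rule degree_eq_zeroE)
    then show False using p unfolding ok_def by auto
  qed
  have dc: "coeff (pderiv p) i \<in> rg S" for i
    unfolding coeff_pderiv using p rg_mul[OF rg_nat[of "Suc i"]] unfolding ok_def by simp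
  have "poly (pderiv p) y \<noteq> 0"
  proof
    assume "poly (pderiv p) y = 0"
    moreover have "pderiv p \<noteq> 0" using nz by (simp add: pderiv_eq_0_iff)
    ultimately have "ok (pderiv p)" unfolding ok_def using dc by blast
    then have "degree p \<le> degree (pderiv p)" by (rule m)
    then show False using nz by (simp add: degree_pderiv)
  qed
  then consider "poly (pderiv p) y > 0" | "poly (pderiv (- p)) y > 0" unfolding pderiv_minus poly_minus
    by linarith
  then show ?thesis
  proof cases
    case 1 then show ?thesis using p unfolding ok_def by blast
  next
    case 2
    have "coeff (- p) i \<in> rg S" for i using p rg_neg unfolding ok_def by simp
    then show ?thesis using 2 p unfolding ok_def by (intro exI[of _ "- p"]) simp
  qed
qed

lemma cl_X: assumes y: "y \<in> cl (rho ` G n)" shows "\<exists>k. X n k = y"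
proof -
  obtain p where p: "\<forall>i. coeff p i \<in> rg (rho ` G n)" "poly p y = 0" "poly (pderiv p) y > 0"
    using simple_root[OF y] by blast
  obtain e where e: "\<And>z. PQ n e z = poly p z" using poly_term p(1) by blast
  have "((\<lambda>z. poly p z) has_real_derivative PQ n (tder e) y) (at y)" using tder_deriv[of "cv n" e y] unfolding e .
  then have d: "PQ n (tder e) y > 0" using DERIV_unique[OF poly_DERIV] p(3) by metis
  have "\<exists>a. y - 1 / (real r + 1) < qv a \<and> qv a < y" for r by (rule qv_dense) (simp add: add_nonneg_pos)
  then obtain a where a: "\<And>r. y - 1 / (real r + 1) < qv (a r)" "\<And>r. qv (a r) < y" by metis
  have "\<exists>c. y < qv c \<and> qv c < y + 1 / (real r + 1)" for r by (rule qv_dense) (simp add: add_nonneg_pos)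
  then obtain c where c: "\<And>r. y < qv (c r)" "\<And>r. qv (c r) < y + 1 / (real r + 1)" by metis
  \<comment> \<open>The shape of ball used by \<open>dr1\<close>. It shrinks to \<open>y\<close>, so
    that the derivative is eventually seen to be positive on the interval from \<open>a r\<close> to
    \<open>c r\<close>.\<close>
  define B where "B r = (a r, qadd (c r) (qneg (a r)))" for r
  have "bconv B y"
  proof (rule bconvI)
    fix s show "inb (B s) y" unfolding inb_def B_def using a(2)[of s] c(1)[of s] by simp
  next
    have z: "(\<lambda>s. 2 / (real s + 1)) \<longlonglongrightarrow> 0"
      using tendsto_mult[OF tendsto_const[of 2] LIMSEQ_inverse_real_of_nat] by (simp add: divide_inverse add.commute)
    have "norm (qv (snd (B s))) \<le> norm (2 / (real s + 1)) * 1" for s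
    proof -
      have "2 / (real s + 1) = 1 / (real s + 1) + 1 / (real s + 1)" by simp
      then show ?thesis using a[of s] c[of s] unfolding B_def real_norm_def snd_conv qv_qadd qv_qneg by linarith
    qed
    then show "(\<lambda>s. qv (snd (B s))) \<longlonglongrightarrow> 0"
      by (intro tendsto_0_le[OF z, where K = 1] always_eventually allI)
  qed
  then have "\<forall>\<^sub>F s in sequentially. bpos (beval (\<lambda>i. case_nat (B s) (gb n s) i) (tder e))"
    using d by (intro bconv_bpos[OF bconv_env])
  then obtain r where "bpos (beval (\<lambda>i. case_nat (B r) (gb n r) i) (tder e))"
    using eventually_happens'[OF sequentially_bot] by blast
  then have r: "dr1 n r e (a r) (c r)" unfolding dr1_def B_def .
  have l: "qv (a r) < y" "y < qv (c r)" by (rule a(2), rule c(1))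
  have dP: "PQ n (tder e) t > 0" if "qv (a r) \<le> t" "t \<le> qv (c r)" for t
    using dr1_sound[OF r that] .
  have "PQ n e (qv (a r)) < PQ n e y"
    by (rule PQ_mono[OF l(1) dP[OF _ order.trans[OF _ less_imp_le[OF l(2)]]]])
  moreover have "PQ n e y < PQ n e (qv (c r))"
    by (rule PQ_mono[OF l(2) dP[OF order.trans[OF less_imp_le[OF l(1)]]]])
  ultimately have sg: "PQ n e (qv (a r)) < 0" "PQ n e (qv (c r)) > 0" using e[of y] p(2) by linarith+
  obtain s1 where s1: "ng1 n s1 e (a r)" using eventually_happens'[OF sequentially_bot ng1_ev[OF sg(1)]] by (rule exE)
  obtain s2 where s2: "ps1 n s2 e (c r)" using eventually_happens'[OF sequentially_bot ps1_ev[OF sg(2)]] by (rule exE)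
  \<comment> \<open>Strictly above all three stages, since \<open>valid\<close> searches below
    \<open>rs u\<close>.\<close>
  obtain N where N: "r < N" "s1 < N" "s2 < N"
    using that[of "Suc (r + s1 + s2)"] by simp
  obtain u where u: "re u = e" "ra u = a r" "rb u = c r" "rs u = N"
    using that[of "prod_encode (e, cd (a r, c r, N))"] by (simp add: re_def rd_def)
  have v: "valid n u"
    using l r s1 s2 N by (auto simp add: valid_def u qlt_iff)
  have "isrt n u y" using l e[of y] p(2) by (simp add: isrt_def u)
  then have "rt n u = y" by (rule rt_eq[OF v])
  then show ?thesis using v by (intro exI[of _ "prod_encode (1, u)"]) (simp add: X_def)
qed

lemma range_X: "range (X n) = cl (rho ` G n)"
  using X_cl cl_X by blast

lemma cmp_D' [cmp_intros]: "cmp n \<Longrightarrow> cmp i \<Longrightarrow> cmp t \<Longrightarrow> cmp (\<lambda>x. D (n x) (i x) (t x))"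
  by (rule cmp_comp3[where g = D, OF cmp_D])

lemma cmp_ap' [cmp_intros]: "cmp i \<Longrightarrow> cmp t \<Longrightarrow> cmp (\<lambda>x. ap (i x) (t x))"
  by (rule cmp_comp2[where g = ap, OF cmp_ap])

lemma cmp_dead [cmp_intros]: "cmp n \<Longrightarrow> cmp m \<Longrightarrow> cmp s \<Longrightarrow> cmp (\<lambda>x. dead (n x) (m x) (s x))"
  by (rule cmp_comp3[where g = dead]) (unfold dead_def gi_def gt_def, intro cmp_intros)

lemma cmp_ds [cmp_intros]: "cmp n \<Longrightarrow> cmp m \<Longrightarrow> cmp s \<Longrightarrow> cmp (\<lambda>x. ds (n x) (m x) (s x))"
  by (rule cmp_comp3[where g = ds]) (unfold ds_def, intro cmp_intros, blast)

lemma cmp_gb [cmp_intros]: "cmp n \<Longrightarrow> cmp s \<Longrightarrow> cmp m \<Longrightarrow> cmp (\<lambda>x. gb (n x) (s x) (m x))"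
  by (rule cmp_comp3[where g = gb]) (unfold gb_def gi_def, intro cmp_intros)

lemma cmp_tests [cmp_intros]:
  assumes a: "cmp n" "cmp s" "cmp e" "cmp a"
  shows "cmp (\<lambda>x. ng1 (n x) (s x) (e x) (a x))" "cmp (\<lambda>x. ps1 (n x) (s x) (e x) (a x))"
  unfolding ng1_def ps1_def by (intro cmp_intros a cmp_comp[OF a(1)] cmp_comp[OF a(2)] cmp_comp[OF a(4)])+

lemma cmp_re_rd [cmp_intros]: "cmp u \<Longrightarrow> cmp (\<lambda>x. re (u x))" "cmp u \<Longrightarrow> cmp (\<lambda>x. rd (u x))"
  unfolding re_def rd_def by (intro cmp_intros; assumption)+

lemma cmp_dr1: "cmp (\<lambda>p. dr1 (fst p) (fst (snd p)) (fst (snd (snd p))) (fst (snd (snd (snd p)))) (snd (snd (snd (snd p)))))"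
  unfolding dr1_def by (intro cmp_intros)

lemma cmp_dr1' [cmp_intros]:
  assumes "cmp n" "cmp s" "cmp e" "cmp a" "cmp c" shows "cmp (\<lambda>x. dr1 (n x) (s x) (e x) (a x) (c x))"
proof -
  have "cmp (\<lambda>x. (n x, s x, e x, a x, c x))" by (intro cmp_pair assms)
  from cmp_comp[OF cmp_dr1 this] show ?thesis unfolding fst_conv snd_conv .
qed

lemma cmp_valid [cmp_intros]: "cmp n \<Longrightarrow> cmp u \<Longrightarrow> cmp (\<lambda>x. valid (n x) (u x))"
  by (rule cmp_comp2[where g = valid]) (unfold valid_def, intro cmp_intros)

lemma cmp_goodc [cmp_intros]: "cmp n \<Longrightarrow> cmp s \<Longrightarrow> cmp u \<Longrightarrow> cmp c \<Longrightarrow> cmp (\<lambda>x. goodc (n x) (s x) (u x) (c x))"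
  by (rule cmp_comp4[where g = goodc]) (unfold goodc_def, intro cmp_intros)

lemma cmp_bll [cmp_intros]: "cmp c \<Longrightarrow> cmp (\<lambda>x. bll (c x))"
  unfolding bll_def by (intro cmp_intros)

lemma cmp_bestk [cmp_intros]: "cmp n \<Longrightarrow> cmp s \<Longrightarrow> cmp u \<Longrightarrow> cmp k \<Longrightarrow> cmp (\<lambda>x. bestk (n x) (s x) (u x) (k x))"
  by (rule cmp_comp4[where g = bestk]) (unfold bestk_def, intro cmp_intros)

lemma cmp_nb [cmp_intros]: "cmp n \<Longrightarrow> cmp s \<Longrightarrow> cmp k \<Longrightarrow> cmp (\<lambda>x. nb (n x) (s x) (k x))"
  by (rule cmp_comp3[where g = nb]) (unfold nb_def, intro cmp_intros)

text \<open>The equation known for name \<open>k\<close> at stage \<open>s\<close>: linear with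
  rational solution for a dead generator, the trivial one for a generator not yet refuted, the
  translated root term for a valid root name, and \<open>x k = 0\<close> for an invalid one.\<close>

definition rel :: "nat \<Rightarrow> nat \<Rightarrow> nat \<Rightarrow> nat" where
  "rel n s k = (if fst (prod_decode k) = 0 then
     (if dead n (snd (prod_decode k)) s
      then tadd (tmul (tnum (Suc (snd (snd (ap (gi (snd (prod_decode k))) (ds n (snd (prod_decode k)) s)))))) (tvar k))
        (tadd (tnum (fst (snd (ap (gi (snd (prod_decode k))) (ds n (snd (prod_decode k)) s)))))
          (tneg (tnum (fst (ap (gi (snd (prod_decode k))) (ds n (snd (prod_decode k)) s))))))
      else tzero)
     else if valid n (snd (prod_decode k)) then tsub k (re (snd (prod_decode k))) else tvar k)"

lemma rel_dead: "dead n m s \<Longrightarrow> pv x (rel n s (nvar m)) = real (Suc (snd (snd (ap (gi m) (ds n m s))))) * x (nvar m)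
    + (real (fst (snd (ap (gi m) (ds n m s)))) + - real (fst (ap (gi m) (ds n m s))))"
  by (simp add: rel_def nvar_def del: of_nat_Suc)

lemma rel_valid: "fst (prod_decode k) \<noteq> 0 \<Longrightarrow> valid n (snd (prod_decode k)) \<Longrightarrow>
    pv x (rel n s k) = pv (case_nat (x k) (\<lambda>m. x (nvar m))) (re (snd (prod_decode k)))"
  by (simp add: rel_def pv_tsub)

lemma rel_invalid: "fst (prod_decode k) \<noteq> 0 \<Longrightarrow> \<not> valid n (snd (prod_decode k)) \<Longrightarrow> pv x (rel n s k) = x k"
  by (simp add: rel_def)

lemma X_env: "(\<lambda>m. X n (nvar m)) = cv n"
  by (rule ext) (rule X_nvar)

lemma qv_lin: "real (Suc (snd (snd r))) * qv r + (real (fst (snd r)) + - real (fst r)) = 0"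
proof -
  have "real (snd (snd r)) + 1 \<noteq> 0" by linarith
  then have "(real (snd (snd r)) + 1) * qv r = real (fst r) - real (fst (snd r))" unfolding qv_def by simp
  then show ?thesis by (simp add: add.commute)
qed

lemma rel_sound: "pv (X n) (rel n s k) = 0"
proof (cases "fst (prod_decode k) = 0")
  case True
  define m where "m = snd (prod_decode k)"
  have "prod_decode k = (0, m)" using True by (simp add: prod_eq_iff m_def)
  then have k: "k = nvar m" unfolding nvar_def by (metis prod_decode_inverse)
  show ?thesis
  proof (cases "dead n m s")
    case True
    then have "\<not> alive n m" unfolding alive_def by blast
    then have "X n (nvar m) = qv (ap (gi m) (ds n m s))" unfolding X_nvar cv_def using ds_eq[OF True] by simp
    then show ?thesis unfolding k rel_dead[OF True] by (simp only: qv_lin)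
  next
    case False
    then show ?thesis by (simp add: rel_def k nvar_def)
  qed
next
  case False
  show ?thesis
  proof (cases "valid n (snd (prod_decode k))")
    case True
    then have "X n k = rt n (snd (prod_decode k))" using False by (simp add: X_def)
    then show ?thesis unfolding rel_valid[OF False True] X_env using rtD(3)[OF True] by simp
  next
    case iv: False
    then show ?thesis unfolding rel_invalid[OF False iv] using False by (simp add: X_def)
  qed
qed

definition zterm :: "nat \<Rightarrow> nat \<Rightarrow> nat \<Rightarrow> nat \<Rightarrow> (nat \<times> nat) list \<Rightarrow> nat" where
  "zterm n t S L l = tadd (tmul L t) (tneg (foldr (\<lambda>p r. tadd (tmul (snd p) (rel n S (fst p))) r) l tzero))"

text \<open>The components of \<open>w\<close> are the stage for the ball test, the stage for the
  relations, the multiplier \<open>L\<close> and the cofactors. The identity is checked as a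
  polynomial identity, so only the nonvanishing of \<open>L\<close> concerns the actual
  point.\<close>

definition zcert :: "nat \<Rightarrow> nat \<Rightarrow> nat \<times> nat \<times> nat \<times> (nat \<times> nat) list \<Rightarrow> bool" where
  "zcert n t w \<longleftrightarrow> zt (zterm n t (fst (snd w)) (fst (snd (snd w))) (snd (snd (snd w))))
     \<and> (bpos (beval (\<lambda>i. nb n (fst w) i) (fst (snd (snd w)))) \<or> bpos (bneg (beval (\<lambda>i. nb n (fst w) i) (fst (snd (snd w))))))"

lemma pv_zterm: "pv x (zterm n t S L l) = pv x L * pv x t - (\<Sum>p\<leftarrow>l. pv x (snd p) * pv x (rel n S (fst p)))"
proof -
  have "pv x (foldr (\<lambda>p r. tadd (tmul (snd p) (rel n S (fst p))) r) l tzero)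
      = (\<Sum>p\<leftarrow>l. pv x (snd p) * pv x (rel n S (fst p)))" by (induction l) simp_all
  then show ?thesis unfolding zterm_def by simp
qed

lemma beval_pos: "bpos (beval (\<lambda>i. nb n s i) t) \<Longrightarrow> pv (X n) t > 0"
  by (rule bpos_inb[OF _ inb_beval[OF inb_nb]])

lemma beval_neg: "bpos (bneg (beval (\<lambda>i. nb n s i) t)) \<Longrightarrow> pv (X n) t < 0"
  using bpos_inb[OF _ inb_bneg[OF inb_beval[OF inb_nb]]] by fastforce

lemma beval_pos_ex: assumes "pv (X n) t > 0" shows "\<exists>s. bpos (beval (\<lambda>i. nb n s i) t)"
  using eventually_happens'[OF sequentially_bot bconv_bpos[OF bconv_beval[OF bconv_nb] assms]] .

lemma beval_neg_ex: assumes "pv (X n) t < 0" shows "\<exists>s. bpos (bneg (beval (\<lambda>i. nb n s i) t))"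
proof -
  have "- pv (X n) t > 0" using assms by simp
  from eventually_happens'[OF sequentially_bot bconv_bpos[OF bconv_bneg[OF bconv_beval[OF bconv_nb]] this]]
  show ?thesis .
qed

lemma zcert_sound: assumes "zcert n t w" shows "pv (X n) t = 0"
proof -
  define L where "L = fst (snd (snd w))"
  have "pv (X n) L \<noteq> 0"
    using assms beval_pos[of n "fst w" L] beval_neg[of n "fst w" L] unfolding zcert_def L_def by fastforce
  moreover have "(\<Sum>p\<leftarrow>l. pv (X n) (snd p) * pv (X n) (rel n S (fst p))) = 0" for l :: "(nat \<times> nat) list" and S
    by (induction l) (simp_all add: rel_sound)
  moreover have "pv (X n) (zterm n t (fst (snd w)) L (snd (snd (snd w)))) = 0"
    using assms unfolding zcert_def zt_iff L_def by blast
  ultimately show ?thesis unfolding pv_zterm by simp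
qed

lemma cmp_rel [cmp_intros]: "cmp n \<Longrightarrow> cmp s \<Longrightarrow> cmp k \<Longrightarrow> cmp (\<lambda>x. rel (n x) (s x) (k x))"
  by (rule cmp_comp3[where g = rel]) (unfold rel_def gi_def, intro cmp_intros)

lemma cmp_zcert [cmp_intros]: "cmp n \<Longrightarrow> cmp t \<Longrightarrow> cmp w \<Longrightarrow> cmp (\<lambda>x. zcert (n x) (t x) (w x))"
  by (rule cmp_comp3[where g = zcert]) (unfold zcert_def zterm_def, intro cmp_intros)

lemma ex_stage: "\<exists>S. \<forall>m\<le>k. \<not> alive n m \<longrightarrow> dead n m S"
proof (induction k)
  case 0
  show ?case
  proof (cases "alive n 0")
    case False
    then obtain s where "dead n 0 s" unfolding alive_def by blast
    then show ?thesis by (intro exI[of _ s]) simp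
  qed simp
next
  case (Suc k)
  then obtain S where S: "\<forall>m\<le>k. \<not> alive n m \<longrightarrow> dead n m S" ..
  obtain s where s: "\<not> alive n (Suc k) \<longrightarrow> dead n (Suc k) s" unfolding alive_def by blast
  have "dead n m (max S s)" if m: "m \<le> Suc k" "\<not> alive n m" for m
  proof (cases "m = Suc k")
    case True
    then show ?thesis using s m dead_mono[of n m s "max S s"] by simp
  next
    case False
    then have "dead n m S" using S m by simp
    then show ?thesis by (rule dead_mono) simp
  qed
  then show ?case by (intro exI[of _ "max S s"] allI impI)
qed

end

lemma nvar_eq_iff: "nvar a = nvar b \<longleftrightarrow> a = b"
  by (simp add: nvar_def prod_encode_eq)

text \<open>Independence is required only among members of \<open>G n\<close>, against smaller
  members; reals rejected by the index set are unrestricted.\<close>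

locale gen_indep = gen +
  assumes indep: "i \<in> G n \<Longrightarrow> rho i \<notin> cl (rho ` {j \<in> G n. j < i})"
begin

text \<open>\<open>Zp\<close> is extended from the empty set to all names that can occur in
  \<open>t\<close>: generator names by increasing generator index, then root names, whose terms
  mention generators only.\<close>

lemma zcert_complete: assumes t: "pv (X n) t = 0" shows "\<exists>w. zcert n t w"
proof -
  \<comment> \<open>One stage at which all wrong guesses among the names concerned have been
    refuted, so their linear relations are available.\<close>
  obtain S where S: "\<forall>m\<le>t. \<not> alive n m \<longrightarrow> dead n m S" using ex_stage by (rule exE)
  define R where "R v = (\<lambda>x. pv x (rel n S v))" for v
  interpret Re: relations "X n" R
    by unfold_locales (unfold R_def, rule pv_pf, simp)
  have g1: "Re.Zp (insert (nvar m) V)"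
    if Z: "Re.Zp V" and v: "nvar m \<notin> V" and m: "m \<le> t" and al: "alive n m \<Longrightarrow> X n (nvar m) \<notin> cl (X n ` V)" for m V
  proof (cases "alive n m")
    case True
    show ?thesis by (rule Re.Zp_trans[OF Z v al[OF True]])
  next
    case False
    then have d: "dead n m S" using S m by simp
    define c p q where "c = Suc (snd (snd (ap (gi m) (ds n m S))))" and "p = fst (ap (gi m) (ds n m S))"
      and "q = fst (snd (ap (gi m) (ds n m S)))"
    have e: "R (nvar m) = (\<lambda>x. real c * x (nvar m) + (real q + - real p))"
      unfolding R_def rel_dead[OF d] c_def p_def q_def ..
    show ?thesis
    proof (rule Re.Zp_alg[OF Z v, where d = "real c"])
      show "R (nvar m) \<in> pf (insert (nvar m) V)"
        unfolding e by (rule pf_add[OF pf_mul[OF pf_nat pf_var] pf_add[OF pf_nat pf_neg[OF pf_nat]]]) simp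
      show "R (nvar m) (X n) = 0" unfolding R_def by (rule rel_sound)
      show "((\<lambda>t. R (nvar m) ((X n)(nvar m := t))) has_real_derivative real c) (at (X n (nvar m)))"
        unfolding e fun_upd_same by (auto intro!: derivative_eq_intros)
      show "real c \<noteq> 0" unfolding c_def by simp
    qed
  qed
  have g2: "Re.Zp (nvar ` {m. m \<le> t \<and> gi m < I})" for I
  proof (induction I)
    case 0
    show ?case using Re.Zp_empty by simp
  next
    case (Suc I)
    define A where "A = {m. m \<le> t \<and> gi m < I}"
    \<comment> \<open>Names with the same index \<open>I\<close> are added in any order: at most one
      of them is alive, the others are rationals, so the living one is still transcendental over
      what has been added.\<close>
    have inner: "F \<subseteq> {m. m \<le> t \<and> gi m = I} \<Longrightarrow> Re.Zp (nvar ` (F \<union> A))" if "finite F" for F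
      using that
    proof (induction F rule: finite_induct)
      case empty
      show ?case using Suc.IH unfolding A_def by simp
    next
      case (insert m F)
      have m: "m \<le> t" "gi m = I" and F: "F \<subseteq> {m. m \<le> t \<and> gi m = I}" using insert.prems by auto
      have mn: "m \<notin> F \<union> A" using insert.hyps(2) m unfolding A_def by simp
      have "Re.Zp (insert (nvar m) (nvar ` (F \<union> A)))"
      proof (rule g1[OF insert.IH[OF F] _ m(1)])
        show "nvar m \<notin> nvar ` (F \<union> A)" using mn by (auto simp: nvar_eq_iff)
        assume al: "alive n m"
        have "X n ` nvar ` (F \<union> A) \<subseteq> cl (rho ` {j \<in> G n. j < I})"
        proof
          fix y assume "y \<in> X n ` nvar ` (F \<union> A)"
          then obtain m' where m': "m' \<in> F \<union> A" "y = cv n m'" unfolding X_nvar[symmetric] by blast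
          show "y \<in> cl (rho ` {j \<in> G n. j < I})"
          proof (cases "alive n m'")
            case True
            have "gi m' \<noteq> I" using alive_unique[OF True al] m(2) m'(1) mn by auto
            then have "gi m' < I" using m'(1) F unfolding A_def by auto
            then have "rho (gi m') \<in> rho ` {j \<in> G n. j < I}" using alive_G[OF True] by simp
            then show ?thesis unfolding m'(2) cv_def using True cl_incl[of "rho ` {j \<in> G n. j < I}"] by auto
          next
            case False
            then show ?thesis unfolding m'(2) cv_def using qv_sfield[OF cl_sfield] by simp
          qed
        qed
        then have "cl (X n ` nvar ` (F \<union> A)) \<subseteq> cl (rho ` {j \<in> G n. j < I})" by (rule cl_least)
        moreover have "X n (nvar m) = rho I" unfolding X_nvar cv_def using al m(2) by simp
        moreover have "I \<in> G n" using alive_G[OF al] m(2) by simp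
        ultimately show "X n (nvar m) \<notin> cl (X n ` nvar ` (F \<union> A))" using indep[of I n] by auto
      qed
      then show ?case by simp
    qed
    have "finite {m. m \<le> t \<and> gi m = I}" by (rule finite_subset[of _ "{..t}"]) auto
    from inner[OF this] have "Re.Zp (nvar ` ({m. m \<le> t \<and> gi m = I} \<union> A))" by simp
    moreover have "{m. m \<le> t \<and> gi m = I} \<union> A = {m. m \<le> t \<and> gi m < Suc I}" unfolding A_def by auto
    ultimately show ?case by simp
  qed
  have gil: "gi m \<le> m" for m unfolding gi_def by (rule fst_prod_decode_le)
  have "{m. m \<le> t \<and> gi m < Suc t} = {..t}"
  proof (rule set_eqI)
    fix m show "m \<in> {m. m \<le> t \<and> gi m < Suc t} \<longleftrightarrow> m \<in> {..t}" using gil[of m] by auto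
  qed
  then have g3: "Re.Zp (nvar ` {..t})" using g2[of "Suc t"] by simp
  \<comment> \<open>A term inside the name \<open>k\<close> has code at most \<open>k\<close>, so
    its generators lie among those already treated; the derivative condition of
    \<open>Zp_alg\<close> is part of validity.\<close>
  have r1: "F \<subseteq> {k. k \<le> t \<and> fst (prod_decode k) \<noteq> 0} \<Longrightarrow> Re.Zp (F \<union> nvar ` {..t})" if "finite F" for F
    using that
  proof (induction F rule: finite_induct)
    case empty
    show ?case using g3 by simp
  next
    case (insert k F)
    define u where "u = snd (prod_decode k)"
    have k: "k \<le> t" "fst (prod_decode k) \<noteq> 0" and F: "F \<subseteq> {k. k \<le> t \<and> fst (prod_decode k) \<noteq> 0}"
      using insert.prems by auto
    have kn: "nvar m \<noteq> k" for m using k(2) by (auto simp: nvar_def)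
    then have kV: "k \<notin> F \<union> nvar ` {..t}" using insert.hyps(2) by auto
    have "Re.Zp (insert k (F \<union> nvar ` {..t}))"
    proof (cases "valid n u")
      case True
      have e: "R k = (\<lambda>x. pv (case_nat (x k) (\<lambda>m. x (nvar m))) (re u))"
        unfolding R_def u_def rel_valid[OF k(2) True[unfolded u_def]] ..
      have ru: "re u \<le> t" unfolding re_def u_def
        by (rule order.trans[OF fst_prod_decode_le order.trans[OF snd_prod_decode_le k(1)]])
      have Xk: "X n k = rt n u" using True k(2) by (simp add: X_def u_def)
      show ?thesis
      proof (rule Re.Zp_alg[OF insert.IH[OF F] kV])
        show "R k \<in> pf (insert k (F \<union> nvar ` {..t}))"
          unfolding e
        proof (rule pv_pf_env)
          fix i assume i: "i \<le> re u"
          show "(\<lambda>x. case i of 0 \<Rightarrow> x k | Suc m \<Rightarrow> x (nvar m)) \<in> pf (insert k (F \<union> nvar ` {..t}))"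
          proof (cases i)
            case 0 then show ?thesis using pf_var[of k] by simp
          next
            case (Suc m)
            then have "nvar m \<in> insert k (F \<union> nvar ` {..t})" using i ru by auto
            then show ?thesis using Suc pf_var by simp
          qed
        qed
        show "R k (X n) = 0" unfolding R_def by (rule rel_sound)
        have "((\<lambda>t. pv (case_nat t (cv n)) (re u)) has_real_derivative PQ n (tder (re u)) (rt n u)) (at (rt n u))"
          by (rule tder_deriv)
        moreover have "(\<lambda>t. R k ((X n)(k := t))) = (\<lambda>t. pv (case_nat t (cv n)) (re u))"
        proof
          fix s
          have "(\<lambda>m. ((X n)(k := s)) (nvar m)) = cv n" using kn by (auto simp: X_nvar)
          then show "R k ((X n)(k := s)) = pv (case_nat s (cv n)) (re u)" unfolding e fun_upd_same by simp
        qed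
        ultimately show "((\<lambda>t. R k ((X n)(k := t))) has_real_derivative PQ n (tder (re u)) (rt n u)) (at (X n k))"
          unfolding Xk by simp
        show "PQ n (tder (re u)) (rt n u) \<noteq> 0"
          using valid_facts(4)[OF True less_imp_le[OF rtD(1)[OF True]] less_imp_le[OF rtD(2)[OF True]]] by simp
      qed
    next
      case False
      have e: "R k = (\<lambda>x. x k)" unfolding R_def rel_invalid[OF k(2) False[unfolded u_def]] ..
      show ?thesis
      proof (rule Re.Zp_alg[OF insert.IH[OF F] kV, where d = 1])
        show "R k \<in> pf (insert k (F \<union> nvar ` {..t}))" unfolding e by (rule pf_var) simp
        show "R k (X n) = 0" unfolding R_def by (rule rel_sound)
        show "((\<lambda>t. R k ((X n)(k := t))) has_real_derivative 1) (at (X n k))"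
          unfolding e fun_upd_same by (rule DERIV_ident)
      qed simp
    qed
    then show ?case by simp
  qed
  have "finite {k. k \<le> t \<and> fst (prod_decode k) \<noteq> 0}" by (rule finite_subset[of _ "{..t}"]) auto
  from r1[OF this] have "Re.Zp ({k. k \<le> t \<and> fst (prod_decode k) \<noteq> 0} \<union> nvar ` {..t})" by simp
  moreover have "{..t} \<subseteq> {k. k \<le> t \<and> fst (prod_decode k) \<noteq> 0} \<union> nvar ` {..t}"
  proof
    fix k assume k: "k \<in> {..t}"
    show "k \<in> {k. k \<le> t \<and> fst (prod_decode k) \<noteq> 0} \<union> nvar ` {..t}"
    proof (cases "fst (prod_decode k) = 0")
      case True
      have "prod_decode k = (0, snd (prod_decode k))" using True by (simp add: prod_eq_iff)
      then have kk: "k = nvar (snd (prod_decode k))" unfolding nvar_def by (metis prod_decode_inverse)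
      have "snd (prod_decode k) \<in> {..t}" using snd_prod_decode_le[of k] k by simp
      from imageI[OF this, of nvar] show ?thesis using kk by simp
    next
      case False
      then show ?thesis using k by simp
    qed
  qed
  ultimately have Zt: "Re.Zp {..t}" by (rule Re.Zp_antimono)
  have pft: "(\<lambda>x. pv x t) \<in> pf {..t}" by (rule pv_pf) simp
  have "Re.cert (\<lambda>x. pv x t)" using bspec[OF Zt[unfolded Re.Zp_def] pft] t by simp
  then obtain L where L: "L \<in> pf UNIV" "L (X n) \<noteq> 0" "(\<lambda>x. L x * pv x t) \<in> Re.J" unfolding Re.cert_def by (elim bexE conjE)
  obtain c where c: "\<forall>x. pv x c = L x" using pf_code[OF L(1)] by (rule exE)
  obtain l :: "(nat \<times> nat) list" where l: "\<forall>x. L x * pv x t = (\<Sum>p\<leftarrow>l. pv x (snd p) * R (fst p) x)"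
    using Re.J_code[OF L(3)] by (rule exE)
  have z: "zt (zterm n t S c l)" unfolding zt_iff pv_zterm using c l by (simp add: R_def)
  have "\<exists>s. bpos (beval (\<lambda>i. nb n s i) c) \<or> bpos (bneg (beval (\<lambda>i. nb n s i) c))"
  proof (cases "pv (X n) c > 0")
    case True
    obtain s where "bpos (beval (\<lambda>i. nb n s i) c)" using beval_pos_ex[OF True] by (rule exE)
    then show ?thesis by (intro exI[of _ s] disjI1)
  next
    case False
    then have "pv (X n) c < 0" using L(2) c by simp
    from beval_neg_ex[OF this] obtain s where "bpos (bneg (beval (\<lambda>i. nb n s i) c))" by (rule exE)
    then show ?thesis by (intro exI[of _ s] disjI2)
  qed
  then obtain s where "bpos (beval (\<lambda>i. nb n s i) c) \<or> bpos (bneg (beval (\<lambda>i. nb n s i) c))" by (rule exE)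
  then have "zcert n t (s, S, c, l)" unfolding zcert_def using z by simp
  then show ?thesis ..
qed

text \<open>One witness type for all three outcomes, so that a single unbounded search decides the
  sign; it terminates by trichotomy.\<close>

definition dec :: "nat \<Rightarrow> nat \<Rightarrow> nat \<times> nat \<times> nat \<times> (nat \<times> nat) list \<Rightarrow> bool" where
  "dec n t w \<longleftrightarrow> bpos (beval (\<lambda>i. nb n (fst w) i) t) \<or> bpos (bneg (beval (\<lambda>i. nb n (fst w) i) t)) \<or> zcert n t w"

lemma ex_dec: "\<exists>i. dec n t (dc i)"
proof -
  have "\<exists>w. dec n t w"
  proof (cases "pv (X n) t" "0 :: real" rule: linorder_cases)
    case less
    obtain s where "bpos (bneg (beval (\<lambda>i. nb n s i) t))" using beval_neg_ex[OF less] by (rule exE)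
    then show ?thesis unfolding dec_def by (intro exI[of _ "(s, 0, 0, [])"]) simp
  next
    case equal
    from zcert_complete[OF this] obtain w where "zcert n t w" by (rule exE)
    then show ?thesis unfolding dec_def by (intro exI[of _ w] disjI2)
  next
    case greater
    obtain s where "bpos (beval (\<lambda>i. nb n s i) t)" using beval_pos_ex[OF greater] by (rule exE)
    then show ?thesis unfolding dec_def by (intro exI[of _ "(s, 0, 0, [])"]) simp
  qed
  then obtain w where "dec n t w" ..
  then show ?thesis by (intro exI[of _ "cd w"]) simp
qed

definition dw :: "nat \<Rightarrow> nat \<Rightarrow> nat \<times> nat \<times> nat \<times> (nat \<times> nat) list" where
  "dw n t = dc (LEAST i. dec n t (dc i))"

lemma dec_dw: "dec n t (dw n t)"
  unfolding dw_def by (rule LeastI_ex[OF ex_dec])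

text \<open>Once a decisive witness is found, the outcomes exclude each other by soundness, and the
  ball test at that witness settles positivity.\<close>

lemma pos_iff: "pv (X n) t > 0 \<longleftrightarrow> bpos (beval (\<lambda>i. nb n (fst (dw n t)) i) t)"
  using dec_dw[of n t] beval_pos[of n "fst (dw n t)" t] beval_neg[of n "fst (dw n t)" t] zcert_sound[of n t "dw n t"]
  unfolding dec_def by fastforce

lemma cmp_dec: "cmp (\<lambda>p. dec (fst p) (fst (snd p)) (snd (snd p)))"
  unfolding dec_def by (intro cmp_intros)

lemma cmp_dw: "cmp (\<lambda>p. dw (fst p) (snd p))"
  unfolding dw_def by (intro cmp_intros cmp_comp3[where g = dec, OF cmp_dec] ex_dec)

lemma cmp_pos [cmp_intros]: "cmp n \<Longrightarrow> cmp t \<Longrightarrow> cmp (\<lambda>x. 0 < pv (X (n x)) (t x))"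
  by (rule cmp_comp2[where g = "\<lambda>n t. 0 < pv (X n) t"])
    (unfold pos_iff, intro cmp_intros cmp_comp2[where g = dw, OF cmp_dw])

lemma cmp_zero [cmp_intros]: assumes "cmp n" "cmp t" shows "cmp (\<lambda>x. pv (X (n x)) (t x) = 0)"
proof -
  have "cmp (\<lambda>x. \<not> 0 < pv (X (n x)) (t x) \<and> \<not> 0 < pv (X (n x)) (tneg (t x)))"
    by (intro cmp_not cmp_conj cmp_pos cmp_terms(2) assms)
  moreover have "(\<lambda>x. \<not> 0 < pv (X (n x)) (t x) \<and> \<not> 0 < pv (X (n x)) (tneg (t x))) = (\<lambda>x. pv (X (n x)) (t x) = 0)"
    by (rule ext) (simp only: pv_simps, linarith)
  ultimately show ?thesis by (simp only:)
qed

end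

section \<open>Uniformly computable real closed fields\<close>

lemma poly_pos_ex: assumes "lead_coeff p > 0" shows "\<exists>n. \<forall>x\<ge>n. poly p (x :: real) > 0"
proof -
  obtain n where n: "\<forall>x\<ge>n. poly p x \<ge> lead_coeff p" using poly_pinfty_gt_lc[OF assms] by (rule exE)
  have "poly p x > 0" if "x \<ge> n" for x using n[rule_format, OF that] assms by linarith
  then show ?thesis by (intro exI[of _ n] allI impI)
qed

text \<open>Intermediate values: with positive leading coefficient, \<open>q\<close> is eventually
  positive, and so is \<open>- q(- x)\<close> because the degree is odd.\<close>

lemma odd_degree_root: assumes o: "odd (degree (p :: real poly))" shows "\<exists>x. poly p x = 0"
proof -
  have pos: "\<exists>x. poly q x = 0" if q: "odd (degree q)" "lead_coeff q > 0" for q :: "real poly"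
  proof -
    obtain n where n: "\<forall>x\<ge>n. poly q x > 0" using poly_pos_ex[OF q(2)] by (rule exE)
    define r where "r = - pcompose q [:0, - 1:]"
    have "lead_coeff (pcompose q [:0, - 1:]) = lead_coeff q * lead_coeff [:0, - 1:] ^ degree q"
      by (rule lead_coeff_comp) simp
    then have "lead_coeff r > 0" unfolding r_def using q by simp
    then obtain m where m: "\<forall>x\<ge>m. poly r x > 0" using poly_pos_ex[of r] by auto
    define a where "a = max 1 (max n m)"
    have "poly r a > 0" "poly q a > 0" using n m unfolding a_def by simp_all
    then have "poly q (- a) < 0" "poly q a > 0" unfolding r_def by (simp_all add: poly_pcompose)
    moreover have "- a < a" unfolding a_def by simp
    ultimately show ?thesis using poly_IVT_pos[of "- a" a q] by blast
  qed
  show ?thesis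
  proof (cases "lead_coeff p > 0")
    case True then show ?thesis using pos o by blast
  next
    case False
    have "p \<noteq> 0" using o by auto
    then have "lead_coeff (- p) > 0" using False by (simp add: less_le)
    then show ?thesis using pos[of "- p"] o by simp
  qed
qed

lemma rcf_set_cl: "rcf_set (cl S)"
proof -
  note F = sfieldD[OF cl_sfield[of S]]
  have root: "y \<in> cl S" if "p \<noteq> 0" "\<And>i. coeff p i \<in> cl S" "poly p y = 0" for p y
    using that by (intro cl_algb) (auto simp: algb_def)
  have sq: "sqrt x \<in> cl S" if x: "x \<in> cl S" "x > 0" for x
  proof (rule root)
    show "[:- x, 0, 1:] \<noteq> 0" by simp
    show "coeff [:- x, 0, 1:] i \<in> cl S" for i using F(1,2) F(5)[OF x(1)] by (auto simp: coeff_pCons split: nat.split)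
    show "poly [:- x, 0, 1:] (sqrt x) = 0" using x(2) by simp
  qed
  have od: "\<exists>x\<in>cl S. poly p x = 0" if p: "\<forall>i. coeff p i \<in> cl S" "odd (degree p)" for p
  proof -
    obtain x where x: "poly p x = 0" using odd_degree_root[OF p(2)] by (rule exE)
    have "x \<in> cl S" by (rule root[OF _ _ x]) (use p in auto)
    then show ?thesis using x by (rule bexI[rotated])
  qed
  show ?thesis unfolding rcf_set_def
  proof (intro conjI)
    show "0 \<in> cl S" "1 \<in> cl S" by (rule F(1), rule F(2))
    show "\<forall>x\<in>cl S. \<forall>y\<in>cl S. x + y \<in> cl S \<and> x * y \<in> cl S" using F(3,4) by simp
    show "\<forall>x\<in>cl S. - x \<in> cl S" using F(5) by simp
    show "\<forall>x\<in>cl S. x \<noteq> 0 \<longrightarrow> inverse x \<in> cl S" using F(6) by simp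
    show "\<forall>x\<in>cl S. 0 < x \<longrightarrow> sqrt x \<in> cl S" using sq by simp
    show "\<forall>p. (\<forall>i. coeff p i \<in> cl S) \<and> odd (degree p) \<longrightarrow> (\<exists>x\<in>cl S. poly p x = 0)"
    proof (intro allI impI)
      fix p assume "(\<forall>i. coeff p i \<in> cl S) \<and> odd (degree p)"
      then show "\<exists>x\<in>cl S. poly p x = 0" by (elim conjE) (rule od)
    qed
  qed
qed

section \<open>Atomic diagrams of the fields named by term codes\<close>

lemma code_tm_terms:
  "code_tm (TC k) = tvar k" "code_tm TZ = tzero" "code_tm TO = tone"
  "code_tm (TAdd a b) = tadd (code_tm a) (code_tm b)" "code_tm (TMul a b) = tmul (code_tm a) (code_tm b)"
  "code_tm (TNeg a) = tneg (code_tm a)"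
  by (simp_all add: term_defs)

text \<open>\<open>pv\<close> gives every number a value, but the diagram admits only genuine terms:
  the leaves for the constants 0 and 1 must carry 0, and element constants must belong to
  \<open>C\<close>.\<close>

definition okt :: "(nat \<Rightarrow> bool) \<Rightarrow> nat \<Rightarrow> bool" where
  "okt C e = tfold (\<lambda>t r. t = 0 \<and> C r \<or> (t = 1 \<or> t = 2) \<and> r = 0) (\<lambda>a. a) (\<and>) (\<and>) e"

lemma okt_simps:
  "okt C (tadd a b) \<longleftrightarrow> okt C a \<and> okt C b" "okt C (tmul a b) \<longleftrightarrow> okt C a \<and> okt C b" "okt C (tneg a) \<longleftrightarrow> okt C a"
  "okt C (tvar k) \<longleftrightarrow> C k" "okt C tzero" "okt C tone"
  unfolding okt_def by simp_all

lemma okt_iff: "okt C e \<longleftrightarrow> (\<exists>a. code_tm a = e \<and> (\<forall>k\<in>tm_consts a. C k))"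
proof
  show "okt C e \<Longrightarrow> \<exists>a. code_tm a = e \<and> (\<forall>k\<in>tm_consts a. C k)"
  proof (induction e rule: term_induct)
    case (leaf t r)
    then have "t = 0 \<and> C r \<or> (t = 1 \<or> t = 2) \<and> r = 0" by (simp add: okt_def tfold_leaf)
    then consider "t = 0" "C r" | "t = 1" "r = 0" | "t = 2" "r = 0" by blast
    then show ?case
    proof cases
      case 1 then show ?thesis by (intro exI[of _ "TC r"]) simp
    next
      case 2 then show ?thesis by (intro exI[of _ TZ]) simp
    next
      case 3 then show ?thesis by (intro exI[of _ TO]) simp
    qed
  next
    case (add a b)
    then obtain x y where "code_tm x = a" "\<forall>k\<in>tm_consts x. C k" "code_tm y = b" "\<forall>k\<in>tm_consts y. C k"
      unfolding okt_simps by (elim conjE meta_impE exE)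
    then show ?case by (intro exI[of _ "TAdd x y"]) (auto simp: tadd_def)
  next
    case (mul a b)
    then obtain x y where "code_tm x = a" "\<forall>k\<in>tm_consts x. C k" "code_tm y = b" "\<forall>k\<in>tm_consts y. C k"
      unfolding okt_simps by (elim conjE meta_impE exE)
    then show ?case by (intro exI[of _ "TMul x y"]) (auto simp: tmul_def)
  next
    case (neg a)
    then obtain x where "code_tm x = a" "\<forall>k\<in>tm_consts x. C k"
      unfolding okt_simps by (elim conjE meta_impE exE)
    then show ?case by (intro exI[of _ "TNeg x"]) (auto simp: tneg_def)
  qed
next
  assume "\<exists>a. code_tm a = e \<and> (\<forall>k\<in>tm_consts a. C k)"
  then obtain a where a: "code_tm a = e" "\<forall>k\<in>tm_consts a. C k" by (elim exE conjE)
  have "\<forall>k\<in>tm_consts a. C k \<Longrightarrow> okt C (code_tm a)"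
    by (induction a) (simp_all only: code_tm_terms okt_simps tm_consts.simps, simp_all)
  then show "okt C e" using a by simp
qed

definition dlit :: "(nat \<Rightarrow> bool) \<Rightarrow> (nat \<Rightarrow> nat \<Rightarrow> bool) \<Rightarrow> (nat \<Rightarrow> nat \<Rightarrow> bool) \<Rightarrow> nat \<Rightarrow> bool" where
  "dlit C eq lt x \<longleftrightarrow> okt C (fst (prod_decode (snd (prod_decode x)))) \<and> okt C (snd (prod_decode (snd (prod_decode x)))) \<and>
     (fst (prod_decode x) = 0 \<and> eq (fst (prod_decode (snd (prod_decode x)))) (snd (prod_decode (snd (prod_decode x)))) \<or>
      fst (prod_decode x) = 1 \<and> lt (fst (prod_decode (snd (prod_decode x)))) (snd (prod_decode (snd (prod_decode x)))) \<or>
      fst (prod_decode x) = 2 \<and> \<not> eq (fst (prod_decode (snd (prod_decode x)))) (snd (prod_decode (snd (prod_decode x)))) \<or>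
      fst (prod_decode x) = 3 \<and> \<not> lt (fst (prod_decode (snd (prod_decode x)))) (snd (prod_decode (snd (prod_decode x)))))"

lemma diag_dlit:
  assumes eq: "\<And>a b. tm_consts a \<subseteq> s_carrier B \<Longrightarrow> tm_consts b \<subseteq> s_carrier B \<Longrightarrow> eq (code_tm a) (code_tm b) \<longleftrightarrow> tm_val B a = tm_val B b"
    and lt: "\<And>a b. tm_consts a \<subseteq> s_carrier B \<Longrightarrow> tm_consts b \<subseteq> s_carrier B \<Longrightarrow> lt (code_tm a) (code_tm b) \<longleftrightarrow> s_less B (tm_val B a) (tm_val B b)"
  shows "x \<in> diag B \<longleftrightarrow> dlit (\<lambda>k. k \<in> s_carrier B) eq lt x"
proof
  have ok: "okt (\<lambda>k. k \<in> s_carrier B) (code_tm a)" if "tm_consts a \<subseteq> s_carrier B" for a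
    unfolding okt_iff using that by (intro exI[of _ a]) auto
  assume "x \<in> diag B"
  then obtain l where l: "x = code_lit l" "lit_consts l \<subseteq> s_carrier B" "lit_holds B l" unfolding diag_def by (elim CollectE exE conjE)
  show "dlit (\<lambda>k. k \<in> s_carrier B) eq lt x"
    using l ok eq lt by (cases l) (simp_all add: dlit_def)
next
  assume d: "dlit (\<lambda>k. k \<in> s_carrier B) eq lt x"
  define T r where "T = fst (prod_decode x)" and "r = snd (prod_decode x)"
  have "okt (\<lambda>k. k \<in> s_carrier B) (fst (prod_decode r))" "okt (\<lambda>k. k \<in> s_carrier B) (snd (prod_decode r))"
    using d unfolding dlit_def r_def by simp_all
  then obtain a b where a: "code_tm a = fst (prod_decode r)" "\<forall>k\<in>tm_consts a. k \<in> s_carrier B"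
    and b: "code_tm b = snd (prod_decode r)" "\<forall>k\<in>tm_consts b. k \<in> s_carrier B"
    unfolding okt_iff by (elim exE conjE)
  have ab: "tm_consts a \<subseteq> s_carrier B" "tm_consts b \<subseteq> s_carrier B" using a b by auto
  have "prod_encode (code_tm a, code_tm b) = r" unfolding a b by simp
  then have x: "prod_encode (T, prod_encode (code_tm a, code_tm b)) = x" unfolding T_def r_def by simp
  note d' = d[unfolded dlit_def, folded T_def r_def, folded a(1) b(1)]
  then consider "T = 0" "eq (code_tm a) (code_tm b)" | "T = 1" "lt (code_tm a) (code_tm b)"
    | "T = 2" "\<not> eq (code_tm a) (code_tm b)" | "T = 3" "\<not> lt (code_tm a) (code_tm b)" by (elim conjE disjE) simp_all
  then show "x \<in> diag B"
  proof cases
    case 1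
    then have "lit_holds B (LEq a b)" "code_lit (LEq a b) = x" using eq[OF ab] x by simp_all
    then show ?thesis unfolding diag_def using ab by (intro CollectI exI[of _ "LEq a b"]) simp
  next
    case 2
    then have "lit_holds B (LLt a b)" "code_lit (LLt a b) = x" using lt[OF ab] x by simp_all
    then show ?thesis unfolding diag_def using ab by (intro CollectI exI[of _ "LLt a b"]) simp
  next
    case 3
    then have "lit_holds B (LNEq a b)" "code_lit (LNEq a b) = x" using eq[OF ab] x by simp_all
    then show ?thesis unfolding diag_def using ab by (intro CollectI exI[of _ "LNEq a b"]) simp
  next
    case 4
    then have "lit_holds B (LNLt a b)" "code_lit (LNLt a b) = x" using lt[OF ab] x by simp_all
    then show ?thesis unfolding diag_def using ab by (intro CollectI exI[of _ "LNLt a b"]) simp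
  qed
qed

context gen_indep
begin

text \<open>The universe keeps the least name of each element. The inequality is phrased as the
  value of a term so that the decision procedure for zero applies.\<close>

definition crr :: "nat \<Rightarrow> nat \<Rightarrow> bool" where
  "crr n k \<longleftrightarrow> (\<forall>j<k. pv (X n) (tadd (tvar j) (tneg (tvar k))) \<noteq> 0)"

definition nm :: "nat \<Rightarrow> nat \<Rightarrow> nat" where "nm n t = (LEAST k. X n k = pv (X n) t)"

definition Bs :: "nat \<Rightarrow> ostr" where
  "Bs n = \<lparr>s_carrier = {k. crr n k}, s_add = \<lambda>i j. nm n (tadd (tvar i) (tvar j)),
     s_mul = \<lambda>i j. nm n (tmul (tvar i) (tvar j)), s_neg = \<lambda>i. nm n (tneg (tvar i)),
     s_zero = nm n tzero, s_one = nm n tone, s_less = \<lambda>i j. X n i < X n j\<rparr>"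

lemma X_nm: "X n (nm n t) = pv (X n) t"
proof -
  have "(\<lambda>x. pv x t) \<in> pf UNIV" by (rule pv_pf) simp
  from pf_rg[OF this, of "X n"] have "pv (X n) t \<in> rg (range (X n))" .
  then have "pv (X n) t \<in> cl (rho ` G n)" by (rule rg_least[OF _ cl_sfield]) (simp add: range_X)
  then have "pv (X n) t \<in> range (X n)" by (simp add: range_X)
  then obtain k where "pv (X n) t = X n k" by (rule rangeE)
  then have "\<exists>k. X n k = pv (X n) t" by (intro exI[of _ k]) simp
  then show ?thesis unfolding nm_def by (rule LeastI_ex)
qed

lemma crr_iff: "crr n k \<longleftrightarrow> (\<forall>j<k. X n j \<noteq> X n k)"
  unfolding crr_def by simp

lemma crr_nm: "crr n (nm n t)"
  unfolding crr_iff
proof (intro allI impI)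
  fix j assume "j < nm n t"
  then have "X n j \<noteq> pv (X n) t" unfolding nm_def by (rule not_less_Least)
  then show "X n j \<noteq> X n (nm n t)" by (simp only: X_nm) simp
qed

lemma crr_inj: assumes "crr n i" "crr n j" "X n i = X n j" shows "i = j"
proof (rule ccontr)
  assume "i \<noteq> j"
  then consider "i < j" | "j < i" by linarith
  then show False using assms unfolding crr_iff by cases auto
qed

lemma emb_Bs: "emb (Bs n) (X n)"
  unfolding emb_def
proof (intro conjI)
  show "wf_str (Bs n)" unfolding wf_str_def by (simp add: Bs_def crr_nm)
  show "inj_on (X n) (s_carrier (Bs n))"
  proof (rule inj_onI)
    fix i j assume "i \<in> s_carrier (Bs n)" "j \<in> s_carrier (Bs n)" and e: "X n i = X n j"
    then have "crr n i" "crr n j" by (simp_all add: Bs_def)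
    then show "i = j" using e by (rule crr_inj)
  qed
qed (simp_all add: Bs_def X_nm)

lemma image_Bs: "X n ` s_carrier (Bs n) = cl (rho ` G n)"
proof
  show "X n ` s_carrier (Bs n) \<subseteq> cl (rho ` G n)" unfolding range_X[symmetric] by auto
  show "cl (rho ` G n) \<subseteq> X n ` s_carrier (Bs n)"
  proof
    fix y assume "y \<in> cl (rho ` G n)"
    then have "y \<in> range (X n)" by (simp add: range_X)
    then obtain k where k: "y = X n k" by (rule rangeE)
    have "X n (nm n (tvar k)) = y" unfolding X_nm k by simp
    moreover have "nm n (tvar k) \<in> s_carrier (Bs n)" by (simp add: Bs_def crr_nm)
    ultimately show "y \<in> X n ` s_carrier (Bs n)" by (rule image_eqI[OF sym])
  qed
qed

lemma arch_rcf_Bs: "arch_rcf (Bs n)"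
  by (rule arch_rcf_embI[OF emb_Bs]) (simp only: image_Bs rcf_set_cl)

text \<open>Atomic statements about \<open>Bs n\<close> become sign questions about terms over
  names, so the diagram is decided without computing the operations \<open>nm\<close>.\<close>

lemma tm_val_Bs: "X n (tm_val (Bs n) a) = pv (X n) (code_tm a)"
  by (induction a) (simp_all add: code_tm_terms Bs_def X_nm del: code_tm.simps)

lemma tm_val_crr: "tm_consts a \<subseteq> s_carrier (Bs n) \<Longrightarrow> crr n (tm_val (Bs n) a)"
  by (cases a) (simp_all add: Bs_def crr_nm)

definition dd :: "nat \<Rightarrow> nat \<Rightarrow> bool" where
  "dd n x = dlit (crr n) (\<lambda>a b. pv (X n) (tadd a (tneg b)) = 0) (\<lambda>a b. 0 < pv (X n) (tadd b (tneg a))) x"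

lemma diag_Bs: "x \<in> diag (Bs n) \<longleftrightarrow> dd n x"
proof -
  have c: "(\<lambda>k. k \<in> s_carrier (Bs n)) = crr n" by (rule ext) (simp add: Bs_def)
  show ?thesis unfolding dd_def c[symmetric]
  proof (rule diag_dlit)
    fix a b assume a: "tm_consts a \<subseteq> s_carrier (Bs n)" "tm_consts b \<subseteq> s_carrier (Bs n)"
    have "pv (X n) (tadd (code_tm a) (tneg (code_tm b))) = 0 \<longleftrightarrow> X n (tm_val (Bs n) a) = X n (tm_val (Bs n) b)"
      unfolding tm_val_Bs by simp
    also have "\<dots> \<longleftrightarrow> tm_val (Bs n) a = tm_val (Bs n) b"
      using crr_inj[OF tm_val_crr[OF a(1)] tm_val_crr[OF a(2)]] by auto
    finally show "pv (X n) (tadd (code_tm a) (tneg (code_tm b))) = 0 \<longleftrightarrow> tm_val (Bs n) a = tm_val (Bs n) b" .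
    have "s_less (Bs n) i j \<longleftrightarrow> X n i < X n j" for i j by (simp add: Bs_def)
    then show "0 < pv (X n) (tadd (code_tm b) (tneg (code_tm a))) \<longleftrightarrow> s_less (Bs n) (tm_val (Bs n) a) (tm_val (Bs n) b)"
      by (simp add: tm_val_Bs)
  qed
qed

lemma cmp_crr: "cmp (\<lambda>p. crr (fst p) (snd p))"
  unfolding crr_def by (intro cmp_intros)

lemma cmp_dd: "cmp (\<lambda>p. dd (fst p) (snd p))"
  unfolding dd_def dlit_def okt_def by (intro cmp_intros cmp_comp2[where g = crr, OF cmp_crr])

theorem uniform_rcf:
  "\<exists>f. computable_fun f \<and> (\<forall>n. \<exists>B h. arch_rcf B \<and> emb B h \<and> is_index (f n) B \<and> h ` s_carrier B = cl (rho ` G n))"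
proof -
  obtain f where f: "computable_fun f" "\<forall>n x. phi (f n) x = Some (cd (dd n x))" using smn[OF cmp_dd] by (elim exE conjE)
  have "is_index (f n) (Bs n)" for n
    unfolding is_index_def diag_Bs using f(2) by (simp add: cd_bool_def)
  then have "\<exists>B h. arch_rcf B \<and> emb B h \<and> is_index (f n) B \<and> h ` s_carrier B = cl (rho ` G n)" for n
    by (intro exI[of _ "Bs n"] exI[of _ "X n"] conjI arch_rcf_Bs emb_Bs image_Bs)
  then show ?thesis using f(1) by (intro exI[of _ f] conjI allI)
qed

end

section \<open>Literals and certificates\<close>

lemma okt_mono: "okt C e \<Longrightarrow> (\<And>k. C k \<Longrightarrow> D k) \<Longrightarrow> okt D e"
  by (induction e rule: term_induct) (auto simp: okt_simps, auto simp: okt_def tfold_leaf)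

lemma okt_tnum: "okt C (tnum k)"
  unfolding tnum_def by (induction k) (simp_all add: okt_simps)

lemma cmp_okt [cmp_intros]:
  assumes "cmp (\<lambda>p. C (fst p) (snd p))" "cmp e" shows "cmp (\<lambda>x. okt (\<lambda>k. C x k) (e x))"
  unfolding okt_def by (intro cmp_intros cmp_comp2[OF assms(1)] assms(2))

lemma emb_tm_val:
  assumes e: "emb B g" shows "tm_consts a \<subseteq> s_carrier B \<Longrightarrow> tm_val B a \<in> s_carrier B \<and> g (tm_val B a) = pv g (code_tm a)"
  by (induction a) (use e in \<open>simp_all add: code_tm_terms emb_def wf_str_def del: code_tm.simps\<close>)

lemma diag_emb:
  assumes e: "emb B g"
  shows "x \<in> diag B \<longleftrightarrow> dlit (\<lambda>k. k \<in> s_carrier B) (\<lambda>a b. pv g a = pv g b) (\<lambda>a b. pv g a < pv g b) x"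
proof (rule diag_dlit)
  fix a b assume ab: "tm_consts a \<subseteq> s_carrier B" "tm_consts b \<subseteq> s_carrier B"
  note v = emb_tm_val[OF e ab(1)] emb_tm_val[OF e ab(2)]
  have inj: "inj_on g (s_carrier B)" and lt: "\<forall>x\<in>s_carrier B. \<forall>y\<in>s_carrier B. s_less B x y \<longleftrightarrow> g x < g y"
    using e unfolding emb_def by auto
  show "pv g (code_tm a) = pv g (code_tm b) \<longleftrightarrow> tm_val B a = tm_val B b"
    using v inj_on_eq_iff[OF inj, of "tm_val B a" "tm_val B b"] by simp
  show "pv g (code_tm a) < pv g (code_tm b) \<longleftrightarrow> s_less B (tm_val B a) (tm_val B b)"
    using v lt by simp
qed

definition eqc :: "nat \<Rightarrow> nat \<Rightarrow> nat" where "eqc a b = prod_encode (0, prod_encode (a, b))"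
definition ltc :: "nat \<Rightarrow> nat \<Rightarrow> nat" where "ltc a b = prod_encode (1, prod_encode (a, b))"
definition nec :: "nat \<Rightarrow> nat \<Rightarrow> nat" where "nec a b = prod_encode (2, prod_encode (a, b))"

lemma lit_diag:
  assumes e: "emb B g"
  shows "eqc a b \<in> diag B \<longleftrightarrow> okt (\<lambda>k. k \<in> s_carrier B) a \<and> okt (\<lambda>k. k \<in> s_carrier B) b \<and> pv g a = pv g b"
    "ltc a b \<in> diag B \<longleftrightarrow> okt (\<lambda>k. k \<in> s_carrier B) a \<and> okt (\<lambda>k. k \<in> s_carrier B) b \<and> pv g a < pv g b"
    "nec a b \<in> diag B \<longleftrightarrow> okt (\<lambda>k. k \<in> s_carrier B) a \<and> okt (\<lambda>k. k \<in> s_carrier B) b \<and> pv g a \<noteq> pv g b"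
  unfolding diag_emb[OF e] dlit_def eqc_def ltc_def nec_def by simp_all

text \<open>The literal \<open>y = y\<close>, which is in the diagram exactly when \<open>y\<close>
  belongs to the universe.\<close>

definition cc :: "nat \<Rightarrow> nat" where "cc y = eqc (tvar y) (tvar y)"
text \<open>The literal for \<open>r < y\<close> with the denominator cleared; it makes rational
  cuts part of the diagram.\<close>

definition litq :: "q \<Rightarrow> nat \<Rightarrow> nat" where
  "litq r y = ltc (tnum (fst r)) (tadd (tmul (tnum (Suc (snd (snd r)))) (tvar y)) (tnum (fst (snd r))))"

lemma cmp_lits [cmp_intros]:
  "cmp a \<Longrightarrow> cmp b \<Longrightarrow> cmp (\<lambda>x. eqc (a x) (b x))" "cmp a \<Longrightarrow> cmp b \<Longrightarrow> cmp (\<lambda>x. nec (a x) (b x))"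
  "cmp a \<Longrightarrow> cmp (\<lambda>x. cc (a x))" "cmp r \<Longrightarrow> cmp a \<Longrightarrow> cmp (\<lambda>x. litq (r x) (a x))"
  unfolding eqc_def nec_def cc_def litq_def ltc_def by (intro cmp_intros; assumption)+

lemma cc_diag: "emb B g \<Longrightarrow> cc y \<in> diag B \<longleftrightarrow> y \<in> s_carrier B"
  unfolding cc_def by (simp add: lit_diag okt_simps)

lemma litq_diag: assumes e: "emb B g" shows "litq r y \<in> diag B \<longleftrightarrow> y \<in> s_carrier B \<and> qv r < g y"
proof -
  have p: "real (snd (snd r)) + 1 > 0" by linarith
  have "qv r < g y \<longleftrightarrow> real (fst r) < (1 + real (snd (snd r))) * g y + real (fst (snd r))"
    unfolding qv_def pos_divide_less_eq[OF p] by (auto simp: algebra_simps)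
  then show ?thesis unfolding litq_def lit_diag[OF e] by (simp add: okt_simps okt_tnum)
qed

lemma qv_cut_eq: assumes "\<And>r. qv r < u \<longleftrightarrow> qv r < v" shows "u = v"
proof (rule ccontr)
  assume "u \<noteq> v"
  then consider "u < v" | "v < u" by linarith
  then show False
  proof cases
    case 1
    from qv_dense[OF 1] obtain r where "u < qv r \<and> qv r < v" ..
    then show False using assms[of r] by linarith
  next
    case 2
    from qv_dense[OF 2] obtain r where "v < qv r \<and> qv r < u" ..
    then show False using assms[of r] by linarith
  qed
qed

text \<open>The diagram determines the universe through \<open>cc\<close> and every cut through
  \<open>litq\<close>. Hence the image belongs to the index, whichever structure and embedding are
  chosen.\<close>

lemma diag_image:
  assumes e: "emb B g" "emb B' g'" and d: "diag B = diag B'"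
  shows "g ` s_carrier B = g' ` s_carrier B'"
proof (rule image_cong)
  show c: "s_carrier B = s_carrier B'" using cc_diag[OF e(1)] cc_diag[OF e(2)] d by auto
  fix y assume y: "y \<in> s_carrier B'"
  show "g y = g' y"
  proof (rule qv_cut_eq)
    fix r show "qv r < g y \<longleftrightarrow> qv r < g' y" using litq_diag[OF e(1), of r y] litq_diag[OF e(2), of r y] d c y by simp
  qed
qed

lemma is_index_diag: assumes "is_index a B" "is_index a B'" shows "diag B = diag B'"
proof (rule set_eqI)
  fix x
  have "Some (if x \<in> diag B then 1 else 0 :: nat) = Some (if x \<in> diag B' then 1 else 0)"
    using assms unfolding is_index_def by metis
  then show "x \<in> diag B \<longleftrightarrow> x \<in> diag B'" by (simp split: if_splits)
qed

lemma is_index_TT: "is_index a B \<Longrightarrow> (\<exists>w. TT a x v w) \<longleftrightarrow> v = (if x \<in> diag B then 1 else 0)"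
  unfolding phi_TT[symmetric] is_index_def by auto

text \<open>Horner's scheme as a term, with coefficient terms \<open>ts\<close>.\<close>

definition hz :: "nat list \<Rightarrow> nat \<Rightarrow> nat" where
  "hz ts y = foldr (\<lambda>t r. tadd t (tmul (tvar y) r)) ts tzero"

lemma cmp_hz [cmp_intros]: "cmp ts \<Longrightarrow> cmp y \<Longrightarrow> cmp (\<lambda>x. hz (ts x) (y x))"
  by (rule cmp_comp2[where g = hz]) (unfold hz_def, intro cmp_intros)

lemma pv_hz: "pv g (hz ts y) = poly (Poly (map (pv g) ts)) (g y)"
  unfolding hz_def by (induction ts) simp_all

lemma okt_hz: "(\<And>t. t \<in> set ts \<Longrightarrow> okt C t) \<Longrightarrow> C y \<Longrightarrow> okt C (hz ts y)"
  unfolding hz_def by (induction ts) (simp_all add: okt_simps)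

lemma okt_rg: "okt W t \<Longrightarrow> pv g t \<in> rg (g ` {k. W k})"
proof (induction t rule: term_induct)
  case (leaf t r)
  then have "t = 0 \<and> W r \<or> (t = 1 \<or> t = 2) \<and> r = 0" by (simp add: okt_def tfold_leaf)
  then show ?case using leaf(1) by (auto simp: pv_leaf rg_zero rg_one intro!: rg_base)
next
  case (add a b) then show ?case by (simp add: okt_simps rg_add)
next
  case (mul a b) then show ?case by (simp add: okt_simps rg_mul)
next
  case (neg a) then show ?case by (simp add: okt_simps rg_neg)
qed

lemma rg_okt: "c \<in> rg (g ` {k. W k}) \<Longrightarrow> \<exists>t. okt W t \<and> pv g t = c"
proof (induction rule: rg.induct)
  case (rg_base x)
  then obtain k where "W k" "x = g k" by auto
  then show ?case by (intro exI[of _ "tvar k"]) (simp add: okt_simps)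
next
  case rg_one
  show ?case by (intro exI[of _ tone]) (simp add: okt_simps)
next
  case (rg_neg x)
  then obtain e where "okt W e" "pv g e = x" by (elim exE conjE)
  then show ?case by (intro exI[of _ "tneg e"]) (simp add: okt_simps)
next
  case (rg_add x y)
  then obtain e f where "okt W e" "pv g e = x" "okt W f" "pv g f = y" by (elim exE conjE)
  then show ?case by (intro exI[of _ "tadd e f"]) (simp add: okt_simps)
next
  case (rg_mul x y)
  then obtain e f where "okt W e" "pv g e = x" "okt W f" "pv g f = y" by (elim exE conjE)
  then show ?case by (intro exI[of _ "tmul e f"]) (simp add: okt_simps)
qed

text \<open>Algebraic dependence as the existence of finitely many terms with an equation and an
  inequation in the diagram; this is its enumerable form.\<close>

lemma cl_terms:
  "g y \<in> cl (g ` {k. W k}) \<longleftrightarrow> (\<exists>ts. (\<forall>t\<in>set ts. okt W t) \<and> pv g (hz ts y) = 0 \<and> (\<exists>t\<in>set ts. pv g t \<noteq> 0))"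
proof
  assume "g y \<in> cl (g ` {k. W k})"
  then obtain p where p: "p \<noteq> 0" "\<forall>i. coeff p i \<in> rg (g ` {k. W k})" "poly p (g y) = 0"
    unfolding cl_def algb_def by (elim CollectE exE conjE)
  define f where "f c = (SOME t. okt W t \<and> pv g t = c)" for c
  have f: "okt W (f c) \<and> pv g (f c) = c" if "c \<in> set (coeffs p)" for c
  proof -
    obtain i where "i < length (coeffs p)" "c = coeffs p ! i" using \<open>c \<in> set (coeffs p)\<close> by (auto simp: in_set_conv_nth)
    then have "c = coeff p i" using nth_default_coeffs_eq[of p] by (metis nth_default_nth)
    then have "c \<in> rg (g ` {k. W k})" using p(2) by simp
    then show ?thesis unfolding f_def using someI_ex[OF rg_okt[of c g W]] by blast
  qed
  have m: "map (pv g) (map f (coeffs p)) = coeffs p" unfolding map_map by (rule map_idI) (use f in simp)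
  have l1: "last (coeffs p) \<in> set (coeffs p)" using p(1) by (intro last_in_set) simp
  have l2: "last (coeffs p) \<noteq> 0" using p(1) by (simp add: last_coeffs_eq_coeff_degree)
  have "\<forall>t\<in>set (map f (coeffs p)). okt W t" using f by simp
  moreover have "pv g (hz (map f (coeffs p)) y) = 0" unfolding pv_hz m using p(3) by simp
  moreover have "\<exists>t\<in>set (map f (coeffs p)). pv g t \<noteq> 0"
  proof (rule bexI)
    show "pv g (f (last (coeffs p))) \<noteq> 0" using f[OF l1] l2 by simp
    show "f (last (coeffs p)) \<in> set (map f (coeffs p))" using l1 by simp
  qed
  ultimately show "\<exists>ts. (\<forall>t\<in>set ts. okt W t) \<and> pv g (hz ts y) = 0 \<and> (\<exists>t\<in>set ts. pv g t \<noteq> 0)"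
    by (intro exI[of _ "map f (coeffs p)"] conjI)
next
  assume "\<exists>ts. (\<forall>t\<in>set ts. okt W t) \<and> pv g (hz ts y) = 0 \<and> (\<exists>t\<in>set ts. pv g t \<noteq> 0)"
  then obtain ts t where ts: "\<forall>t\<in>set ts. okt W t" "pv g (hz ts y) = 0" "t \<in> set ts" "pv g t \<noteq> 0"
    by (elim exE conjE bexE)
  define p where "p = Poly (map (pv g) ts)"
  have "coeff p i \<in> rg (g ` {k. W k})" for i
    unfolding p_def coeff_Poly_eq nth_default_def using ts(1) okt_rg rg_zero by simp
  moreover have "p \<noteq> 0"
  proof
    obtain i where "i < length ts" "t = ts ! i" using ts(3) by (auto simp: in_set_conv_nth)
    then have "coeff p i = pv g t" unfolding p_def coeff_Poly_eq nth_default_def by simp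
    moreover assume "p = 0"
    ultimately show False using ts(4) by simp
  qed
  moreover have "poly p (g y) = 0" using ts(2) unfolding pv_hz p_def .
  ultimately show "g y \<in> cl (g ` {k. W k})" unfolding cl_def algb_def by (intro CollectI exI[of _ p] conjI allI)
qed

lemma map_preimage: "set l \<subseteq> g ` S \<Longrightarrow> \<exists>ys. set ys \<subseteq> S \<and> map g ys = l"
proof (induction l)
  case (Cons a l)
  then obtain ys b where "set ys \<subseteq> S" "map g ys = l" "b \<in> S" "a = g b" by auto
  then show ?case by (intro exI[of _ "b # ys"]) simp
qed simp

section \<open>The index set of a computable Archimedean real closed field\<close>

lemma uniform_indices:
  fixes D :: "nat \<Rightarrow> nat \<Rightarrow> nat \<Rightarrow> bool"
  assumes "cmp (\<lambda>p. D (fst p) (fst (snd p)) (snd (snd p)))" "cmp (\<lambda>p. ap (fst p) (snd p))"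
    and "\<And>i s. \<bar>qv (ap i s) - rho i\<bar> \<le> 1 / (real s + 1)"
    and i: "\<And>n i. finite {t. D n i t} \<Longrightarrow> rho i \<notin> cl (rho ` {j. finite {t. D n j t} \<and> j < i})"
  shows "\<exists>f. computable_fun f \<and> (\<forall>n. \<exists>B g. arch_rcf B \<and> emb B g \<and> is_index (f n) B
    \<and> g ` s_carrier B = cl (rho ` {i. finite {t. D n i t}}))"
proof -
  interpret g: gen D ap rho by (rule gen.intro) (rule assms)+
  interpret gi: gen_indep D ap rho
    by unfold_locales (use i in \<open>simp add: g.G_def\<close>)
  show ?thesis using gi.uniform_rcf unfolding g.G_def .
qed

locale comp_arch =
  fixes A :: ostr and h :: "nat \<Rightarrow> real"
  assumes comp: "computable_str A" and arch: "arch_rcf A" and em: "emb A h"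
begin

abbreviation "C \<equiv> s_carrier A"
abbreviation "F \<equiv> h ` s_carrier A"

lemma rcf_F: "rcf_set F" by (rule rcf_set_emb[OF em arch])

lemma index_iff:
  assumes "arch_rcf B" "emb B g" "is_index a B" shows "a \<in> I_str A \<longleftrightarrow> g ` s_carrier B = F"
proof
  assume "a \<in> I_str A"
  then obtain B' g' where B': "emb B' g'" "is_index a B'" "g' ` s_carrier B' = F"
    unfolding I_str_eq[OF arch em] by (elim CollectE exE conjE)
  show "g ` s_carrier B = F" using diag_image[OF assms(2) B'(1) is_index_diag[OF assms(3) B'(2)]] B'(3) by simp
next
  assume "g ` s_carrier B = F"
  then show "a \<in> I_str A" unfolding I_str_eq[OF arch em] using assms by (intro CollectI exI[of _ B] exI[of _ g] conjI)
qed

lemma I_str_sub: assumes "a \<in> I_str A" shows "a \<in> I_K"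
  using assms unfolding I_str_eq[OF arch em] I_K_def by (elim CollectE exE conjE) (intro CollectI exI conjI)

text \<open>Inside \<open>I_K\<close> an index determines its image, so a bound within
  \<open>K\<close> amounts to describing the equality with \<open>F\<close>.\<close>

lemma within_iff:
  assumes "\<And>a B g. arch_rcf B \<Longrightarrow> emb B g \<Longrightarrow> is_index a B \<Longrightarrow> a \<in> R \<longleftrightarrow> g ` s_carrier B = F"
  shows "I_str A = R \<inter> I_K"
proof (rule set_eqI)
  fix a
  show "a \<in> I_str A \<longleftrightarrow> a \<in> R \<inter> I_K"
  proof (cases "a \<in> I_K")
    case True
    then obtain B where B: "arch_rcf B" "is_index a B" unfolding I_K_def by (elim CollectE exE conjE)
    obtain g where g: "emb B g" using arch_rcf_emb[OF B(1)] by (rule exE)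
    show ?thesis using True assms[OF B(1) g B(2)] index_iff[OF B(1) g B(2)] by simp
  next
    case False
    then show ?thesis using I_str_sub by blast
  qed
qed

text \<open>The common frame of the three lower bounds: it remains to choose \<open>D\<close>, the
  reals and their approximations so that the generated field is \<open>F\<close> exactly for
  \<open>n \<in> S\<close>.\<close>

lemma reduction:
  fixes D :: "nat \<Rightarrow> nat \<Rightarrow> nat \<Rightarrow> bool"
  assumes "cmp (\<lambda>p. D (fst p) (fst (snd p)) (snd (snd p)))" "cmp (\<lambda>p. ap (fst p) (snd p))"
    and "\<And>i s. \<bar>qv (ap i s) - rho i\<bar> \<le> 1 / (real s + 1)"
    and "\<And>n i. finite {t. D n i t} \<Longrightarrow> rho i \<notin> cl (rho ` {j. finite {t. D n j t} \<and> j < i})"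
    and S: "\<And>n. n \<in> S \<longleftrightarrow> cl (rho ` {i. finite {t. D n i t}}) = F"
  shows "\<exists>f. computable_fun f \<and> (\<forall>n. f n \<in> I_K) \<and> (\<forall>n. n \<in> S \<longleftrightarrow> f n \<in> I_str A)"
proof -
  have "\<exists>f. computable_fun f \<and> (\<forall>n. \<exists>B g. arch_rcf B \<and> emb B g \<and> is_index (f n) B
      \<and> g ` s_carrier B = cl (rho ` {i. finite {t. D n i t}}))"
    by (rule uniform_indices[OF assms(1-3)]) (rule assms(4))
  then obtain f where f: "computable_fun f" "\<forall>n. \<exists>B g. arch_rcf B \<and> emb B g \<and> is_index (f n) B
      \<and> g ` s_carrier B = cl (rho ` {i. finite {t. D n i t}})" by (elim exE conjE)
  have "f n \<in> I_K \<and> (n \<in> S \<longleftrightarrow> f n \<in> I_str A)" for n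
  proof -
    obtain B g where B: "arch_rcf B" "emb B g" "is_index (f n) B"
        "g ` s_carrier B = cl (rho ` {i. finite {t. D n i t}})" using f(2)[rule_format, of n] by (elim exE conjE)
    have "f n \<in> I_K" unfolding I_K_def using B by (intro CollectI exI[of _ B] conjI)
    then show ?thesis using S[of n] index_iff[OF B(1-3)] B(4) by simp
  qed
  then show ?thesis using f(1) by (intro exI[of _ f]) simp
qed

section \<open>Cuts of the given field and upper bounds\<close>

lemma cmp_diag: assumes "cmp f" shows "cmp (\<lambda>x. f x \<in> diag A)"
proof -
  have "cmp (\<lambda>x. x \<in> diag A)" using comp unfolding computable_str_def computable_set_iff by blast
  from cmp_comp[OF this assms] show ?thesis .
qed

lemma cmp_carr [cmp_intros]: assumes "cmp f" shows "cmp (\<lambda>x. f x \<in> C)"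
  unfolding cc_diag[OF em, symmetric] by (intro cmp_diag cmp_intros assms)

definition cut :: "q \<Rightarrow> nat \<Rightarrow> bool" where "cut r y \<longleftrightarrow> y \<in> C \<and> qv r < h y"

lemma cmp_cut [cmp_intros]: assumes "cmp r" "cmp y" shows "cmp (\<lambda>x. cut (r x) (y x))"
  unfolding cut_def litq_diag[OF em, symmetric] by (intro cmp_diag cmp_intros assms)

text \<open>The wrong answer to the question whether \<open>r\<close> is below \<open>x\<close>.
  Agreement of two cuts can then be stated as the absence of computations with wrong output, which
  is a universal condition.\<close>

definition nv :: "q \<Rightarrow> nat \<Rightarrow> nat" where "nv r x = (if cut r x then 0 else 1)"

lemma cmp_nv [cmp_intros]: "cmp r \<Longrightarrow> cmp y \<Longrightarrow> cmp (\<lambda>x. nv (r x) (y x))"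
  unfolding nv_def by (intro cmp_intros)

lemma agree:
  assumes e: "emb B g" and i: "is_index a B" and x: "x \<in> C"
  shows "(\<forall>r w. \<not> TT a (litq r y) (nv r x) w) \<longleftrightarrow> y \<in> s_carrier B \<and> g y = h x"
proof -
  have t: "(\<forall>w. \<not> TT a (litq r y) (nv r x) w) \<longleftrightarrow> (y \<in> s_carrier B \<and> qv r < g y \<longleftrightarrow> qv r < h x)" for r
  proof -
    have "(\<forall>w. \<not> TT a (litq r y) (nv r x) w) \<longleftrightarrow> nv r x \<noteq> (if litq r y \<in> diag B then 1 else 0)"
      unfolding is_index_TT[OF i, symmetric] by simp
    then show ?thesis unfolding nv_def cut_def litq_diag[OF e] using x by simp
  qed
  show ?thesis unfolding t
  proof
    assume r: "\<forall>r. y \<in> s_carrier B \<and> qv r < g y \<longleftrightarrow> qv r < h x"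
    \<comment> \<open>Some rational is below \<open>h x\<close>; were \<open>y\<close> outside the
      universe, the test at that rational would disagree.\<close>
    have "h x - 1 < h x" by simp
    from qv_dense[OF this] obtain s where "h x - 1 < qv s \<and> qv s < h x" ..
    then have "y \<in> s_carrier B" using r by blast
    moreover from this have "g y = h x" 
    proof (intro qv_cut_eq)
      fix s show "qv s < g y \<longleftrightarrow> qv s < h x" using r[rule_format, of s] \<open>y \<in> s_carrier B\<close> by simp
    qed
    ultimately show "y \<in> s_carrier B \<and> g y = h x" ..
  qed simp
qed

text \<open>Both inclusions at once. \<open>y\<close> holds an element of \<open>A\<close>, an
  element of \<open>B\<close> and a computation showing that the latter is in the universe;
  \<open>z\<close> holds the partners, and \<open>w\<close> ranges over possible
  disagreements.\<close>

definition up3 :: "nat \<Rightarrow> nat \<times> nat \<times> nat \<Rightarrow> nat \<times> nat \<Rightarrow> q \<times> nat \<Rightarrow> bool" where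
  "up3 a y z w \<longleftrightarrow> (fst y \<in> C \<longrightarrow> \<not> TT a (litq (fst w) (fst z)) (nv (fst w) (fst y)) (snd w))
     \<and> (TT a (cc (fst (snd y))) 1 (snd (snd y)) \<longrightarrow>
         snd z \<in> C \<and> \<not> TT a (litq (fst w) (fst (snd y))) (nv (fst w) (snd z)) (snd w))"

lemma up3_iff:
  assumes e: "emb B g" and i: "is_index a B"
  shows "(\<forall>y. \<exists>z. \<forall>w. up3 a y z w) \<longleftrightarrow> g ` s_carrier B = F"
proof
  assume u: "\<forall>y. \<exists>z. \<forall>w. up3 a y z w"
  show "g ` s_carrier B = F"
  proof
    show "F \<subseteq> g ` s_carrier B"
    proof
      fix v assume "v \<in> F"
      then obtain x where x: "x \<in> C" "v = h x" by blast
      obtain z where z: "\<forall>w. up3 a (x, 0, 0) z w" using u[rule_format, of "(x, 0, 0)"] by (rule exE)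
      have "\<not> TT a (litq r (fst z)) (nv r x) w" for r w using z[rule_format, of "(r, w)"] x(1) unfolding up3_def by simp
      then have "fst z \<in> s_carrier B \<and> g (fst z) = h x" using agree[OF e i x(1), of "fst z"] by blast
      then show "v \<in> g ` s_carrier B" unfolding x(2) by (intro image_eqI[of _ g "fst z"]) simp_all
    qed
    show "g ` s_carrier B \<subseteq> F"
    proof
      fix v assume "v \<in> g ` s_carrier B"
      then obtain y where y: "y \<in> s_carrier B" "v = g y" by blast
      have "\<exists>w. TT a (cc y) 1 w" unfolding is_index_TT[OF i] using y(1) cc_diag[OF e] by simp
      then obtain w where w: "TT a (cc y) 1 w" by (rule exE)
      obtain z where z: "\<forall>v. up3 a (0, y, w) z v" using u[rule_format, of "(0, y, w)"] by (rule exE)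
      have "snd z \<in> C \<and> \<not> TT a (litq r y) (nv r (snd z)) v" for r v
        using z[rule_format, of "(r, v)"] w unfolding up3_def by simp
      then have x: "snd z \<in> C" "\<forall>r v. \<not> TT a (litq r y) (nv r (snd z)) v" by simp_all
      then have "g y = h (snd z)" using agree[OF e i x(1), of y] by blast
      then show "v \<in> F" using x(1) y(2) by simp
    qed
  qed
next
  assume eq: "g ` s_carrier B = F"
  show "\<forall>y. \<exists>z. \<forall>w. up3 a y z w"
  proof
    fix y :: "nat \<times> nat \<times> nat"
    have "\<exists>y'. fst y \<in> C \<longrightarrow> y' \<in> s_carrier B \<and> g y' = h (fst y)"
    proof (cases "fst y \<in> C")
      case True
      then have "h (fst y) \<in> g ` s_carrier B" unfolding eq by simp
      then obtain y' where "h (fst y) = g y'" "y' \<in> s_carrier B" by (rule imageE)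
      then show ?thesis by (intro exI[of _ y']) simp
    qed simp
    then obtain y' where y': "fst y \<in> C \<longrightarrow> y' \<in> s_carrier B \<and> g y' = h (fst y)" by (rule exE)
    have "\<exists>x'. fst (snd y) \<in> s_carrier B \<longrightarrow> x' \<in> C \<and> g (fst (snd y)) = h x'"
    proof (cases "fst (snd y) \<in> s_carrier B")
      case True
      then have "g (fst (snd y)) \<in> F" unfolding eq[symmetric] by simp
      then obtain x' where "g (fst (snd y)) = h x'" "x' \<in> C" by (rule imageE)
      then show ?thesis by (intro exI[of _ x']) simp
    qed simp
    then obtain x' where x': "fst (snd y) \<in> s_carrier B \<longrightarrow> x' \<in> C \<and> g (fst (snd y)) = h x'" by (rule exE)
    have "up3 a y (y', x') w" for w
      unfolding up3_def fst_conv snd_conv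
    proof (intro conjI impI)
      assume c: "fst y \<in> C"
      show "\<not> TT a (litq (fst w) y') (nv (fst w) (fst y)) (snd w)" using agree[OF e i c, of y'] y' c by blast
    next
      assume "TT a (cc (fst (snd y))) 1 (snd (snd y))"
      then have "\<exists>w. TT a (cc (fst (snd y))) 1 w" by (rule exI)
      then have "fst (snd y) \<in> s_carrier B"
        unfolding is_index_TT[OF i] cc_diag[OF e] by (simp split: if_splits)
      then have c: "x' \<in> C" "fst (snd y) \<in> s_carrier B" "g (fst (snd y)) = h x'" using x' by simp_all
      show "x' \<in> C" by (rule c)
      show "\<not> TT a (litq (fst w) (fst (snd y))) (nv (fst w) x') (snd w)" using agree[OF e i c(1), of "fst (snd y)"] c by blast
    qed
    then show "\<exists>z. \<forall>w. up3 a y z w" by (intro exI[of _ "(y', x')"] allI)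
  qed
qed

lemma upper3: "in_within (pi_cls 3) (I_str A) I_K"
proof -
  have "{a. \<forall>y. \<exists>z. \<forall>w. up3 a y z w} \<in> pi_cls 3"
    by (rule pi3I) (unfold up3_def, intro cmp_intros)
  moreover have "I_str A = {a. \<forall>y. \<exists>z. \<forall>w. up3 a y z w} \<inter> I_K"
    by (rule within_iff) (simp only: mem_Collect_eq up3_iff)
  ultimately show ?thesis unfolding in_within_def by (rule bexI[rotated])
qed

text \<open>Every \<open>d + 1\<close> elements of \<open>B\<close> are dependent. The computations
  that place them in \<open>B\<close> belong to the universal block; position, coefficient terms and
  the computations verifying the two literals belong to the existential block.\<close>

definition up2 :: "nat \<Rightarrow> nat \<Rightarrow> nat list \<times> nat list \<Rightarrow> nat \<times> nat list \<times> nat \<times> nat \<Rightarrow> bool" where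
  "up2 d a p z \<longleftrightarrow> (length (fst p) = Suc d \<and> (\<forall>j<Suc d. TT a (cc (nthd 0 (fst p) j)) 1 (nthd 0 (snd p) j)) \<longrightarrow>
     fst z < Suc d \<and> (\<forall>t\<in>set (fst (snd z)). okt (\<lambda>k. k \<in> set (take (fst z) (fst p))) t)
     \<and> TT a (eqc (hz (fst (snd z)) (nthd 0 (fst p) (fst z))) tzero) 1 (fst (snd (snd z)))
     \<and> (\<exists>t\<in>set (fst (snd z)). TT a (nec t tzero) 1 (snd (snd (snd z)))))"

lemma cl_indep_map: "cl_indep (map g ys) \<longleftrightarrow> (\<forall>i<length ys. g (ys ! i) \<notin> cl (g ` {k. k \<in> set (take i ys)}))"
  unfolding cl_indep_def by (simp add: take_map)

lemma index_TT1: "is_index a B \<Longrightarrow> (\<exists>w. TT a x 1 w) \<longleftrightarrow> x \<in> diag B"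
  by (simp add: is_index_TT)

lemma up2_iff:
  assumes e: "emb B g" and i: "is_index a B"
  shows "(\<forall>p. \<exists>z. up2 d a p z) \<longleftrightarrow> (\<forall>ys. set ys \<subseteq> s_carrier B \<and> length ys = Suc d \<longrightarrow> \<not> cl_indep (map g ys))"
proof
  assume u: "\<forall>p. \<exists>z. up2 d a p z"
  show "\<forall>ys. set ys \<subseteq> s_carrier B \<and> length ys = Suc d \<longrightarrow> \<not> cl_indep (map g ys)"
  proof (intro allI impI)
    fix ys assume ys: "set ys \<subseteq> s_carrier B \<and> length ys = Suc d"
    define ws where "ws = map (\<lambda>j. SOME w. TT a (cc (ys ! j)) 1 w) [0..<Suc d]"
    have "TT a (cc (nthd 0 ys j)) 1 (nthd 0 ws j)" if j: "j < Suc d" for j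
    proof -
      have "ys ! j \<in> s_carrier B" using ys j nth_mem[of j ys] by auto
      then have "\<exists>w. TT a (cc (ys ! j)) 1 w" unfolding index_TT1[OF i] cc_diag[OF e] .
      from someI_ex[OF this] show ?thesis using ys j unfolding ws_def nthd_def by (simp del: upt_Suc)
    qed
    moreover obtain z where "up2 d a (ys, ws) z" using u[rule_format, of "(ys, ws)"] by (rule exE)
    ultimately have z: "fst z < Suc d" "\<forall>t\<in>set (fst (snd z)). okt (\<lambda>k. k \<in> set (take (fst z) ys)) t"
      "TT a (eqc (hz (fst (snd z)) (nthd 0 ys (fst z))) tzero) 1 (fst (snd (snd z)))"
      "\<exists>t\<in>set (fst (snd z)). TT a (nec t tzero) 1 (snd (snd (snd z)))"
      using ys unfolding up2_def fst_conv snd_conv by simp_all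
    define y ts where "y = nthd 0 ys (fst z)" and "ts = fst (snd z)"
    have y: "y = ys ! fst z" unfolding y_def nthd_def using z(1) ys by simp
    have "eqc (hz ts y) tzero \<in> diag B" using z(3) index_TT1[OF i] unfolding y_def ts_def by blast
    then have "pv g (hz ts y) = 0" unfolding lit_diag[OF e] by simp
    moreover obtain t where t: "t \<in> set ts" "TT a (nec t tzero) 1 (snd (snd (snd z)))" using z(4) unfolding ts_def by (rule bexE)
    then have "nec t tzero \<in> diag B" using index_TT1[OF i] by blast
    then have "pv g t \<noteq> 0" unfolding lit_diag[OF e] by simp
    ultimately have "g y \<in> cl (g ` {k. k \<in> set (take (fst z) ys)})" unfolding cl_terms using z(2) t(1)
      by (intro exI[of _ ts] conjI bexI[of _ t]) (simp_all add: ts_def)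
    then show "\<not> cl_indep (map g ys)" unfolding cl_indep_map y using z(1) ys by auto
  qed
next
  assume n: "\<forall>ys. set ys \<subseteq> s_carrier B \<and> length ys = Suc d \<longrightarrow> \<not> cl_indep (map g ys)"
  show "\<forall>p. \<exists>z. up2 d a p z"
  proof
    fix p :: "nat list \<times> nat list"
    define ys where "ys = fst p"
    show "\<exists>z. up2 d a p z"
    proof (cases "length ys = Suc d \<and> (\<forall>j<Suc d. TT a (cc (nthd 0 ys j)) 1 (nthd 0 (snd p) j))")
      case False
      then show ?thesis unfolding up2_def ys_def by (intro exI[of _ "(0, [], 0, 0)"]) simp
    next
      case True
      have C: "ys ! j \<in> s_carrier B" if j: "j < Suc d" for j
      proof -
        have "nthd 0 ys j = ys ! j" using True j by (simp add: nthd_def)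
        then have "\<exists>w. TT a (cc (ys ! j)) 1 w" using True j by (intro exI[of _ "nthd 0 (snd p) j"]) auto
        then show ?thesis unfolding index_TT1[OF i] cc_diag[OF e] .
      qed
      then have sub: "set ys \<subseteq> s_carrier B" using True by (auto simp: in_set_conv_nth)
      then have "\<not> cl_indep (map g ys)" using n True by blast
      then obtain k where k: "k < Suc d" "g (ys ! k) \<in> cl (g ` {j. j \<in> set (take k ys)})"
        unfolding cl_indep_map using True by auto
      then obtain ts where ts: "\<forall>t\<in>set ts. okt (\<lambda>j. j \<in> set (take k ys)) t" "pv g (hz ts (ys ! k)) = 0"
        "\<exists>t\<in>set ts. pv g t \<noteq> 0" unfolding cl_terms by (elim exE conjE)
      obtain t where t: "t \<in> set ts" "pv g t \<noteq> 0" using ts(3) by (rule bexE)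
      have ok: "okt (\<lambda>k. k \<in> s_carrier B) s" if "s \<in> set ts" for s
        by (rule okt_mono[OF ts(1)[rule_format, OF that]]) (use sub in \<open>auto dest: in_set_takeD\<close>)
      have y: "nthd 0 ys k = ys ! k" using True k(1) by (simp add: nthd_def)
      have "eqc (hz ts (ys ! k)) tzero \<in> diag B"
        unfolding lit_diag[OF e] using ts(2) okt_hz[of ts "\<lambda>k. k \<in> s_carrier B", OF ok C[OF k(1)]] by (simp add: okt_simps)
      then obtain w1 where w1: "TT a (eqc (hz ts (ys ! k)) tzero) 1 w1" unfolding index_TT1[OF i, symmetric] by (rule exE)
      have "nec t tzero \<in> diag B" unfolding lit_diag[OF e] using t(2) ok[OF t(1)] by (simp add: okt_simps)
      then obtain w2 where w2: "TT a (nec t tzero) 1 w2" unfolding index_TT1[OF i, symmetric] by (rule exE)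
      have "up2 d a p (k, ts, w1, w2)"
        unfolding up2_def fst_conv snd_conv ys_def[symmetric] y using k(1) ts(1) w1 w2 t(1)
        by (intro impI conjI bexI[of _ t])
      then show ?thesis by (rule exI)
    qed
  qed
qed

lemma up2_pi2: "{a. \<forall>p. \<exists>z. up2 d a p z} \<in> pi_cls 2"
  by (rule pi2I) (unfold up2_def, intro cmp_intros)

text \<open>Containing the basis gives one inclusion. An element outside \<open>F\<close> would
  extend the basis to an independent list that is one longer.\<close>

lemma basis_iff:
  assumes B: "arch_rcf B" "emb B g" and xs: "cl_indep xs" "F = cl (set xs)"
  shows "g ` s_carrier B = F \<longleftrightarrow> set xs \<subseteq> g ` s_carrier B
    \<and> (\<forall>ys. set ys \<subseteq> s_carrier B \<and> length ys = Suc (length xs) \<longrightarrow> \<not> cl_indep (map g ys))"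
proof (intro iffI conjI)
  assume eq: "g ` s_carrier B = F"
  show "set xs \<subseteq> g ` s_carrier B" unfolding eq xs(2) by (rule cl_incl)
  show "\<forall>ys. set ys \<subseteq> s_carrier B \<and> length ys = Suc (length xs) \<longrightarrow> \<not> cl_indep (map g ys)"
  proof (intro allI impI notI)
    fix ys assume ys: "set ys \<subseteq> s_carrier B \<and> length ys = Suc (length xs)" and i: "cl_indep (map g ys)"
    have "set (map g ys) \<subseteq> cl (set xs)" using ys unfolding xs(2)[symmetric] eq[symmetric] by auto
    from cl_indep_length[OF _ this i] have "length ys \<le> card (set xs)" by simp
    then show False using ys card_length[of xs] by simp
  qed
next
  assume a: "set xs \<subseteq> g ` s_carrier B
    \<and> (\<forall>ys. set ys \<subseteq> s_carrier B \<and> length ys = Suc (length xs) \<longrightarrow> \<not> cl_indep (map g ys))"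
  show "g ` s_carrier B = F"
  proof
    show "F \<subseteq> g ` s_carrier B" unfolding xs(2) using a cl_rcf_set[OF rcf_set_emb[OF B(2,1)]] by blast
    show "g ` s_carrier B \<subseteq> F"
    proof (rule subsetI, rule ccontr)
      fix y assume y: "y \<in> g ` s_carrier B" "y \<notin> F"
      have "set (xs @ [y]) \<subseteq> g ` s_carrier B" using a y(1) by simp
      then have "\<exists>ys. set ys \<subseteq> s_carrier B \<and> map g ys = xs @ [y]"
        by (rule map_preimage)
      then obtain ys where ys: "set ys \<subseteq> s_carrier B" "map g ys = xs @ [y]" by (elim exE conjE)
      have "cl_indep (xs @ [y])" unfolding cl_indep_def
      proof (intro allI impI)
        fix i assume i: "i < length (xs @ [y])"
        show "(xs @ [y]) ! i \<notin> cl (set (take i (xs @ [y])))"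
        proof (cases "i < length xs")
          case True
          then show ?thesis using xs(1) unfolding cl_indep_def by (simp add: nth_append)
        next
          case False
          then have "i = length xs" using i by simp
          then show ?thesis using y(2) xs(2) by simp
        qed
      qed
      moreover have "length ys = Suc (length xs)" using arg_cong[OF ys(2), of length] by simp
      ultimately show False using a ys by auto
    qed
  qed
qed

text \<open>The empty basis: no single element of \<open>B\<close> is transcendental.\<close>

lemma upper1: assumes "F = cl {}" shows "in_within (pi_cls 2) (I_str A) I_K"
proof -
  have "I_str A = {a. \<forall>p. \<exists>z. up2 0 a p z} \<inter> I_K"
  proof (rule within_iff)
    fix a B g assume B: "arch_rcf B" "emb B g" "is_index a B"
    have "cl_indep []" by (simp add: cl_indep_def)
    then show "a \<in> {a. \<forall>p. \<exists>z. up2 0 a p z} \<longleftrightarrow> g ` s_carrier B = F"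
      unfolding mem_Collect_eq up2_iff[OF B(2,3)] using basis_iff[OF B(1,2), of "[]"] assms by simp
  qed
  then show ?thesis unfolding in_within_def using up2_pi2 by (rule bexI)
qed

text \<open>Having a copy of the basis is \<open>\<Sigma>\<^sub>2\<close>: the copy is guessed and
  its cuts are compared. Having no longer independent list is \<open>\<Pi>\<^sub>2\<close>.\<close>

lemma upper2: assumes xs: "cl_indep xs" "F = cl (set xs)" shows "in_within d_sigma2 (I_str A) I_K"
proof -
  have "set xs \<subseteq> F" unfolding xs(2) by (rule cl_incl)
  then obtain as where as: "set as \<subseteq> C" "map h as = xs" using map_preimage by blast
  have l: "length as = length xs" using arg_cong[OF as(2), of length] by simp
  define d where "d = length as"
  define P where "P a bs z \<longleftrightarrow> (fst z < d \<longrightarrow>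
      \<not> TT a (litq (fst (snd z)) (nthd 0 bs (fst z))) (nv (fst (snd z)) (nthd 0 as (fst z))) (snd (snd z)))"
    for a and bs :: "nat list" and z :: "nat \<times> q \<times> nat"
  define R1 where "R1 = {a. \<exists>bs. \<forall>z. P a bs z}"
  define R2 where "R2 = {a. \<forall>p. \<exists>z. up2 d a p z}"
  have "R1 \<in> sigma_cls 2" unfolding R1_def by (rule sigma2I) (unfold P_def, intro cmp_intros)
  moreover have "- R2 \<in> sigma_cls 2" using up2_pi2[of d] unfolding R2_def pi_cls_def by simp
  ultimately have d2: "R1 - (- R2) \<in> d_sigma2" unfolding d_sigma2_def
    by (intro CollectI exI[of _ R1] exI[of _ "- R2"] conjI refl)
  have "I_str A = (R1 - (- R2)) \<inter> I_K"
  proof (rule within_iff)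
    fix a B g assume B: "arch_rcf B" "emb B g" "is_index a B"
    have r1: "a \<in> R1 \<longleftrightarrow> set xs \<subseteq> g ` s_carrier B"
    proof
      assume "a \<in> R1"
      then obtain bs where bs: "\<forall>z. P a bs z" unfolding R1_def by blast
      show "set xs \<subseteq> g ` s_carrier B"
      proof
        fix v assume "v \<in> set xs"
        then obtain i where i: "i < d" "v = xs ! i" unfolding d_def l by (auto simp: in_set_conv_nth)
        have ai: "nthd 0 as i = as ! i" "as ! i \<in> C" "xs ! i = h (as ! i)"
          using i(1) as unfolding d_def by (auto simp: nthd_def)
        have "\<not> TT a (litq r (nthd 0 bs i)) (nv r (as ! i)) w" for r w
          using bs[rule_format, of "(i, r, w)"] i(1) ai(1) unfolding P_def by simp
        then have "nthd 0 bs i \<in> s_carrier B \<and> g (nthd 0 bs i) = h (as ! i)"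
          using agree[OF B(2,3) ai(2), of "nthd 0 bs i"] by blast
        then show "v \<in> g ` s_carrier B" unfolding i(2) ai(3) by (intro image_eqI[of _ g "nthd 0 bs i"]) simp_all
      qed
    next
      assume "set xs \<subseteq> g ` s_carrier B"
      then obtain bs where bs: "set bs \<subseteq> s_carrier B" "map g bs = xs" using map_preimage by blast
      have lb: "length bs = d" unfolding d_def l using arg_cong[OF bs(2), of length] by simp
      have "P a bs z" for z
        unfolding P_def
      proof
        assume z: "fst z < d"
        then have ai: "nthd 0 as (fst z) = as ! fst z" "as ! fst z \<in> C" "nthd 0 bs (fst z) = bs ! fst z" "bs ! fst z \<in> s_carrier B"
          using as(1) bs(1) lb unfolding d_def by (auto simp: nthd_def)
        have "g (bs ! fst z) = h (as ! fst z)"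
          using arg_cong[OF trans[OF bs(2) as(2)[symmetric]], of "\<lambda>l. l ! fst z"] z lb unfolding d_def by simp
        then show "\<not> TT a (litq (fst (snd z)) (nthd 0 bs (fst z))) (nv (fst (snd z)) (nthd 0 as (fst z))) (snd (snd z))"
          unfolding ai(1,3) using agree[OF B(2,3) ai(2), of "bs ! fst z"] ai(4) by blast
      qed
      then show "a \<in> R1" unfolding R1_def by blast
    qed
    have "a \<in> R1 - - R2 \<longleftrightarrow> a \<in> R1 \<and> a \<in> R2" by blast
    also have "\<dots> \<longleftrightarrow> g ` s_carrier B = F"
      unfolding r1 basis_iff[OF B(1,2) xs] unfolding R2_def mem_Collect_eq up2_iff[OF B(2,3)] d_def l ..
    finally show "a \<in> R1 - - R2 \<longleftrightarrow> g ` s_carrier B = F" .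
  qed
  then show ?thesis unfolding in_within_def using d2 by (rule bexI)
qed

section \<open>Approximations of the elements and a computable real outside the field\<close>

definition bd :: "nat \<Rightarrow> nat \<Rightarrow> q \<Rightarrow> bool" where
  "bd y s r \<longleftrightarrow> cut (qadd r (qneg (1, 0, s))) y \<and> \<not> cut (qadd r (1, 0, s)) y"
text \<open>Outside the universe the search condition is trivially true, which keeps the
  minimisation total for all \<open>y\<close>.\<close>

definition apA :: "nat \<Rightarrow> nat \<Rightarrow> q" where
  "apA y s = (if y \<in> C then dc (LEAST i. y \<in> C \<longrightarrow> bd y s (dc i)) else qn 0)"
definition hh :: "nat \<Rightarrow> real" where "hh y = (if y \<in> C then h y else 0)"

lemma bd_ex: "\<exists>i. y \<in> C \<longrightarrow> bd y s (dc i)"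
proof (cases "y \<in> C")
  case True
  have e: "qv (1, 0, s) = 1 / (real s + 1)" by (simp add: qv_def)
  have "h y - 1 / (real s + 1) < h y" by (simp add: add_nonneg_pos)
  from qv_dense[OF this] obtain r where r: "h y - 1 / (real s + 1) < qv r \<and> qv r < h y" ..
  then have "bd y s r" unfolding bd_def cut_def qv_qadd qv_qneg e using True by auto
  then show ?thesis by (intro exI[of _ "cd r"]) simp
qed simp

lemma apA: "\<bar>qv (apA y s) - hh y\<bar> \<le> 1 / (real s + 1)"
proof (cases "y \<in> C")
  case True
  have e: "qv (1, 0, s) = 1 / (real s + 1)" by (simp add: qv_def)
  have "bd y s (apA y s)" using LeastI_ex[OF bd_ex[of y s]] True unfolding apA_def by simp
  then have "qv (apA y s) - 1 / (real s + 1) < h y" "h y \<le> qv (apA y s) + 1 / (real s + 1)"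
    unfolding bd_def cut_def qv_qadd qv_qneg e using True by auto
  then show ?thesis unfolding hh_def using True by (simp add: abs_le_iff)
next
  case False
  then show ?thesis by (simp add: apA_def hh_def)
qed

lemma cmp_bd: "cmp (\<lambda>p. bd (fst p) (fst (snd p)) (snd (snd p)))"
  unfolding bd_def by (intro cmp_intros)

lemma cmp_apA: "cmp (\<lambda>p. apA (fst p) (snd p))"
  unfolding apA_def by (intro cmp_intros cmp_comp3[where g = bd, OF cmp_bd] bd_ex)

text \<open>The interval from \<open>fst (V i)\<close> of length \<open>snd (V i)\<close> shrinks to its first or last quarter, whichever avoids the
  element named by \<open>i\<close>; the common point of all intervals is a computable real outside \<open>F\<close>.\<close>

definition V :: "nat \<Rightarrow> q \<times> q" where
  "V i = rec_nat (qn 0, qn 1) (\<lambda>i r. (if cut (qadd (fst r) (qmul (snd r) (1, 0, 1))) i then fst r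
     else qadd (fst r) (qmul (snd r) (3, 0, 3)), qmul (snd r) (1, 0, 3))) i"

abbreviation "vu i \<equiv> qv (fst (V i))"
abbreviation "vw i \<equiv> qv (snd (V i))"

lemma V_0: "vu 0 = 0" "vw 0 = 1" unfolding V_def by simp_all

lemma V_Suc: "vw (Suc i) = vw i / 4"
  "vu (Suc i) = (if i \<in> C \<and> vu i + vw i / 2 < h i then vu i else vu i + vw i * 3 / 4)"
proof -
  have q: "qv (1, 0, 1) = 1 / 2" "qv (1, 0, 3) = 1 / 4" "qv (3, 0, 3) = 3 / 4" by (simp_all add: qv_def)
  have e: "V (Suc i) = (if cut (qadd (fst (V i)) (qmul (snd (V i)) (1, 0, 1))) i then fst (V i)
     else qadd (fst (V i)) (qmul (snd (V i)) (3, 0, 3)), qmul (snd (V i)) (1, 0, 3))" unfolding V_def by simp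
  show "vw (Suc i) = vw i / 4" unfolding e snd_conv qv_qmul q by simp
  show "vu (Suc i) = (if i \<in> C \<and> vu i + vw i / 2 < h i then vu i else vu i + vw i * 3 / 4)"
    unfolding e fst_conv cut_def qv_qadd qv_qmul q by (simp add: q(3))
qed

lemma V_w: "vw i = (1 / 4) ^ i"
  by (induction i) (simp_all add: V_0 V_Suc)

lemma V_pos: "vw i > 0" unfolding V_w by simp

lemma V_step: "vu i \<le> vu (Suc i) \<and> vu (Suc i) + vw (Suc i) \<le> vu i + vw i"
  unfolding V_Suc using V_pos[of i] by auto

lemma V_mono: "i \<le> j \<Longrightarrow> vu i \<le> vu j \<and> vu j + vw j \<le> vu i + vw i"
proof (induction j rule: dec_induct)
  case (step j)
  then show ?case using V_step[of j] by linarith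
qed simp

definition zz :: real where "zz = (SUP i. vu i)"

lemma zz: "vu j \<le> zz" "zz \<le> vu j + vw j"
proof -
  have b: "vu i \<le> vu j + vw j" for i j
  proof (cases "i \<le> j")
    case True then show ?thesis using V_mono[OF True] V_pos[of j] by linarith
  next
    case False
    then have "j \<le> i" by simp
    then show ?thesis using V_mono[of j i] V_pos[of i] by linarith
  qed
  have bdd: "bdd_above (range vu)" by (rule bdd_aboveI[of _ "vu 0 + vw 0"]) (use b[of _ 0] in auto)
  show "vu j \<le> zz" unfolding zz_def by (rule cSUP_upper[OF _ bdd]) simp
  show "zz \<le> vu j + vw j" unfolding zz_def by (rule cSUP_least) (simp_all add: b)
qed

lemma zz_notin: "zz \<notin> F"
proof
  assume "zz \<in> F"
  then obtain x where x: "x \<in> C" "zz = h x" by blast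
  show False
  proof (cases "vu x + vw x / 2 < h x")
    case True
    then have "zz \<le> vu x + vw x / 4" using zz(2)[of "Suc x"] x(1) unfolding V_Suc by simp
    then show False using True x(2) V_pos[of x] by linarith
  next
    case False
    then have "vu x + vw x * 3 / 4 \<le> zz" using zz(1)[of "Suc x"] unfolding V_Suc by simp
    then show False using False x(2) V_pos[of x] by linarith
  qed
qed

lemma zz_ap: "\<bar>qv (fst (V s)) - zz\<bar> \<le> 1 / (real s + 1)"
proof -
  have "real s + 1 \<le> 4 ^ s" by (induction s) auto
  then have "1 / 4 ^ s \<le> 1 / (real s + 1)" by (intro divide_left_mono) auto
  then have "vw s \<le> 1 / (real s + 1)" unfolding V_w by (simp add: power_one_over)
  then show ?thesis using zz[of s] by linarith
qed

lemma cmp_V: assumes "cmp f" shows "cmp (\<lambda>x. fst (V (f x)))"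
  by (rule cmp_comp[OF _ assms]) (unfold V_def, intro cmp_intros)

section \<open>Reductions\<close>

lemma lower1:
  assumes F: "F = cl {}" and S: "S \<in> pi_cls 2"
  shows "\<exists>f. computable_fun f \<and> (\<forall>n. f n \<in> I_K) \<and> (\<forall>n. n \<in> S \<longleftrightarrow> f n \<in> I_str A)"
proof -
  have "- S \<in> sigma_cls 2" using S unfolding pi_cls_def by blast
  from sigma2_finite[OF this] obtain D0 :: "nat \<Rightarrow> nat \<Rightarrow> bool" where D0: "cmp (\<lambda>p. D0 (fst p) (snd p))"
    "\<forall>x. x \<in> - S \<longleftrightarrow> finite {t. D0 x t}" by (elim exE conjE)
  \<comment> \<open>For \<open>i \<noteq> 0\<close> the condition holds at every \<open>t\<close>,
    so the set is infinite and index 0 is the only possible generator, present iff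
    \<open>n \<notin> S\<close>.\<close>
  have fin: "finite {t :: nat. i = 0 \<longrightarrow> D0 n t} \<longleftrightarrow> i = 0 \<and> n \<notin> S" for i n :: nat
    using D0(2)[rule_format, of n] by (cases "i = 0") simp_all
  show ?thesis
  proof (rule reduction[where D = "\<lambda>n i t. i = 0 \<longrightarrow> D0 n t" and ap = "\<lambda>i s. fst (V s)" and rho = "\<lambda>i. zz"])
    show "cmp (\<lambda>p :: nat \<times> nat \<times> nat. fst (snd p) = 0 \<longrightarrow> D0 (fst p) (snd (snd p)))"
      by (intro cmp_intros cmp_comp2[where g = D0, OF D0(1)])
    show "cmp (\<lambda>p :: nat \<times> nat. fst (V (snd p)))" by (intro cmp_V cmp_intros)
    show "\<bar>qv (fst (V s)) - zz\<bar> \<le> 1 / (real s + 1)" for s by (rule zz_ap)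
    show "zz \<notin> cl ((\<lambda>i. zz) ` {j. finite {t. j = 0 \<longrightarrow> D0 n t} \<and> j < i})" if "finite {t. i = 0 \<longrightarrow> D0 n t}" for n i :: nat
    proof -
      have e: "{j. finite {t. j = 0 \<longrightarrow> D0 n t} \<and> j < i} = {}" using that unfolding fin by auto
      show ?thesis unfolding e image_empty using zz_notin F by simp
    qed
    show "n \<in> S \<longleftrightarrow> cl ((\<lambda>i. zz) ` {i :: nat. finite {t. i = 0 \<longrightarrow> D0 n t}}) = F" for n
    proof (cases "n \<in> S")
      case True
      then have "{i :: nat. finite {t. i = 0 \<longrightarrow> D0 n t}} = {}" unfolding fin by simp
      then show ?thesis using True F by (simp only: image_empty) simp
    next
      case False
      then have "{i :: nat. finite {t. i = 0 \<longrightarrow> D0 n t}} = {0}" unfolding fin by simp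
      then have e: "(\<lambda>i. zz) ` {i :: nat. finite {t. i = 0 \<longrightarrow> D0 n t}} = {zz}" by (simp only: image_insert image_empty)
      have "zz \<in> cl {zz}" using cl_incl[of "{zz}"] by simp
      then show ?thesis unfolding e using False zz_notin by auto
    qed
  qed
qed

text \<open>A nonempty basis has a last element to make conditional. It is missing for
  \<open>n \<notin> S1\<close>, which makes the field too small, and the outside real is present for
  \<open>n \<in> S2\<close>; a field containing it is never \<open>F\<close>.\<close>

lemma lower2:
  assumes xs: "xs \<noteq> []" "cl_indep xs" "F = cl (set xs)" and S: "S \<in> d_sigma2"
  shows "\<exists>f. computable_fun f \<and> (\<forall>n. f n \<in> I_K) \<and> (\<forall>n. n \<in> S \<longleftrightarrow> f n \<in> I_str A)"
proof -
  obtain S1 S2 where S12: "S1 \<in> sigma_cls 2" "S2 \<in> sigma_cls 2" "S = S1 - S2" using S unfolding d_sigma2_def by blast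
  obtain D1 :: "nat \<Rightarrow> nat \<Rightarrow> bool" where D1: "cmp (\<lambda>p. D1 (fst p) (snd p))"
    "\<forall>x. x \<in> S1 \<longleftrightarrow> finite {t. D1 x t}" using sigma2_finite[OF S12(1)] by (elim exE conjE)
  obtain D2 :: "nat \<Rightarrow> nat \<Rightarrow> bool" where D2: "cmp (\<lambda>p. D2 (fst p) (snd p))"
    "\<forall>x. x \<in> S2 \<longleftrightarrow> finite {t. D2 x t}" using sigma2_finite[OF S12(2)] by (elim exE conjE)
  have "set xs \<subseteq> F" unfolding xs(3) by (rule cl_incl)
  then obtain as where as: "set as \<subseteq> C" "map h as = xs" using map_preimage by blast
  obtain d where d: "length xs = Suc d" using xs(1) by (cases xs) simp_all
  have la: "length as = Suc d" using arg_cong[OF as(2), of length] d by simp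
  \<comment> \<open>Indices below \<open>d\<close> have an empty set and are always kept, indices
    above \<open>Suc d\<close> an infinite one and are never kept.\<close>
  define D where "D n i t \<longleftrightarrow> \<not> i < d \<and> (i = d \<longrightarrow> D1 n t) \<and> (i = Suc d \<longrightarrow> D2 n t)" for n i t :: nat
  define rho where "rho i = (if i < Suc d then xs ! i else zz)" for i
  define ap where "ap i s = (if i < Suc d then apA (nthd 0 as i) s else fst (V s))" for i s
  have fin: "finite {t. D n i t} \<longleftrightarrow> i < d \<or> i = d \<and> n \<in> S1 \<or> i = Suc d \<and> n \<in> S2" for n i
  proof -
    consider "i < d" | "i = d" | "i = Suc d" | "i > Suc d" by linarith
    then show ?thesis
      by cases (use D1(2) D2(2) in \<open>simp_all add: D_def\<close>)
  qed
  have xsi: "xs ! i \<notin> cl (set (take i xs))" if "i < Suc d" for i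
    using xs(2) d that unfolding cl_indep_def by simp
  have tk: "xs ! j \<in> set (take i xs)" if "j < i" "i \<le> Suc d" for i j
    using that d by (auto simp: in_set_conv_nth intro!: exI[of _ j])
  show ?thesis
  proof (rule reduction[where D = D and ap = ap and rho = rho])
    show "cmp (\<lambda>p. D (fst p) (fst (snd p)) (snd (snd p)))"
      unfolding D_def by (intro cmp_intros cmp_comp2[where g = D1, OF D1(1)] cmp_comp2[where g = D2, OF D2(1)])
    show "cmp (\<lambda>p. ap (fst p) (snd p))"
      unfolding ap_def by (intro cmp_intros cmp_V cmp_comp2[where g = apA, OF cmp_apA])
    show "\<bar>qv (ap i s) - rho i\<bar> \<le> 1 / (real s + 1)" for i s
    proof (cases "i < Suc d")
      case True
      have "as ! i \<in> C" using as(1) la True nth_mem[of i as] by auto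
      moreover have "xs ! i = h (as ! i)" using as(2) la True by auto
      ultimately have "rho i = hh (nthd 0 as i)" unfolding rho_def hh_def nthd_def using True la by simp
      then show ?thesis unfolding ap_def using True apA by simp
    next
      case False
      then show ?thesis unfolding ap_def rho_def using zz_ap by simp
    qed
    show "rho i \<notin> cl (rho ` {j. finite {t. D n j t} \<and> j < i})" if f: "finite {t. D n i t}" for n i
    proof -
      have i: "i \<le> Suc d" using f unfolding fin by auto
      have "rho ` {j. finite {t. D n j t} \<and> j < i} \<subseteq> set (take i xs)"
      proof
        fix v assume "v \<in> rho ` {j. finite {t. D n j t} \<and> j < i}"
        then obtain j where "j < i" "v = rho j" by blast
        then show "v \<in> set (take i xs)" using tk[of j i] i by (simp add: rho_def)
      qed
      then have sub: "cl (rho ` {j. finite {t. D n j t} \<and> j < i}) \<subseteq> cl (set (take i xs))" by (rule cl_mono)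
      show ?thesis
      proof (cases "i = Suc d")
        case True
        have "take i xs = xs" using True d by simp
        then show ?thesis using sub zz_notin xs(3) True by (auto simp: rho_def)
      next
        case False
        then show ?thesis using sub xsi[of i] i by (auto simp: rho_def)
      qed
    qed
    show "n \<in> S \<longleftrightarrow> cl (rho ` {i. finite {t. D n i t}}) = F" for n
    proof
      assume n: "n \<in> S"
      then have "{i. finite {t. D n i t}} = {..<Suc d}" unfolding fin S12(3) by auto
      moreover have "rho ` {..<Suc d} = set xs" unfolding rho_def using d by (auto simp: set_conv_nth)
      ultimately show "cl (rho ` {i. finite {t. D n i t}}) = F" using xs(3) by simp
    next
      assume e: "cl (rho ` {i. finite {t. D n i t}}) = F"
      have "n \<notin> S2"
      proof
        assume "n \<in> S2"
        then have "rho (Suc d) \<in> rho ` {i. finite {t. D n i t}}" unfolding fin by blast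
        from subsetD[OF cl_incl this] have "rho (Suc d) \<in> F" unfolding e .
        then show False using zz_notin by (simp add: rho_def)
      qed
      \<comment> \<open>Without the last basis element the field lies in the closure of the first
        \<open>d\<close>, which omits \<open>xs ! d\<close>.\<close>
      moreover have "n \<in> S1"
      proof (rule ccontr)
        assume n1: "n \<notin> S1"
        have "rho ` {i. finite {t. D n i t}} \<subseteq> set (take d xs)"
        proof
          fix v assume "v \<in> rho ` {i. finite {t. D n i t}}"
          then obtain j where "j < d" "v = rho j" unfolding fin using n1 \<open>n \<notin> S2\<close> by blast
          then show "v \<in> set (take d xs)" using tk[of j d] by (simp add: rho_def)
        qed
        then have "F \<subseteq> cl (set (take d xs))" unfolding e[symmetric] by (rule cl_mono)
        moreover have "xs ! d \<in> F" using \<open>set xs \<subseteq> F\<close> d nth_mem[of d xs] by auto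
        ultimately show False using xsi[of d] by auto
      qed
      ultimately show "n \<in> S" unfolding S12(3) by simp
    qed
  qed
qed

text \<open>A decidable proof that element \<open>i\<close> depends algebraically on earlier
  elements of the universe.\<close>

definition certA :: "nat \<Rightarrow> nat list \<Rightarrow> bool" where
  "certA i ts \<longleftrightarrow> (\<forall>t\<in>set ts. okt (\<lambda>k. k < i \<and> k \<in> C) t) \<and> eqc (hz ts i) tzero \<in> diag A
     \<and> (\<exists>t\<in>set ts. nec t tzero \<in> diag A)"

lemma certA_iff: assumes i: "i \<in> C" shows "(\<exists>ts. certA i ts) \<longleftrightarrow> h i \<in> cl (h ` {k. k < i \<and> k \<in> C})"
proof -
  have ok: "okt (\<lambda>k. k \<in> C) t" if "okt (\<lambda>k. k < i \<and> k \<in> C) t" for t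
    using that by (rule okt_mono) simp
  have "certA i ts \<longleftrightarrow> (\<forall>t\<in>set ts. okt (\<lambda>k. k < i \<and> k \<in> C) t) \<and> pv h (hz ts i) = 0 \<and> (\<exists>t\<in>set ts. pv h t \<noteq> 0)" for ts
  proof (cases "\<forall>t\<in>set ts. okt (\<lambda>k. k < i \<and> k \<in> C) t")
    case True
    then have o: "okt (\<lambda>k. k \<in> C) t" if "t \<in> set ts" for t using ok that by simp
    have "okt (\<lambda>k. k \<in> C) (hz ts i)" by (rule okt_hz[of ts "\<lambda>k. k \<in> C", OF o i])
    then show ?thesis unfolding certA_def lit_diag[OF em] using True o by (simp add: okt_simps)
  next
    case False
    then show ?thesis unfolding certA_def by blast
  qed
  then show ?thesis unfolding cl_terms by simp
qed

lemma cmp_certA: "cmp (\<lambda>p. certA (fst p) (snd p))"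
  unfolding certA_def by (intro cmp_intros cmp_diag)

text \<open>For \<open>n \<in> S\<close> the whole greedy basis is kept and generates
  \<open>F\<close>. Otherwise the failing condition \<open>y\<close> removes all indices from
  \<open>y\<close> on, and the rest is finite, hence not generating.\<close>

lemma lower3:
  assumes inf: "\<And>X. finite X \<Longrightarrow> F \<noteq> cl X" and S: "S \<in> pi_cls 3"
  shows "\<exists>f. computable_fun f \<and> (\<forall>n. f n \<in> I_K) \<and> (\<forall>n. n \<in> S \<longleftrightarrow> f n \<in> I_str A)"
proof -
  have "(3 :: nat) = Suc 2" by simp
  then have "- S \<in> sigma_cls (Suc 2)" using S unfolding pi_cls_def by simp
  then obtain R where R: "- R \<in> sigma_cls 2" "- S = {x. \<exists>y. prod_encode (x, y) \<in> R}" unfolding sigma_cls.simps(2) by blast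
  obtain E :: "nat \<Rightarrow> nat \<Rightarrow> bool" where E: "cmp (\<lambda>p. E (fst p) (snd p))"
    "\<forall>x. x \<in> - R \<longleftrightarrow> finite {t. E x t}" using sigma2_finite[OF R(1)] by (elim exE conjE)
  have Sn: "n \<in> S \<longleftrightarrow> (\<forall>y. finite {t. E (prod_encode (n, y)) t})" for n
  proof -
    have "n \<in> - S \<longleftrightarrow> (\<exists>y. prod_encode (n, y) \<in> R)" unfolding R(2) by simp
    moreover have "prod_encode (n, y) \<notin> R \<longleftrightarrow> finite {t. E (prod_encode (n, y)) t}" for y
      using E(2)[rule_format, of "prod_encode (n, y)"] by simp
    ultimately show ?thesis by auto
  qed
  \<comment> \<open>Three reasons to drop \<open>i\<close>: a condition up to \<open>i\<close>
    fails, \<open>i\<close> is not in the universe, or it depends on its predecessors. A certificate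
    counts at every later stage, so a single one makes the set infinite.\<close>
  define D where "D n i t \<longleftrightarrow> (\<exists>j<Suc i. E (prod_encode (n, j)) t) \<or> i \<notin> C \<or> (\<exists>c<t. certA i (dc c))" for n i t
  \<comment> \<open>The greedy basis in the order of the universe: it keeps each element that is
    transcendental over its predecessors.\<close>
  define P where "P = {i. i \<in> C \<and> h i \<notin> cl (h ` {k. k < i \<and> k \<in> C})}"
  have fin: "finite {t. D n i t} \<longleftrightarrow> (\<forall>j<Suc i. finite {t. E (prod_encode (n, j)) t}) \<and> i \<in> P" for n i
  proof -
    have e: "{t. D n i t} = (\<Union>j\<in>{..<Suc i}. {t. E (prod_encode (n, j)) t}) \<union> ({t. i \<notin> C} \<union> {t. \<exists>c<t. certA i (dc c)})"
      unfolding D_def by auto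
    have "finite {t. \<exists>c<t. certA i (dc c)} \<longleftrightarrow> \<not> (\<exists>ts. certA i ts)"
    proof (cases "\<exists>ts. certA i ts")
      case True
      then obtain ts where "certA i ts" ..
      then have "{cd ts<..} \<subseteq> {t. \<exists>c<t. certA i (dc c)}" by (auto intro!: exI[of _ "cd ts"])
      then show ?thesis using True finite_subset infinite_Ioi by blast
    next
      case False
      then show ?thesis by simp
    qed
    then have "finite ({t :: nat. i \<notin> C} \<union> {t. \<exists>c<t. certA i (dc c)}) \<longleftrightarrow> i \<in> P"
      unfolding P_def using certA_iff[of i] by (cases "i \<in> C") simp_all
    moreover have u: "finite (\<Union>j\<in>{..<Suc i}. {t. E (prod_encode (n, j)) t})
        \<longleftrightarrow> (\<forall>j<Suc i. finite {t. E (prod_encode (n, j)) t})"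
      by (simp only: finite_UN finite_lessThan lessThan_iff Ball_def)
    ultimately show ?thesis unfolding e finite_Un[of "\<Union>j\<in>{..<Suc i}. {t. E (prod_encode (n, j)) t}"] u by (simp only:)
  qed
  have hP: "hh i = h i" if "i \<in> P" for i using that unfolding P_def hh_def by simp
  have clP: "cl (h ` P) = F"
  proof
    show "cl (h ` P) \<subseteq> F" by (rule cl_rcf_set[OF rcf_F]) (auto simp: P_def)
    have "i \<in> C \<Longrightarrow> h i \<in> cl (h ` P)" for i
    proof (induction i rule: less_induct)
      case (less i)
      show ?case
      proof (cases "i \<in> P")
        case True then show ?thesis using cl_incl[of "h ` P"] by auto
      next
        case False
        then have "h i \<in> cl (h ` {k. k < i \<and> k \<in> C})" using less.prems unfolding P_def by simp
        moreover have "h ` {k. k < i \<and> k \<in> C} \<subseteq> cl (h ` P)" using less.IH by auto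
        ultimately show ?thesis using cl_least by blast
      qed
    qed
    then show "F \<subseteq> cl (h ` P)" by auto
  qed
  show ?thesis
  proof (rule reduction[where D = D and ap = apA and rho = hh])
    show "cmp (\<lambda>p. D (fst p) (fst (snd p)) (snd (snd p)))"
      unfolding D_def by (intro cmp_intros cmp_comp2[where g = E, OF E(1)] cmp_comp2[where g = certA, OF cmp_certA])
    show "cmp (\<lambda>p. apA (fst p) (snd p))" by (rule cmp_apA)
    show "\<bar>qv (apA i s) - hh i\<bar> \<le> 1 / (real s + 1)" for i s by (rule apA)
    show "hh i \<notin> cl (hh ` {j. finite {t. D n j t} \<and> j < i})" if f: "finite {t. D n i t}" for n i
    proof -
      have i: "i \<in> P" using f unfolding fin by blast
      have sub: "hh ` {j. finite {t. D n j t} \<and> j < i} \<subseteq> h ` {k. k < i \<and> k \<in> C}"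
      proof
        fix v assume "v \<in> hh ` {j. finite {t. D n j t} \<and> j < i}"
        then obtain j where j: "j \<in> P" "j < i" "v = hh j" unfolding fin by blast
        have "j \<in> C" using j(1) unfolding P_def by simp
        then show "v \<in> h ` {k. k < i \<and> k \<in> C}" unfolding j(3) hP[OF j(1)] using j(2) by simp
      qed
      have "h i \<notin> cl (h ` {k. k < i \<and> k \<in> C})" using i unfolding P_def by simp
      then show ?thesis unfolding hP[OF i] using subsetD[OF cl_mono[OF sub]] by blast
    qed
    show "n \<in> S \<longleftrightarrow> cl (hh ` {i. finite {t. D n i t}}) = F" for n
    proof
      assume "n \<in> S"
      then have "{i. finite {t. D n i t}} = P" unfolding fin Sn by auto
      moreover have "hh ` P = h ` P" using hP by (intro image_cong) simp_all
      ultimately show "cl (hh ` {i. finite {t. D n i t}}) = F" using clP by simp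
    next
      assume e: "cl (hh ` {i. finite {t. D n i t}}) = F"
      show "n \<in> S"
      proof (rule ccontr)
        assume "n \<notin> S"
        then obtain y where y: "\<not> finite {t. E (prod_encode (n, y)) t}" unfolding Sn by blast
        have "{i. finite {t. D n i t}} \<subseteq> {..<y}"
        proof
          fix i assume "i \<in> {i. finite {t. D n i t}}"
          then have "\<forall>j<Suc i. finite {t. E (prod_encode (n, j)) t}" unfolding fin by simp
          then have "\<not> y < Suc i" using y by blast
          then show "i \<in> {..<y}" by simp
        qed
        then have "finite {i. finite {t. D n i t}}" by (rule finite_subset) simp
        then have "F \<noteq> cl (hh ` {i. finite {t. D n i t}})" by (intro inf finite_imageI)
        from notE[OF this e[symmetric]] show False .
      qed
    qed
  qed
qed

end

theorem theorem4p2: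
  assumes "computable_str A" and "arch_rcf A"
  shows "(trdeg A = 0 \<longrightarrow> m_complete_within (pi_cls 2) (I_str A) I_K)
       \<and> (trdeg A \<noteq> 0 \<and> trdeg A \<noteq> \<infinity> \<longrightarrow> m_complete_within d_sigma2 (I_str A) I_K)
       \<and> (trdeg A = \<infinity> \<longrightarrow> m_complete_within (pi_cls 3) (I_str A) I_K)"
proof -
  obtain h where h: "emb A h" using arch_rcf_emb[OF assms(2)] by (rule exE)
  interpret comp_arch A h by unfold_locales (rule assms h)+
  show ?thesis
  proof (intro conjI impI)
    assume "trdeg A = 0"
    then have "F = cl {}" by (rule trdeg_zero[OF h assms(2)])
    then show "m_complete_within (pi_cls 2) (I_str A) I_K"
      unfolding m_complete_within_def using upper1 lower1 by blast
  next
    assume "trdeg A \<noteq> 0 \<and> trdeg A \<noteq> \<infinity>"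
    then obtain xs where xs: "xs \<noteq> []" "cl_indep xs" "F = cl (set xs)"
      using trdeg_finite[OF h assms(2)] by auto
    show "m_complete_within d_sigma2 (I_str A) I_K"
      unfolding m_complete_within_def using upper2[OF xs(2,3)] lower2[OF xs] by (intro conjI ballI)
  next
    assume "trdeg A = \<infinity>"
    then have "F \<noteq> cl X" if "finite X" for X using trdeg_infinite[OF h assms(2)] that by blast
    then show "m_complete_within (pi_cls 3) (I_str A) I_K"
      unfolding m_complete_within_def using upper3 lower3 by (intro conjI ballI) simp_all
  qed
qed

end
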